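(* Let $p\in(0,1)$. (i) If $\ell\in\{2,3,\dots\}$, $\alpha\in[\frac1\ell,\frac1{\ell-1})\cup(2-\frac1{\ell-1},2-\frac1\ell]$ and $r^{1/\alpha}\in\mathbb{N}$, then \[\sup_{x\in\mathbb{R}}\Big|\mathsf{P}\Big\{\frac{S_n-\mu_1^{\alpha,p}n}{n^{1/\alpha}}\le x\Big\}-\tilde G_{n,\ell-1}^{\alpha,p}(x)\Big|=O\big(n^{-1/\alpha}\big)\quad(n\to\infty).\] (ii) If either $\ell=2$ and $\alpha\in(\frac12,1)\cup(1,\frac32)$, or $\ell\in\{3,4,\dots\}$ and $\alpha\in(\frac1\ell,\frac1{\ell-1}]\cup[2-\frac1{\ell-1},2-\frac1\ell)$, and moreover $r^{1/\alpha}\notin\mathbb{N}$, then \[\sup_{x\in\mathbb{R}}\Big|\mathsf{P}\Big\{\frac{S_n-\mu_1^{\alpha,p}n}{n^{1/\alpha}}\le x\Big\}-\tilde{\tilde G}_{n,\ell-1}^{\alpha,p}(x)\Big|=o\big(n^{-1/\alpha}\big)\quad(n\to\infty).\]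
   Context: Let $p\in(0,1)$, $q=1-p$, $r=1/q$, $\alpha\in(0,1)\cup(1,2)$. Let $X$ satisfy $\mathsf{P}\{X=r^{k/\alpha}\}=q^{k-1}p$, $k\in\mathbb{N}$; $X_1,X_2,\dots$ i.i.d. copies, $S_n=X_1+\dots+X_n$. For $\beta>0$, $\beta\ne\alpha$, $\mu_\beta^{\alpha,p}=p/(q^{\beta/\alpha}-q)$. Let $\gamma_n=n/r^{\lceil\log_r n\rceil}\in(q,1]$. For $\gamma\in(q,1]$, $t\in\mathbb{R}$: if $\alpha\in(0,1)$, $y_\gamma^{\alpha,p}(t)=\sum_{k\in\mathbb{Z}}(\exp\{\mathrm{i}tr^{k/\alpha}/\gamma^{1/\alpha}\}-1)\frac{p\gamma}{qr^k}$; if $\alpha\in(1,2)$, $y_\gamma^{\alpha,p}(t)=\sum_{k\in\mathbb{Z}}(\exp\{\mathrm{i}tr^{k/\alpha}/\gamma^{1/\alpha}\}-1-\mathrm{i}tr^{k/\alpha}/\gamma^{1/\alpha})\frac{p\gamma}{qr^k}$. $G_{\alpha,p,\gamma}$ is the distribution function with characteristic function $e^{y_\gamma^{\alpha,p}}$; for integers $k,j\ge0$, $G^{(k,j)}_{\alpha,p,\gamma}$ is the function of bounded variation with limit $0$ at $-\infty$ and Fourier–Stieltjes transform $(-\mathrm{i}t)^k[y_\gamma^{\alpha,p}(t)]^je^{y_\gamma^{\alpha,p}(t)}$. Let $D^{\alpha,p}(a,b)=\mu_1^{\alpha,p}a-b+\log(1+b+\sum_{s\ge1}\mu_s^{\alpha,p}(-a)^s/s!)$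 (formal power series in $a,b$), and $w^{\alpha,p}_{m,k,j}$ the coefficient of $a^kb^{j+m}$ in $[D^{\alpha,p}(a,b)]^m$. Define \[\tilde G_{n,\ell-1}^{\alpha,p}=\begin{cases}G_{\alpha,p,\gamma_n}+\sum_{j=1}^{\ell-1}\sum_{m=1}^{j}\frac{w^{\alpha,p}_{m,0,j}G^{(0,j+m)}_{\alpha,p,\gamma_n}}{m!\,n^j}, & \alpha\in(0,1),\\[2mm] G_{\alpha,p,\gamma_n}+\sum_{j=1}^{\ell-1}\frac{(-1)^j([\mu_1^{\alpha,p}]^2-\mu_2^{\alpha,p})^jG^{(2j,0)}_{\alpha,p,\gamma_n}}{j!\,2^j\,n^{j(2-\alpha)/\alpha}}, & \alpha\in(1,2),\end{cases}\] and $\tilde{\tilde G}_{n,\ell-1}^{\alpha,p}=\tilde G_{n,\ell-1}^{\alpha,p}+\mu_1^{\alpha,p}G^{(1,1)}_{\alpha,p,\gamma_n}/n^{1/\alpha}$. *)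

theory Defs
  imports "HOL-Probability.Probability" "HOL-Computational_Algebra.Formal_Power_Series"
    "HOL-Library.Landau_Symbols"
begin

definition qq :: "real \<Rightarrow> real" where "qq p = 1 - p"
definition rr :: "real \<Rightarrow> real" where "rr p = 1 / (1 - p)"

definition mu :: "real \<Rightarrow> real \<Rightarrow> real \<Rightarrow> real" where
  "mu \<alpha> p \<beta> = p / (qq p powr (\<beta> / \<alpha>) - qq p)"

definition gam :: "real \<Rightarrow> nat \<Rightarrow> real" where
  "gam p n = real n / rr p powr (of_int \<lceil>log (rr p) (real n)\<rceil>)"

definition yfun :: "real \<Rightarrow> real \<Rightarrow> real \<Rightarrow> real \<Rightarrow> complex" where
  "yfun \<alpha> p \<gamma> t =
    (if \<alpha> < 1 then
       (\<Sum>\<^sub>\<infinity>k\<in>(UNIV::int set).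
          (exp (\<i> * complex_of_real (t * rr p powr (real_of_int k / \<alpha>) / \<gamma> powr (1 / \<alpha>))) - 1)
          * complex_of_real (p * \<gamma> / (qq p * rr p powr real_of_int k)))
     else
       (\<Sum>\<^sub>\<infinity>k\<in>(UNIV::int set).
          (exp (\<i> * complex_of_real (t * rr p powr (real_of_int k / \<alpha>) / \<gamma> powr (1 / \<alpha>))) - 1
             - \<i> * complex_of_real (t * rr p powr (real_of_int k / \<alpha>) / \<gamma> powr (1 / \<alpha>)))
          * complex_of_real (p * \<gamma> / (qq p * rr p powr real_of_int k))))"

definition Glaw :: "real \<Rightarrow> real \<Rightarrow> real \<Rightarrow> real measure" where
  "Glaw \<alpha> p \<gamma> = (SOME N. real_distribution N \<and> char N = (\<lambda>t. exp (yfun \<alpha> p \<gamma> t)))"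

definition G :: "real \<Rightarrow> real \<Rightarrow> real \<Rightarrow> real \<Rightarrow> real" where
  "G \<alpha> p \<gamma> x = measure (Glaw \<alpha> p \<gamma>) {..x}"

(* G^{(k,j)}: function of bounded variation F (difference of distribution functions of two
   finite Borel measures, so F(-\<infinity>) = 0) whose Fourier-Stieltjes transform
   \<integral> e^{itx} dF(x) equals (-it)^k y^j e^y *)
definition Gkj :: "nat \<Rightarrow> nat \<Rightarrow> real \<Rightarrow> real \<Rightarrow> real \<Rightarrow> real \<Rightarrow> real" where
  "Gkj k j \<alpha> p \<gamma> = (SOME F. \<exists>N1 N2.
      finite_measure N1 \<and> sets N1 = sets borel \<and>
      finite_measure N2 \<and> sets N2 = sets borel \<and>
      (\<forall>x. F x = measure N1 {..x} - measure N2 {..x}) \<and>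
      (\<forall>t. char N1 t - char N2 t =
             (- \<i> * complex_of_real t) ^ k * (yfun \<alpha> p \<gamma> t) ^ j * exp (yfun \<alpha> p \<gamma> t)))"

(* Bivariate formal power series in (a,b): outer variable b, inner variable a.
   Coefficient of a^k b^n of S is fps_nth (fps_nth S n) k. *)
definition bvA :: "real fps fps" where "bvA = fps_const fps_X"
definition bvB :: "real fps fps" where "bvB = fps_X"

(* formal log(1+u) = \<Sum>_{n\<ge>1} (-1)^(n+1) u^n / n, for u without constant term;
   the coefficient of a^k b^N only involves n \<le> N + k *)
definition bv_log1p :: "real fps fps \<Rightarrow> real fps fps" where
  "bv_log1p u = Abs_fps (\<lambda>N. Abs_fps (\<lambda>k.
      \<Sum>n=1..N+k. (-1) ^ (n+1) / real n * fps_nth (fps_nth (u ^ n) N) k))"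

definition Dser :: "real \<Rightarrow> real \<Rightarrow> real fps fps" where
  "Dser \<alpha> p = fps_const (fps_const (mu \<alpha> p 1)) * bvA - bvB
     + bv_log1p (bvB + fps_const (Abs_fps (\<lambda>s. if s = 0 then 0
                     else mu \<alpha> p (real s) * (-1) ^ s / fact s)))"

definition w :: "real \<Rightarrow> real \<Rightarrow> nat \<Rightarrow> nat \<Rightarrow> nat \<Rightarrow> real" where
  "w \<alpha> p m k j = fps_nth (fps_nth (Dser \<alpha> p ^ m) (j + m)) k"

(* tilde G_{n,l-1}^{alpha,p}; the argument L is l - 1 *)
definition Gt :: "real \<Rightarrow> real \<Rightarrow> nat \<Rightarrow> nat \<Rightarrow> real \<Rightarrow> real" where
  "Gt \<alpha> p L n x =
    (if \<alpha> < 1 then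
       G \<alpha> p (gam p n) x +
       (\<Sum>j=1..L. \<Sum>m=1..j. w \<alpha> p m 0 j * Gkj 0 (j + m) \<alpha> p (gam p n) x
                              / (fact m * real n ^ j))
     else
       G \<alpha> p (gam p n) x +
       (\<Sum>j=1..L. (-1) ^ j * ((mu \<alpha> p 1)\<^sup>2 - mu \<alpha> p 2) ^ j * Gkj (2 * j) 0 \<alpha> p (gam p n) x
                   / (fact j * 2 ^ j * real n powr (real j * (2 - \<alpha>) / \<alpha>))))"

definition Gtt :: "real \<Rightarrow> real \<Rightarrow> nat \<Rightarrow> nat \<Rightarrow> real \<Rightarrow> real" where
  "Gtt \<alpha> p L n x = Gt \<alpha> p L n x + mu \<alpha> p 1 * Gkj 1 1 \<alpha> p (gam p n) x / real n powr (1 / \<alpha>)"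

definition Fn :: "'a measure \<Rightarrow> (nat \<Rightarrow> 'a \<Rightarrow> real) \<Rightarrow> real \<Rightarrow> real \<Rightarrow> nat \<Rightarrow> real \<Rightarrow> real" where
  "Fn M X \<alpha> p n x = measure M {\<omega> \<in> space M.
      ((\<Sum>i=1..n. X i \<omega>) - mu \<alpha> p 1 * real n) / real n powr (1 / \<alpha>) \<le> x}"

end

theory Submission
  imports Defs "HOL-Real_Asymp.Real_Asymp"
begin

text \<open>By semistability the exponents along \<open>\<gamma>\<^sub>n\<close> are rescalings of a single function: \<open>y\<close> at \<open>\<gamma>\<^sub>n\<close> and \<open>t\<close>
  equals \<open>n Y(t / n powr (1/\<alpha>))\<close>. Up to a smooth term, \<open>Y\<close> is the characteristic function of a single gain
  minus one. Hence the characteristic function of the centred gain is, near the origin, \<open>1 + Y\<close> (or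
  \<open>exp Y\<close> times a Gaussian factor for \<open>\<alpha> > 1\<close>) plus the correction \<open>- i \<mu>\<^sub>1 s Y(s)\<close>, which is responsible for
  \<open>G\<^sup>(\<^sup>1\<^sup>,\<^sup>1\<^sup>)\<close>. Taking \<open>n\<close>-th powers and expanding yields the transforms of the approximating functions with
  an error that Esseen's smoothing inequality carries over to distribution functions. On
  \<open>\<epsilon> \<le> \<bar>s\<bar> \<le> D\<close> the characteristic function is bounded away from one in modulus unless
  \<open>r powr (1/\<alpha>)\<close> is an integer, i.e. unless the gain is a lattice variable; this is what separates
  \<open>o(n powr (- 1/\<alpha>))\<close> from \<open>O(n powr (- 1/\<alpha>))\<close>. The functions \<open>G\<^sup>(\<^sup>k\<^sup>,\<^sup>j\<^sup>)\<close> exist because \<open>exp y\<close> splits into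
  a compound Poisson characteristic function and a smooth rapidly decreasing factor.\<close>

subsection \<open>Finite signed measures on the line and their Fourier transforms\<close>

text \<open>All comparisons take place on the side of transforms. \<open>G\<close> and
  \<open>Gkj\<close> are given by Hilbert choice, so that only their transforms are accessible; this
  suffices, because smoothing needs just a Lipschitz bound for the approximating function, and
  Fourier inversion gives one, uniformly in n, from the integrability of its transform. Cutting the
  transforms off at D times n powr (1/\<alpha>) costs a constant times n powr (-1/\<alpha>) divided
  by D. A fixed D therefore gives O. For o, D has to be arbitrarily large while the neighbourhood of
  the local expansion stays fixed, and the gap between the two must be bridged. Near the origin only
  terms of order up to 1+\<alpha> in s matter. For \<alpha> < 1 the square of Y is among them and s
  squared is not, whence the principal part 1+Y; for \<alpha> > 1 it is the other way round, whence
  exp Y times a Gaussian factor. Keeping L = l-1 terms leaves an error of order n powr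
  (-l*\<open>\<tau>\<close>), where \<open>\<tau>\<close> is 1 for \<alpha> < 1 and
  (2-\<alpha>)/\<alpha> otherwise. The intervals for \<alpha> guarantee l*\<open>\<tau>\<close>
  \<ge> 1/\<alpha> in the first claim and l*\<open>\<tau>\<close> > 1/\<alpha> in the
  second.\<close>

definition add_measure :: "'a measure \<Rightarrow> 'a measure \<Rightarrow> 'a measure" where
  "add_measure M N = measure_of (space M) (sets M) (\<lambda>A. emeasure M A + emeasure N A)"

lemma space_add_measure [simp]: "space (add_measure M N) = space M"
  and sets_add_measure [simp, measurable_cong]: "sets (add_measure M N) = sets M"
  by (auto simp: add_measure_def)

lemma emeasure_add_measure:
  assumes "sets N = sets M" "A \<in> sets M"
  shows "emeasure (add_measure M N) A = emeasure M A + emeasure N A"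
  unfolding add_measure_def
proof (rule emeasure_measure_of_sigma)
  show "countably_additive (sets M) (\<lambda>A. emeasure M A + emeasure N A)"
    unfolding countably_additive_def
  proof (intro allI impI)
    fix A :: "nat \<Rightarrow> 'a set" assume A: "range A \<subseteq> sets M" "disjoint_family A" "(\<Union>i. A i) \<in> sets M"
    have "(\<Sum>i. emeasure M (A i) + emeasure N (A i)) = (\<Sum>i. emeasure M (A i)) + (\<Sum>i. emeasure N (A i))"
      by (intro suminf_add[symmetric] summableI)
    then show "(\<Sum>i. emeasure M (A i) + emeasure N (A i)) = emeasure M (\<Union> (range A)) + emeasure N (\<Union> (range A))"
      using A assms(1) by (simp add: suminf_emeasure)
  qed
qed (use assms in \<open>auto simp: positive_def sets.sigma_algebra_axioms\<close>)

lemma le_add_measure: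
  assumes "sets N = sets M"
  shows "M \<le> add_measure M N" "N \<le> add_measure M N"
  using assms by (auto simp: le_measure emeasure_add_measure)

lemma integrable_mono_measure:
  fixes f :: "'a \<Rightarrow> 'b::{banach, second_countable_topology}"
  assumes "M \<le> N" "sets M = sets N" "integrable N f"
  shows "integrable M f"
proof (rule integrableI_bounded)
  show "f \<in> borel_measurable M" 
    using borel_measurable_integrable[OF assms(3)] by (subst measurable_cong_sets[OF assms(2) refl])
  have "(\<integral>\<^sup>+x. norm (f x) \<partial>M) \<le> (\<integral>\<^sup>+x. norm (f x) \<partial>N)"
    using assms(2,1) by (rule nn_integral_mono_measure)
  also have "\<dots> < \<infinity>" using assms(3) by (simp add: integrable_iff_bounded)
  finally show "(\<integral>\<^sup>+x. norm (f x) \<partial>M) < \<infinity>" .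
qed

text \<open>Induction over the functions integrable for the sum: each summand lies below the sum, so
  integrability passes to both, and one dominating function serves all three integrals in the limit
  step.\<close>

lemma integral_add_measure:
  fixes f :: "'a \<Rightarrow> 'b::{banach, second_countable_topology}"
  assumes eq: "sets N = sets M" and f: "integrable (add_measure M N) f"
  shows "integral\<^sup>L (add_measure M N) f = integral\<^sup>L M f + integral\<^sup>L N f"
  using f
proof (induction rule: integrable_induct)
  case (base A c)
  then have A: "A \<in> sets M" "emeasure M A < \<infinity>" "emeasure N A < \<infinity>" "A \<in> sets N"
    using eq by (auto simp: emeasure_add_measure ennreal_add_eq_top top.not_eq_extremum)
  then have "measure (add_measure M N) A = measure M A + measure N A"
    unfolding measure_def using emeasure_add_measure[OF eq A(1)]
    by (simp add: enn2real_plus)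
  with A show ?case
    using base by (simp add: scaleR_left_distrib)
next
  case (add f g)
  have "integrable M f" "integrable N f" "integrable M g" "integrable N g"
    by (auto intro!: integrable_mono_measure[OF le_add_measure(1)[OF eq]]
         integrable_mono_measure[OF le_add_measure(2)[OF eq]] add simp: eq)
  with add show ?case by simp
next
  case (lim f s)
  have sp: "space N = space M" using eq by (rule sets_eq_imp_space_eq)
  have iM: "integrable M g" if "integrable (add_measure M N) g" for g :: "'a \<Rightarrow> 'b"
    by (rule integrable_mono_measure[OF le_add_measure(1)[OF eq]]) (use that in auto)
  have iN: "integrable N g" if "integrable (add_measure M N) g" for g :: "'a \<Rightarrow> 'b"
    by (rule integrable_mono_measure[OF le_add_measure(2)[OF eq]]) (use that eq in auto)
  have 0: "(\<lambda>i. integral\<^sup>L (add_measure M N) (s i)) \<longlonglongrightarrow> integral\<^sup>L (add_measure M N) f"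
    by (rule integral_dominated_convergence[where w="\<lambda>x. 2 * norm (f x)"])
       (use lim in auto)
  have 1: "(\<lambda>i. integral\<^sup>L M (s i)) \<longlonglongrightarrow> integral\<^sup>L M f"
    by (rule integral_dominated_convergence[where w="\<lambda>x. 2 * norm (f x)"])
       (use lim iM in auto)
  have 2: "(\<lambda>i. integral\<^sup>L N (s i)) \<longlonglongrightarrow> integral\<^sup>L N f"
    by (rule integral_dominated_convergence[where w="\<lambda>x. 2 * norm (f x)"])
       (use lim iN sp in auto)
  show ?case
    using LIMSEQ_unique[OF 0] tendsto_add[OF 1 2] lim.IH by simp
qed

lemma finite_borel_measureI:
  "finite_measure M \<Longrightarrow> sets M = sets borel \<Longrightarrow> finite_borel_measure M"
  by (simp add: finite_borel_measure_def finite_borel_measure_axioms_def)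

lemma finite_borel_measureD:
  "finite_borel_measure M \<Longrightarrow> finite_measure M" "finite_borel_measure M \<Longrightarrow> sets M = sets borel"
  by (simp_all add: finite_borel_measure_def finite_borel_measure_axioms_def)

context finite_borel_measure
begin

declare M_is_borel [measurable_cong, simp]

lemma integrable_bounded_fun:
  fixes f :: "real \<Rightarrow> 'b::{banach, second_countable_topology}"
  assumes "f \<in> borel_measurable borel" "\<And>x. norm (f x) \<le> B"
  shows "integrable M f"
  using assms by (intro integrable_const_bound[where B = B]) auto

lemma integrable_iexp_mult: "integrable M (\<lambda>x. iexp (t * x))"
  by (rule integrable_bounded_fun[where B = 1]) auto

lemma norm_char_le: "norm (char M t) \<le> measure M UNIV"
proof -
  have "norm (char M t) \<le> (\<integral>x. norm (iexp (t * x)) \<partial>M)"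
    unfolding char_def by (rule integral_norm_bound)
  also have "\<dots> = measure M UNIV" by (simp add: borel_UNIV del: of_real_mult)
  finally show ?thesis .
qed

lemma char_at_0: "char M 0 = measure M UNIV"
  by (simp add: char_def borel_UNIV scaleR_conv_of_real)

end

lemma finite_borel_add_measure:
  assumes "finite_borel_measure M" "finite_borel_measure N"
  shows "finite_borel_measure (add_measure M N)"
proof -
  interpret M: finite_borel_measure M by fact
  interpret N: finite_borel_measure N by fact
  have "emeasure (add_measure M N) (space (add_measure M N)) = emeasure M UNIV + emeasure N UNIV"
    using M.borel_UNIV by (simp add: emeasure_add_measure)
  also have "\<dots> \<noteq> \<infinity>" by (simp add: M.emeasure_eq_measure N.emeasure_eq_measure)
  finally show ?thesis
    by (intro finite_borel_measureI finite_measureI) auto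
qed

lemma measure_add_measure:
  assumes "finite_borel_measure M" "finite_borel_measure N" "A \<in> sets borel"
  shows "measure (add_measure M N) A = measure M A + measure N A"
proof -
  interpret M: finite_borel_measure M by fact
  interpret N: finite_borel_measure N by fact
  show ?thesis
    using assms by (simp add: measure_def emeasure_add_measure)
      (simp add: M.emeasure_eq_measure N.emeasure_eq_measure flip: ennreal_plus)
qed

lemma char_add_measure:
  assumes "finite_borel_measure M" "finite_borel_measure N"
  shows "char (add_measure M N) t = char M t + char N t"
proof -
  interpret M: finite_borel_measure M by fact
  interpret N: finite_borel_measure N by fact
  interpret MN: finite_borel_measure "add_measure M N" by (rule finite_borel_add_measure) fact+
  show ?thesis
    unfolding char_def by (rule integral_add_measure) (use MN.integrable_iexp_mult[of t] in auto)
qed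

lemma
  fixes r :: real
  assumes "finite_borel_measure M" "0 \<le> r"
  shows finite_borel_scale: "finite_borel_measure (density M (\<lambda>_. r))"
    and measure_scale: "A \<in> sets borel \<Longrightarrow> measure (density M (\<lambda>_. r)) A = r * measure M A"
    and char_scale: "char (density M (\<lambda>_. r)) t = r * char M t"
proof -
  interpret M: finite_borel_measure M by fact
  show "finite_borel_measure (density M (\<lambda>_. r))"
    by (intro finite_borel_measureI finite_measureI)
       (auto simp: emeasure_density_const M.emeasure_eq_measure M.borel_UNIV ennreal_mult_eq_top_iff)
  show "A \<in> sets borel \<Longrightarrow> measure (density M (\<lambda>_. r)) A = r * measure M A"
    using assms by (simp add: measure_def emeasure_density_const enn2real_mult)
  show "char (density M (\<lambda>_. r)) t = r * char M t"
    unfolding char_def using assms by (subst integral_density) (auto simp: scaleR_conv_of_real)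
qed

lemma
  assumes "finite_borel_measure M" "finite_borel_measure N"
  shows finite_borel_convolution: "finite_borel_measure (M \<star> N)"
    and char_convolution: "char (M \<star> N) t = char M t * char N t"
    and measure_convolution_atMost: "measure (M \<star> N) {..x} = (\<integral>u. measure M {..x - u} \<partial>N)"
proof -
  interpret M: finite_borel_measure M by fact
  interpret N: finite_borel_measure N by fact
  interpret P: pair_sigma_finite M N ..
  have sp: "space M = UNIV" "space N = UNIV" using M.borel_UNIV N.borel_UNIV by auto
  show f: "finite_borel_measure (M \<star> N)"
    by (intro finite_borel_measureI convolution_finite)
       (auto simp: M.finite_measure_axioms N.finite_measure_axioms)
  interpret C: finite_borel_measure "M \<star> N" by (rule f)
  have fm: "finite_measure (M \<Otimes>\<^sub>M N)"
    by (intro finite_measure_pair_measure N.finite_measure_axioms M.finite_measure_axioms)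
  have int: "integrable (M \<Otimes>\<^sub>M N) (\<lambda>(x, y). iexp (t * (x + y)))"
    using fm by (intro finite_measure.integrable_const_bound[where B = 1]) (auto simp del: of_real_mult of_real_add)
  have "char (M \<star> N) t = (\<integral>z. (case z of (x, y) \<Rightarrow> iexp (t * (x + y))) \<partial>(M \<Otimes>\<^sub>M N))"
    unfolding char_def convolution_def by (subst integral_distr) (auto simp: case_prod_unfold)
  also have "\<dots> = (\<integral>x. \<integral>y. iexp (t * (x + y)) \<partial>N \<partial>M)"
    using P.integral_fst'[OF int] by simp
  also have "\<dots> = (\<integral>x. iexp (t * x) * char N t \<partial>M)"
    by (simp add: char_def distrib_left exp_add)
  also have "\<dots> = char M t * char N t" by (simp add: char_def)
  finally show "char (M \<star> N) t = char M t * char N t" .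
  have mm: "(\<lambda>u. measure M {..x - u}) \<in> borel_measurable borel"
  proof -
    have "mono (cdf M)" by (simp add: mono_def M.cdf_nondecreasing)
    then have "cdf M \<in> borel_measurable borel" by (rule borel_measurable_mono)
    then have "(\<lambda>u. cdf M (x - u)) \<in> borel_measurable borel" by measurable
    then show ?thesis by (simp add: cdf_def)
  qed
  \<comment> \<open>The factors are commuted so that sections are measured by \<open>M\<close> and
    integrated against \<open>N\<close>.\<close>
  have "emeasure (M \<star> N) {..x} = emeasure (N \<star> M) {..x}"
    by (subst convolution_commutative) (auto simp: M.finite_measure_axioms N.finite_measure_axioms)
  also have "\<dots> = (\<integral>\<^sup>+u. emeasure M {a. a + u \<in> {..x}} \<partial>N)"
    by (rule convolution_emeasure) (auto simp: M.finite_measure_axioms N.finite_measure_axioms sp)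
  also have "\<dots> = (\<integral>\<^sup>+u. ennreal (measure M {..x - u}) \<partial>N)"
  proof (rule nn_integral_cong)
    fix u
    have "{a. a + u \<in> {..x}} = {..x - u}" by auto
    then show "emeasure M {a. a + u \<in> {..x}} = ennreal (measure M {..x - u})"
      by (simp add: M.emeasure_eq_measure)
  qed
  finally have "emeasure (M \<star> N) {..x} = (\<integral>\<^sup>+u. ennreal (measure M {..x - u}) \<partial>N)" .
  then show "measure (M \<star> N) {..x} = (\<integral>u. measure M {..x - u} \<partial>N)"
    using mm by (subst integral_eq_nn_integral) (auto simp: measure_def)
qed

lemma
  assumes "finite_borel_measure M"
  shows finite_borel_distr_scale: "finite_borel_measure (distr M borel (\<lambda>x. c * x))"
    and char_distr_scale: "char (distr M borel (\<lambda>x. c * x)) t = char M (c * t)"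
proof -
  interpret M: finite_borel_measure M by fact
  show "finite_borel_measure (distr M borel (\<lambda>x. c * x))"
    by (intro finite_borel_measureI M.finite_measure_distr) auto
  show "char (distr M borel (\<lambda>x. c * x)) t = char M (c * t)"
    unfolding char_def by (subst integral_distr) (auto simp: ac_simps)
qed

lemma
  shows finite_borel_return: "finite_borel_measure (return borel a)"
    and char_return: "char (return borel a) t = iexp (t * a)"
proof -
  interpret prob_space "return borel a" by (rule prob_space_return) auto
  show "finite_borel_measure (return borel a)"
    by (intro finite_borel_measureI finite_measure_axioms) auto
  show "char (return borel a) t = iexp (t * a)"
    unfolding char_def by (subst integral_return) auto
qed

lemma
  shows finite_borel_null: "finite_borel_measure (null_measure borel)"
    and char_null: "char (null_measure borel) t = 0"
  by (auto intro!: finite_borel_measureI finite_measureI simp: char_def)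

text \<open>Pairs a function of bounded variation vanishing at minus infinity with its
  Fourier-Stieltjes transform. The body has the shape of the predicate under the choice operator in
  \<open>Gkj\<close>, so the chosen function inherits everything proved for such pairs without a
  uniqueness argument.\<close>

definition bv_char :: "(real \<Rightarrow> real) \<Rightarrow> (real \<Rightarrow> complex) \<Rightarrow> bool" where
  "bv_char F h \<longleftrightarrow> (\<exists>N1 N2. finite_borel_measure N1 \<and> finite_borel_measure N2 \<and>
      (\<forall>x. F x = measure N1 {..x} - measure N2 {..x}) \<and> (\<forall>t. char N1 t - char N2 t = h t))"

definition pos_char :: "(real \<Rightarrow> complex) \<Rightarrow> bool" where
  "pos_char h \<longleftrightarrow> (\<exists>N. finite_borel_measure N \<and> h = char N)"

text \<open>Differences of transforms of finite measures form a real algebra, closed under dilation.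
  Existence of \<open>Gkj\<close> thus reduces to a few generators.\<close>

definition sgn_char :: "(real \<Rightarrow> complex) \<Rightarrow> bool" where
  "sgn_char h \<longleftrightarrow> (\<exists>u v. pos_char u \<and> pos_char v \<and> h = (\<lambda>t. u t - v t))"

section \<open>Closure properties of transforms of finite measures\<close>

lemma bv_charI:
  assumes "finite_borel_measure N1" "finite_borel_measure N2"
    "\<And>x. F x = measure N1 {..x} - measure N2 {..x}" "\<And>t. h t = char N1 t - char N2 t"
  shows "bv_char F h"
  using assms unfolding bv_char_def by metis

lemma bv_char_cdf: "finite_borel_measure N \<Longrightarrow> bv_char (cdf N) (char N)"
  by (rule bv_charI[of N "null_measure borel"]) (auto simp: finite_borel_null char_null cdf_def measure_def)

lemma sgn_char_iff_bv_char: "sgn_char h \<longleftrightarrow> (\<exists>F. bv_char F h)"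
  unfolding sgn_char_def bv_char_def pos_char_def by (auto 4 4 simp: fun_eq_iff)

lemma pos_charI: "finite_borel_measure N \<Longrightarrow> (\<And>t. h t = char N t) \<Longrightarrow> pos_char h"
  unfolding pos_char_def by blast

lemma pos_charE:
  assumes "pos_char h"
  obtains N where "finite_borel_measure N" "h = char N"
  using assms unfolding pos_char_def by blast

lemma pos_char_add: "pos_char g \<Longrightarrow> pos_char h \<Longrightarrow> pos_char (\<lambda>t. g t + h t)"
  by (elim pos_charE) (auto intro: pos_charI[OF finite_borel_add_measure] simp: char_add_measure)

lemma pos_char_mult: "pos_char g \<Longrightarrow> pos_char h \<Longrightarrow> pos_char (\<lambda>t. g t * h t)"
  by (elim pos_charE) (auto intro: pos_charI[OF finite_borel_convolution] simp: char_convolution)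

lemma pos_char_scale: "pos_char g \<Longrightarrow> 0 \<le> r \<Longrightarrow> pos_char (\<lambda>t. complex_of_real r * g t)"
  by (elim pos_charE) (auto intro: pos_charI[OF finite_borel_scale] simp: char_scale)

lemma pos_char_dilate: "pos_char g \<Longrightarrow> pos_char (\<lambda>t. g (c * t))"
  by (elim pos_charE) (auto intro: pos_charI[OF finite_borel_distr_scale] simp: char_distr_scale)

lemma pos_char_iexp: "pos_char (\<lambda>t. iexp (t * a))"
  by (rule pos_charI[OF finite_borel_return]) (simp add: char_return)

lemma pos_char_const: "0 \<le> r \<Longrightarrow> pos_char (\<lambda>t. complex_of_real r)"
  using pos_char_scale[OF pos_char_iexp[of 0]] by simp

lemma pos_char_power: "pos_char g \<Longrightarrow> pos_char (\<lambda>t. g t ^ n)"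
  by (induction n) (use pos_char_const[of 1] pos_char_mult in auto)

lemma pos_char_imp_sgn_char: "pos_char g \<Longrightarrow> sgn_char g"
  unfolding sgn_char_def using pos_char_const[of 0] by (intro exI[of _ g] exI[of _ "\<lambda>_. 0"]) auto

lemma sgn_char_add: "sgn_char g \<Longrightarrow> sgn_char h \<Longrightarrow> sgn_char (\<lambda>t. g t + h t)"
  unfolding sgn_char_def
proof (elim exE conjE)
  fix u v u' v' assume "pos_char u" "pos_char v" "pos_char u'" "pos_char v'"
    "g = (\<lambda>t. u t - v t)" "h = (\<lambda>t. u' t - v' t)"
  then show "\<exists>u v. pos_char u \<and> pos_char v \<and> (\<lambda>t. g t + h t) = (\<lambda>t. u t - v t)"
    by (intro exI[of _ "\<lambda>t. u t + u' t"] exI[of _ "\<lambda>t. v t + v' t"]) (auto intro: pos_char_add)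
qed

lemma sgn_char_mult: "sgn_char g \<Longrightarrow> sgn_char h \<Longrightarrow> sgn_char (\<lambda>t. g t * h t)"
  unfolding sgn_char_def
proof (elim exE conjE)
  fix u v u' v' assume "pos_char u" "pos_char v" "pos_char u'" "pos_char v'"
    "g = (\<lambda>t. u t - v t)" "h = (\<lambda>t. u' t - v' t)"
  then show "\<exists>u v. pos_char u \<and> pos_char v \<and> (\<lambda>t. g t * h t) = (\<lambda>t. u t - v t)"
    by (intro exI[of _ "\<lambda>t. u t * u' t + v t * v' t"] exI[of _ "\<lambda>t. u t * v' t + v t * u' t"])
       (auto intro!: pos_char_add pos_char_mult simp: algebra_simps)
qed

lemma sgn_char_uminus: "sgn_char g \<Longrightarrow> sgn_char (\<lambda>t. - g t)"
  unfolding sgn_char_def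
proof (elim exE conjE)
  fix u v assume "pos_char u" "pos_char v" "g = (\<lambda>t. u t - v t)"
  then show "\<exists>u v. pos_char u \<and> pos_char v \<and> (\<lambda>t. - g t) = (\<lambda>t. u t - v t)"
    by (intro exI[of _ v] exI[of _ u]) auto
qed

lemma sgn_char_const: "sgn_char (\<lambda>t. complex_of_real r)"
proof (cases "r \<ge> 0")
  case True then show ?thesis by (simp add: pos_char_const pos_char_imp_sgn_char)
next
  case False
  then have "sgn_char (\<lambda>t. - complex_of_real (- r))"
    by (intro sgn_char_uminus pos_char_imp_sgn_char pos_char_const) simp
  then show ?thesis by simp
qed

lemma sgn_char_power: "sgn_char g \<Longrightarrow> sgn_char (\<lambda>t. g t ^ n)"
  by (induction n) (use sgn_char_const[of 1] sgn_char_mult in auto)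

lemma sgn_char_dilate: "sgn_char g \<Longrightarrow> sgn_char (\<lambda>t. g (c * t))"
  unfolding sgn_char_def
proof (elim exE conjE)
  fix u v assume "pos_char u" "pos_char v" "g = (\<lambda>t. u t - v t)"
  then show "\<exists>u v. pos_char u \<and> pos_char v \<and> (\<lambda>t. g (c * t)) = (\<lambda>t. u t - v t)"
    by (intro exI[of _ "\<lambda>t. u (c * t)"] exI[of _ "\<lambda>t. v (c * t)"]) (auto intro: pos_char_dilate)
qed

lemma bv_char_zero: "bv_char (\<lambda>_. 0) (\<lambda>_. 0)"
  by (rule bv_charI[OF finite_borel_null finite_borel_null]) auto

lemma bv_char_add:
  assumes "bv_char F g" "bv_char F' h"
  shows "bv_char (\<lambda>x. F x + F' x) (\<lambda>t. g t + h t)"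
proof -
  from assms obtain N1 N2 K1 K2 where N: "finite_borel_measure N1" "finite_borel_measure N2"
    "finite_borel_measure K1" "finite_borel_measure K2"
    "\<And>x. F x = measure N1 {..x} - measure N2 {..x}" "\<And>t. char N1 t - char N2 t = g t"
    "\<And>x. F' x = measure K1 {..x} - measure K2 {..x}" "\<And>t. char K1 t - char K2 t = h t"
    unfolding bv_char_def by blast
  show ?thesis
    by (rule bv_charI[of "add_measure N1 K1" "add_measure N2 K2"])
       (use N in \<open>auto simp: finite_borel_add_measure measure_add_measure char_add_measure N(6,8)[symmetric]\<close>)
qed

lemma bv_char_scale:
  assumes "bv_char F g"
  shows "bv_char (\<lambda>x. r * F x) (\<lambda>t. complex_of_real r * g t)"
proof -
  from assms obtain N1 N2 where N: "finite_borel_measure N1" "finite_borel_measure N2"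
    "\<And>x. F x = measure N1 {..x} - measure N2 {..x}" "\<And>t. g t = char N1 t - char N2 t"
    unfolding bv_char_def by metis
  show ?thesis
  proof (cases "r \<ge> 0")
    case True
    show ?thesis
      by (rule bv_charI[of "density N1 (\<lambda>_. r)" "density N2 (\<lambda>_. r)"])
         (use N True in \<open>auto simp: finite_borel_scale measure_scale char_scale right_diff_distrib left_diff_distrib\<close>)
  next
    case False
    then have "0 \<le> - r" by simp
    then show ?thesis
      by (intro bv_charI[of "density N2 (\<lambda>_. -r)" "density N1 (\<lambda>_. -r)"])
         (use N in \<open>auto simp: finite_borel_scale measure_scale char_scale right_diff_distrib left_diff_distrib\<close>)
  qed
qed

lemma bv_char_sum:
  assumes "finite I" "\<And>i. i \<in> I \<Longrightarrow> bv_char (F i) (g i)"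
  shows "bv_char (\<lambda>x. \<Sum>i\<in>I. F i x) (\<lambda>t. \<Sum>i\<in>I. g i t)"
  using assms by (induction I rule: finite_induct) (auto simp: bv_char_zero bv_char_add)

lemma bv_char_diff:
  assumes "bv_char F g" "bv_char F' h"
  shows "bv_char (\<lambda>x. F x - F' x) (\<lambda>t. g t - h t)"
  using bv_char_add[OF assms(1) bv_char_scale[OF assms(2), of "-1"]] by simp

text \<open>This is how a transform is cut off: if the transform of \<open>U\<close> vanishes
  outside an interval, only the values of g inside it survive.\<close>

lemma bv_char_convolution:
  assumes "bv_char F g" "finite_borel_measure U"
  shows "bv_char (\<lambda>x. \<integral>u. F (x - u) \<partial>U) (\<lambda>t. g t * char U t)"
proof -
  interpret U: finite_borel_measure U by fact
  from assms obtain N1 N2 where N: "finite_borel_measure N1" "finite_borel_measure N2"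
    "\<And>x. F x = measure N1 {..x} - measure N2 {..x}" "\<And>t. g t = char N1 t - char N2 t"
    unfolding bv_char_def by metis
  have int: "integrable U (\<lambda>u. measure N {..x - u})" if "finite_borel_measure N" for N x
  proof -
    interpret N: finite_borel_measure N by fact
    have "mono (cdf N)" by (simp add: mono_def N.cdf_nondecreasing)
    then have [measurable]: "cdf N \<in> borel_measurable borel" by (rule borel_measurable_mono)
    have "integrable U (\<lambda>u. cdf N (x - u))"
      by (rule U.integrable_bounded_fun[of _ "measure N (space N)"]) (auto simp: N.cdf_bounded N.cdf_nonneg)
    then show ?thesis by (simp add: cdf_def)
  qed
  show ?thesis
    by (rule bv_charI[of "N1 \<star> U" "N2 \<star> U"])
       (use N assms in \<open>auto simp: finite_borel_convolution char_convolution left_diff_distrib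
          measure_convolution_atMost int\<close>)
qed

lemma bv_char_bounded:
  assumes "bv_char F h"
  obtains B where "\<And>x. \<bar>F x\<bar> \<le> B" "\<And>t. norm (h t) \<le> B"
proof -
  from assms obtain N1 N2 where N: "finite_borel_measure N1" "finite_borel_measure N2"
    "\<And>x. F x = measure N1 {..x} - measure N2 {..x}" "\<And>t. h t = char N1 t - char N2 t"
    unfolding bv_char_def by metis
  interpret N1: finite_borel_measure N1 by fact
  interpret N2: finite_borel_measure N2 by fact
  show thesis
  proof (rule that[of "measure N1 UNIV + measure N2 UNIV"])
    fix x t
    show "\<bar>F x\<bar> \<le> measure N1 UNIV + measure N2 UNIV"
      using N1.bounded_measure[of "{..x}"] N2.bounded_measure[of "{..x}"]
      unfolding N(3) N1.borel_UNIV N2.borel_UNIV by (smt (verit) measure_nonneg)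
    show "norm (h t) \<le> measure N1 UNIV + measure N2 UNIV"
      unfolding N(4) using N1.norm_char_le[of t] N2.norm_char_le[of t] norm_triangle_ineq4[of "char N1 t" "char N2 t"]
      by linarith
  qed
qed

subsection \<open>Levy inversion for finite signed measures\<close>

text \<open>Division by the total mass carries inversion for probability laws over to finite
  measures.\<close>

lemma finite_borel_measure_normalize:
  assumes "finite_borel_measure M" "measure M UNIV > 0"
  shows "real_distribution (density M (\<lambda>_. 1 / measure M UNIV))"
proof -
  interpret M: finite_borel_measure M by fact
  interpret D: finite_borel_measure "density M (\<lambda>_. 1 / measure M UNIV)"
    by (rule finite_borel_scale) (use assms in auto)
  have "measure (density M (\<lambda>_. 1 / measure M UNIV)) UNIV = 1"
    using assms by (subst measure_scale) auto
  then have "emeasure (density M (\<lambda>_. 1 / measure M UNIV)) (space (density M (\<lambda>_. 1 / measure M UNIV))) = 1"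
    by (metis D.borel_UNIV D.emeasure_eq_measure ennreal_1)
  then interpret prob_space "density M (\<lambda>_. 1 / measure M UNIV)" by (rule prob_spaceI)
  show ?thesis by unfold_locales (auto simp: M.borel_UNIV)
qed

text \<open>The kernel of Levy's inversion formula. Its bound by b-a leads to Lipschitz estimates,
  its bound by 2/\<bar>t\<bar> to estimates of the supremum; the conventional value 0 at t = 0
  agrees with both.\<close>

definition inv_kernel :: "real \<Rightarrow> real \<Rightarrow> real \<Rightarrow> complex" where
  "inv_kernel a b t = (iexp (-(t * a)) - iexp (-(t * b))) / (\<i> * t)"

lemma norm_inv_kernel_le: "a \<le> b \<Longrightarrow> norm (inv_kernel a b t) \<le> b - a"
  using Levy_Inversion_aux2[of "-b" "-a" t] unfolding inv_kernel_def
  by (cases "t = 0") auto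

lemma norm_inv_kernel_le': "norm (inv_kernel a b t) \<le> 2 / \<bar>t\<bar>"
  unfolding inv_kernel_def norm_divide norm_mult
  by (rule order_trans[OF divide_right_mono[OF norm_triangle_ineq4]]) (auto simp flip: of_real_mult of_real_minus)

lemma inv_kernel_measurable [measurable]: "inv_kernel a b \<in> borel_measurable borel"
  unfolding inv_kernel_def by measurable

lemma real_distribution_finite_borel: "real_distribution M \<Longrightarrow> finite_borel_measure M"
  by (auto simp: real_distribution_def real_distribution_axioms_def prob_space_def intro!: finite_borel_measureI)

lemma char_borel_measurable [measurable]:
  assumes "finite_borel_measure N"
  shows "char N \<in> borel_measurable borel"
proof -
  interpret N: finite_borel_measure N by fact
  show ?thesis unfolding char_def by measurable
qed

lemma Levy_inversion_finite:
  assumes N: "finite_borel_measure N" and "a \<le> b" "measure N {a} = 0" "measure N {b} = 0"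
  shows "(\<lambda>T::nat. 1 / (2 * pi) * (CLBINT t:{- real T..real T}. inv_kernel a b t * char N t))
     \<longlonglongrightarrow> complex_of_real (measure N {a<..b})"
proof (cases "measure N UNIV > 0")
  case False
  interpret N: finite_borel_measure N by fact
  have z: "measure N A = 0" for A
    using False N.bounded_measure[of A] measure_nonneg[of N A] unfolding N.borel_UNIV by linarith
  have "char N t = 0" for t
    using N.norm_char_le[of t] z by simp
  then show ?thesis by (simp add: z)
next
  case True
  interpret N: finite_borel_measure N by fact
  define c where "c = measure N UNIV"
  interpret D: real_distribution "density N (\<lambda>_. 1 / c)"
    unfolding c_def by (rule finite_borel_measure_normalize) fact+
  have c: "c > 0" using True by (simp add: c_def)
  have m: "measure (density N (\<lambda>_. 1 / c)) A = measure N A / c" if "A \<in> sets borel" for A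
    using measure_scale[OF N _ that, of "1/c"] c by simp
  have ch: "char (density N (\<lambda>_. 1 / c)) t = char N t / c" for t
    using char_scale[OF N, of "1/c"] c by simp
  have "(\<lambda>T. 1 / (2 * pi) * (CLBINT t=-T..T. (iexp (-(t * a)) - iexp (-(t * b))) / (\<i> * t) * char (density N (\<lambda>_. 1 / c)) t))
      \<longlonglongrightarrow> complex_of_real (measure (density N (\<lambda>_. 1 / c)) {a<..b})"
    by (rule D.Levy_Inversion) (use assms m in auto)
  then have "(\<lambda>T::nat. 1 / (2 * pi) * (CLBINT t:{- real T..real T}. inv_kernel a b t * (char N t / c)))
      \<longlonglongrightarrow> complex_of_real (measure N {a<..b} / c)"
    by (simp add: m ch inv_kernel_def interval_integral_Icc)
  from tendsto_mult[OF tendsto_const[of "complex_of_real c"] this]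
  show ?thesis using c by simp
qed

lemma bv_char_measurable:
  assumes "bv_char F h"
  shows "h \<in> borel_measurable borel"
proof -
  from assms obtain N1 N2 where N: "finite_borel_measure N1" "finite_borel_measure N2"
    "\<And>t. h t = char N1 t - char N2 t"
    unfolding bv_char_def by metis
  have [measurable]: "char N1 \<in> borel_measurable borel" "char N2 \<in> borel_measurable borel"
    using N by auto
  have "h = (\<lambda>t. char N1 t - char N2 t)" using N by auto
  then show ?thesis by simp
qed

lemma bv_char_right_cont:
  assumes "bv_char F h"
  shows "continuous (at_right x) F"
proof -
  from assms obtain N1 N2 where N: "finite_borel_measure N1" "finite_borel_measure N2"
    "\<And>x. F x = cdf N1 x - cdf N2 x"
    unfolding bv_char_def cdf_def by metis
  have "F = (\<lambda>x. cdf N1 x - cdf N2 x)" using N by auto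
  then show ?thesis
    using finite_borel_measure.cdf_is_right_cont[OF N(1)] finite_borel_measure.cdf_is_right_cont[OF N(2)]
    by (auto intro!: continuous_intros)
qed

lemma bv_char_at_bot:
  assumes "bv_char F h"
  shows "(F \<longlongrightarrow> 0) at_bot"
proof -
  from assms obtain N1 N2 where N: "finite_borel_measure N1" "finite_borel_measure N2"
    "\<And>x. F x = cdf N1 x - cdf N2 x"
    unfolding bv_char_def cdf_def by metis
  have "F = (\<lambda>x. cdf N1 x - cdf N2 x)" using N by auto
  then show ?thesis
    using tendsto_diff[OF finite_borel_measure.cdf_lim_at_bot[OF N(1)] finite_borel_measure.cdf_lim_at_bot[OF N(2)]]
    by simp
qed

lemma bv_char_measurable_fun:
  assumes "bv_char F h"
  shows "F \<in> borel_measurable borel"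
proof -
  from assms obtain N1 N2 where N: "finite_borel_measure N1" "finite_borel_measure N2"
    "\<And>x. F x = cdf N1 x - cdf N2 x"
    unfolding bv_char_def cdf_def by metis
  have "mono (cdf N1)" "mono (cdf N2)"
    using finite_borel_measure.cdf_nondecreasing[OF N(1)] finite_borel_measure.cdf_nondecreasing[OF N(2)]
    by (auto simp: mono_def)
  then have [measurable]: "cdf N1 \<in> borel_measurable borel" "cdf N2 \<in> borel_measurable borel"
    by (auto intro: borel_measurable_mono)
  have "F = (\<lambda>x. cdf N1 x - cdf N2 x)" using N by auto
  then show ?thesis by simp
qed

text \<open>Inversion is valid only at endpoints without atoms. Atoms are countable and distribution
  functions are right continuous, so every point can be approached by admissible ones from the
  right.\<close>

lemma right_limit_avoiding_countable:
  fixes D :: "real set"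
  assumes "countable D"
  obtains X where "\<And>n::nat. X n > x" "\<And>n. X n \<notin> D" "X \<longlonglongrightarrow> x" "filterlim X (at_right x) sequentially"
proof -
  have "\<exists>y. x < y \<and> y < x + 1 / real (Suc n) \<and> y \<notin> D" for n :: nat
  proof -
    have "uncountable ({x<..<x + 1 / real (Suc n)} - D)"
      using assms by (intro uncountable_minus_countable) (auto simp: uncountable_open_interval)
    then obtain y where "y \<in> {x<..<x + 1 / real (Suc n)} - D"
      by (metis countable_empty ex_in_conv)
    then show ?thesis by auto
  qed
  then obtain X where X: "\<And>n. x < X n" "\<And>n. X n < x + 1 / real (Suc n)" "\<And>n. X n \<notin> D"
    by metis
  have lim: "X \<longlonglongrightarrow> x"
  proof (rule tendsto_sandwich[where f = "\<lambda>_. x" and h = "\<lambda>n. x + 1 / real (Suc n)"])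
    show "(\<lambda>n. x + 1 / real (Suc n)) \<longlonglongrightarrow> x"
      using tendsto_add[OF tendsto_const[of x] LIMSEQ_inverse_real_of_nat] by (simp add: inverse_eq_divide)
  qed (use X in \<open>auto intro!: always_eventually less_imp_le simp del: of_nat_Suc\<close>)
  show ?thesis
    by (rule that[of X]) (use X lim less_imp_neq[OF X(1)] in \<open>auto simp: filterlim_at intro!: always_eventually\<close>)
qed

text \<open>Common source of the Lipschitz bound and of the bound of the supremum: \<open>W\<close>
  is either majorant of kernel times transform. It has to work for all subintervals of [c,d], with b
  < d, because b is approached by atom-free points lying above it.\<close>

lemma bv_char_increment_bound:
  assumes F: "bv_char F h" and W: "integrable lborel W" and "a \<le> b"
    and bnd: "\<And>a b t. c \<le> a \<Longrightarrow> a \<le> b \<Longrightarrow> b \<le> d \<Longrightarrow> norm (inv_kernel a b t * h t) \<le> W t"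
    and ab: "c \<le> a" "b < d"
  shows "\<bar>F b - F a\<bar> \<le> (1 / (2 * pi)) * (\<integral>t. W t \<partial>lborel)"
proof -
  from F obtain N1 N2 where N: "finite_borel_measure N1" "finite_borel_measure N2"
    "\<And>x. F x = cdf N1 x - cdf N2 x" "\<And>t. h t = char N1 t - char N2 t"
    unfolding bv_char_def cdf_def by metis
  interpret N1: finite_borel_measure N1 by fact
  interpret N2: finite_borel_measure N2 by fact
  have [measurable]: "h \<in> borel_measurable borel" using bv_char_measurable[OF F] .
  \<comment> \<open>All atoms of the two measures whose difference defines \<open>F\<close>.\<close>
  define D where "D = {x. measure N1 {x} > 0} \<union> {x. measure N2 {x} > 0}"
  have cD: "countable D" unfolding D_def using N1.countable_atoms N2.countable_atoms by simp
  have D0: "measure N1 {x} = 0" "measure N2 {x} = 0" if "x \<notin> D" for x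
    using that measure_nonneg[of N1 "{x}"] measure_nonneg[of N2 "{x}"] unfolding D_def by auto
  have main: "\<bar>F b - F a\<bar> \<le> (1 / (2 * pi)) * (\<integral>t. W t \<partial>lborel)"
    if ab: "c \<le> a" "a < b" "b \<le> d" "a \<notin> D" "b \<notin> D" for a b
  proof -
    have int: "set_integrable lborel {-T..T} (\<lambda>t. inv_kernel a b t * char N t)"
      if "finite_borel_measure N" for N and T :: real
    proof -
      interpret N: finite_borel_measure N by fact
      have [measurable]: "char N \<in> borel_measurable borel" using that by simp
      show ?thesis unfolding set_integrable_def
      proof (rule integrableI_bounded_set_indicator[where B = "(b - a) * measure N UNIV"])
        show "AE x in lborel. x \<in> {-T..T} \<longrightarrow> norm (inv_kernel a b x * char N x) \<le> (b - a) * measure N UNIV"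
          using norm_inv_kernel_le[of a b] N.norm_char_le ab
          by (auto simp: norm_mult intro!: mult_mono)
      qed (auto simp: emeasure_lborel_Icc_eq)
    qed
    have "(\<lambda>T::nat. 1 / (2 * pi) * (CLBINT t:{- real T..real T}. inv_kernel a b t * char N1 t) -
       1 / (2 * pi) * (CLBINT t:{- real T..real T}. inv_kernel a b t * char N2 t))
     \<longlonglongrightarrow> complex_of_real (measure N1 {a<..b}) - complex_of_real (measure N2 {a<..b})"
      by (intro tendsto_diff Levy_inversion_finite N) (use ab D0 in auto)
    also have "(\<lambda>T::nat. 1 / (2 * pi) * (CLBINT t:{- real T..real T}. inv_kernel a b t * char N1 t) -
       1 / (2 * pi) * (CLBINT t:{- real T..real T}. inv_kernel a b t * char N2 t)) =
       (\<lambda>T::nat. 1 / (2 * pi) * (CLBINT t:{- real T..real T}. inv_kernel a b t * h t))"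
      by (simp add: N(4) right_diff_distrib set_integral_diff int[OF N(1)] int[OF N(2)])
    also have "complex_of_real (measure N1 {a<..b}) - complex_of_real (measure N2 {a<..b}) = complex_of_real (F b - F a)"
      using ab by (simp add: N1.cdf_diff_eq[symmetric] N2.cdf_diff_eq[symmetric] N(3))
    finally have lim: "(\<lambda>T::nat. 1 / (2 * pi) * (CLBINT t:{- real T..real T}. inv_kernel a b t * h t)) \<longlonglongrightarrow> complex_of_real (F b - F a)" .
    have "norm (1 / (2 * pi) * (CLBINT t:{- real T..real T}. inv_kernel a b t * h t)) \<le> (1 / (2 * pi)) * (\<integral>t. W t \<partial>lborel)" for T :: nat
    proof -
      have "norm (CLBINT t:{- real T..real T}. inv_kernel a b t * h t) \<le> (\<integral>t. W t \<partial>lborel)"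
        unfolding set_lebesgue_integral_def
      proof (rule Bochner_Integration.integral_norm_bound_integral)
        show "complex_integrable lborel (\<lambda>t. indicat_real {- real T..real T} t *\<^sub>R (inv_kernel a b t * h t))"
        proof (rule Bochner_Integration.integrable_bound[OF W])
          show "AE x in lborel. norm (indicat_real {- real T..real T} x *\<^sub>R (inv_kernel a b x * h x)) \<le> norm (W x)"
            using bnd[of a b] ab by (auto simp: indicator_def intro!: order_trans[OF _ abs_ge_self])
        qed measurable
        fix t
        have "0 \<le> W t" using bnd[of a b t] ab norm_ge_zero order_trans by (metis less_imp_le)
        then show "norm (indicat_real {- real T..real T} t *\<^sub>R (inv_kernel a b t * h t)) \<le> W t"
          using bnd[of a b t] ab by (auto simp: indicator_def)
      qed (rule W)
      then show ?thesis by (simp add: norm_mult norm_divide divide_right_mono)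
    qed
    then have "norm (complex_of_real (F b - F a)) \<le> (1 / (2 * pi)) * (\<integral>t. W t \<partial>lborel)"
      by (intro tendsto_upperbound[OF tendsto_norm[OF lim]]) auto
    then show ?thesis by (simp only: norm_of_real)
  qed
  show ?thesis
  proof (cases "a = b")
    case True
    have "0 \<le> W t" for t using bnd[of a a t] ab assms(3) norm_ge_zero order_trans
      by (metis True less_imp_le order_refl)
    then have "0 \<le> (\<integral>t. W t \<partial>lborel)" by (intro integral_nonneg_AE) auto
    then show ?thesis using True by simp
  next
    case False
    obtain X where X: "\<And>n. X n > a" "\<And>n. X n \<notin> D" "X \<longlonglongrightarrow> a" "filterlim X (at_right a) sequentially"
      using right_limit_avoiding_countable[OF cD] by blast
    obtain Y where Y: "\<And>n. Y n > b" "\<And>n. Y n \<notin> D" "Y \<longlonglongrightarrow> b" "filterlim Y (at_right b) sequentially"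
      using right_limit_avoiding_countable[OF cD] by blast
    have "(\<lambda>n. F (X n)) \<longlonglongrightarrow> F a" "(\<lambda>n. F (Y n)) \<longlonglongrightarrow> F b"
      using bv_char_right_cont[OF F] X(4) Y(4) unfolding continuous_within
      by (auto intro: filterlim_compose)
    then have lim: "(\<lambda>n. \<bar>F (Y n) - F (X n)\<bar>) \<longlonglongrightarrow> \<bar>F b - F a\<bar>" by (intro tendsto_intros)
    have "\<forall>\<^sub>F n in sequentially. X n < b" "\<forall>\<^sub>F n in sequentially. Y n < d"
      using X(3) Y(3) False assms(3) ab by (auto intro: order_tendstoD(2))
    then have "\<forall>\<^sub>F n in sequentially. \<bar>F (Y n) - F (X n)\<bar> \<le> (1 / (2 * pi)) * (\<integral>t. W t \<partial>lborel)"
    proof eventually_elim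
      case (elim n)
      show ?case
        by (rule main) (use X(1)[of n] Y(1)[of n] X(2)[of n] Y(2)[of n] elim ab in auto)
    qed
    then show ?thesis by (intro tendsto_upperbound[OF lim]) auto
  qed
qed

text \<open>An integrable transform forces a bounded density. The interval is first enlarged by e to
  leave room on the right, then e tends to 0.\<close>

lemma bv_char_lipschitz:
  assumes F: "bv_char F h" and h: "integrable lborel (\<lambda>t. norm (h t))" and "a \<le> b"
  shows "\<bar>F b - F a\<bar> \<le> (b - a) * ((1 / (2 * pi)) * (\<integral>t. norm (h t) \<partial>lborel))"
proof -
  have *: "\<bar>F b - F a\<bar> \<le> (b + e - a) * ((1 / (2 * pi)) * (\<integral>t. norm (h t) \<partial>lborel))" if "e > 0" for e
  proof -
    have "\<bar>F b - F a\<bar> \<le> (1 / (2 * pi)) * (\<integral>t. (b + e - a) * norm (h t) \<partial>lborel)"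
    proof (rule bv_char_increment_bound[OF F _ assms(3), of _ a "b + e"])
      fix c d t assume "a \<le> c" "c \<le> d" "d \<le> b + e"
      then show "norm (inv_kernel c d t * h t) \<le> (b + e - a) * norm (h t)"
        using norm_inv_kernel_le[of c d t] by (auto simp: norm_mult intro!: mult_right_mono)
    qed (use that h in auto)
    then show ?thesis by simp
  qed
  define K where "K = (1 / (2 * pi)) * (\<integral>t. norm (h t) \<partial>lborel)"
  have "((\<lambda>e. (b + e - a) * K) \<longlongrightarrow> (b + 0 - a) * K) (at_right 0)"
    by (intro tendsto_intros)
  then have "\<bar>F b - F a\<bar> \<le> (b + 0 - a) * K"
    by (rule tendsto_lowerbound)
       (use * in \<open>auto simp: K_def eventually_at_right_field intro!: exI[of _ 1]\<close>)
  then show ?thesis by (simp add: K_def)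
qed

text \<open>Here the bound 2/\<bar>t\<bar> of the kernel is used, which does not depend on the
  interval, so that the left endpoint can go to minus infinity, where \<open>F\<close>
  vanishes.\<close>

lemma bv_char_sup_bound:
  assumes F: "bv_char F h" and B: "integrable lborel B" and hB: "\<And>t. norm (h t) \<le> \<bar>t\<bar> * B t" and B0: "\<And>t. 0 \<le> B t"
  shows "\<bar>F x\<bar> \<le> (1 / pi) * (\<integral>t. B t \<partial>lborel)"
proof -
  have le: "\<bar>F x - F a\<bar> \<le> (1 / pi) * (\<integral>t. B t \<partial>lborel)" if "a \<le> x" for a
  proof -
    have "\<bar>F x - F a\<bar> \<le> (1 / (2 * pi)) * (\<integral>t. 2 * B t \<partial>lborel)"
    proof (rule bv_char_increment_bound[OF F _ that, of _ a "x + 1"])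
      fix c d t
      have "norm (inv_kernel c d t * h t) \<le> (2 / \<bar>t\<bar>) * (\<bar>t\<bar> * B t)"
        unfolding norm_mult by (intro mult_mono norm_inv_kernel_le' hB) auto
      also have "\<dots> \<le> 2 * B t" using B0[of t] by auto
      finally show "norm (inv_kernel c d t * h t) \<le> 2 * B t" .
    qed (use B in auto)
    then show ?thesis by simp
  qed
  have "((\<lambda>a. \<bar>F x - F a\<bar>) \<longlongrightarrow> \<bar>F x - 0\<bar>) at_bot"
    by (intro tendsto_intros bv_char_at_bot[OF F])
  then have "\<bar>F x - 0\<bar> \<le> (1 / pi) * (\<integral>t. B t \<partial>lborel)"
    by (rule tendsto_upperbound) (use le in \<open>auto simp: eventually_at_bot_linorder\<close>)
  then show ?thesis by simp
qed

subsection \<open>Inverse Fourier transforms of integrable functions\<close>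

text \<open>By Fubini, both sides are the integral of \<open>iexp (t * x)\<close> over the product
  measure. With a normal law as \<open>N\<close>, averages of a characteristic function turn into
  expectations of a Gaussian.\<close>

lemma finite_borel_Parseval:
  assumes "finite_borel_measure M" "finite_borel_measure N"
  shows "(\<integral>t. char M t \<partial>N) = (\<integral>x. char N x \<partial>M)"
proof -
  interpret M: finite_borel_measure M by fact
  interpret N: finite_borel_measure N by fact
  interpret P: pair_sigma_finite N M ..
  have fm: "finite_measure (N \<Otimes>\<^sub>M M)"
    by (intro finite_measure_pair_measure N.finite_measure_axioms M.finite_measure_axioms)
  have int: "integrable (N \<Otimes>\<^sub>M M) (\<lambda>(t, x). iexp (t * x))"
    using fm by (intro finite_measure.integrable_const_bound[where B = 1]) (auto simp del: of_real_mult)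
  show ?thesis
    using P.Fubini_integral[OF int] by (simp add: char_def mult.commute)
qed

lemma integrable_inverse_1_plus_square_lborel: "integrable lborel (\<lambda>x::real. 1 / (1 + x\<^sup>2))"
  using integrable_inverse_1_plus_square unfolding set_integrable_def
  by (simp add: einterval_def inverse_eq_divide)

lemma integral_gaussian_iexp:
  assumes "\<epsilon> > 0"
  shows "integrable lborel (\<lambda>x. exp (- (\<epsilon> * x)\<^sup>2 / 2))"
    and "(\<integral>x. iexp (u * x) * complex_of_real (exp (- (\<epsilon> * x)\<^sup>2 / 2)) \<partial>lborel) =
      complex_of_real (sqrt (2 * pi) / \<epsilon> * exp (- (u / \<epsilon>)\<^sup>2 / 2))"
proof -
  interpret N: real_distribution std_normal_distribution by (rule real_dist_normal_dist)
  have int0: "integrable lborel std_normal_density"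
    using integrable_normal_density[of 1 0] by simp
  have eq: "exp (- (\<epsilon> * x)\<^sup>2 / 2) = sqrt (2 * pi) * std_normal_density (\<epsilon> * x)" for x
    by (simp add: std_normal_density_def)
  show "integrable lborel (\<lambda>x. exp (- (\<epsilon> * x)\<^sup>2 / 2))"
    unfolding eq using lborel_integrable_real_affine[OF int0, of \<epsilon> 0] assms by simp
  have "complex_of_real (exp (- (u / \<epsilon>)\<^sup>2 / 2)) = char std_normal_distribution (u / \<epsilon>)"
    by (simp add: char_std_normal_distribution)
  also have "\<dots> = (\<integral>x. complex_of_real (std_normal_density x) * iexp (u / \<epsilon> * x) \<partial>lborel)"
    unfolding char_def by (subst integral_density) (auto simp: normal_density_nonneg scaleR_conv_of_real)
  also have "\<dots> = \<epsilon> * (\<integral>x. complex_of_real (std_normal_density (\<epsilon> * x)) * iexp (u * x) \<partial>lborel)"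
    using assms lborel_integral_real_affine[of \<epsilon> "\<lambda>x. complex_of_real (std_normal_density x) * iexp (u / \<epsilon> * x)" 0]
    by (simp add: scaleR_conv_of_real)
  also have "(\<integral>x. complex_of_real (std_normal_density (\<epsilon> * x)) * iexp (u * x) \<partial>lborel) =
      (\<integral>x. (1 / complex_of_real (sqrt (2 * pi))) * (iexp (u * x) * complex_of_real (exp (- (\<epsilon> * x)\<^sup>2 / 2))) \<partial>lborel)"
    unfolding eq by (intro Bochner_Integration.integral_cong) (auto simp: field_simps)
  finally show "(\<integral>x. iexp (u * x) * complex_of_real (exp (- (\<epsilon> * x)\<^sup>2 / 2)) \<partial>lborel) =
      complex_of_real (sqrt (2 * pi) / \<epsilon> * exp (- (u / \<epsilon>)\<^sup>2 / 2))"
    using assms by (simp add: field_simps)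
qed

definition inv_fourier :: "(real \<Rightarrow> complex) \<Rightarrow> real \<Rightarrow> complex" where
  "inv_fourier h x = (1 / (2 * pi)) * (\<integral>t. iexp (- (t * x)) * h t \<partial>lborel)"

lemma inv_fourier_measurable:
  assumes [measurable]: "h \<in> borel_measurable borel"
  shows "inv_fourier h \<in> borel_measurable borel"
  unfolding inv_fourier_def by measurable

lemma norm_inv_fourier_le:
  assumes "integrable lborel h"
  shows "norm (inv_fourier h x) \<le> (1 / (2 * pi)) * (\<integral>t. norm (h t) \<partial>lborel)"
proof -
  have "norm (\<integral>t. iexp (- (t * x)) * h t \<partial>lborel) \<le> (\<integral>t. norm (iexp (- (t * x)) * h t) \<partial>lborel)"
    by (rule integral_norm_bound)
  also have "\<dots> = (\<integral>t. norm (h t) \<partial>lborel)" by (simp add: norm_mult del: of_real_minus of_real_mult)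
  finally show ?thesis
    by (simp add: inv_fourier_def norm_mult norm_divide divide_right_mono)
qed

text \<open>Gaussian regularisation: multiplying \<open>inv_fourier h\<close> by a wide Gaussian amounts to averaging
  \<open>h\<close> against a narrow one.\<close>

lemma fourier_inversion_L1:
  assumes cont: "continuous_on UNIV h" and int: "integrable lborel h" and bnd: "\<And>t. norm (h t) \<le> B"
    and intg: "integrable lborel (inv_fourier h)"
  shows "(\<integral>x. iexp (s * x) * inv_fourier h x \<partial>lborel) = h s"
proof -
  have [measurable]: "h \<in> borel_measurable borel" using cont by (rule borel_measurable_continuous_onI)
  note [measurable] = inv_fourier_measurable[of h]
  define E where "E k = 1 / real (Suc k)" for k
  have E0: "E k > 0" for k by (simp add: E_def)
  have Elim: "E \<longlonglongrightarrow> 0" unfolding E_def using LIMSEQ_inverse_real_of_nat by (simp add: inverse_eq_divide)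
  define L where "L k = (\<integral>x. iexp (s * x) * inv_fourier h x * complex_of_real (exp (- (E k * x)\<^sup>2 / 2)) \<partial>lborel)" for k
  have 1: "L \<longlonglongrightarrow> (\<integral>x. iexp (s * x) * inv_fourier h x * complex_of_real (exp (- (0 * x)\<^sup>2 / 2)) \<partial>lborel)"
    unfolding L_def
  proof (rule integral_dominated_convergence[where w = "\<lambda>x. norm (inv_fourier h x)"])
    show "AE x in lborel. (\<lambda>i. iexp (s * x) * inv_fourier h x * complex_of_real (exp (- (E i * x)\<^sup>2 / 2)))
        \<longlonglongrightarrow> iexp (s * x) * inv_fourier h x * complex_of_real (exp (- (0 * x)\<^sup>2 / 2))"
      by (intro AE_I2 tendsto_intros Elim) auto
    show "AE x in lborel. norm (iexp (s * x) * inv_fourier h x * complex_of_real (exp (- (E i * x)\<^sup>2 / 2)))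
         \<le> norm (inv_fourier h x)" for i
      by (intro AE_I2) (auto simp: norm_mult mult_left_le simp del: of_real_mult)
  qed (use intg in auto)
  have 2: "L k = (\<integral>z. complex_of_real (std_normal_density z) * h (s - E k * z) \<partial>lborel)" for k
  proof -
    define e where "e = E k"
    have e: "e > 0" by (simp add: e_def E0)
    let ?g = "\<lambda>x t. iexp (s * x) * (iexp (- (t * x)) * h t) * complex_of_real (exp (- (e * x)\<^sup>2 / 2))"
    have "integrable (lborel \<Otimes>\<^sub>M lborel) (\<lambda>z. complex_of_real (exp (- (e * fst z)\<^sup>2 / 2)) * h (snd z))"
    proof (rule lborel_pair.Fubini_integrable)
      show "integrable lborel (\<lambda>x. \<integral>y. norm (complex_of_real (exp (- (e * fst (x, y))\<^sup>2 / 2)) * h (snd (x, y))) \<partial>lborel)"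
        using integral_gaussian_iexp(1)[OF e] by (simp add: norm_mult)
      show "AE x in lborel. integrable lborel (\<lambda>y. complex_of_real (exp (- (e * fst (x, y))\<^sup>2 / 2)) * h (snd (x, y)))"
        using int by simp
    qed measurable
    then have gint: "integrable (lborel \<Otimes>\<^sub>M lborel) (\<lambda>(x, t). ?g x t)"
      by (rule Bochner_Integration.integrable_bound)
         (auto simp: norm_mult simp del: of_real_mult of_real_minus)
    have "L k = (1 / (2 * pi)) * (\<integral>x. \<integral>t. ?g x t \<partial>lborel \<partial>lborel)"
    proof -
      have "(\<integral>t. ?g x t \<partial>lborel) = (2 * pi) * (iexp (s * x) * inv_fourier h x * complex_of_real (exp (- (e * x)\<^sup>2 / 2)))" for x
      proof -
        have "(\<integral>t. ?g x t \<partial>lborel) =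
           (\<integral>t. (iexp (s * x) * complex_of_real (exp (- (e * x)\<^sup>2 / 2))) * (iexp (- (t * x)) * h t) \<partial>lborel)"
          by (intro Bochner_Integration.integral_cong) (simp_all only: mult_ac)
        also have "\<dots> = (iexp (s * x) * complex_of_real (exp (- (e * x)\<^sup>2 / 2))) * (\<integral>t. iexp (- (t * x)) * h t \<partial>lborel)"
          by (rule integral_mult_right_zero)
        finally show ?thesis unfolding inv_fourier_def by simp
      qed
      then have "(\<integral>x. \<integral>t. ?g x t \<partial>lborel \<partial>lborel) = (2 * pi) * L k"
        unfolding L_def e_def[symmetric] by (simp only: integral_mult_right_zero)
      then show ?thesis by simp
    qed
    also have "(\<integral>x. \<integral>t. ?g x t \<partial>lborel \<partial>lborel) = (\<integral>t. \<integral>x. ?g x t \<partial>lborel \<partial>lborel)"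
      by (rule lborel_pair.Fubini_integral[symmetric, OF gint])
    also have "\<dots> = (\<integral>t. h t * complex_of_real (sqrt (2 * pi) / e * exp (- ((s - t) / e)\<^sup>2 / 2)) \<partial>lborel)"
    proof (rule Bochner_Integration.integral_cong[OF refl])
      fix t
      have "(\<integral>x. ?g x t \<partial>lborel) = (\<integral>x. h t * (iexp ((s - t) * x) * complex_of_real (exp (- (e * x)\<^sup>2 / 2))) \<partial>lborel)"
        by (intro Bochner_Integration.integral_cong) (auto simp: exp_add[symmetric] algebra_simps simp flip: exp_of_real)
      also have "\<dots> = h t * (\<integral>x. (iexp ((s - t) * x) * complex_of_real (exp (- (e * x)\<^sup>2 / 2))) \<partial>lborel)"
        by (rule integral_mult_right_zero)
      finally show "(\<integral>x. ?g x t \<partial>lborel) = h t * complex_of_real (sqrt (2 * pi) / e * exp (- ((s - t) / e)\<^sup>2 / 2))"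
        by (simp only: integral_gaussian_iexp(2)[OF e])
    qed
    \<comment> \<open>Substitution t = s - e z; the Jacobian e cancels the 1/e of the Gaussian
      transform, so that an average over the standard normal law remains.\<close>
    also have "\<dots> = \<bar>- e\<bar> *\<^sub>R (\<integral>z. h (s + (- e) * z) * complex_of_real (sqrt (2 * pi) / e * exp (- ((s - (s + (- e) * z)) / e)\<^sup>2 / 2)) \<partial>lborel)"
      using e by (intro lborel_integral_real_affine) auto
    also have "\<dots> = (2 * pi) * (\<integral>z. complex_of_real (std_normal_density z) * h (s - e * z) \<partial>lborel)"
    proof -
      have "h (s + (- e) * z) * complex_of_real (sqrt (2 * pi) / e * exp (- ((s - (s + (- e) * z)) / e)\<^sup>2 / 2))
         = complex_of_real (2 * pi / e) * (complex_of_real (std_normal_density z) * h (s - e * z))" for z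
      proof -
        have "sqrt (2 * pi) / e * exp (- ((s - (s + (- e) * z)) / e)\<^sup>2 / 2) = 2 * pi / e * std_normal_density z"
          using e by (simp add: std_normal_density_def field_simps)
        moreover have "s + (- e) * z = s - e * z" by simp
        ultimately show ?thesis by (simp only: of_real_mult mult_ac)
      qed
      then have "(\<integral>z. h (s + (- e) * z) * complex_of_real (sqrt (2 * pi) / e * exp (- ((s - (s + (- e) * z)) / e)\<^sup>2 / 2)) \<partial>lborel)
        = (\<integral>z. complex_of_real (2 * pi / e) * (complex_of_real (std_normal_density z) * h (s - e * z)) \<partial>lborel)" by presburger
      also have "\<dots> = complex_of_real (2 * pi / e) * (\<integral>z. complex_of_real (std_normal_density z) * h (s - e * z) \<partial>lborel)"
        by (rule integral_mult_right_zero)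
      finally show ?thesis using e by (simp add: scaleR_conv_of_real)
    qed
    finally show ?thesis by (simp add: e_def)
  qed
  have "(\<lambda>k. \<integral>z. complex_of_real (std_normal_density z) * h (s - E k * z) \<partial>lborel)
    \<longlonglongrightarrow> (\<integral>z. complex_of_real (std_normal_density z) * h (s - 0 * z) \<partial>lborel)"
  proof (rule integral_dominated_convergence[where w = "\<lambda>z. std_normal_density z * B"])
    have "isCont h x" for x using cont by (simp add: continuous_on_eq_continuous_at)
    then show "AE x in lborel. (\<lambda>i. complex_of_real (std_normal_density x) * h (s - E i * x))
         \<longlonglongrightarrow> complex_of_real (std_normal_density x) * h (s - 0 * x)"
      by (intro AE_I2 tendsto_intros isCont_tendsto_compose[of _ h] Elim)
    show "AE x in lborel. norm (complex_of_real (std_normal_density x) * h (s - E i * x)) \<le> std_normal_density x * B" for i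
      using bnd by (intro AE_I2) (auto simp: norm_mult normal_density_nonneg intro!: mult_left_mono)
  qed (use integrable_normal_density[of 1 0] in auto)
  also have "(\<integral>z. complex_of_real (std_normal_density z) * h (s - 0 * z) \<partial>lborel) = h s"
  proof -
    have "(\<integral>z. complex_of_real (std_normal_density z) * h (s - 0 * z) \<partial>lborel) =
        (\<integral>z. complex_of_real (std_normal_density z) \<partial>lborel) * h s" by simp
    also have "(\<integral>z. complex_of_real (std_normal_density z) \<partial>lborel) = complex_of_real (\<integral>z. std_normal_density z \<partial>lborel)"
      by (rule integral_complex_of_real)
    finally show ?thesis using integral_normal_density[of 1 0] by simp
  qed
  finally have "(\<lambda>k. \<integral>z. complex_of_real (std_normal_density z) * h (s - E k * z) \<partial>lborel) \<longlonglongrightarrow> h s" .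
  moreover have "L = (\<lambda>k. \<integral>z. complex_of_real (std_normal_density z) * h (s - E k * z) \<partial>lborel)"
    using 2 by (rule ext)
  ultimately have "L \<longlonglongrightarrow> h s" by simp
  from LIMSEQ_unique[OF 1 this] show ?thesis by simp
qed

text \<open>Hermitian symmetry makes the inverse transform real. Its positive and negative parts are
  densities of two finite measures whose transforms differ by h; if it is nonnegative, the second
  measure has transform 0.\<close>

lemma sgn_char_of_integrable:
  assumes cont: "continuous_on UNIV h" and int: "integrable lborel h" and bnd: "\<And>t. norm (h t) \<le> B"
    and intg: "integrable lborel (inv_fourier h)" and herm: "\<And>t. h (- t) = cnj (h t)"
  shows "sgn_char h" and "(\<And>x. 0 \<le> Re (inv_fourier h x)) \<Longrightarrow> pos_char h"
proof -
  have [measurable]: "h \<in> borel_measurable borel" using cont by (rule borel_measurable_continuous_onI)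
  note [measurable] = inv_fourier_measurable[of h]
  have real: "inv_fourier h x = complex_of_real (Re (inv_fourier h x))" for x
  proof -
    have "(\<integral>t. iexp (- (t * x)) * h t \<partial>lborel) = (\<integral>t. iexp (- ((- t) * x)) * h (- t) \<partial>lborel)"
      using lborel_integral_real_affine[of "-1" "\<lambda>t. iexp (- (t * x)) * h t" 0] by simp
    also have "\<dots> = (\<integral>t. cnj (iexp (- (t * x)) * h t) \<partial>lborel)"
      by (intro Bochner_Integration.integral_cong) (auto simp: herm exp_cnj)
    also have "\<dots> = cnj (\<integral>t. iexp (- (t * x)) * h t \<partial>lborel)" by (rule Bochner_Integration.integral_cnj)
    finally have "cnj (inv_fourier h x) = inv_fourier h x"
      by (simp add: inv_fourier_def)
    then show ?thesis by (simp add: complex_eq_iff)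
  qed
  \<comment> \<open>\<open>P 1\<close> and \<open>P (-1)\<close> have the positive and the negative
    part as density.\<close>
  define P where "P r = density lborel (\<lambda>x. ennreal (max 0 (r * Re (inv_fourier h x))))" for r :: real
  have Pint: "integrable lborel (\<lambda>x. max 0 (r * Re (inv_fourier h x)))" for r
    using intg by (intro integrable_max) auto
  have P: "finite_borel_measure (P r)" for r
  proof (rule finite_borel_measureI[OF finite_measureI])
    have "emeasure (P r) (space (P r)) = (\<integral>\<^sup>+x. ennreal (max 0 (r * Re (inv_fourier h x))) \<partial>lborel)"
      by (simp add: P_def emeasure_density)
    also have "\<dots> < \<infinity>" using integrableD(2)[OF Pint[of r]] by (simp add: less_top)
    finally show "emeasure (P r) (space (P r)) \<noteq> \<infinity>" by simp
  qed (simp add: P_def)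
  have chP: "char (P r) t = (\<integral>x. iexp (t * x) * complex_of_real (max 0 (r * Re (inv_fourier h x))) \<partial>lborel)" for r t
    unfolding P_def char_def
    by (subst integral_density) (auto simp: scaleR_conv_of_real mult.commute)
  have iP: "complex_integrable lborel (\<lambda>x. iexp (t * x) * complex_of_real (max 0 (r * Re (inv_fourier h x))))" for r t
    by (rule Bochner_Integration.integrable_bound[OF Pint[of r]]) (auto simp: norm_mult simp del: of_real_mult)
  have eq: "h t = char (P 1) t - char (P (-1)) t" for t
  proof -
    have "h t = (\<integral>x. iexp (t * x) * inv_fourier h x \<partial>lborel)"
      using fourier_inversion_L1[OF cont int bnd intg] by simp
    also have "\<dots> = (\<integral>x. iexp (t * x) * complex_of_real (max 0 (1 * Re (inv_fourier h x)))
         - iexp (t * x) * complex_of_real (max 0 ((-1) * Re (inv_fourier h x))) \<partial>lborel)"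
    proof (rule Bochner_Integration.integral_cong[OF refl])
      fix x
      have "inv_fourier h x = complex_of_real (max 0 (1 * Re (inv_fourier h x)) - max 0 ((-1) * Re (inv_fourier h x)))"
        by (subst real) (simp add: max_def)
      then show "iexp (t * x) * inv_fourier h x = iexp (t * x) * complex_of_real (max 0 (1 * Re (inv_fourier h x)))
         - iexp (t * x) * complex_of_real (max 0 ((-1) * Re (inv_fourier h x)))"
        by (simp only: of_real_diff right_diff_distrib[symmetric])
    qed
    also have "\<dots> = char (P 1) t - char (P (-1)) t"
      unfolding chP by (rule Bochner_Integration.integral_diff[OF iP iP])
    finally show ?thesis .
  qed
  have "bv_char (\<lambda>x. measure (P 1) {..x} - measure (P (-1)) {..x}) h"
    by (rule bv_charI[OF P P _ eq]) simp
  then show "sgn_char h" unfolding sgn_char_iff_bv_char by blast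
  show "pos_char h" if "\<And>x. 0 \<le> Re (inv_fourier h x)"
  proof -
    have "char (P (-1)) t = 0" for t
    proof -
      have "max 0 ((-1) * Re (inv_fourier h x)) = 0" for x using that[of x] by simp
      then show ?thesis by (simp only: chP) simp
    qed
    then show ?thesis using eq by (intro pos_charI[OF P[of 1]]) simp
  qed
qed

lemma integrable_of_inverse_square_bound:
  fixes h :: "real \<Rightarrow> 'a::{banach, second_countable_topology}"
  assumes [measurable]: "h \<in> borel_measurable borel" and "\<And>t. norm (h t) \<le> A" and "\<And>t. t\<^sup>2 * norm (h t) \<le> B"
  shows "integrable lborel h"
proof (rule Bochner_Integration.integrable_bound)
  show "integrable lborel (\<lambda>t::real. (A + B) * (1 / (1 + t\<^sup>2)))"
    using integrable_inverse_1_plus_square_lborel by (intro integrable_mult_right)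
  have "norm (h t) \<le> (A + B) * (1 / (1 + t\<^sup>2))" for t
  proof -
    have "(1 + t\<^sup>2) * norm (h t) \<le> A + B" using assms(2)[of t] assms(3)[of t] by (simp add: distrib_right)
    then show ?thesis by (simp add: field_simps add_pos_nonneg)
  qed
  then show "AE t in lborel. norm (h t) \<le> norm ((A + B) * (1 / (1 + t\<^sup>2)))"
    by (intro AE_I2) (metis abs_ge_self order_trans real_norm_def)
qed measurable

subsection \<open>The Fejer kernel and the smoothing inequality\<close>

text \<open>The characteristic function of the Fejer density (1 - cos x)/(pi x^2): a probability law
  whose transform has compact support.\<close>

definition triangle :: "real \<Rightarrow> real" where "triangle t = max 0 (1 - \<bar>t\<bar>)"

lemma integral_triangle_cos:
  fixes x :: real
  assumes "x \<noteq> 0"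
  shows "(\<integral>t. indicator {0..1} t *\<^sub>R ((1 - t) * cos (t * x)) \<partial>lborel) = (1 - cos x) / x\<^sup>2"
proof -
  have "(\<integral>t. indicator {0..1} t *\<^sub>R ((1 - t) * cos (t * x)) \<partial>lborel) =
     ((1 - 1) * sin (1 * x) / x - cos (1 * x) / x\<^sup>2) - ((1 - 0) * sin (0 * x) / x - cos (0 * x) / x\<^sup>2)"
  proof (rule integral_FTC_Icc[where F = "\<lambda>t. (1 - t) * sin (t * x) / x - cos (t * x) / x\<^sup>2"])
    fix t :: real
    show "((\<lambda>t. (1 - t) * sin (t * x) / x - cos (t * x) / x\<^sup>2) has_vector_derivative (1 - t) * cos (t * x)) (at t within {0..1})"
      unfolding has_real_derivative_iff_has_vector_derivative[symmetric]
      using assms by (auto intro!: derivative_eq_intros simp: field_simps power2_eq_square)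
  qed (auto intro!: continuous_intros)
  then show ?thesis by (simp add: diff_divide_distrib)
qed

lemma triangle_pos_char: "pos_char (\<lambda>t. complex_of_real (triangle t))"
proof -
  let ?h = "\<lambda>t. complex_of_real (triangle t)"
  have cont: "continuous_on UNIV ?h" unfolding triangle_def by (intro continuous_intros)
  then have [measurable]: "?h \<in> borel_measurable borel" by (rule borel_measurable_continuous_onI)
  have mt [measurable]: "triangle \<in> borel_measurable borel" unfolding triangle_def by measurable
  have int: "integrable lborel ?h"
    by (rule integrable_of_inverse_square_bound[of _ 1 1])
       (auto simp: triangle_def max_def abs_le_iff intro!: mult_le_one abs_square_le_1[THEN iffD2])
  have val: "inv_fourier ?h x = complex_of_real ((1 - cos x) / (pi * x\<^sup>2))" if x: "x \<noteq> 0" for x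
  proof -
    have i0: "integrable lborel (\<lambda>t. iexp (- (t * x)) * ?h t)"
      by (rule Bochner_Integration.integrable_bound[OF int]) (auto simp: norm_mult simp del: of_real_mult of_real_minus)
    have ic: "integrable lborel (\<lambda>t. cos (t * x) * triangle t)"
    proof (rule Bochner_Integration.integrable_bound[OF int])
      show "AE t in lborel. norm (cos (t * x) * triangle t) \<le> norm (?h t)"
        by (intro AE_I2) (auto simp: norm_mult abs_mult mult_left_le_one_le)
    qed measurable
    have "(\<integral>t. iexp (- (t * x)) * ?h t \<partial>lborel) = (\<integral>t. iexp (- ((- t) * x)) * ?h (- t) \<partial>lborel)"
      using lborel_integral_real_affine[of "-1" "\<lambda>t. iexp (- (t * x)) * ?h t" 0] by simp
    then have "2 * (\<integral>t. iexp (- (t * x)) * ?h t \<partial>lborel) =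
        (\<integral>t. iexp (- (t * x)) * ?h t \<partial>lborel) + (\<integral>t. iexp (- ((- t) * x)) * ?h (- t) \<partial>lborel)"
      by simp
    also have "\<dots> = (\<integral>t. iexp (- (t * x)) * ?h t + iexp (- ((- t) * x)) * ?h (- t) \<partial>lborel)"
      using i0 lborel_integrable_real_affine[OF i0, of "-1" 0]
      by (intro Bochner_Integration.integral_add[symmetric]) simp_all
    also have "\<dots> = (\<integral>t. complex_of_real (2 * (cos (t * x) * triangle t)) \<partial>lborel)"
      by (intro Bochner_Integration.integral_cong)
         (auto simp: triangle_def complex_eq_iff Re_exp Im_exp)
    also have "\<dots> = complex_of_real (\<integral>t. 2 * (cos (t * x) * triangle t) \<partial>lborel)"
      by (rule integral_complex_of_real)
    also have "\<dots> = 2 * complex_of_real (\<integral>t. cos (t * x) * triangle t \<partial>lborel)"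
      by simp
    finally have 1: "(\<integral>t. iexp (- (t * x)) * ?h t \<partial>lborel) = complex_of_real (\<integral>t. cos (t * x) * triangle t \<partial>lborel)"
      by simp
    have j: "integrable lborel (\<lambda>t. indicator {0..1} t *\<^sub>R ((1 - t) * cos (t * x)))"
      using borel_integrable_atLeastAtMost'[of 0 1 "\<lambda>t. (1 - t) * cos (t * x)"]
      by (simp add: set_integrable_def continuous_intros)
    have "(\<integral>t. cos (t * x) * triangle t \<partial>lborel) =
       (\<integral>t. indicator {0..1} t *\<^sub>R ((1 - t) * cos (t * x)) + indicator {0..1} (-t) *\<^sub>R ((1 - (-t)) * cos ((-t) * x)) \<partial>lborel)"
    proof (rule integral_cong_AE)
      \<comment> \<open>At t = 0 both indicators are 1, so the decomposition into two halves fails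
        there and holds only almost everywhere.\<close>
      have "AE t in lborel. t \<noteq> (0::real)" by (rule AE_lborel_singleton)
      then show "AE t in lborel. cos (t * x) * triangle t = indicator {0..1} t *\<^sub>R ((1 - t) * cos (t * x)) + indicator {0..1} (-t) *\<^sub>R ((1 - (-t)) * cos ((-t) * x))"
        by eventually_elim (auto simp: triangle_def indicator_def)
    qed measurable
    also have "\<dots> = (\<integral>t. indicator {0..1} t *\<^sub>R ((1 - t) * cos (t * x)) \<partial>lborel) +
        (\<integral>t. indicator {0..1} (-t) *\<^sub>R ((1 - (-t)) * cos ((-t) * x)) \<partial>lborel)"
      using j lborel_integrable_real_affine[OF j, of "-1" 0] by (intro Bochner_Integration.integral_add) simp_all
    also have "(\<integral>t. indicator {0..1} (-t) *\<^sub>R ((1 - (-t)) * cos ((-t) * x)) \<partial>lborel) = (\<integral>t. indicator {0..1} t *\<^sub>R ((1 - t) * cos (t * x)) \<partial>lborel)"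
      using lborel_integral_real_affine[of "-1" "\<lambda>t. indicator {0..1} t *\<^sub>R ((1 - t) * cos (t * x))" 0] by simp
    finally have "(\<integral>t. cos (t * x) * triangle t \<partial>lborel) = 2 * ((1 - cos x) / x\<^sup>2)"
      by (simp only: integral_triangle_cos[OF x])
    then have "1 / (2 * pi) * (\<integral>t. cos (t * x) * triangle t \<partial>lborel) = (1 - cos x) / (pi * x\<^sup>2)"
      using x by (simp add: divide_simps)
    then have "complex_of_real (1 / (2 * pi) * (\<integral>t. cos (t * x) * triangle t \<partial>lborel)) = complex_of_real ((1 - cos x) / (pi * x\<^sup>2))"
      by (simp only:)
    then show ?thesis unfolding inv_fourier_def 1 by (simp only: of_real_mult of_real_divide of_real_1 of_real_numeral)
  qed
  have intg: "integrable lborel (inv_fourier ?h)"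
  proof (rule integrable_of_inverse_square_bound)
    show "norm (inv_fourier ?h x) \<le> (1 / (2 * pi)) * (\<integral>t. norm (?h t) \<partial>lborel)" for x
      by (rule norm_inv_fourier_le[OF int])
    show "x\<^sup>2 * norm (inv_fourier ?h x) \<le> 2" for x
    proof (cases "x = 0")
      case False
      have "x\<^sup>2 * norm (inv_fourier ?h x) = x\<^sup>2 * ((1 - cos x) / (pi * x\<^sup>2))"
        unfolding val[OF False] norm_of_real by simp
      also have "\<dots> = (1 - cos x) / pi" using False by simp
      also have "\<dots> \<le> 2 / 1" using pi_gt3 cos_ge_minus_one[of x] by (intro frac_le) auto
      finally show ?thesis by simp
    qed simp
  qed (rule inv_fourier_measurable, measurable)
  \<comment> \<open>The closed formula is available only for x \<noteq> 0; the value at 0 is a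
    multiple of the integral of \<open>triangle\<close>.\<close>
  have nn: "0 \<le> Re (inv_fourier ?h x)" for x
  proof (cases "x = 0")
    case True
    have "inv_fourier ?h 0 = complex_of_real ((1 / (2 * pi)) * (\<integral>t. triangle t \<partial>lborel))"
      by (simp add: inv_fourier_def)
    moreover have "0 \<le> (\<integral>t. triangle t \<partial>lborel)" by (rule Bochner_Integration.integral_nonneg) (simp add: triangle_def)
    ultimately show ?thesis using True by simp
  qed (simp add: val)
  show ?thesis
    by (rule sgn_char_of_integrable(2)[OF cont int _ intg _ nn, of 1]) (auto simp: triangle_def)
qed

lemma pos_char_real_distribution:
  assumes "pos_char h" "h 0 = 1"
  obtains N where "real_distribution N" "char N = h"
proof -
  obtain N where N: "finite_borel_measure N" "h = char N"
    using assms(1) by (rule pos_charE)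
  interpret N: finite_borel_measure N by fact
  have "complex_of_real (measure N UNIV) = 1"
    using N.char_at_0 N(2) assms(2) by simp
  then have "emeasure N (space N) = 1"
    by (simp add: N.borel_UNIV N.emeasure_eq_measure)
  then interpret P: prob_space N by (rule prob_spaceI)
  have "real_distribution N" by unfold_locales (auto simp: N.borel_UNIV)
  then show ?thesis using N(2) that by blast
qed

lemma fejer_distribution:
  obtains U where "real_distribution U" "\<And>t. char U t = complex_of_real (triangle t)"
  by (rule pos_char_real_distribution[OF triangle_pos_char]) (auto simp: triangle_def fun_eq_iff)

text \<open>If the averages of \<open>D\<close> at scale \<open>1/T\<close> are small, and \<open>D\<close> cannot decrease quickly, then \<open>D\<close> is small:
  near a point where \<open>\<bar>D\<bar>\<close> is almost maximal, \<open>D\<close> stays large on one side.\<close>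

lemma smoothing_inequality:
  assumes U: "real_distribution U" and \<kappa>: "measure U {-a..a} \<ge> 3/4" "a \<ge> 0"
    and D: "D \<in> borel_measurable borel" "\<And>x. \<bar>D x\<bar> \<le> B"
    and mono: "\<And>x s. 0 \<le> s \<Longrightarrow> D (x + s) \<ge> D x - m * s" and m: "m \<ge> 0"
    and J: "\<And>x. \<bar>\<integral>u. D (x - u) \<partial>U\<bar> \<le> J"
  shows "\<bar>D x\<bar> \<le> 2 * J + 4 * m * a"
proof -
  interpret U: real_distribution U by fact
  note [measurable] = D(1)
  define \<eta> where "\<eta> = (SUP x. \<bar>D x\<bar>)"
  have bdd: "bdd_above (range (\<lambda>x. \<bar>D x\<bar>))" using D(2) by (auto intro!: bdd_aboveI)
  have le: "\<bar>D x\<bar> \<le> \<eta>" for x unfolding \<eta>_def using bdd by (intro cSUP_upper) auto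
  have \<eta>0: "0 \<le> \<eta>" using le[of 0] by linarith
  define k where "k = measure U {-a..a}"
  have k: "3/4 \<le> k" "k \<le> 1" using \<kappa> by (auto simp: k_def)
  have int: "integrable U (\<lambda>u. D (x - u))" for x
    by (rule U.integrable_const_bound[where B = B]) (use D in auto)
  \<comment> \<open>On [-a,a], of mass k, the integrand is at least d - 2ma; elsewhere only the
    bound -\<open>\<eta>\<close> is at hand. The sign \<open>\<sigma>\<close> treats both signs of
    \<open>D\<close> at once.\<close>
  have lowerbound: "J \<ge> (d - 2 * m * a) * k - \<eta> * (1 - k)"
    if "\<And>u. \<bar>u\<bar> \<le> a \<Longrightarrow> \<sigma> * D (y - u) \<ge> d - 2 * m * a" "\<bar>\<sigma>\<bar> = 1" for y d \<sigma>
  proof -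
    have "(d - 2 * m * a) * k - \<eta> * (1 - k) = (d - 2 * m * a + \<eta>) * k - \<eta>" by (simp add: algebra_simps)
    also have "\<dots> = (\<integral>u. (d - 2 * m * a + \<eta>) * indicator {-a..a} u - \<eta> \<partial>U)"
      by (subst Bochner_Integration.integral_diff) (auto simp: k_def U.emeasure_eq_measure U.prob_space[unfolded U.borel_UNIV] U.borel_UNIV)
    also have "\<dots> \<le> (\<integral>u. \<sigma> * D (y - u) \<partial>U)"
    proof (rule integral_mono)
      fix u
      have "\<bar>\<sigma> * D (y - u)\<bar> \<le> \<eta>" using le[of "y - u"] that(2) by (simp add: abs_mult)
      then show "(d - 2 * m * a + \<eta>) * indicator {-a..a} u - \<eta> \<le> \<sigma> * D (y - u)"
        using that(1)[of u] by (cases "u \<in> {-a..a}") (auto simp: indicator_def abs_le_iff)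
    qed (auto intro!: integrable_mult_right int simp: U.emeasure_eq_measure)
    also have "\<dots> \<le> \<bar>\<integral>u. D (y - u) \<partial>U\<bar>"
      using that(2) by (auto simp: abs_if split: if_splits)
    also have "\<dots> \<le> J" by (rule J)
    finally show ?thesis .
  qed
  \<comment> \<open>Since \<open>D\<close> cannot fall fast, it stays large to the right of a point
    with a large positive value and very negative to the left of a point with a large negative
    value. The centre of averaging is therefore moved by a in that direction.\<close>
  have J': "J \<ge> (d - 2 * m * a) * k - \<eta> * (1 - k)" if "\<bar>D x\<bar> = d" for x d
  proof (cases "D x \<ge> 0")
    case True
    show ?thesis
    proof (rule lowerbound[of d 1 "x + a"])
      fix u assume "\<bar>u\<bar> \<le> a"
      then have "D (x + (a - u)) \<ge> D x - m * (a - u)" "m * (a - u) \<le> m * (2 * a)"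
        by (auto intro!: mono mult_left_mono m)
      then show "1 * D (x + a - u) \<ge> d - 2 * m * a" using that True by (simp add: algebra_simps)
    qed auto
  next
    case False
    show ?thesis
    proof (rule lowerbound[of d "-1" "x - a"])
      fix u assume "\<bar>u\<bar> \<le> a"
      then have "D ((x - a - u) + (a + u)) \<ge> D (x - a - u) - m * (a + u)" "m * (a + u) \<le> m * (2 * a)"
        by (intro mono mult_left_mono m; simp)+
      moreover have "x - a - u + (a + u) = x" by simp
      ultimately show "-1 * D (x - a - u) \<ge> d - 2 * m * a" using that False by (simp add: algebra_simps)
    qed auto
  qed
  have "\<eta> \<le> 2 * J + 4 * m * a"
  proof (rule ccontr)
    assume "\<not> ?thesis"
    then have gt: "2 * J + 4 * m * a < \<eta>" by simp
    have J0: "0 \<le> J" using J[of 0] by linarith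
    have "\<forall>x. \<bar>D x\<bar> * k \<le> J + 2 * m * a * k + \<eta> * (1 - k)"
      using J' by (auto simp: algebra_simps)
    then have "\<bar>D x\<bar> \<le> (J + 2 * m * a * k + \<eta> * (1 - k)) / k" for x
      using k by (simp add: field_simps)
    then have "\<eta> \<le> (J + 2 * m * a * k + \<eta> * (1 - k)) / k" unfolding \<eta>_def by (intro cSUP_least) auto
    then have "\<eta> * k \<le> J + 2 * m * a * k + \<eta> * (1 - k)" using k by (simp add: field_simps)
    then have 1: "\<eta> * (2 * k - 1) \<le> J + 2 * m * a * k" by (simp add: algebra_simps)
    \<comment> \<open>Mass at least 3/4 on [-a,a] makes 2k-1 at least 1/2; this is the source of the
      factors 2 and 4 in the conclusion.\<close>
    have "\<eta> * (1/2) \<le> \<eta> * (2 * k - 1)" using k \<eta>0 by (intro mult_left_mono) auto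
    moreover have "2 * m * a * k \<le> 2 * m * a * 1" using k m \<kappa> by (intro mult_left_mono) auto
    ultimately show False using 1 gt by linarith
  qed
  then show ?thesis using le[of x] by linarith
qed

text \<open>Smoothing with the Fejer law shrunk by T leaves only \<bar>t\<bar> \<le> T. The
  condition on \<open>D\<close> is one-sided since \<open>D\<close> will be a monotone function
  minus a Lipschitz one. The constant precedes all other parameters and so depends on the Fejer law
  alone.\<close>

theorem Esseen_inequality:
  obtains C where "C > 0" "\<And>D h T m B x. \<lbrakk>bv_char D h; T > 0; m \<ge> 0;
     \<And>x s. 0 \<le> s \<Longrightarrow> D (x + s) \<ge> D x - m * s;
     integrable lborel B; \<And>t. 0 \<le> B t; \<And>t. \<bar>t\<bar> \<le> T \<Longrightarrow> norm (h t) \<le> \<bar>t\<bar> * B t\<rbrakk>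
    \<Longrightarrow> \<bar>D x\<bar> \<le> (\<integral>t. B t \<partial>lborel) + C * m / T"
proof -
  obtain U where U: "real_distribution U" "\<And>t. char U t = complex_of_real (triangle t)"
    using fejer_distribution by blast
  interpret U: real_distribution U by fact
  have "(\<lambda>k. measure U {- real k..real k}) \<longlonglongrightarrow> measure U (\<Union>k. {- real k..real k})"
    by (rule U.finite_Lim_measure_incseq) (auto simp: incseq_def)
  moreover have "(\<Union>k. {- real k..real k}) = UNIV"
  proof -
    have "\<exists>k. x \<in> {- real k..real k}" for x :: real
      using real_arch_simple[of "\<bar>x\<bar>"] by (metis abs_le_iff atLeastAtMost_iff minus_le_iff)
    then show ?thesis by blast
  qed
  ultimately have "(\<lambda>k. measure U {- real k..real k}) \<longlonglongrightarrow> 1"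
    using U.prob_space U.borel_UNIV by simp
  then have "\<forall>\<^sub>F k in sequentially. measure U {- real k..real k} > 3/4"
    by (rule order_tendstoD) simp
  then obtain a :: nat where a: "measure U {- real a..real a} > 3/4"
    by (auto simp: eventually_sequentially)
  show ?thesis
  \<comment> \<open>[-a,a] carries 3/4 of the Fejer law and shrinks to half-width a/T after scaling;
    adding 1 keeps the constant positive.\<close>
  proof (rule that[of "4 * (real a + 1)"])
    fix D h and T m :: real and B x
    assume F: "bv_char D h" and T: "T > 0" and m: "m \<ge> 0"
      and mono: "\<And>x s. 0 \<le> s \<Longrightarrow> D (x + s) \<ge> D x - m * s"
      and B: "integrable lborel B" "\<And>t. 0 \<le> B t" "\<And>t. \<bar>t\<bar> \<le> T \<Longrightarrow> norm (h t) \<le> \<bar>t\<bar> * B t"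
    define V where "V = distr U borel (\<lambda>u. (1 / T) * u)"
    have fU: "finite_borel_measure U" using U(1) by (rule real_distribution_finite_borel)
    interpret V: real_distribution V unfolding V_def by (rule U.real_distribution_distr) simp
    have fV: "finite_borel_measure V" by (rule real_distribution_finite_borel) unfold_locales
    have chV: "char V t = complex_of_real (triangle (t / T))" for t
      unfolding V_def char_distr_scale[OF fU] U(2) by simp
    obtain b where b: "\<And>x. \<bar>D x\<bar> \<le> b" using bv_char_bounded[OF F] by metis
    have J: "\<bar>\<integral>u. D (x - u) \<partial>V\<bar> \<le> (1 / pi) * (\<integral>t. B t \<partial>lborel)" for x
    proof (rule bv_char_sup_bound[OF bv_char_convolution[OF F fV] B(1) _ B(2)])
      fix t
      show "norm (h t * char V t) \<le> \<bar>t\<bar> * B t"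
      proof (cases "\<bar>t\<bar> \<le> T")
        case True
        have "norm (char V t) \<le> 1" by (rule V.cmod_char_le_1)
        then have "norm (h t * char V t) \<le> norm (h t)" unfolding norm_mult by (rule mult_left_le) simp
        then show ?thesis using B(3)[OF True] by linarith
      next
        case False
        then have "char V t = 0" using T by (simp add: chV triangle_def max_def field_simps)
        then show ?thesis using B(2) by simp
      qed
    qed
    have ma: "measure V {- (a / T)..a / T} \<ge> 3/4"
    proof -
      have *: "(\<lambda>u. (1 / T) * u) -` {- (a / T)..a / T} \<inter> space U = {- real a..real a}"
        using T by (auto simp: U.borel_UNIV field_simps)
      have "measure V {- (a / T)..a / T} = measure U ((\<lambda>u. (1 / T) * u) -` {- (a / T)..a / T} \<inter> space U)"
        unfolding V_def by (rule measure_distr) auto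
      then show ?thesis unfolding * using a by linarith
    qed
    have "\<bar>D x\<bar> \<le> 2 * ((1 / pi) * (\<integral>t. B t \<partial>lborel)) + 4 * m * (a / T)"
      by (rule smoothing_inequality[OF V.real_distribution_axioms ma _ bv_char_measurable_fun[OF F] b mono m J]) (use T in auto)
    moreover have "2 * ((1 / pi) * (\<integral>t. B t \<partial>lborel)) \<le> (\<integral>t. B t \<partial>lborel)"
    proof -
      have "(2 / pi) * (\<integral>t. B t \<partial>lborel) \<le> 1 * (\<integral>t. B t \<partial>lborel)"
        using pi_gt3 B(2) by (intro mult_right_mono Bochner_Integration.integral_nonneg) auto
      then show ?thesis by simp
    qed
    moreover have "4 * m * (a / T) \<le> 4 * (real a + 1) * m / T" using m T by (simp add: field_simps)
    ultimately show "\<bar>D x\<bar> \<le> (\<integral>t. B t \<partial>lborel) + 4 * (real a + 1) * m / T" by linarith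
  qed simp
qed

subsection \<open>Closure of characteristic functions under limits\<close>

text \<open>Averaging the characteristic function over a normal law yields the expectation of exp
  (-(\<sigma> x)^2/2), and for \<bar>x\<bar> \<ge> 1/\<sigma> this variable falls short of 1 by at
  least 1 - exp (-1/2).\<close>

lemma real_distribution_tail_bound:
  assumes M: "real_distribution M" and \<sigma>: "\<sigma> > 0"
  shows "(1 - exp (- (1/2))) * measure M {x. \<bar>x\<bar> \<ge> 1 / \<sigma>} \<le> 1 - Re (\<integral>z. char M (\<sigma> * z) \<partial>std_normal_distribution)"
proof -
  interpret M: real_distribution M by fact
  interpret N: real_distribution std_normal_distribution by (rule real_dist_normal_dist)
  have fM: "finite_borel_measure M" and fN: "finite_borel_measure std_normal_distribution"
    using M real_dist_normal_dist by (auto intro: real_distribution_finite_borel)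
  have int: "integrable M (\<lambda>x. exp (- (\<sigma> * x)\<^sup>2 / 2))"
    by (rule M.integrable_const_bound[where B = 1]) auto
  have "(\<integral>z. char M (\<sigma> * z) \<partial>std_normal_distribution) = (\<integral>z. char (distr M borel (\<lambda>x. \<sigma> * x)) z \<partial>std_normal_distribution)"
    by (simp add: char_distr_scale[OF fM])
  also have "\<dots> = (\<integral>x. char std_normal_distribution x \<partial>(distr M borel (\<lambda>x. \<sigma> * x)))"
    by (rule finite_borel_Parseval[OF finite_borel_distr_scale[OF fM] fN])
  also have "\<dots> = (\<integral>x. complex_of_real (exp (- (\<sigma> * x)\<^sup>2 / 2)) \<partial>M)"
    unfolding char_std_normal_distribution by (subst integral_distr) auto
  also have "\<dots> = complex_of_real (\<integral>x. exp (- (\<sigma> * x)\<^sup>2 / 2) \<partial>M)" by (rule integral_complex_of_real)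
  finally have eq: "Re (\<integral>z. char M (\<sigma> * z) \<partial>std_normal_distribution) = (\<integral>x. exp (- (\<sigma> * x)\<^sup>2 / 2) \<partial>M)"
    by simp
  have "(1 - exp (- (1/2))) * measure M {x. \<bar>x\<bar> \<ge> 1 / \<sigma>} = (\<integral>x. (1 - exp (- (1/2))) * indicator {x. \<bar>x\<bar> \<ge> 1 / \<sigma>} x \<partial>M)"
    by (simp add: M.borel_UNIV)
  also have "\<dots> \<le> (\<integral>x. 1 - exp (- (\<sigma> * x)\<^sup>2 / 2) \<partial>M)"
  proof (rule integral_mono)
    fix x
    show "(1 - exp (- (1/2))) * indicator {x. \<bar>x\<bar> \<ge> 1 / \<sigma>} x \<le> 1 - exp (- (\<sigma> * x)\<^sup>2 / 2)"
    proof (cases "\<bar>x\<bar> \<ge> 1 / \<sigma>")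
      case True
      then have "1 \<le> \<bar>\<sigma> * x\<bar>" using \<sigma> by (simp add: abs_mult field_simps)
      then have "1 \<le> (\<sigma> * x)\<^sup>2" by (metis one_le_power power2_abs)
      then show ?thesis using True by simp
    qed simp
  qed (auto intro!: integrable_mult_right int M.integrable_const_bound[where B = 1] simp: M.emeasure_eq_measure)
  also have "\<dots> = 1 - (\<integral>x. exp (- (\<sigma> * x)\<^sup>2 / 2) \<partial>M)"
    using int M.prob_space by (subst Bochner_Integration.integral_diff) (auto simp: M.borel_UNIV)
  finally show ?thesis using eq by simp
qed

text \<open>Levy's continuity theorem when the limit is known only as a function continuous at 0.
  Continuity gives tightness via the tail bound, tightness a weakly convergent subsequence, and its
  limit law has transform \<open>\<phi>\<close>.\<close>

lemma pos_char_limit: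
  assumes u: "\<And>n. pos_char (u n)" "\<And>n. u n 0 = 1" and lim: "\<And>t. (\<lambda>n. u n t) \<longlonglongrightarrow> \<phi> t" and cont: "isCont \<phi> 0"
  shows "pos_char \<phi>"
proof -
  have "\<exists>N. real_distribution N \<and> char N = u n" for n
    using pos_char_real_distribution[OF u(1) u(2)] by metis
  then obtain M where M: "\<And>n. real_distribution (M n)" "\<And>n. char (M n) = u n" by metis
  interpret M: real_distribution "M n" for n by (rule M)
  interpret N: real_distribution std_normal_distribution by (rule real_dist_normal_dist)
  have meas_u [measurable]: "u n \<in> borel_measurable borel" for n
    using M.char_measurable M(2) by metis
  have meas [measurable]: "\<phi> \<in> borel_measurable borel"
    by (rule borel_measurable_LIMSEQ_metric[OF meas_u lim])
  have nu: "norm (u n t) \<le> 1" for n t using M.cmod_char_le_1 M(2) by metis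
  have n\<phi>: "norm (\<phi> t) \<le> 1" for t
    by (rule tendsto_upperbound[OF tendsto_norm[OF lim]]) (auto simp: nu)
  have \<phi>0: "\<phi> 0 = 1" using lim[of 0] u(2) by (simp add: LIMSEQ_const_iff)
  define I where "I \<sigma> = (\<integral>z. \<phi> (\<sigma> * z) \<partial>std_normal_distribution)" for \<sigma> :: real
  have Ilim: "(\<lambda>n. \<integral>z. u n (\<sigma> * z) \<partial>std_normal_distribution) \<longlonglongrightarrow> I \<sigma>" for \<sigma>
    unfolding I_def
    by (rule integral_dominated_convergence[where w = "\<lambda>_. 1"]) (auto simp: nu intro!: lim)
  have "(\<lambda>k. I (1 / real (Suc k))) \<longlonglongrightarrow> (\<integral>z. \<phi> 0 \<partial>std_normal_distribution)"
    unfolding I_def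
  proof (rule integral_dominated_convergence[where w = "\<lambda>_. 1"])
    have "(\<lambda>k. 1 / real (Suc k) * z) \<longlonglongrightarrow> 0" for z
      using tendsto_mult[OF LIMSEQ_inverse_real_of_nat tendsto_const[of z]] by (simp add: inverse_eq_divide)
    then show "AE x in std_normal_distribution. (\<lambda>i. \<phi> (1 / real (Suc i) * x)) \<longlonglongrightarrow> \<phi> 0"
      by (intro AE_I2 isCont_tendsto_compose[OF cont])
  qed (auto simp: n\<phi>)
  then have I1: "(\<lambda>k. I (1 / real (Suc k))) \<longlonglongrightarrow> 1"
    using N.prob_space by (simp add: \<phi>0)
  have "tight M"
    unfolding tight_def
  proof (intro conjI allI impI)
    fix \<epsilon> :: real assume \<epsilon>: "\<epsilon> > 0"
    \<comment> \<open>\<open>c\<close> is the factor in the tail bound. The tolerance c \<epsilon>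
      is halved: one half for replacing \<phi> by 1 at a small scale \<open>\<sigma>\<close>, the
      other for replacing u n by \<phi> at that scale for n \<ge> n0.\<close>
    define c where "c = 1 - exp (- (1/2::real))"
    have c: "c > 0" by (simp add: c_def)
    have "\<forall>\<^sub>F k in sequentially. dist (I (1 / real (Suc k))) 1 < c * \<epsilon> / 2"
      using I1 c \<epsilon> by (intro tendstoD) auto
    then obtain k where k: "dist (I (1 / real (Suc k))) 1 < c * \<epsilon> / 2"
      by (auto simp: eventually_sequentially)
    define \<sigma> where "\<sigma> = 1 / real (Suc k)"
    have \<sigma>: "\<sigma> > 0" by (simp add: \<sigma>_def)
    have "\<forall>\<^sub>F n in sequentially. dist (\<integral>z. u n (\<sigma> * z) \<partial>std_normal_distribution) (I \<sigma>) < c * \<epsilon> / 2"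
      using Ilim c \<epsilon> by (intro tendstoD) auto
    then obtain n0 where n0: "\<And>n. n \<ge> n0 \<Longrightarrow> dist (\<integral>z. u n (\<sigma> * z) \<partial>std_normal_distribution) (I \<sigma>) < c * \<epsilon> / 2"
      by (auto simp: eventually_sequentially)
    have tail: "measure (M n) {x. \<bar>x\<bar> \<ge> 1 / \<sigma>} < \<epsilon>" if "n \<ge> n0" for n
    proof -
      have "norm (1 - (\<integral>z. u n (\<sigma> * z) \<partial>std_normal_distribution)) < c * \<epsilon>"
        using n0[OF that] k dist_triangle[of 1 "(\<integral>z. u n (\<sigma> * z) \<partial>std_normal_distribution)" "I \<sigma>"]
        by (simp add: dist_norm norm_minus_commute \<sigma>_def)
      then have "1 - Re (\<integral>z. u n (\<sigma> * z) \<partial>std_normal_distribution) < c * \<epsilon>"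
        using complex_Re_le_cmod[of "1 - (\<integral>z. u n (\<sigma> * z) \<partial>std_normal_distribution)"] by simp
      then have "c * measure (M n) {x. \<bar>x\<bar> \<ge> 1 / \<sigma>} < c * \<epsilon>"
        using real_distribution_tail_bound[OF M(1) \<sigma>, of n] unfolding M(2) c_def by linarith
      then show ?thesis by (simp only: mult_less_cancel_left_pos[OF c])
    qed
    have "\<exists>R>0. 1 - \<epsilon> < measure (M n) {-R<..R}" for n
    proof -
      have "(\<lambda>k. measure (M n) {- real k<..real k}) \<longlonglongrightarrow> measure (M n) (\<Union>k. {- real k<..real k})"
        by (rule M.finite_Lim_measure_incseq) (auto simp: incseq_def)
      then have "(\<lambda>k. measure (M n) {- real k<..real k}) \<longlonglongrightarrow> 1"
        using M.prob_space unfolding UN_Ioc_eq_UNIV M.borel_UNIV by simp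
      then have "\<forall>\<^sub>F k in sequentially. 1 - \<epsilon> < measure (M n) {- real k<..real k}"
        by (rule order_tendstoD) (use \<epsilon> in simp)
      then have "\<forall>\<^sub>F k in sequentially. 1 - \<epsilon> < measure (M n) {- real k<..real k} \<and> k > 0"
        using eventually_gt_at_top by (rule eventually_conj)
      then obtain k :: nat where "1 - \<epsilon> < measure (M n) {- real k<..real k} \<and> k > 0"
        using eventually_happens' sequentially_bot by blast
      then show ?thesis by (intro exI[of _ "real k"]) auto
    qed
    then obtain R where R: "\<And>n. R n > 0" "\<And>n. 1 - \<epsilon> < measure (M n) {- R n<..R n}" by metis
    \<comment> \<open>The tail bound serves n \<ge> n0 with radius 1/\<open>\<sigma>\<close>; the
      finitely many earlier laws are covered by adding their individual radii.\<close>
    define S where "S = 1 / \<sigma> + (\<Sum>n<n0. R n)"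
    have S: "S > 0" "1 / \<sigma> \<le> S" using \<sigma> R(1) by (auto simp: S_def less_imp_le intro!: add_pos_nonneg sum_nonneg)
    have "1 - \<epsilon> < measure (M n) {-S<..S}" for n
    proof (cases "n < n0")
      case True
      have "R n \<le> (\<Sum>n<n0. R n)" using True R(1) by (intro member_le_sum) (auto simp: less_imp_le)
      moreover have "0 < 1 / \<sigma>" using \<sigma> by simp
      ultimately have "R n \<le> S" unfolding S_def by linarith
      then have "measure (M n) {- R n<..R n} \<le> measure (M n) {-S<..S}"
        by (intro M.finite_measure_mono) auto
      then show ?thesis using R(2)[of n] by linarith
    next
      case False
      have "measure (M n) (space (M n) - {x. \<bar>x\<bar> \<ge> 1 / \<sigma>}) = 1 - measure (M n) {x. \<bar>x\<bar> \<ge> 1 / \<sigma>}"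
        by (rule M.prob_compl) auto
      moreover have "measure (M n) (space (M n) - {x. \<bar>x\<bar> \<ge> 1 / \<sigma>}) \<le> measure (M n) {-S<..S}"
        using S by (intro M.finite_measure_mono) auto
      ultimately show ?thesis using tail[of n] False by linarith
    qed
    then show "\<exists>a b. a < b \<and> (\<forall>n. 1 - \<epsilon> < measure (M n) {a<..b})"
      using S by (intro exI[of _ "-S"] exI[of _ S]) auto
  qed (rule M)
  from tight_imp_convergent_subsubsequence[OF this strict_mono_id]
  obtain r N where r: "strict_mono r" "real_distribution N" "weak_conv_m (M \<circ> id \<circ> r) N" by blast
  have "(\<lambda>n. char ((M \<circ> id \<circ> r) n) t) \<longlonglongrightarrow> char N t" for t
    using levy_continuity1[of "M \<circ> id \<circ> r", OF _ r(2,3)] M(1) by simp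
  moreover have "(\<lambda>n. char ((M \<circ> id \<circ> r) n) t) \<longlonglongrightarrow> \<phi> t" for t
    using LIMSEQ_subseq_LIMSEQ[OF lim r(1)] by (simp add: M(2) comp_def)
  ultimately have "\<phi> t = char N t" for t using LIMSEQ_unique by blast
  then show ?thesis using real_distribution_finite_borel[OF r(2)] by (rule pos_charI[rotated])
qed

subsection \<open>Smooth rapidly decreasing functions are Fourier--Stieltjes transforms\<close>

text \<open>Two integrations by parts move the factor x^2 onto the second derivative; the boundary
  terms vanish because h and h' do at infinity.\<close>

lemma norm_inv_fourier_smooth:
  assumes d: "\<And>t. (h has_vector_derivative h' t) (at t)" "\<And>t. (h' has_vector_derivative h'' t) (at t)"
    and cont: "continuous_on UNIV h''" and int: "integrable lborel h" "integrable lborel h''"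
    and lim: "(h \<longlongrightarrow> 0) at_top" "(h \<longlongrightarrow> 0) at_bot" "(h' \<longlongrightarrow> 0) at_top" "(h' \<longlongrightarrow> 0) at_bot"
  shows "x\<^sup>2 * norm (inv_fourier h x) \<le> (1 / (2 * pi)) * (\<integral>t. norm (h'' t) \<partial>lborel)"
proof -
  \<comment> \<open>Both integrations by parts in one antiderivative: the derivative of
    \<open>\<Phi>\<close> is \<open>\<psi>\<close>, that is, the exponential times h'' + x^2 h, and
    its integral over the line is 0.\<close>
  define \<Phi> where "\<Phi> t = iexp (- (t * x)) * (h' t + \<i> * x * h t)" for t :: real
  define \<psi> where "\<psi> t = iexp (- (t * x)) * h'' t + x\<^sup>2 * (iexp (- (t * x)) * h t)" for t :: real
  have [measurable]: "h \<in> borel_measurable borel" "h'' \<in> borel_measurable borel" using int by auto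
  have i1: "integrable lborel (\<lambda>t. iexp (- (t * x)) * h t)"
    by (rule Bochner_Integration.integrable_bound[OF int(1)]) (auto simp: norm_mult simp del: of_real_mult of_real_minus)
  have i2: "integrable lborel (\<lambda>t. iexp (- (t * x)) * h'' t)"
    by (rule Bochner_Integration.integrable_bound[OF int(2)]) (auto simp: norm_mult simp del: of_real_mult of_real_minus)
  have ch: "continuous_on UNIV h" using d(1) by (auto intro!: continuous_at_imp_continuous_on has_vector_derivative_continuous)
  have i\<psi>: "integrable lborel \<psi>" unfolding \<psi>_def using i1 i2 by (intro Bochner_Integration.integrable_add integrable_mult_right)
  have FTC: "(\<integral>t. indicator {- real n..real n} t *\<^sub>R \<psi> t \<partial>lborel) = \<Phi> (real n) - \<Phi> (- real n)" for n
  proof (rule integral_FTC_Icc)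
    fix t :: real
    have e: "((\<lambda>t. iexp (- (t * x))) has_vector_derivative (- \<i> * x) * iexp (- (t * x))) (at t)"
      by (auto intro!: derivative_eq_intros simp: has_vector_derivative_complex_iff Re_exp Im_exp)
    have "(\<Phi> has_vector_derivative (iexp (- (t * x)) * (h'' t + \<i> * x * h' t) + ((- \<i> * x) * iexp (- (t * x))) * (h' t + \<i> * x * h t))) (at t)"
      unfolding \<Phi>_def using d
      by (intro has_vector_derivative_mult e has_vector_derivative_add has_vector_derivative_mult_right)
    also have "(iexp (- (t * x)) * (h'' t + \<i> * x * h' t) + ((- \<i> * x) * iexp (- (t * x))) * (h' t + \<i> * x * h t)) = \<psi> t"
      unfolding \<psi>_def by (simp add: algebra_simps power2_eq_square)
    finally show "(\<Phi> has_vector_derivative \<psi> t) (at t within {- real n..real n})"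
      by (rule has_vector_derivative_at_within)
  next
    show "continuous_on {- real n..real n} \<psi>" unfolding \<psi>_def
      using cont ch by (intro continuous_intros) (auto intro: continuous_on_subset)
  qed simp
  have "(\<lambda>n. \<integral>t. indicator {- real n..real n} t *\<^sub>R \<psi> t \<partial>lborel) \<longlonglongrightarrow> (\<integral>t. \<psi> t \<partial>lborel)"
  proof (rule integral_dominated_convergence[where w = "\<lambda>t. norm (\<psi> t)"])
    have "(\<lambda>i. indicat_real {- real i..real i} t *\<^sub>R \<psi> t) \<longlonglongrightarrow> \<psi> t" for t
    proof (rule tendsto_eventually)
      obtain n where "\<bar>t\<bar> \<le> real n" using real_arch_simple by blast
      then show "\<forall>\<^sub>F i in sequentially. indicat_real {- real i..real i} t *\<^sub>R \<psi> t = \<psi> t"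
        unfolding eventually_sequentially by (intro exI[of _ n]) (auto simp: indicator_def abs_le_iff)
    qed
    then show "AE t in lborel. (\<lambda>i. indicat_real {- real i..real i} t *\<^sub>R \<psi> t) \<longlonglongrightarrow> \<psi> t" by simp
  qed (use i\<psi> in \<open>auto simp: indicator_def\<close>)
  moreover have "(\<lambda>n. \<integral>t. indicator {- real n..real n} t *\<^sub>R \<psi> t \<partial>lborel) \<longlonglongrightarrow> 0"
  proof -
    have "(\<lambda>t. norm (h' t) + \<bar>x\<bar> * norm (h t)) = (\<lambda>t. norm (h' t) + \<bar>x\<bar> * norm (h t))" ..
    have b: "norm (\<Phi> t) \<le> norm (h' t) + \<bar>x\<bar> * norm (h t)" for t
      unfolding \<Phi>_def norm_mult using norm_triangle_ineq[of "h' t" "\<i> * x * h t"]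
      by (simp add: norm_mult del: of_real_mult of_real_minus)
    have t: "(\<Phi> \<longlongrightarrow> 0) at_top"
      by (rule Lim_null_comparison[where g = "\<lambda>t. norm (h' t) + \<bar>x\<bar> * norm (h t)"])
         (auto intro!: always_eventually b tendsto_eq_intros lim tendsto_norm_zero)
    have bt: "(\<Phi> \<longlongrightarrow> 0) at_bot"
      by (rule Lim_null_comparison[where g = "\<lambda>t. norm (h' t) + \<bar>x\<bar> * norm (h t)"])
         (auto intro!: always_eventually b tendsto_eq_intros lim tendsto_norm_zero)
    have "(\<lambda>n. \<Phi> (real n)) \<longlonglongrightarrow> 0" by (rule filterlim_compose[OF t filterlim_real_sequentially])
    moreover have "(\<lambda>n. \<Phi> (- real n)) \<longlonglongrightarrow> 0"
      by (rule filterlim_compose[OF bt]) (simp add: filterlim_uminus_at_bot filterlim_real_sequentially)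
    ultimately show ?thesis unfolding FTC by (auto intro: tendsto_eq_intros)
  qed
  ultimately have "(\<integral>t. \<psi> t \<partial>lborel) = 0" by (rule LIMSEQ_unique)
  moreover have "(\<integral>t. \<psi> t \<partial>lborel) = (\<integral>t. iexp (- (t * x)) * h'' t \<partial>lborel) + x\<^sup>2 * (\<integral>t. iexp (- (t * x)) * h t \<partial>lborel)"
    unfolding \<psi>_def by (subst Bochner_Integration.integral_add) (use i1 i2 in \<open>auto intro!: integrable_mult_right\<close>)
  ultimately have "x\<^sup>2 * (\<integral>t. iexp (- (t * x)) * h t \<partial>lborel) = - (\<integral>t. iexp (- (t * x)) * h'' t \<partial>lborel)"
    by (simp add: eq_neg_iff_add_eq_0 add.commute)
  then have "x\<^sup>2 * norm (\<integral>t. iexp (- (t * x)) * h t \<partial>lborel) = norm (\<integral>t. iexp (- (t * x)) * h'' t \<partial>lborel)"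
  proof -
    assume eq: "x\<^sup>2 * (\<integral>t. iexp (- (t * x)) * h t \<partial>lborel) = - (\<integral>t. iexp (- (t * x)) * h'' t \<partial>lborel)"
    have "x\<^sup>2 * norm (\<integral>t. iexp (- (t * x)) * h t \<partial>lborel) = norm (x\<^sup>2 * (\<integral>t. iexp (- (t * x)) * h t \<partial>lborel))"
      by (simp add: norm_mult norm_power)
    then show ?thesis unfolding eq norm_minus_cancel .
  qed
  also have "\<dots> \<le> (\<integral>t. norm (iexp (- (t * x)) * h'' t) \<partial>lborel)" by (rule integral_norm_bound)
  also have "\<dots> = (\<integral>t. norm (h'' t) \<partial>lborel)" by (simp add: norm_mult del: of_real_minus of_real_mult)
  finally show ?thesis
    by (simp add: inv_fourier_def norm_mult norm_divide field_simps)
qed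

lemma tendsto_0_of_inverse_square_bound:
  fixes h :: "real \<Rightarrow> complex"
  assumes "\<And>t. (1 + t\<^sup>2) * norm (h t) \<le> K"
  shows "(h \<longlongrightarrow> 0) at_top" "(h \<longlongrightarrow> 0) at_bot"
proof -
  have b: "norm (h t) \<le> K / (1 + t\<^sup>2)" for t
    using assms[of t] by (simp add: field_simps add_pos_nonneg)
  have "((\<lambda>t::real. K / (1 + t\<^sup>2)) \<longlongrightarrow> 0) at_top" by real_asymp
  then show "(h \<longlongrightarrow> 0) at_top" by (rule Lim_null_comparison[rotated]) (simp add: b)
  have "((\<lambda>t::real. K / (1 + t\<^sup>2)) \<longlongrightarrow> 0) at_bot" by real_asymp
  then show "(h \<longlongrightarrow> 0) at_bot" by (rule Lim_null_comparison[rotated]) (simp add: b)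
qed

text \<open>Decay of h'' makes the inverse transform of order 1/x^2 at infinity, integrability of h
  makes it bounded; together it is integrable and inversion applies.\<close>

lemma sgn_char_of_smooth:
  assumes d: "\<And>t. (h has_vector_derivative h' t) (at t)" "\<And>t. (h' has_vector_derivative h'' t) (at t)"
    and cont: "continuous_on UNIV h''"
    and bnd: "\<And>t. (1 + t\<^sup>2) * norm (h t) \<le> K" "\<And>t. (1 + t\<^sup>2) * norm (h' t) \<le> K" "\<And>t. (1 + t\<^sup>2) * norm (h'' t) \<le> K"
    and herm: "\<And>t. h (- t) = cnj (h t)"
  shows "sgn_char h"
proof -
  have ch: "continuous_on UNIV h" using d(1) by (auto intro!: continuous_at_imp_continuous_on has_vector_derivative_continuous)
  have m [measurable]: "h \<in> borel_measurable borel" "h'' \<in> borel_measurable borel"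
    using ch cont by (auto intro: borel_measurable_continuous_onI)
  have b1: "norm (f t) \<le> K" "t\<^sup>2 * norm (f t) \<le> K" if "(1 + t\<^sup>2) * norm (f t) \<le> K" for f :: "real \<Rightarrow> complex" and t
  proof -
    have "0 \<le> t\<^sup>2 * norm (f t)" "0 \<le> norm (f t)" by auto
    moreover have "norm (f t) + t\<^sup>2 * norm (f t) \<le> K" using that by (simp add: distrib_right)
    ultimately show "norm (f t) \<le> K" "t\<^sup>2 * norm (f t) \<le> K" by linarith+
  qed
  have int: "integrable lborel h" "integrable lborel h''"
    by (rule integrable_of_inverse_square_bound[of _ K K]; use b1 bnd in auto)+
  show ?thesis
  proof (rule sgn_char_of_integrable(1)[OF ch int(1) _ _ herm])
    show "norm (h t) \<le> K" for t by (rule b1) (rule bnd)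
    show "integrable lborel (inv_fourier h)"
      by (rule integrable_of_inverse_square_bound[OF inv_fourier_measurable norm_inv_fourier_le[OF int(1)]])
         (auto intro!: norm_inv_fourier_smooth[OF d cont int] tendsto_0_of_inverse_square_bound bnd)
  qed
qed

subsection \<open>The semistable exponent\<close>

text \<open>Suited to series: Taylor remainders of the terms add up to a multiple of h^2, so
  termwise differentiation needs no separate interchange of limits.\<close>

lemma has_vector_derivative_quadratic_bound:
  fixes F :: "real \<Rightarrow> complex" and F' :: complex
  assumes "\<And>h. norm (F (t + h) - F t - h * F') \<le> K * h\<^sup>2"
  shows "(F has_vector_derivative F') (at t)"
proof -
  have "((\<lambda>h. norm (F (t + h) - F t - h *\<^sub>R F') / norm h) \<longlongrightarrow> 0) (at 0)"
  proof (rule Lim_null_comparison[where g = "\<lambda>h. K * \<bar>h\<bar>"])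
    show "\<forall>\<^sub>F h in at 0. norm (norm (F (t + h) - F t - h *\<^sub>R F') / norm h) \<le> K * \<bar>h\<bar>"
    proof (rule eventually_at_topological[THEN iffD2], intro exI[of _ UNIV] conjI ballI impI)
      fix h :: real assume "h \<noteq> 0"
      have "norm (F (t + h) - F t - h *\<^sub>R F') / \<bar>h\<bar> \<le> K * h\<^sup>2 / \<bar>h\<bar>"
        using assms[of h] by (intro divide_right_mono) (auto simp: scaleR_conv_of_real)
      also have "\<dots> = K * \<bar>h\<bar>" using \<open>h \<noteq> 0\<close> by (simp add: power2_eq_square field_simps abs_if)
      finally show "norm (norm (F (t + h) - F t - h *\<^sub>R F') / norm h) \<le> K * \<bar>h\<bar>" by simp
    qed auto
  qed (auto intro!: tendsto_eq_intros)
  then show ?thesis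
    unfolding has_vector_derivative_def has_derivative_at by (auto simp: bounded_linear_scaleR_left)
qed

section \<open>Exponential limits and compound Poisson transforms\<close>

lemma norm_power_diff_le:
  fixes a b :: complex
  assumes "norm a \<le> M" "norm b \<le> M"
  shows "norm (a ^ n - b ^ n) \<le> real n * M ^ (n - 1) * norm (a - b)"
proof (induction n)
  case (Suc n)
  have M: "0 \<le> M" using assms(1) norm_ge_zero order_trans by blast
  have "a ^ Suc n - b ^ Suc n = a ^ n * (a - b) + (a ^ n - b ^ n) * b" by (simp add: algebra_simps)
  then have "norm (a ^ Suc n - b ^ Suc n) \<le> norm (a ^ n * (a - b)) + norm ((a ^ n - b ^ n) * b)"
    by (metis norm_triangle_ineq)
  also have "\<dots> \<le> M ^ n * norm (a - b) + (real n * M ^ (n - 1) * norm (a - b)) * M"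
    unfolding norm_mult norm_power using assms Suc M
    by (intro add_mono mult_mono power_mono mult_nonneg_nonneg) auto
  also have "(real n * M ^ (n - 1) * norm (a - b)) * M = real n * M ^ n * norm (a - b)"
    by (cases n) auto
  finally show ?case by (simp add: algebra_simps)
qed simp

text \<open>From (k+m)! \<ge> k!, the m-th power splits off termwise and a full exponential series
  remains. The crude factor exp (norm z) is affordable because it will be absorbed by decay.\<close>

lemma norm_exp_remainder:
  fixes z :: complex
  shows "norm (exp z - (\<Sum>k<m. z ^ k / fact k)) \<le> norm z ^ m * exp (norm z)"
proof -
  have s: "summable (\<lambda>k. z ^ k / fact k)"
    using summable_exp[of z] by (simp add: divide_inverse mult.commute)
  have e: "exp z = (\<Sum>k. z ^ k / fact k)" unfolding exp_def by (simp add: scaleR_conv_of_real divide_inverse mult.commute)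
  have se: "(\<lambda>k. norm z ^ m * (norm z ^ k / fact k)) sums (norm z ^ m * exp (norm z))"
    using exp_converges[of "norm z"] by (intro sums_mult) (simp add: divide_inverse mult.commute)
  have b: "norm (z ^ (k + m) / fact (k + m)) \<le> norm z ^ m * (norm z ^ k / fact k)" for k
  proof -
    have "norm z ^ (k + m) / fact (k + m) \<le> norm z ^ (k + m) / fact k"
      by (intro divide_left_mono fact_mono) auto
    then show ?thesis by (simp add: norm_divide norm_power norm_mult power_add mult.commute)
  qed
  have "exp z - (\<Sum>k<m. z ^ k / fact k) = (\<Sum>k. z ^ (k + m) / fact (k + m))"
    unfolding e using suminf_split_initial_segment[OF s, of m] by simp
  also have "norm \<dots> \<le> norm z ^ m * exp (norm z)"
  proof -
    have sn: "summable (\<lambda>k. norm (z ^ (k + m) / fact (k + m)))"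
      by (rule summable_comparison_test[OF _ sums_summable[OF se]]) (use b in auto)
    have "norm (\<Sum>k. z ^ (k + m) / fact (k + m)) \<le> (\<Sum>k. norm (z ^ (k + m) / fact (k + m)))"
      by (rule summable_norm[OF sn])
    also have "\<dots> \<le> norm z ^ m * exp (norm z)"
      using suminf_le[OF b sn sums_summable[OF se]] sums_unique[OF se] by simp
    finally show ?thesis .
  qed
  finally show ?thesis .
qed

lemma tendsto_exp_limit_complex: "(\<lambda>n. (1 + z / of_nat n) ^ n) \<longlonglongrightarrow> exp (z :: complex)"
proof -
  have "(\<lambda>n. (1 + z / of_nat n) ^ n - exp z) \<longlonglongrightarrow> 0"
  proof (rule Lim_null_comparison)
    show "\<forall>\<^sub>F n in sequentially. norm ((1 + z / of_nat n) ^ n - exp z) \<le> (exp (norm z) * (norm z)\<^sup>2 * exp (norm z)) * (1 / real n)"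
      using eventually_gt_at_top[of 0]
    proof eventually_elim
      case (elim n)
      define b where "b = z / of_nat n"
      have nb: "norm b = norm z / real n" by (simp add: b_def norm_divide)
      have ez: "exp z = exp b ^ n" using elim by (simp add: b_def exp_of_nat_mult[symmetric])
      have 1: "norm (1 + b) \<le> exp (norm b)"
        using norm_triangle_ineq[of 1 b] exp_ge_add_one_self[of "norm b"] unfolding norm_one by linarith
      have 2: "norm (exp b) \<le> exp (norm b)" by (rule norm_exp)
      have "norm (exp b - (1 + b)) \<le> norm b ^ 2 * exp (norm b)"
        using norm_exp_remainder[of b 2] by (simp add: numeral_2_eq_2)
      also have "\<dots> \<le> norm b ^ 2 * exp (norm z)"
        using elim mult_right_mono[of 1 "real n" "norm z"] by (intro mult_left_mono) (auto simp: nb field_simps)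
      finally have 3: "norm (1 + b - exp b) \<le> norm b ^ 2 * exp (norm z)" by (simp add: norm_minus_commute)
      have "norm ((1 + b) ^ n - exp b ^ n) \<le> real n * exp (norm b) ^ (n - 1) * norm (1 + b - exp b)"
        by (rule norm_power_diff_le[OF 1 2])
      also have "\<dots> \<le> real n * exp (norm z) * (norm b ^ 2 * exp (norm z))"
      proof (intro mult_mono 3)
        have "real (n - 1) * (norm z / real n) \<le> norm z"
          using elim by (simp add: field_simps mult_right_mono)
        then show "exp (norm b) ^ (n - 1) \<le> exp (norm z)"
          unfolding nb exp_of_nat_mult[symmetric] by simp
      qed auto
      also have "\<dots> = (exp (norm z) * (norm z)\<^sup>2 * exp (norm z)) * (1 / real n)"
        using elim by (simp add: nb power2_eq_square)
      finally show ?case unfolding ez b_def .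
    qed
    have "(\<lambda>n. 1 / real n) \<longlonglongrightarrow> 0" by (rule lim_1_over_n)
    then show "(\<lambda>n. (exp (norm z) * (norm z)\<^sup>2 * exp (norm z)) * (1 / real n)) \<longlonglongrightarrow> 0"
      by (rule tendsto_mult_right_zero)
  qed
  then show ?thesis by (simp add: LIM_zero_iff)
qed

text \<open>The limit of n-th powers of the mixtures (1 - c/n) + (c/n) h, which are characteristic
  functions once n \<ge> c.\<close>

lemma pos_char_compound_Poisson:
  assumes h: "pos_char h" "h 0 = 1" and c: "c \<ge> 0"
  shows "pos_char (\<lambda>s. exp (complex_of_real c * (h s - 1)))"
proof -
  \<comment> \<open>The index is shifted so that c/(n+N) never exceeds 1 and every mixture has
    nonnegative weights.\<close>
  define N where "N = nat \<lceil>c\<rceil> + 1"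
  have N: "real (n + N) \<ge> c" "real (n + N) > 0" for n unfolding N_def by linarith+
  define u where "u n s = (1 + complex_of_real c * (h s - 1) / of_nat (n + N)) ^ (n + N)" for n s
  have cont: "isCont h t" for t
  proof -
    obtain M where "real_distribution M" "char M = h" using pos_char_real_distribution[OF h] .
    then show ?thesis using real_distribution.isCont_char by metis
  qed
  show ?thesis
  proof (rule pos_char_limit)
    show "pos_char (u n)" for n
    proof -
      have "pos_char (\<lambda>s. complex_of_real (1 - c / real (n + N)) + complex_of_real (c / real (n + N)) * h s)"
        using N[of n] c by (intro pos_char_add pos_char_const pos_char_scale h) (auto simp: field_simps)
      from pos_char_power[OF this, of "n + N"] show ?thesis
        unfolding u_def by (rule back_subst[of pos_char]) (simp add: algebra_simps diff_divide_distrib)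
    qed
    show "u n 0 = 1" for n by (simp add: u_def h)
    show "(\<lambda>n. u n s) \<longlonglongrightarrow> exp (complex_of_real c * (h s - 1))" for s
      unfolding u_def by (rule LIMSEQ_ignore_initial_segment[OF tendsto_exp_limit_complex])
    show "isCont (\<lambda>s. exp (complex_of_real c * (h s - 1))) 0"
      by (intro continuous_intros cont)
  qed
qed

lemma power_exp_neg_powr_bounded:
  fixes \<alpha> c :: real
  assumes "\<alpha> > 0" "c > 0"
  obtains K where "K > 0" "\<And>t. (1 + \<bar>t\<bar>) ^ N * exp (- c * \<bar>t\<bar> powr \<alpha>) \<le> K"
proof -
  \<comment> \<open>With k \<ge> N/\<alpha>, the power \<bar>t\<bar>^N is at most (\<bar>t\<bar>
    powr \<alpha>)^k for \<bar>t\<bar> > 1, and a single term of the exponential series controls the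
    latter.\<close>
  define k where "k = nat \<lceil>real N / \<alpha>\<rceil>"
  have k: "real N \<le> \<alpha> * real k"
  proof -
    have "real N / \<alpha> \<le> real k" unfolding k_def by linarith
    then show ?thesis using assms by (simp add: field_simps)
  qed
  define K where "K = 2 ^ N * (1 + fact k / c ^ k)"
  have "0 \<le> fact k / c ^ k" using assms by simp
  then have "K > 0" unfolding K_def by (intro mult_pos_pos) (simp, linarith)
  moreover have "(1 + \<bar>t\<bar>) ^ N * exp (- c * \<bar>t\<bar> powr \<alpha>) \<le> K" for t
  proof (cases "\<bar>t\<bar> \<le> 1")
    case True
    have "(1 + \<bar>t\<bar>) ^ N * exp (- c * \<bar>t\<bar> powr \<alpha>) \<le> 2 ^ N * 1"
      using True assms by (intro mult_mono power_mono) auto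
    also have "\<dots> \<le> K" using assms by (simp add: K_def)
    finally show ?thesis .
  next
    case False
    define v where "v = \<bar>t\<bar> powr \<alpha>"
    have v: "v > 0" using False by (simp add: v_def)
    have "(c * v) ^ k / fact k \<le> exp (c * v)"
    proof -
      have "summable (\<lambda>n. (c * v) ^ n /\<^sub>R fact n)" by (rule summable_exp_generic)
      from sum_le_suminf[OF this, of "{k}"] show ?thesis
        using assms v by (simp add: exp_def divide_inverse mult.commute)
    qed
    then have "v ^ k * exp (- (c * v)) \<le> fact k / c ^ k"
      using assms by (simp add: exp_minus field_simps power_mult_distrib)
    moreover have "\<bar>t\<bar> ^ N \<le> v ^ k"
    proof -
      have "\<bar>t\<bar> ^ N = \<bar>t\<bar> powr real N" using False by (simp add: powr_realpow)
      also have "\<dots> \<le> \<bar>t\<bar> powr (\<alpha> * real k)" using False k by (intro powr_mono) auto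
      also have "\<dots> = v ^ k" using v by (simp add: v_def powr_powr[symmetric] powr_realpow)
      finally show ?thesis .
    qed
    then have "\<bar>t\<bar> ^ N * exp (- (c * v)) \<le> v ^ k * exp (- (c * v))"
      by (rule mult_right_mono) simp
    ultimately have tN: "\<bar>t\<bar> ^ N * exp (- (c * v)) \<le> fact k / c ^ k" by linarith
    have "(1 + \<bar>t\<bar>) ^ N \<le> (2 * \<bar>t\<bar>) ^ N" using False by (intro power_mono) auto
    also have "\<dots> = 2 ^ N * \<bar>t\<bar> ^ N" by (rule power_mult_distrib)
    finally have "(1 + \<bar>t\<bar>) ^ N * exp (- (c * v)) \<le> (2 ^ N * \<bar>t\<bar> ^ N) * exp (- (c * v))"
      by (rule mult_right_mono) simp
    also have "\<dots> = 2 ^ N * (\<bar>t\<bar> ^ N * exp (- (c * v)))" by (rule mult.assoc)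
    also have "\<dots> \<le> 2 ^ N * (fact k / c ^ k)" by (rule mult_left_mono[OF tN]) simp
    also have "2 ^ N * (fact k / c ^ k) \<le> K" unfolding K_def by (rule mult_left_mono) simp_all
    finally show ?thesis by (simp add: v_def)
  qed
  ultimately show ?thesis by (rule that)
qed

locale semistable =
  fixes \<alpha> p :: real
  assumes p: "0 < p" "p < 1" and \<alpha>: "0 < \<alpha>" "\<alpha> < 2" "\<alpha> \<noteq> 1"
begin

text \<open>\<open>f\<close> is the characteristic function of a single gain; up to the compensator it consists of the terms \<open>k \<ge> 1\<close> of the
  series for \<open>y\<^sub>1\<close>, and \<open>Z\<close> of the compensated terms \<open>k = - j \<le> 0\<close>. Hence \<open>Y = y\<^sub>1\<close>: for \<open>\<alpha> < 1\<close> the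
  compensators of \<open>Z\<close> add up to \<open>- i m1 s\<close>, for \<open>\<alpha> > 1\<close> the gain has mean \<open>m1\<close>.\<close>

definition q :: real where "q = 1 - p"
definition \<theta> :: real where "\<theta> = q powr (1 / \<alpha>)"
definition wt :: "nat \<Rightarrow> real" where "wt j = (p / q) / q ^ j"
definition f :: "real \<Rightarrow> complex" where "f s = (\<Sum>k. complex_of_real (p * q ^ k) * iexp (s * (1 / \<theta>) ^ Suc k))"
definition Z :: "real \<Rightarrow> complex" where
  "Z s = (\<Sum>j. (iexp (s * \<theta> ^ j) - 1 - \<i> * complex_of_real (s * \<theta> ^ j)) * complex_of_real (wt j))"
definition m1 :: real where "m1 = p / (\<theta> - q)"
definition m2 :: real where "m2 = p / (\<theta>\<^sup>2 - q)"
definition Y :: "real \<Rightarrow> complex" where "Y s = f s - 1 - \<i> * complex_of_real (m1 * s) + Z s"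

lemma q: "0 < q" "q < 1" using p by (auto simp: q_def)

lemma \<theta>01: "0 < \<theta>" "\<theta> < 1"
  using q \<alpha> powr_less_mono'[of q 0 "1/\<alpha>"] by (auto simp: \<theta>_def)

lemma \<theta>_power_eq_powr: "\<theta> ^ j = q powr (real j / \<alpha>)"
  using q by (simp add: \<theta>_def powr_powr powr_realpow[symmetric])

lemma \<theta>_powr_\<alpha>: "\<theta> powr \<alpha> = q"
  using q \<alpha> by (simp add: \<theta>_def powr_powr)

lemma \<theta>_neq_q: "\<theta> \<noteq> q"
proof
  assume "\<theta> = q"
  then have "q powr \<alpha> = q powr 1" using \<theta>_powr_\<alpha> q by simp
  then have "\<alpha> = 1" by (rule powr_inj[THEN iffD1, rotated 2]) (use q in auto)
  then show False using \<alpha> by simp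
qed

lemma \<theta>2_less_q: "\<theta>\<^sup>2 < q"
proof -
  have "\<theta>\<^sup>2 = q powr (2 / \<alpha>)" using \<theta>_power_eq_powr[of 2] by simp
  also have "\<dots> < q powr 1" using q \<alpha> by (intro powr_less_mono') auto
  finally show ?thesis using q by simp
qed

lemma \<theta>3_less_q: "\<theta> ^ 3 < q"
proof -
  have "\<theta> ^ 3 \<le> \<theta>\<^sup>2" using \<theta>01 by (intro power_decreasing) auto
  then show ?thesis using \<theta>2_less_q by simp
qed

lemma mu_eq: "mu \<alpha> p 1 = m1" "mu \<alpha> p 2 = m2"
  using \<theta>_power_eq_powr[of 2] by (simp_all add: mu_def m1_def m2_def qq_def q_def \<theta>_def)

lemma wt_nonneg: "wt j \<ge> 0" using p q by (simp add: wt_def)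

text \<open>Moments of the terms with index k \<le> 0. The condition says i > \<alpha>, since
  \<theta>^i = q powr (i/\<alpha>).\<close>

lemma sums_weighted_power:
  assumes "\<theta> ^ i < q"
  shows "(\<lambda>j. (\<theta> ^ j) ^ i * wt j) sums (p / (q - \<theta> ^ i))"
proof -
  have "(\<lambda>j. (p / q) * (\<theta> ^ i / q) ^ j) sums ((p / q) * (1 / (1 - \<theta> ^ i / q)))"
    using assms q \<theta>01 by (intro sums_mult geometric_sums) auto
  moreover have "(p / q) * (1 / (1 - \<theta> ^ i / q)) = p / (q - \<theta> ^ i)"
  proof -
    have e: "q * (1 - \<theta> ^ i / q) = q - \<theta> ^ i" using q by (simp add: right_diff_distrib)
    have "(p / q) * (1 / (1 - \<theta> ^ i / q)) = p / (q * (1 - \<theta> ^ i / q))" by simp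
    then show ?thesis unfolding e .
  qed
  moreover have "(\<lambda>j. (p / q) * (\<theta> ^ i / q) ^ j) = (\<lambda>j. (\<theta> ^ j) ^ i * wt j)"
    by (rule ext) (simp add: wt_def power_divide power_mult[symmetric] mult.commute)
  ultimately show ?thesis by metis
qed

lemmas sums_wt2 = sums_weighted_power[OF \<theta>2_less_q]
lemmas sums_wt3 = sums_weighted_power[OF \<theta>3_less_q]

text \<open>\<open>m2\<close> is a formal second moment: the geometric series for the gain diverges
  because \<alpha> < 2, and its closed form is negative. Up to sign it is the convergent second
  moment of the weights in \<open>Z\<close>.\<close>

lemma m2_neg: "- m2 = p / (q - \<theta>\<^sup>2)" "m2 < 0"
proof -
  show "- m2 = p / (q - \<theta>\<^sup>2)" unfolding m2_def minus_divide_right by simp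
  show "m2 < 0" unfolding m2_def using p \<theta>2_less_q by (intro divide_pos_neg) auto
qed

lemma summable_norm_le:
  fixes a :: "nat \<Rightarrow> complex"
  assumes "b sums B" "\<And>n. norm (a n) \<le> b n"
  shows "summable (\<lambda>n. norm (a n))" "summable a" "norm (suminf a) \<le> B"
proof -
  show 1: "summable (\<lambda>n. norm (a n))"
    by (rule summable_comparison_test[OF _ sums_summable[OF assms(1)]]) (use assms(2) in auto)
  show 2: "summable a" using 1 by (rule summable_norm_cancel)
  have "norm (suminf a) \<le> (\<Sum>n. norm (a n))" by (rule summable_norm[OF 1])
  also have "\<dots> \<le> suminf b" by (rule suminf_le[OF assms(2) 1 sums_summable[OF assms(1)]])
  also have "\<dots> = B" using assms(1) by (rule sums_unique[symmetric])
  finally show "norm (suminf a) \<le> B" .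
qed

lemma norm_iexp2: "norm (iexp x - 1 - \<i> * complex_of_real x) \<le> x\<^sup>2 / 2"
  using iexp_approx1[of x 1] by (simp add: diff_diff_eq power2_eq_square)

lemma norm_iexp1: "norm (iexp x - 1) \<le> \<bar>x\<bar>"
  using iexp_approx1[of x 0] by simp

lemma norm_iexp3: "norm (iexp x - 1 - \<i> * complex_of_real x + complex_of_real (x\<^sup>2 / 2)) \<le> \<bar>x\<bar> ^ 3 / 6"
proof -
  have "(\<Sum>k\<le>2. (\<i> * complex_of_real x) ^ k / fact k) = 1 + \<i> * complex_of_real x - complex_of_real (x\<^sup>2 / 2)"
  proof -
    have "(\<Sum>k\<le>Suc (Suc 0). (\<i> * complex_of_real x) ^ k / fact k) = 1 + \<i> * complex_of_real x + (\<i> * complex_of_real x)\<^sup>2 / 2"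
      by (simp add: power2_eq_square)
    moreover have "(\<i> * complex_of_real x)\<^sup>2 = - complex_of_real (x\<^sup>2)" by (simp add: power_mult_distrib)
    ultimately show ?thesis by (simp add: numeral_2_eq_2)
  qed
  then have "iexp x - (\<Sum>k\<le>2. (\<i> * complex_of_real x) ^ k / fact k) = iexp x - 1 - \<i> * complex_of_real x + complex_of_real (x\<^sup>2 / 2)"
    by simp
  moreover have "fact (Suc 2) = (6::real)" "Suc 2 = 3" by (simp_all add: eval_nat_numeral)
  ultimately show ?thesis using iexp_approx1[of x 2] by (simp only:)
qed

definition Zt :: "real \<Rightarrow> nat \<Rightarrow> complex" where
  "Zt s j = (iexp (s * \<theta> ^ j) - 1 - \<i> * complex_of_real (s * \<theta> ^ j)) * complex_of_real (wt j)"

lemma norm_Zt: "norm (Zt s j) \<le> (s\<^sup>2 / 2) * ((\<theta> ^ j)\<^sup>2 * wt j)"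
  unfolding Zt_def norm_mult norm_of_real abs_of_nonneg[OF wt_nonneg]
  using mult_right_mono[OF norm_iexp2[of "s * \<theta> ^ j"] wt_nonneg[of j]]
  by (simp add: power_mult_distrib mult.assoc)

lemma Z_eq: "Z s = (\<Sum>j. Zt s j)" unfolding Z_def Zt_def ..

lemma summable_Zt: "summable (Zt s)" "summable (\<lambda>j. norm (Zt s j))"
  using summable_norm_le[OF sums_mult[OF sums_wt2, of "s\<^sup>2/2"] norm_Zt] by auto

lemma norm_Z: "norm (Z s) \<le> (s\<^sup>2 / 2) * (- m2)"
  unfolding Z_eq m2_neg by (rule summable_norm_le(3)[OF sums_mult[OF sums_wt2] norm_Zt])

definition m3 :: real where "m3 = p / (q - \<theta> ^ 3)"

lemma m3_pos: "m3 > 0" using p \<theta>3_less_q by (simp add: m3_def)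

text \<open>Termwise Taylor expansion to third order. The quadratic terms add up to the formal
  second moment, which is how \<open>m2\<close> enters the Gaussian correction.\<close>

lemma norm_Z_expand: "norm (Z s - complex_of_real (m2 * s\<^sup>2 / 2)) \<le> (\<bar>s\<bar> ^ 3 / 6) * m3"
proof -
  have s: "(\<lambda>j. complex_of_real ((s\<^sup>2 / 2) * ((\<theta> ^ j)\<^sup>2 * wt j))) sums complex_of_real ((s\<^sup>2 / 2) * (- m2))"
    unfolding m2_neg by (intro sums_of_real sums_mult sums_wt2)
  have "Z s - complex_of_real (m2 * s\<^sup>2 / 2) = (\<Sum>j. Zt s j) + complex_of_real ((s\<^sup>2 / 2) * (- m2))"
    by (simp add: Z_eq)
  also have "\<dots> = (\<Sum>j. Zt s j + complex_of_real ((s\<^sup>2 / 2) * ((\<theta> ^ j)\<^sup>2 * wt j)))"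
    using suminf_add[OF summable_Zt(1)[of s] sums_summable[OF s]] sums_unique[OF s] by simp
  also have "norm \<dots> \<le> (\<bar>s\<bar> ^ 3 / 6) * m3"
    unfolding m3_def
  proof (rule summable_norm_le(3)[OF sums_mult[OF sums_wt3]])
    fix j
    have "Zt s j + complex_of_real ((s\<^sup>2 / 2) * ((\<theta> ^ j)\<^sup>2 * wt j)) =
      (iexp (s * \<theta> ^ j) - 1 - \<i> * complex_of_real (s * \<theta> ^ j) + complex_of_real ((s * \<theta> ^ j)\<^sup>2 / 2)) * complex_of_real (wt j)"
      unfolding Zt_def distrib_right by (simp add: power_mult_distrib)
    also have "norm \<dots> \<le> \<bar>s * \<theta> ^ j\<bar> ^ 3 / 6 * wt j"
      unfolding norm_mult norm_of_real abs_of_nonneg[OF wt_nonneg]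
      by (intro mult_right_mono norm_iexp3 wt_nonneg)
    also have "\<dots> = (\<bar>s\<bar> ^ 3 / 6) * ((\<theta> ^ j) ^ 3 * wt j)"
      using \<theta>01 by (simp add: abs_mult power_mult_distrib)
    finally show "norm (Zt s j + complex_of_real ((s\<^sup>2 / 2) * ((\<theta> ^ j)\<^sup>2 * wt j))) \<le> (\<bar>s\<bar> ^ 3 / 6) * ((\<theta> ^ j) ^ 3 * wt j)" .
  qed
  finally show ?thesis .
qed

definition ft :: "real \<Rightarrow> nat \<Rightarrow> complex" where
  "ft s k = complex_of_real (p * q ^ k) * iexp (s * (1 / \<theta>) ^ Suc k)"

lemma f_eq: "f s = (\<Sum>k. ft s k)" unfolding f_def ft_def ..

lemma sums_geo: "(\<lambda>k. p * q ^ k) sums 1"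
proof -
  have "(\<lambda>k. p * q ^ k) sums (p * (1 / (1 - q)))" using q by (intro sums_mult geometric_sums) auto
  then show ?thesis using p by (simp add: q_def)
qed

lemma norm_ft: "norm (ft s k) \<le> p * q ^ k"
  unfolding ft_def norm_mult using p q by (simp add: norm_mult norm_power)

lemma summable_ft: "summable (ft s)" "summable (\<lambda>k. norm (ft s k))"
  using summable_norm_le[OF sums_geo norm_ft] by auto

lemma norm_f: "norm (f s) \<le> 1"
  unfolding f_eq by (rule summable_norm_le(3)[OF sums_geo norm_ft])

lemma f_0: "f 0 = 1"
  using sums_unique[OF sums_of_real[OF sums_geo, where 'a = complex]] by (simp add: f_def)

lemma f_scale: "f (\<theta> * s) = p * iexp s + q * f s"
proof -
  have "f (\<theta> * s) = ft (\<theta> * s) 0 + (\<Sum>k. ft (\<theta> * s) (Suc k))"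
    unfolding f_eq by (subst suminf_split_head[OF summable_ft(1)]) simp
  also have "ft (\<theta> * s) (Suc k) = q * ft s k" for k
    using \<theta>01 by (simp add: ft_def field_simps)
  then have "(\<Sum>k. ft (\<theta> * s) (Suc k)) = (\<Sum>k. q * ft s k)" by simp
  also have "\<dots> = q * f s" unfolding f_eq by (rule suminf_mult[OF summable_ft(1)])
  also have "ft (\<theta> * s) 0 = p * iexp s" using \<theta>01 by (simp add: ft_def)
  finally show ?thesis .
qed

lemma Z_scale: "Z (\<theta> * s) = q * Z s - p * (iexp s - 1 - \<i> * s)"
proof -
  have "Zt s (Suc k) = Zt (\<theta> * s) k / q" for k
    using q by (simp add: Zt_def wt_def field_simps)
  then have "(\<Sum>k. Zt s (Suc k)) = (\<Sum>k. Zt (\<theta> * s) k / q)" by simp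
  also have "\<dots> = Z (\<theta> * s) / q" unfolding Z_eq by (rule suminf_divide[OF summable_Zt(1)])
  finally have "Z s = Zt s 0 + Z (\<theta> * s) / q"
    unfolding Z_eq[of s] using suminf_split_head[OF summable_Zt(1)[of s]] by (simp add: diff_eq_eq add.commute)
  moreover have "Zt s 0 = (p / q) * (iexp s - 1 - \<i> * s)" by (simp add: Zt_def wt_def)
  ultimately have "q * Z s = p * (iexp s - 1 - \<i> * s) + Z (\<theta> * s)"
    using q by (simp add: field_simps)
  then show ?thesis by simp
qed

text \<open>Under s to \<theta> s the series for \<open>f\<close> gains exactly the term that
  \<open>Z\<close> loses, and the linear parts match because m1 (\<theta> - q) = p. This is
  semistability in terms of the exponent.\<close>

lemma Y_scale: "Y (\<theta> * s) = q * Y s"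
proof -
  have m: "complex_of_real m1 * \<theta> = complex_of_real m1 * q + p"
  proof -
    have "m1 * (\<theta> - q) = p" using \<theta>_neq_q by (simp add: m1_def)
    then have "m1 * \<theta> = m1 * q + p" by (simp add: right_diff_distrib)
    then show ?thesis by (metis of_real_add of_real_mult)
  qed
  define E F W \<sigma> where "E = iexp s" and "F = f s" and "W = Z s" and "\<sigma> = complex_of_real s"
  have "Y (\<theta> * s) = p * E + q * F - 1 - \<i> * ((complex_of_real m1 * \<theta>) * \<sigma>) + (q * W - p * (E - 1 - \<i> * \<sigma>))"
    unfolding Y_def f_scale Z_scale E_def F_def W_def \<sigma>_def by simp
  also have "\<dots> = q * (F - 1 - \<i> * (complex_of_real m1 * \<sigma>) + W) + (complex_of_real p + q - 1)"
    unfolding m by (simp add: algebra_simps)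
  also have "complex_of_real p + q - 1 = 0" by (simp add: q_def)
  finally show ?thesis by (simp add: Y_def F_def W_def \<sigma>_def)
qed

lemma Y_scale_power: "Y (\<theta> ^ n * s) = q ^ n * Y s"
  by (induction n) (auto simp: Y_scale mult.assoc)

text \<open>Every term has nonpositive real part, so keeping only the one with index 0 gives an
  upper bound.\<close>

lemma Re_Z: "Re (Z s) \<le> - ((1 - cos s) * (p / q))"
proof -
  have "Re (Z s) = (\<Sum>j. Re (Zt s j))" unfolding Z_eq by (rule Re_suminf[OF summable_Zt(1)])
  also have "\<dots> \<le> (\<Sum>j\<in>{0::nat}. Re (Zt s j))"
  proof -
    have n: "Re (Zt s j) = - ((1 - cos (s * \<theta> ^ j)) * wt j)" for j by (simp add: Zt_def Re_exp algebra_simps)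
    have "(\<Sum>j\<in>{0::nat}. - Re (Zt s j)) \<le> (\<Sum>j. - Re (Zt s j))"
    proof (rule sum_le_suminf)
      show "summable (\<lambda>j. - Re (Zt s j))" by (intro summable_minus summable_Re summable_Zt(1))
    qed (auto simp: n wt_nonneg)
    then show ?thesis using suminf_minus[OF summable_Re[OF summable_Zt(1)[of s]]] by simp
  qed
  also have "\<dots> = - ((1 - cos s) * (p / q))" by (simp add: Zt_def Re_exp wt_def left_diff_distrib diff_divide_distrib)
  finally show ?thesis .
qed

lemma Re_Y: "Re (Y s) \<le> - ((1 - cos s) * (p / q))"
  using Re_Z[of s] complex_Re_le_cmod[of "f s"] norm_f[of s] by (simp add: Y_def)

text \<open>Partial sums are completed to probability laws by an atom of mass q^n at 0; uniform
  convergence makes the limit continuous.\<close>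

lemma pos_char_f: "pos_char f"
proof (rule pos_char_limit)
  define u where "u n s = (\<Sum>k<n. ft s k) + complex_of_real (q ^ n)" for n s
  show "pos_char (u n)" for n
  proof -
    have "pos_char (\<lambda>s. \<Sum>k<n. ft s k)"
    proof (induction n)
      case (Suc n)
      have "pos_char (\<lambda>s. ft s n)"
        unfolding ft_def using p q by (intro pos_char_scale pos_char_iexp) auto
      with Suc show ?case by (simp add: pos_char_add)
    qed (use pos_char_const[of 0] in simp)
    then show ?thesis unfolding u_def using q by (intro pos_char_add pos_char_const) auto
  qed
  show "u n 0 = 1" for n
  proof (induction n)
    case (Suc n)
    have "u (Suc n) 0 = u n 0 + complex_of_real (p * q ^ n + q ^ Suc n - q ^ n)" by (simp add: u_def ft_def)
    also have "p * q ^ n + q ^ Suc n - q ^ n = 0" by (simp add: q_def algebra_simps)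
    finally show ?case using Suc by simp
  qed (simp add: u_def)
  show "(\<lambda>n. u n s) \<longlonglongrightarrow> f s" for s
  proof -
    have "(\<lambda>n. u n s) \<longlonglongrightarrow> f s + complex_of_real 0"
      unfolding u_def f_eq by (intro tendsto_intros summable_LIMSEQ summable_ft LIMSEQ_realpow_zero) (use q in auto)
    then show ?thesis by simp
  qed
  show "isCont f 0"
  proof (rule continuous_on_interior)
    have "uniform_limit UNIV (\<lambda>n s. \<Sum>k<n. ft s k) f sequentially"
      unfolding f_eq[abs_def]
      by (rule Weierstrass_m_test[OF _ sums_summable[OF sums_geo]]) (simp add: norm_ft)
    then show "continuous_on UNIV f"
      by (rule uniform_limit_theorem[rotated]) (use \<theta>01 in \<open>auto simp: ft_def intro!: continuous_intros always_eventually\<close>)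
  qed simp
qed

lemma isCont_f: "isCont f s"
proof -
  obtain N where "real_distribution N" "char N = f" using pos_char_real_distribution[OF pos_char_f f_0] .
  then show ?thesis using real_distribution.isCont_char by metis
qed

text \<open>By the scaling relation, everything about \<open>Y\<close> is determined on the
  fundamental domain \<theta> \<le> \<bar>u\<bar> \<le> 1. Small s are scaled up and large s down by
  a power of \<theta>.\<close>

lemma semistable_decomposition:
  assumes "s \<noteq> 0"
  obtains c u where "c > 0" "s = c * u" "\<theta> \<le> \<bar>u\<bar>" "\<bar>u\<bar> \<le> 1" "Y s = c powr \<alpha> * Y u"
proof (cases "\<bar>s\<bar> \<le> 1")
  case True
  have "\<exists>n. \<theta> ^ Suc n < \<bar>s\<bar>"
  proof -
    obtain n where "\<theta> ^ n < \<bar>s\<bar>" using real_arch_pow_inv[of "\<bar>s\<bar>" \<theta>] assms \<theta>01 by auto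
    moreover have "\<theta> ^ Suc n \<le> \<theta> ^ n" using \<theta>01 by (intro power_decreasing) auto
    ultimately show ?thesis by (intro exI[of _ n]) linarith
  qed
  define n where "n = (LEAST n. \<theta> ^ Suc n < \<bar>s\<bar>)"
  have n1: "\<theta> ^ Suc n < \<bar>s\<bar>" unfolding n_def by (rule LeastI_ex) fact
  have n2: "\<bar>s\<bar> \<le> \<theta> ^ n"
  proof (cases n)
    case (Suc m)
    then have "m < n" by simp
    from not_less_Least[OF this[unfolded n_def]] have "\<not> \<theta> ^ Suc m < \<bar>s\<bar>" .
    then show ?thesis using Suc by simp
  qed (use True in simp)
  have pos: "\<theta> ^ n > 0" using \<theta>01 by simp
  show ?thesis
  proof (rule that[of "\<theta> ^ n" "s / \<theta> ^ n"])
    show "Y s = complex_of_real ((\<theta> ^ n) powr \<alpha>) * Y (s / \<theta> ^ n)"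
      using Y_scale_power[of n "s / \<theta> ^ n"] pos \<theta>01 q
      by (simp add: \<theta>_powr_\<alpha>[symmetric] powr_realpow[symmetric] powr_powr mult.commute)
    show "\<theta> \<le> \<bar>s / \<theta> ^ n\<bar>" "\<bar>s / \<theta> ^ n\<bar> \<le> 1" using n1 n2 pos by (auto simp: field_simps)
  qed (use pos \<theta>01 in auto)
next
  case False
  have ex: "\<exists>n. \<theta> ^ n * \<bar>s\<bar> \<le> 1"
  proof -
    have "1 / \<bar>s\<bar> > 0" using False by simp
    then obtain n where "\<theta> ^ n < 1 / \<bar>s\<bar>" using real_arch_pow_inv[of "1 / \<bar>s\<bar>" \<theta>] \<theta>01 by auto
    then show ?thesis using False by (intro exI[of _ n]) (auto simp: field_simps)
  qed
  define n where "n = (LEAST n. \<theta> ^ n * \<bar>s\<bar> \<le> 1)"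
  have n1: "\<theta> ^ n * \<bar>s\<bar> \<le> 1" unfolding n_def by (rule LeastI_ex) fact
  have n2: "\<theta> \<le> \<theta> ^ n * \<bar>s\<bar>"
  proof (cases n)
    case 0 then show ?thesis using n1 False by simp
  next
    case (Suc m)
    then have "m < n" by simp
    from not_less_Least[OF this[unfolded n_def]] have "\<not> \<theta> ^ m * \<bar>s\<bar> \<le> 1" .
    then have "\<theta> * 1 \<le> \<theta> * (\<theta> ^ m * \<bar>s\<bar>)" using \<theta>01 by (intro mult_left_mono) auto
    then show ?thesis using Suc by (simp add: mult.assoc)
  qed
  have pos: "\<theta> ^ n > 0" using \<theta>01 by simp
  have q': "(1 / \<theta> ^ n) powr \<alpha> = 1 / q ^ n"
    using \<theta>01 q by (simp add: powr_divide \<theta>_powr_\<alpha>[symmetric] powr_realpow[symmetric] powr_powr mult.commute)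
  show ?thesis
  proof (rule that[of "1 / \<theta> ^ n" "\<theta> ^ n * s"])
    show "Y s = complex_of_real ((1 / \<theta> ^ n) powr \<alpha>) * Y (\<theta> ^ n * s)"
      unfolding q' Y_scale_power using q by simp
    show "\<theta> \<le> \<bar>\<theta> ^ n * s\<bar>" "\<bar>\<theta> ^ n * s\<bar> \<le> 1" using n1 n2 pos by (auto simp: abs_mult)
  qed (use pos \<theta>01 in auto)
qed

lemma Y_0: "Y 0 = 0"
  using norm_Z[of 0] by (simp add: Y_def f_0)

text \<open>The numerator dominates \<bar>Y\<bar> on [-1,1]; division by q compensates for
  \<bar>u\<bar> powr \<alpha> being as small as q on the fundamental domain. Likewise
  \<open>cY\<close> is the bound for -Re Y on that domain obtained at \<bar>u\<bar> = \<theta>,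
  where 1 - cos u is smallest.\<close>

definition CY :: real where "CY = (2 + \<bar>m1\<bar> - m2) / q"
definition cY :: real where "cY = (1 - cos \<theta>) * (p / q)"

lemma CY_pos: "CY > 0" using m2_neg(2) q by (auto simp: CY_def intro!: divide_pos_pos)

lemma cY_pos: "cY > 0"
proof -
  have "cos \<theta> < cos 0" using \<theta>01 pi_gt3 by (intro cos_monotone_0_pi) auto
  then show ?thesis using p q by (auto simp: cY_def intro!: mult_pos_pos)
qed

lemma norm_Y: "norm (Y s) \<le> CY * \<bar>s\<bar> powr \<alpha>"
proof (cases "s = 0")
  case False
  then obtain c u where cu: "c > 0" "s = c * u" "\<theta> \<le> \<bar>u\<bar>" "\<bar>u\<bar> \<le> 1" "Y s = c powr \<alpha> * Y u"
    by (rule semistable_decomposition)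
  have u2: "u\<^sup>2 \<le> 1" using cu(4) by (simp add: abs_square_le_1)
  have "norm (Y u) \<le> norm (f u) + norm (1::complex) + norm (\<i> * complex_of_real (m1 * u)) + norm (Z u)"
    unfolding Y_def by (intro order_trans[OF norm_triangle_ineq] order_trans[OF norm_triangle_ineq4] add_mono order_refl)
  also have "\<dots> \<le> 1 + 1 + \<bar>m1\<bar> * 1 + (1/2) * (- m2)"
  proof (intro add_mono norm_f)
    show "norm (\<i> * complex_of_real (m1 * u)) \<le> \<bar>m1\<bar> * 1"
      unfolding norm_mult norm_of_real abs_mult using cu(4) by (simp add: mult_left_le)
    have "norm (Z u) \<le> (u\<^sup>2 / 2) * (- m2)" by (rule norm_Z)
    also have "\<dots> \<le> (1/2) * (- m2)" using m2_neg(2) u2 by (intro mult_right_mono) auto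
    finally show "norm (Z u) \<le> (1/2) * (- m2)" .
  qed simp
  also have "\<dots> \<le> CY * q" using q m2_neg(2) by (simp add: CY_def)
  finally have "norm (Y u) \<le> CY * q" .
  moreover have "q \<le> \<bar>u\<bar> powr \<alpha>"
    unfolding \<theta>_powr_\<alpha>[symmetric] using cu \<theta>01 \<alpha> by (intro powr_mono2) auto
  ultimately have "norm (Y u) \<le> CY * \<bar>u\<bar> powr \<alpha>"
    using CY_pos by (meson less_imp_le mult_left_mono order_trans)
  then have "c powr \<alpha> * norm (Y u) \<le> c powr \<alpha> * (CY * \<bar>u\<bar> powr \<alpha>)" by (intro mult_left_mono) auto
  also have "\<dots> = CY * \<bar>s\<bar> powr \<alpha>" using cu(1,2) by (simp add: abs_mult powr_mult)
  finally show ?thesis unfolding cu(5) by (simp add: norm_mult)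
qed (simp add: Y_0)

text \<open>Source of all decay in t: on the fundamental domain 1 - cos u stays away from 0, and
  scaling extends this to the line.\<close>

lemma Re_Y_le: "Re (Y s) \<le> - cY * \<bar>s\<bar> powr \<alpha>"
proof (cases "s = 0")
  case False
  then obtain c u where cu: "c > 0" "s = c * u" "\<theta> \<le> \<bar>u\<bar>" "\<bar>u\<bar> \<le> 1" "Y s = c powr \<alpha> * Y u"
    by (rule semistable_decomposition)
  have "cos \<bar>u\<bar> \<le> cos \<theta>" using cu \<theta>01 pi_gt3 by (intro cos_monotone_0_pi_le) auto
  then have "(1 - cos \<theta>) * (p / q) \<le> (1 - cos u) * (p / q)" using p q by (intro mult_right_mono) auto
  then have "Re (Y u) \<le> - cY" using Re_Y[of u] unfolding cY_def by linarith
  moreover have "\<bar>u\<bar> powr \<alpha> \<le> 1 powr \<alpha>" using cu(4) \<alpha> by (intro powr_mono2) auto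
  then have "cY * \<bar>u\<bar> powr \<alpha> \<le> cY * 1" using cY_pos by (intro mult_left_mono) auto
  ultimately have "Re (Y u) \<le> - (cY * \<bar>u\<bar> powr \<alpha>)" by linarith
  then have "c powr \<alpha> * Re (Y u) \<le> c powr \<alpha> * (- (cY * \<bar>u\<bar> powr \<alpha>))" by (intro mult_left_mono) auto
  also have "\<dots> = - cY * \<bar>s\<bar> powr \<alpha>" using cu(1,2) by (simp add: abs_mult powr_mult)
  finally show ?thesis unfolding cu(5) by simp
qed (simp add: Y_0)

subsection \<open>Derivatives of the exponent and the class of transforms\<close>

definition Z1 :: "real \<Rightarrow> complex" where
  "Z1 s = (\<Sum>j. \<i> * complex_of_real (\<theta> ^ j * wt j) * (iexp (s * \<theta> ^ j) - 1))"
definition Z2 :: "real \<Rightarrow> complex" where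
  "Z2 s = (\<Sum>j. - complex_of_real ((\<theta> ^ j)\<^sup>2 * wt j) * iexp (s * \<theta> ^ j))"

lemma norm_Z1t: "norm (\<i> * complex_of_real (\<theta> ^ j * wt j) * (iexp (s * \<theta> ^ j) - 1)) \<le> \<bar>s\<bar> * ((\<theta> ^ j)\<^sup>2 * wt j)"
proof -
  have "norm (\<i> * complex_of_real (\<theta> ^ j * wt j) * (iexp (s * \<theta> ^ j) - 1)) = (\<theta> ^ j * wt j) * norm (iexp (s * \<theta> ^ j) - 1)"
    unfolding norm_mult norm_of_real using \<theta>01 wt_nonneg by (simp add: abs_mult)
  also have "\<dots> \<le> (\<theta> ^ j * wt j) * \<bar>s * \<theta> ^ j\<bar>"
    using \<theta>01 wt_nonneg by (intro mult_left_mono norm_iexp1) auto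
  also have "\<dots> = \<bar>s\<bar> * ((\<theta> ^ j)\<^sup>2 * wt j)"
    using \<theta>01 by (simp add: abs_mult power2_eq_square mult_ac)
  finally show ?thesis .
qed

lemma norm_Z2t: "norm (- complex_of_real ((\<theta> ^ j)\<^sup>2 * wt j) * iexp (s * \<theta> ^ j)) \<le> (\<theta> ^ j)\<^sup>2 * wt j"
  unfolding norm_mult norm_minus_cancel norm_of_real using wt_nonneg by simp

lemmas summable_Z1t = summable_norm_le(2)[OF sums_mult[OF sums_wt2] norm_Z1t]
lemmas summable_Z2t = summable_norm_le(2)[OF sums_wt2 norm_Z2t]

lemma norm_Z1: "norm (Z1 s) \<le> \<bar>s\<bar> * (- m2)"
  unfolding Z1_def m2_neg by (rule summable_norm_le(3)[OF sums_mult[OF sums_wt2] norm_Z1t])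

lemma norm_Z2: "norm (Z2 s) \<le> - m2"
  unfolding Z2_def m2_neg by (rule summable_norm_le(3)[OF sums_wt2 norm_Z2t])

lemma Z_deriv: "(Z has_vector_derivative Z1 t) (at t)"
proof (rule has_vector_derivative_quadratic_bound)
  fix h :: real
  let ?a = "\<lambda>j. \<i> * complex_of_real (\<theta> ^ j * wt j) * (iexp (t * \<theta> ^ j) - 1)"
  have "Z (t + h) - Z t - h * Z1 t = (\<Sum>j. Zt (t + h) j - Zt t j - h * ?a j)"
    unfolding Z_eq Z1_def suminf_mult[OF summable_Z1t, symmetric]
      suminf_diff[OF summable_Zt(1) summable_Zt(1)]
    by (rule suminf_diff) (intro summable_diff summable_Zt summable_mult summable_Z1t)+
  also have "norm \<dots> \<le> (h\<^sup>2 / 2) * (- m2)"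
    unfolding m2_neg
  proof (rule summable_norm_le(3)[OF sums_mult[OF sums_wt2]])
    fix j
    define x where "x = \<theta> ^ j"
    have ex: "iexp ((t + h) * x) = iexp (t * x) * iexp (h * x)"
      by (simp add: distrib_right distrib_left exp_add)
    \<comment> \<open>Each remainder is the term at h times a phase, so the bound for
      \<open>Z\<close> itself applies.\<close>
    have "Zt (t + h) j - Zt t j - h * ?a j = iexp (t * x) * ((iexp (h * x) - 1 - \<i> * complex_of_real (h * x)) * complex_of_real (wt j))"
      unfolding Zt_def x_def[symmetric] ex by (simp add: algebra_simps)
    also have "norm \<dots> = norm (Zt h j)" unfolding Zt_def x_def norm_mult[of "iexp _"] by simp
    also have "\<dots> \<le> (h\<^sup>2 / 2) * ((\<theta> ^ j)\<^sup>2 * wt j)" by (rule norm_Zt)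
    finally show "norm (Zt (t + h) j - Zt t j - h * ?a j) \<le> (h\<^sup>2 / 2) * ((\<theta> ^ j)\<^sup>2 * wt j)" .
  qed
  finally show "norm (Z (t + h) - Z t - h * Z1 t) \<le> (- m2 / 2) * h\<^sup>2" by (simp add: mult.commute)
qed

text \<open>As for \<open>Z\<close>, with third moments of the weights in place of second ones;
  these are finite since 3 > \<alpha>.\<close>

lemma Z1_deriv: "(Z1 has_vector_derivative Z2 t) (at t)"
proof (rule has_vector_derivative_quadratic_bound)
  fix h :: real
  let ?a = "\<lambda>s j. \<i> * complex_of_real (\<theta> ^ j * wt j) * (iexp (s * \<theta> ^ j) - 1)"
  let ?b = "\<lambda>j. - complex_of_real ((\<theta> ^ j)\<^sup>2 * wt j) * iexp (t * \<theta> ^ j)"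
  have "Z1 (t + h) - Z1 t - h * Z2 t = (\<Sum>j. ?a (t + h) j - ?a t j - h * ?b j)"
    unfolding Z1_def Z2_def suminf_mult[OF summable_Z2t, symmetric]
      suminf_diff[OF summable_Z1t summable_Z1t]
    by (rule suminf_diff) (intro summable_diff summable_Z1t summable_mult summable_Z2t)+
  also have "norm \<dots> \<le> (h\<^sup>2 / 2) * m3"
    unfolding m3_def
  proof (rule summable_norm_le(3)[OF sums_mult[OF sums_wt3]])
    fix j
    define x where "x = \<theta> ^ j"
    have x: "x > 0" using \<theta>01 by (simp add: x_def)
    have ex: "iexp ((t + h) * x) = iexp (t * x) * iexp (h * x)"
      by (simp add: distrib_right distrib_left exp_add)
    have "?a (t + h) j - ?a t j - h * ?b j = (\<i> * iexp (t * x) * complex_of_real (x * wt j)) * (iexp (h * x) - 1 - \<i> * complex_of_real (h * x))"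
      unfolding x_def[symmetric] ex by (simp add: algebra_simps power2_eq_square)
    also have "norm \<dots> = (x * wt j) * norm (iexp (h * x) - 1 - \<i> * complex_of_real (h * x))"
      unfolding norm_mult norm_of_real using x wt_nonneg by (simp add: norm_mult abs_mult)
    also have "\<dots> \<le> (x * wt j) * ((h * x)\<^sup>2 / 2)"
      using x wt_nonneg by (intro mult_left_mono norm_iexp2) auto
    also have "\<dots> = (h\<^sup>2 / 2) * ((\<theta> ^ j) ^ 3 * wt j)"
      by (simp add: x_def power_mult_distrib power2_eq_square power3_eq_cube mult_ac)
    finally show "norm (?a (t + h) j - ?a t j - h * ?b j) \<le> (h\<^sup>2 / 2) * ((\<theta> ^ j) ^ 3 * wt j)" .
  qed
  finally show "norm (Z1 (t + h) - Z1 t - h * Z2 t) \<le> (m3 / 2) * h\<^sup>2" by (simp add: mult.commute)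
qed

lemma continuous_Z2: "continuous_on UNIV Z2"
proof -
  have "uniform_limit UNIV (\<lambda>n s. \<Sum>j<n. - complex_of_real ((\<theta> ^ j)\<^sup>2 * wt j) * iexp (s * \<theta> ^ j)) Z2 sequentially"
    unfolding Z2_def[abs_def]
    by (rule Weierstrass_m_test[OF _ sums_summable[OF sums_wt2]]) (rule norm_Z2t)
  then show ?thesis
    by (rule uniform_limit_theorem[rotated]) (auto intro!: continuous_intros always_eventually)
qed

text \<open>The smooth part of the exponent: what remains of \<open>Y\<close> after removing f - 1,
  the exponent of a compound Poisson law.\<close>

definition B :: "real \<Rightarrow> complex" where "B s = Z s - \<i> * complex_of_real (m1 * s)"

lemma Y_eq_B: "Y s = f s - 1 + B s" by (simp add: Y_def B_def)

lemma Z_minus: "Z (- s) = cnj (Z s)"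
proof -
  have "cnj (Zt s k) = Zt (- s) k" for k by (simp add: Zt_def exp_cnj)
  then have "cnj (Z s) = (\<Sum>k. Zt (- s) k)"
    unfolding Z_eq using bounded_linear.suminf[OF bounded_linear_cnj summable_Zt(1)[of s]] by simp
  then show ?thesis unfolding Z_eq by simp
qed

lemma B_minus: "B (- s) = cnj (B s)" by (simp add: B_def Z_minus)

lemma B_deriv: "(B has_vector_derivative (Z1 t - \<i> * complex_of_real m1)) (at t)"
proof -
  have "((\<lambda>s. \<i> * complex_of_real (m1 * s)) has_vector_derivative (\<i> * complex_of_real m1)) (at t)"
    by (auto intro!: derivative_eq_intros simp: has_vector_derivative_complex_iff)
  then show ?thesis unfolding B_def[abs_def] by (intro has_vector_derivative_diff Z_deriv)
qed

text \<open>Removing f - 1 changes the real part by at most 2, so \<open>B\<close> inherits the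
  decay of the whole exponent up to a constant factor.\<close>

lemma norm_exp_B:
  assumes "c \<ge> 0"
  shows "norm (exp (complex_of_real c * B s)) \<le> exp (2 * c) * exp (- (c * cY) * \<bar>s\<bar> powr \<alpha>)"
proof -
  have "Re (B s) \<le> 2 - cY * \<bar>s\<bar> powr \<alpha>"
    using Re_Y_le[of s] norm_f[of s] abs_Re_le_cmod[of "f s"] by (simp add: Y_eq_B)
  then have "c * Re (B s) \<le> c * (2 - cY * \<bar>s\<bar> powr \<alpha>)" using assms by (rule mult_left_mono)
  then show ?thesis unfolding norm_exp_eq_Re exp_add[symmetric] by (simp add: algebra_simps)
qed

text \<open>Since \<open>B\<close> is smooth, products of the rapidly decreasing \<open>exp (c B)\<close> with moderate functions are transforms
  of integrable functions; the nowhere differentiable part of the exponent is the compound Poisson factor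
  \<open>exp (c (f - 1))\<close>, which is a characteristic function.\<close>

lemma sgn_char_mult_exp_B:
  assumes c: "c > 0"
    and d: "\<And>t. (u has_vector_derivative u' t) (at t)" "\<And>t. (u' has_vector_derivative u'' t) (at t)"
    and cont: "continuous_on UNIV u''" and herm: "\<And>t. u (- t) = cnj (u t)"
    and bnd: "\<And>t. norm (u t) \<le> K * (1 + \<bar>t\<bar>) ^ 2" "\<And>t. norm (u' t) \<le> K * (1 + \<bar>t\<bar>) ^ 2" "\<And>t. norm (u'' t) \<le> K * (1 + \<bar>t\<bar>) ^ 2"
  shows "sgn_char (\<lambda>t. u t * exp (complex_of_real c * B t))"
proof -
  define B1 where "B1 t = Z1 t - \<i> * complex_of_real m1" for t
  define e where "e t = exp (complex_of_real c * B t)" for t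
  define v where "v t = u' t + u t * (c * B1 t)" for t
  define v' where "v' t = u'' t + (u t * (c * Z2 t) + u' t * (c * B1 t))" for t
  define L where "L = c * (\<bar>m1\<bar> - m2)"
  have L: "L \<ge> 0" using c m2_neg by (auto simp: L_def)
  have K: "K \<ge> 0" using order_trans[OF norm_ge_zero bnd(1)[of 0]] by simp
  have dB: "(B has_vector_derivative B1 t) (at t)" for t unfolding B1_def by (rule B_deriv)
  have dB1: "(B1 has_vector_derivative Z2 t) (at t)" for t
    unfolding B1_def[abs_def] using has_vector_derivative_diff[OF Z1_deriv[of t] has_vector_derivative_const[of "\<i> * complex_of_real m1"]] by simp
  have de: "(e has_vector_derivative (c * B1 t) * e t) (at t)" for t
  proof -
    have "((\<lambda>t. complex_of_real c * B t) has_vector_derivative (complex_of_real c * B1 t)) (at t)"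
      by (intro has_vector_derivative_mult_right dB)
    from field_vector_diff_chain_at[OF this DERIV_exp]
    show ?thesis unfolding e_def comp_def by simp
  qed
  have du: "((\<lambda>t. u t * e t) has_vector_derivative v t * e t) (at t)" for t
    using has_vector_derivative_mult[OF d(1)[of t] de[of t]] by (simp add: v_def algebra_simps)
  have dv: "(v has_vector_derivative v' t) (at t)" for t
    unfolding v_def[abs_def] v'_def
    by (intro has_vector_derivative_add d has_vector_derivative_mult has_vector_derivative_mult_right dB1)
  have dve: "((\<lambda>t. v t * e t) has_vector_derivative (v' t + v t * (c * B1 t)) * e t) (at t)" for t
    using has_vector_derivative_mult[OF dv[of t] de[of t]] by (simp add: algebra_simps)
  have b1: "norm (c * B1 t) \<le> L * (1 + \<bar>t\<bar>)" for t
  proof -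
    have "norm (B1 t) \<le> \<bar>t\<bar> * (- m2) + \<bar>m1\<bar>"
      unfolding B1_def by (intro order_trans[OF norm_triangle_ineq4] add_mono norm_Z1) (simp add: norm_mult)
    also have "\<dots> \<le> (\<bar>m1\<bar> - m2) * (1 + \<bar>t\<bar>)"
    proof -
      have "(\<bar>m1\<bar> - m2) * (1 + \<bar>t\<bar>) = \<bar>t\<bar> * (- m2) + \<bar>m1\<bar> + (\<bar>m1\<bar> * \<bar>t\<bar> - m2)" by (simp add: algebra_simps)
      moreover have "0 \<le> \<bar>m1\<bar> * \<bar>t\<bar>" by simp
      ultimately show ?thesis using m2_neg(2) by linarith
    qed
    finally show ?thesis using c by (simp add: L_def norm_mult mult.assoc)
  qed
  have b2: "norm (c * Z2 t) \<le> L" for t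
  proof -
    have "c * norm (Z2 t) \<le> c * (\<bar>m1\<bar> - m2)" using c norm_Z2[of t] by (intro mult_left_mono) auto
    then show ?thesis using c by (simp add: L_def norm_mult)
  qed
  \<comment> \<open>Power 6: growth 4 of the second derivative (2 from u and 2 from the squared
    derivative of \<open>B\<close>) plus 2 for the factor 1 + t^2.\<close>
  obtain K0 where K0: "K0 > 0" "\<And>t. (1 + \<bar>t\<bar>) ^ 6 * exp (- (c * cY) * \<bar>t\<bar> powr \<alpha>) \<le> K0"
    using power_exp_neg_powr_bounded[of \<alpha> "c * cY" 6] \<alpha> c cY_pos by auto
  \<comment> \<open>Collects the terms u'', u Z2, twice u' B1, and u B1^2 of the second derivative;
    \<open>L\<close> absorbs c and the bounds on \<open>B1\<close> and \<open>Z2\<close>.\<close>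
  define K1 where "K1 = K + 3 * (K * L) + K * L * L"
  have bound: "(1 + t\<^sup>2) * norm (x * e t) \<le> M * (exp (2 * c) * K0)"
    if "norm x \<le> M * (1 + \<bar>t\<bar>) ^ 4" for x t M
  proof -
    have M: "0 \<le> M * (1 + \<bar>t\<bar>) ^ 4" using that norm_ge_zero order_trans by blast
    have "(1 + t\<^sup>2) * norm (x * e t) \<le> (1 + \<bar>t\<bar>)\<^sup>2 * ((M * (1 + \<bar>t\<bar>) ^ 4) * (exp (2 * c) * exp (- (c * cY) * \<bar>t\<bar> powr \<alpha>)))"
      unfolding norm_mult e_def using that c M
      by (intro mult_mono norm_exp_B) (auto simp: power2_sum intro!: mult_nonneg_nonneg)
    also have "\<dots> = (M * exp (2 * c)) * ((1 + \<bar>t\<bar>) ^ 6 * exp (- (c * cY) * \<bar>t\<bar> powr \<alpha>))"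
      by (simp add: power_add[of _ 2 4, simplified])
    also have "\<dots> \<le> (M * exp (2 * c)) * K0"
      using M by (intro mult_left_mono K0) (auto simp: zero_le_mult_iff)
    finally show ?thesis by (simp add: mult.assoc)
  qed
  have KL: "0 \<le> K * L" "0 \<le> K * L * L" using K L by auto
  have pw: "a * (1 + \<bar>t\<bar>) ^ i \<le> a * (1 + \<bar>t\<bar>) ^ 4" if "0 \<le> a" "i \<le> 4" for a t :: real and i
    using that by (intro mult_left_mono power_increasing) auto
  have uB: "norm (x * (c * B1 t)) \<le> a * L * (1 + \<bar>t\<bar>) ^ Suc i" if "norm x \<le> a * (1 + \<bar>t\<bar>) ^ i" for x a t i
  proof -
    have "norm x * norm (c * B1 t) \<le> (a * (1 + \<bar>t\<bar>) ^ i) * (L * (1 + \<bar>t\<bar>))"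
      using that order_trans[OF norm_ge_zero that] by (intro mult_mono b1) auto
    then show ?thesis by (simp add: norm_mult mult_ac)
  qed
  have u4: "norm (u t) \<le> K1 * (1 + \<bar>t\<bar>) ^ 4" for t
  proof -
    have "norm (u t) \<le> K * (1 + \<bar>t\<bar>) ^ 4" using bnd(1)[of t] pw[OF K, of 2 t] by simp
    also have "\<dots> \<le> K1 * (1 + \<bar>t\<bar>) ^ 4" using KL by (intro mult_right_mono) (auto simp: K1_def)
    finally show ?thesis .
  qed
  have nv: "norm (v t) \<le> K * (1 + \<bar>t\<bar>) ^ 2 + K * L * (1 + \<bar>t\<bar>) ^ 3" for t
    unfolding v_def using norm_triangle_ineq[of "u' t" "u t * (c * B1 t)"] bnd(2)[of t] uB[OF bnd(1)[of t]]
    by (simp add: eval_nat_numeral)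
  have v4: "norm (v t) \<le> K1 * (1 + \<bar>t\<bar>) ^ 4" for t
  proof -
    have "norm (v t) \<le> K * (1 + \<bar>t\<bar>) ^ 4 + K * L * (1 + \<bar>t\<bar>) ^ 4"
      using nv[of t] pw[OF K, of 2 t] pw[OF KL(1), of 3 t] by simp
    also have "\<dots> = (K + K * L) * (1 + \<bar>t\<bar>) ^ 4" by (simp add: distrib_right)
    also have "\<dots> \<le> K1 * (1 + \<bar>t\<bar>) ^ 4" using KL by (intro mult_right_mono) (auto simp: K1_def)
    finally show ?thesis .
  qed
  have w4: "norm (v' t + v t * (c * B1 t)) \<le> K1 * (1 + \<bar>t\<bar>) ^ 4" for t
  proof -
    have 1: "norm (u t * (c * Z2 t)) \<le> (K * (1 + \<bar>t\<bar>) ^ 2) * L"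
      unfolding norm_mult[of "u t"] using bnd(1)[of t] order_trans[OF norm_ge_zero bnd(1)[of t]] by (intro mult_mono b2) auto
    have 2: "norm (u' t * (c * B1 t)) \<le> K * L * (1 + \<bar>t\<bar>) ^ 3"
      using uB[OF bnd(2)[of t]] by (simp add: eval_nat_numeral)
    have "norm (v t * (c * B1 t)) = norm (u' t * (c * B1 t) + (u t * (c * B1 t)) * (c * B1 t))"
      by (simp add: v_def distrib_right)
    also have "\<dots> \<le> norm (u' t * (c * B1 t)) + norm ((u t * (c * B1 t)) * (c * B1 t))" by (rule norm_triangle_ineq)
    also have "norm ((u t * (c * B1 t)) * (c * B1 t)) \<le> K * L * L * (1 + \<bar>t\<bar>) ^ 4"
      using uB[OF uB[OF bnd(1)[of t]]] by (simp add: eval_nat_numeral)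
    finally have 3: "norm (v t * (c * B1 t)) \<le> K * L * (1 + \<bar>t\<bar>) ^ 3 + K * L * L * (1 + \<bar>t\<bar>) ^ 4"
      using 2 by linarith
    have "norm (v' t + v t * (c * B1 t)) \<le> norm (u'' t) + (norm (u t * (c * Z2 t)) + norm (u' t * (c * B1 t))) + norm (v t * (c * B1 t))"
      unfolding v'_def by (intro order_trans[OF norm_triangle_ineq] add_mono norm_triangle_ineq order_refl)
    also have "\<dots> \<le> K * (1 + \<bar>t\<bar>) ^ 4 + K * L * (1 + \<bar>t\<bar>) ^ 4 + K * L * (1 + \<bar>t\<bar>) ^ 4 + K * L * (1 + \<bar>t\<bar>) ^ 4 + K * L * L * (1 + \<bar>t\<bar>) ^ 4"
      using 1 2 3 bnd(3)[of t] pw[OF K, of 2 t] pw[OF KL(1), of 2 t] pw[OF KL(1), of 3 t] by (simp add: mult_ac)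
    also have "\<dots> = K1 * (1 + \<bar>t\<bar>) ^ 4" by (simp add: K1_def distrib_right)
    finally show ?thesis .
  qed
  have "sgn_char (\<lambda>t. u t * e t)"
  proof (rule sgn_char_of_smooth[OF du dve])
    show "continuous_on UNIV (\<lambda>t. (v' t + v t * (c * B1 t)) * e t)"
    proof -
      have "continuous_on UNIV u" "continuous_on UNIV u'" "continuous_on UNIV B1" "continuous_on UNIV e"
        using d dB1 de by (auto intro!: continuous_at_imp_continuous_on has_vector_derivative_continuous)
      then show ?thesis unfolding v'_def v_def by (intro continuous_intros cont continuous_Z2)
    qed
    show "u (- t) * e (- t) = cnj (u t * e t)" for t
      by (simp add: herm e_def B_minus exp_cnj)
  qed (rule bound[OF u4] bound[OF v4] bound[OF w4])+
  then show ?thesis by (simp add: e_def)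
qed

lemma pos_char_exp_f: "c \<ge> 0 \<Longrightarrow> pos_char (\<lambda>s. exp (complex_of_real c * (f s - 1)))"
  by (rule pos_char_compound_Poisson[OF pos_char_f f_0])

lemma isCont_Y: "isCont Y s"
proof -
  have "isCont B s" using B_deriv by (rule has_vector_derivative_continuous)
  then show ?thesis unfolding Y_eq_B[abs_def] by (intro continuous_intros isCont_f)
qed

text \<open>Infinite divisibility: f - 1 and each term of \<open>Z\<close> contribute a compound
  Poisson factor, their compensators a translation. Partial products converge and the limit is
  continuous at 0.\<close>

lemma pos_char_exp_Y:
  assumes c: "c \<ge> 0"
  shows "pos_char (\<lambda>s. exp (complex_of_real c * Y s))"
proof (rule pos_char_limit)
  define u where "u n s = exp (complex_of_real c * (f s - 1 - \<i> * complex_of_real (m1 * s) + (\<Sum>j<n. Zt s j)))" for n s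
  show "pos_char (u n)" for n
  proof (induction n)
    case 0
    have "pos_char (\<lambda>s. exp (complex_of_real c * (f s - 1)) * iexp (s * (- c * m1)))"
      by (intro pos_char_mult pos_char_exp_f c pos_char_iexp)
    then show ?case by (simp add: u_def exp_add[symmetric] algebra_simps)
  next
    case (Suc n)
    have "pos_char (\<lambda>s. exp (complex_of_real (c * wt n) * (iexp (s * \<theta> ^ n) - 1)))"
      by (rule pos_char_compound_Poisson[OF pos_char_iexp]) (use c wt_nonneg in auto)
    then have "pos_char (\<lambda>s. u n s * (exp (complex_of_real (c * wt n) * (iexp (s * \<theta> ^ n) - 1)) * iexp (s * (- c * wt n * \<theta> ^ n))))"
      by (intro pos_char_mult Suc pos_char_iexp)
    then show ?case
      by (simp add: u_def exp_add[symmetric] Zt_def algebra_simps)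
  qed
  show "u n 0 = 1" for n by (simp add: u_def f_0 Zt_def)
  show "(\<lambda>n. u n s) \<longlonglongrightarrow> exp (complex_of_real c * Y s)" for s
    unfolding u_def Y_def Z_eq by (intro tendsto_intros summable_LIMSEQ summable_Zt)
  show "isCont (\<lambda>s. exp (complex_of_real c * Y s)) 0" by (intro continuous_intros isCont_Y)
qed

text \<open>The generators. With Y = (f - 1) + B, each function is a combination of products of a
  compound Poisson transform, the transform f - 1, and a factor covered by the smooth case.\<close>

lemma sgn_char_exp_Y_mult:
  assumes c: "c > 0"
  shows "sgn_char (\<lambda>s. - \<i> * complex_of_real s * exp (complex_of_real c * Y s))"
    and "sgn_char (\<lambda>s. Y s * exp (complex_of_real c * Y s))"
proof -
  have e: "exp (complex_of_real c * Y s) = exp (complex_of_real c * (f s - 1)) * exp (complex_of_real c * B s)" for s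
    by (simp add: Y_eq_B distrib_left exp_add)
  have ef: "sgn_char (\<lambda>s. exp (complex_of_real c * (f s - 1)))"
    using c by (intro pos_char_imp_sgn_char pos_char_exp_f) simp
  define K where "K = 1 + \<bar>m1\<bar> - m2"
  have K: "K \<ge> 1" "\<bar>m1\<bar> \<le> K" "- m2 \<le> K" using m2_neg by (auto simp: K_def)
  have T: "1 \<le> (1 + \<bar>t\<bar>)\<^sup>2" "\<bar>t\<bar> \<le> (1 + \<bar>t\<bar>)\<^sup>2" "t\<^sup>2 \<le> (1 + \<bar>t\<bar>)\<^sup>2" for t :: real
    by (auto simp: power2_sum)
  have k: "x \<le> K * (1 + \<bar>t\<bar>)\<^sup>2" if "x \<le> (1 + \<bar>t\<bar>)\<^sup>2" for x t
    using that K(1) mult_right_mono[of 1 K "(1 + \<bar>t\<bar>)\<^sup>2"] by simp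
  have s1: "sgn_char (\<lambda>t. 1 * exp (complex_of_real c * B t))"
    by (rule sgn_char_mult_exp_B[OF c, of _ "\<lambda>_. 0" "\<lambda>_. 0" K]) (use k T K in auto)
  have s2: "sgn_char (\<lambda>t. (- \<i> * complex_of_real t) * exp (complex_of_real c * B t))"
  proof (rule sgn_char_mult_exp_B[OF c, of _ "\<lambda>_. - \<i>" "\<lambda>_. 0" K])
    show "((\<lambda>t. - \<i> * complex_of_real t) has_vector_derivative - \<i>) (at t)" for t
      by (auto intro!: derivative_eq_intros simp: has_vector_derivative_complex_iff)
  qed (use k T K in \<open>auto simp: norm_mult\<close>)
  have s3: "sgn_char (\<lambda>t. B t * exp (complex_of_real c * B t))"
  proof (rule sgn_char_mult_exp_B[OF c B_deriv, of Z2 K])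
    show "((\<lambda>t. Z1 t - \<i> * complex_of_real m1) has_vector_derivative Z2 t) (at t)" for t
      using has_vector_derivative_diff[OF Z1_deriv[of t] has_vector_derivative_const[of "\<i> * complex_of_real m1"]] by simp
    show "norm (B t) \<le> K * (1 + \<bar>t\<bar>)\<^sup>2" for t
    proof -
      have "norm (B t) \<le> (t\<^sup>2 / 2) * (- m2) + \<bar>m1\<bar> * \<bar>t\<bar>"
        unfolding B_def by (intro order_trans[OF norm_triangle_ineq4] add_mono norm_Z) (simp add: norm_mult abs_mult)
      also have "\<dots> \<le> (1 + \<bar>t\<bar>)\<^sup>2 * (- m2) + \<bar>m1\<bar> * (1 + \<bar>t\<bar>)\<^sup>2"
        using T[of t] m2_neg by (intro add_mono mult_right_mono mult_left_mono) (auto intro: order_trans[of _ "t\<^sup>2"])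
      also have "\<dots> \<le> K * (1 + \<bar>t\<bar>)\<^sup>2" by (simp add: K_def algebra_simps)
      finally show ?thesis .
    qed
    show "norm (Z1 t - \<i> * complex_of_real m1) \<le> K * (1 + \<bar>t\<bar>)\<^sup>2" for t
    proof -
      have "norm (Z1 t - \<i> * complex_of_real m1) \<le> \<bar>t\<bar> * (- m2) + \<bar>m1\<bar>"
        by (intro order_trans[OF norm_triangle_ineq4] add_mono norm_Z1) (simp add: norm_mult)
      also have "\<dots> \<le> (1 + \<bar>t\<bar>)\<^sup>2 * (- m2) + \<bar>m1\<bar> * (1 + \<bar>t\<bar>)\<^sup>2"
        using T[of t] m2_neg mult_left_mono[of 1 "(1 + \<bar>t\<bar>)\<^sup>2" "\<bar>m1\<bar>"] by (intro add_mono mult_right_mono) auto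
      also have "\<dots> \<le> K * (1 + \<bar>t\<bar>)\<^sup>2" by (simp add: K_def algebra_simps)
      finally show ?thesis .
    qed
    show "norm (Z2 t) \<le> K * (1 + \<bar>t\<bar>)\<^sup>2" for t
    proof -
      have "norm (Z2 t) \<le> K * 1" using norm_Z2[of t] K by simp
      also have "\<dots> \<le> K * (1 + \<bar>t\<bar>)\<^sup>2" using K T(1)[of t] by (intro mult_left_mono) auto
      finally show ?thesis .
    qed
  qed (auto simp: B_minus continuous_Z2)
  show "sgn_char (\<lambda>s. - \<i> * complex_of_real s * exp (complex_of_real c * Y s))"
    using sgn_char_mult[OF s2 ef] by (simp add: e mult_ac)
  have "sgn_char (\<lambda>s. f s - 1)"
    using sgn_char_add[OF pos_char_imp_sgn_char[OF pos_char_f] sgn_char_const[of "-1"]] by simp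
  then have "sgn_char (\<lambda>s. (f s - 1) * (exp (complex_of_real c * (f s - 1)) * (1 * exp (complex_of_real c * B s))))"
    by (intro sgn_char_mult ef s1)
  from sgn_char_add[OF this sgn_char_mult[OF s3 ef]]
  moreover have "Y s * exp (complex_of_real c * Y s) =
      (f s - 1) * (exp (complex_of_real c * (f s - 1)) * (1 * exp (complex_of_real c * B s))) +
      B s * exp (complex_of_real c * B s) * exp (complex_of_real c * (f s - 1))" for s
    unfolding e by (simp only: Y_eq_B distrib_left distrib_right mult_1 mult_ac)
  ultimately show "sgn_char (\<lambda>s. Y s * exp (complex_of_real c * Y s))" by simp
qed

lemma sgn_char_poly_exp_Y:
  assumes c: "c > 0"
  shows "sgn_char (\<lambda>s. (- \<i> * complex_of_real s) ^ k * Y s ^ j * exp (complex_of_real c * Y s))"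
proof -
  \<comment> \<open>The exponent c is divided into k+j+1 equal shares, one for each polynomial
    factor and one left over, so that each factor becomes one of the generators.\<close>
  define b where "b = c / (real k + real j + 1)"
  have b: "b > 0" using c by (simp add: b_def add_pos_nonneg)
  have e: "exp (complex_of_real c * Y s) = exp (complex_of_real b * Y s) ^ k * exp (complex_of_real b * Y s) ^ j * exp (complex_of_real b * Y s)" for s
  proof -
    have "real k + real j + 1 \<noteq> 0" by linarith
    then have "c = (real k + real j + 1) * b" unfolding b_def by simp
    also have "real k + real j + 1 = real (k + j + 1)" by simp
    finally have "c = real (k + j + 1) * b" .
    then have "exp (complex_of_real c * Y s) = exp (of_nat (k + j + 1) * (complex_of_real b * Y s))"
      by (metis mult.assoc of_real_mult of_real_of_nat_eq)
    also have "\<dots> = exp (complex_of_real b * Y s) ^ (k + j + 1)" by (rule exp_of_nat_mult)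
    finally show ?thesis by (simp add: power_add)
  qed
  have "sgn_char (\<lambda>s. (- \<i> * complex_of_real s * exp (complex_of_real b * Y s)) ^ k * (Y s * exp (complex_of_real b * Y s)) ^ j * exp (complex_of_real b * Y s))"
    by (intro sgn_char_mult sgn_char_power sgn_char_exp_Y_mult b pos_char_imp_sgn_char pos_char_exp_Y less_imp_le)
  then show ?thesis unfolding e power_mult_distrib by (simp only: mult_ac)
qed

section \<open>The two-sided series defining the exponent\<close>

lemma has_sum_int_split:
  fixes T :: "int \<Rightarrow> complex"
  assumes "summable (\<lambda>j. norm (T (int j + 1)))" "(\<lambda>j. T (int j + 1)) sums a"
    and "summable (\<lambda>j. norm (T (- int j)))" "(\<lambda>j. T (- int j)) sums b"
  shows "(T has_sum (a + b)) UNIV"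
proof -
  have "((\<lambda>j. T (int j + 1)) has_sum a) UNIV" by (rule norm_summable_imp_has_sum) fact+
  then have 1: "(T has_sum a) (range (\<lambda>j. int j + 1))"
    by (subst has_sum_reindex) (auto simp: inj_on_def comp_def)
  have "((\<lambda>j. T (- int j)) has_sum b) UNIV" by (rule norm_summable_imp_has_sum) fact+
  then have 2: "(T has_sum b) (range (\<lambda>j. - int j))"
    by (subst has_sum_reindex) (auto simp: inj_on_def comp_def)
  have "range (\<lambda>j. int j + 1) \<inter> range (\<lambda>j. - int j) = {}" by auto
  from has_sum_Un_disjoint[OF 1 2 this] have "(T has_sum (a + b)) (range (\<lambda>j. int j + 1) \<union> range (\<lambda>j. - int j))" .
  also have "range (\<lambda>j. int j + 1) \<union> range (\<lambda>j. - int j) = UNIV"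
  proof -
    have "k \<in> range (\<lambda>j. int j + 1) \<union> range (\<lambda>j. - int j)" for k
    proof (cases "k \<ge> 1")
      case True
      then have "k = int (nat (k - 1)) + 1" by simp
      then show ?thesis by blast
    next
      case False
      then have "k = - int (nat (- k))" by simp
      then show ?thesis by blast
    qed
    then show ?thesis by blast
  qed
  finally show ?thesis .
qed

text \<open>Points and weights of the series at \<gamma> = 1. Indices k \<ge> 1 reproduce the law of
  the gain, indices k \<le> 0 the weights of \<open>Z\<close>.\<close>

definition xk :: "int \<Rightarrow> real" where "xk k = (1 / q) powr (real_of_int k / \<alpha>)"
definition wk :: "int \<Rightarrow> real" where "wk k = (p / q) / (1 / q) powr real_of_int k"

lemma xk_pos: "xk (int j + 1) = (1 / \<theta>) ^ Suc j" and xk_neg: "xk (- int j) = \<theta> ^ j"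
proof -
  have "(1 / \<theta>) ^ Suc j = 1 / q powr (real (Suc j) / \<alpha>)"
    unfolding power_divide \<theta>_power_eq_powr by simp
  also have "\<dots> = (1 / q) powr (real (Suc j) / \<alpha>)" using q by (simp add: powr_divide)
  finally show "xk (int j + 1) = (1 / \<theta>) ^ Suc j" by (simp add: xk_def add.commute)
  show "xk (- int j) = \<theta> ^ j"
    using q by (simp add: xk_def \<theta>_power_eq_powr powr_divide powr_minus_divide)
qed

lemma wk_pos: "wk (int j + 1) = p * q ^ j" and wk_neg: "wk (- int j) = wt j"
proof -
  have "(1 / q) powr real_of_int (int j + 1) = (1 / q) ^ Suc j"
    using q by (subst powr_realpow[symmetric]) (auto simp: add.commute)
  then show "wk (int j + 1) = p * q ^ j" using q by (simp add: wk_def field_simps)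
  have "(1 / q) powr real_of_int (- int j) = q ^ j"
    using q by (simp add: powr_minus powr_realpow field_simps)
  then show "wk (- int j) = wt j" by (simp add: wk_def wt_def)
qed

text \<open>Separates the two regimes: if \<theta> < q, the terms with k \<le> 0 have a finite first
  moment and need no compensation; if q < \<theta>, the gain has a finite mean.\<close>

lemma \<theta>_less_q_iff: "\<theta> < q \<longleftrightarrow> \<alpha> < 1"
proof
  assume "\<alpha> < 1"
  then have "q powr (1 / \<alpha>) < q powr 1" using q \<alpha> by (intro powr_less_mono') auto
  then show "\<theta> < q" using q by (simp add: \<theta>_def)
next
  assume less: "\<theta> < q"
  show "\<alpha> < 1"
  proof (rule ccontr)
    assume "\<not> \<alpha> < 1"
    then have "q powr 1 \<le> q powr (1 / \<alpha>)" using q \<alpha> by (intro powr_mono') auto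
    then show False using q less by (simp add: \<theta>_def)
  qed
qed

lemma has_sum_Y_lt1:
  assumes "\<alpha> < 1"
  shows "((\<lambda>k. (iexp (s * xk k) - 1) * complex_of_real (wk k)) has_sum Y s) UNIV"
proof -
  have less: "\<theta> ^ 1 < q" using assms \<theta>_less_q_iff by simp
  note sw = sums_weighted_power[OF less]
  let ?T = "\<lambda>k. (iexp (s * xk k) - 1) * complex_of_real (wk k)"
  have 1: "?T (int j + 1) = ft s j - complex_of_real (p * q ^ j)" for j
    unfolding xk_pos wk_pos ft_def by (simp only: of_real_mult left_diff_distrib right_diff_distrib mult_1 mult_1_right mult_ac)
  have s1: "(\<lambda>j. ?T (int j + 1)) sums (f s - 1)"
    unfolding 1 f_eq using sums_of_real[OF sums_geo, where 'a = complex]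
    by (intro sums_diff summable_sums summable_ft) simp
  have n1: "summable (\<lambda>j. norm (?T (int j + 1)))"
  proof (rule summable_norm_le(1)[OF sums_mult[OF sums_geo, of 2]])
    fix j
    show "norm (?T (int j + 1)) \<le> 2 * (p * q ^ j)"
      unfolding 1 using norm_triangle_ineq4[of "ft s j" "complex_of_real (p * q ^ j)"] norm_ft[of s j] p q
      by (simp add: norm_mult norm_power)
  qed
  have 2: "?T (- int j) = Zt s j + \<i> * complex_of_real (s * ((\<theta> ^ j) ^ 1 * wt j))" for j
    by (simp add: xk_neg wk_neg Zt_def algebra_simps)
  have "(\<lambda>j. Zt s j + \<i> * complex_of_real (s * ((\<theta> ^ j) ^ 1 * wt j))) sums (Z s + \<i> * complex_of_real (s * (p / (q - \<theta> ^ 1))))"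
    unfolding Z_eq by (intro sums_add sums_mult sums_of_real sw summable_sums summable_Zt)
  moreover have "Z s + \<i> * complex_of_real (s * (p / (q - \<theta> ^ 1))) = Z s - \<i> * complex_of_real (m1 * s)"
  proof -
    have pm: "p / (q - \<theta> ^ 1) = - m1" unfolding m1_def minus_divide_right by simp
    show ?thesis unfolding pm by (simp add: mult.commute)
  qed
  ultimately have s2: "(\<lambda>j. ?T (- int j)) sums (Z s - \<i> * complex_of_real (m1 * s))"
    unfolding 2 by (simp only:)
  have n2: "summable (\<lambda>j. norm (?T (- int j)))"
  proof (rule summable_norm_le(1)[OF sums_mult[OF sw]])
    fix j
    have "norm (iexp (s * \<theta> ^ j) - 1) * wt j \<le> \<bar>s * \<theta> ^ j\<bar> * wt j"
      by (intro mult_right_mono norm_iexp1 wt_nonneg)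
    then show "norm (?T (- int j)) \<le> \<bar>s\<bar> * ((\<theta> ^ j) ^ 1 * wt j)"
      unfolding norm_mult norm_of_real xk_neg wk_neg using wt_nonneg \<theta>01 by (simp add: abs_mult mult_ac)
  qed
  have "f s - 1 + (Z s - \<i> * complex_of_real (m1 * s)) = Y s" by (simp add: Y_def)
  then show ?thesis using has_sum_int_split[OF n1 s1 n2 s2] by simp
qed

lemma has_sum_Y_gt1:
  assumes "\<alpha> > 1"
  shows "((\<lambda>k. (iexp (s * xk k) - 1 - \<i> * complex_of_real (s * xk k)) * complex_of_real (wk k)) has_sum Y s) UNIV"
proof -
  have less: "q < \<theta>" using assms \<theta>_less_q_iff \<theta>_neq_q by (meson linorder_neqE_linordered_idom not_less_iff_gr_or_eq)
  let ?T = "\<lambda>k. (iexp (s * xk k) - 1 - \<i> * complex_of_real (s * xk k)) * complex_of_real (wk k)"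
  have sw: "(\<lambda>j. (1 / \<theta>) ^ Suc j * (p * q ^ j)) sums m1"
  proof -
    have "(\<lambda>j. (p / \<theta>) * (q / \<theta>) ^ j) sums ((p / \<theta>) * (1 / (1 - q / \<theta>)))"
      using less q \<theta>01 by (intro sums_mult geometric_sums) auto
    moreover have "(p / \<theta>) * (1 / (1 - q / \<theta>)) = m1"
    proof -
      have e: "\<theta> * (1 - q / \<theta>) = \<theta> - q" using \<theta>01 by (simp add: right_diff_distrib)
      have "(p / \<theta>) * (1 / (1 - q / \<theta>)) = p / (\<theta> * (1 - q / \<theta>))" by simp
      then show ?thesis unfolding e m1_def .
    qed
    moreover have "(\<lambda>j. (p / \<theta>) * (q / \<theta>) ^ j) = (\<lambda>j. (1 / \<theta>) ^ Suc j * (p * q ^ j))"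
      by (rule ext) (simp add: power_divide mult_ac)
    ultimately show ?thesis by metis
  qed
  have 1: "?T (int j + 1) = ft s j - complex_of_real (p * q ^ j) - \<i> * complex_of_real (s * ((1 / \<theta>) ^ Suc j * (p * q ^ j)))" for j
    unfolding xk_pos wk_pos ft_def by (simp only: of_real_mult left_diff_distrib right_diff_distrib mult_1 mult_1_right mult_ac)
  have s1: "(\<lambda>j. ?T (int j + 1)) sums (f s - 1 - \<i> * complex_of_real (s * m1))"
    unfolding 1 f_eq using sums_of_real[OF sums_geo, where 'a = complex]
    by (intro sums_diff summable_sums summable_ft sums_mult sums_of_real sw) simp
  have n1: "summable (\<lambda>j. norm (?T (int j + 1)))"
  proof (rule summable_norm_le(1)[OF sums_add[OF sums_mult[OF sums_geo, of 2] sums_mult[OF sw, of "\<bar>s\<bar>"]]])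
    fix j
    have nn: "0 \<le> (1 / \<theta>) ^ Suc j * (p * q ^ j)" using p q \<theta>01 by simp
    have "norm (\<i> * complex_of_real (s * ((1 / \<theta>) ^ Suc j * (p * q ^ j)))) = \<bar>s\<bar> * ((1 / \<theta>) ^ Suc j * (p * q ^ j))"
      by (simp only: norm_mult[of \<i>] norm_of_real abs_mult[of s] abs_of_nonneg[OF nn] norm_ii mult_1)
    moreover have "norm (complex_of_real (p * q ^ j)) = p * q ^ j" using p q by (simp add: norm_mult norm_power)
    ultimately show "norm (?T (int j + 1)) \<le> 2 * (p * q ^ j) + \<bar>s\<bar> * ((1 / \<theta>) ^ Suc j * (p * q ^ j))"
      unfolding 1
      using norm_triangle_ineq4[of "ft s j" "complex_of_real (p * q ^ j)"] norm_ft[of s j]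
        norm_triangle_ineq4[of "ft s j - complex_of_real (p * q ^ j)" "\<i> * complex_of_real (s * ((1 / \<theta>) ^ Suc j * (p * q ^ j)))"]
      by linarith
  qed
  have 2: "?T (- int j) = Zt s j" for j by (simp add: xk_neg wk_neg Zt_def)
  have s2: "(\<lambda>j. ?T (- int j)) sums Z s" unfolding 2 Z_eq by (intro summable_sums summable_Zt)
  have n2: "summable (\<lambda>j. norm (?T (- int j)))" unfolding 2 by (rule summable_Zt)
  have "f s - 1 - \<i> * complex_of_real (s * m1) + Z s = Y s" by (simp add: Y_def mult_ac)
  then show ?thesis using has_sum_int_split[OF n1 s1 n2 s2] by simp
qed

text \<open>Because of semistability the exponent at \<open>\<gamma>\<^sub>n\<close> is a rescaling of one fixed function.\<close>

lemma yfun_eq: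
  assumes n: "n \<ge> 1"
  shows "yfun \<alpha> p (gam p n) t = real n * Y (t / real n powr (1 / \<alpha>))"
proof -
  \<comment> \<open>\<gamma> is n divided by the K-th power of r, so shifting the index by
    \<open>K\<close> turns the series at \<gamma> into n times the series at \<gamma> = 1, with t
    divided by n powr (1/\<alpha>).\<close>
  define K where "K = \<lceil>log (1 / q) (real n)\<rceil>"
  define \<gamma> where "\<gamma> = gam p n"
  define s where "s = t / real n powr (1 / \<alpha>)"
  have rq: "rr p = 1 / q" "qq p = q" by (auto simp: rr_def qq_def q_def)
  have \<gamma>: "\<gamma> = real n / (1 / q) powr real_of_int K" by (simp add: \<gamma>_def gam_def rq K_def)
  have x: "t * rr p powr (real_of_int k / \<alpha>) / \<gamma> powr (1 / \<alpha>) = s * xk (k + K)" for k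
  proof -
    have "\<gamma> powr (1 / \<alpha>) = real n powr (1 / \<alpha>) / (1 / q) powr (real_of_int K / \<alpha>)"
      unfolding \<gamma> using q n by (simp add: powr_divide powr_powr powr_mult)
    moreover have "xk (k + K) = (1 / q) powr (real_of_int k / \<alpha>) * (1 / q) powr (real_of_int K / \<alpha>)"
      unfolding xk_def by (simp add: add_divide_distrib powr_add)
    ultimately show ?thesis unfolding rq s_def by simp
  qed
  have wgt: "p * \<gamma> / (qq p * rr p powr real_of_int k) = real n * wk (k + K)" for k
    unfolding \<gamma> rq wk_def by (simp add: powr_add mult_ac)
  have bij: "bij_betw (\<lambda>k. k + K) UNIV UNIV" by (rule bij_betw_byWitness[of _ "\<lambda>k. k - K"]) auto
  show ?thesis
  proof (cases "\<alpha> < 1")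
    case True
    have "yfun \<alpha> p \<gamma> t = (\<Sum>\<^sub>\<infinity>k. (iexp (s * xk (k + K)) - 1) * complex_of_real (real n * wk (k + K)))"
      using True by (simp only: yfun_def x wgt if_True)
    also have "\<dots> = (\<Sum>\<^sub>\<infinity>k. (iexp (s * xk k) - 1) * complex_of_real (real n * wk k))"
      by (rule infsum_reindex_bij_betw[OF bij])
    also have "\<dots> = (\<Sum>\<^sub>\<infinity>k. complex_of_real (real n) * ((iexp (s * xk k) - 1) * complex_of_real (wk k)))"
      by (rule infsum_cong) simp
    also have "\<dots> = real n * Y s"
      using has_sum_Y_lt1[OF True, of s] by (subst infsum_cmult_right') (simp add: infsumI)
    finally show ?thesis unfolding \<gamma>_def s_def .
  next
    case False
    then have a1: "\<alpha> > 1" using \<alpha> by simp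
    have "yfun \<alpha> p \<gamma> t = (\<Sum>\<^sub>\<infinity>k. (iexp (s * xk (k + K)) - 1 - \<i> * complex_of_real (s * xk (k + K))) * complex_of_real (real n * wk (k + K)))"
      using False by (simp only: yfun_def x wgt if_False)
    also have "\<dots> = (\<Sum>\<^sub>\<infinity>k. (iexp (s * xk k) - 1 - \<i> * complex_of_real (s * xk k)) * complex_of_real (real n * wk k))"
      by (rule infsum_reindex_bij_betw[OF bij])
    also have "\<dots> = (\<Sum>\<^sub>\<infinity>k. complex_of_real (real n) * ((iexp (s * xk k) - 1 - \<i> * complex_of_real (s * xk k)) * complex_of_real (wk k)))"
      by (rule infsum_cong) simp
    also have "\<dots> = real n * Y s"
      using has_sum_Y_gt1[OF a1, of s] by (subst infsum_cmult_right') (simp add: infsumI)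
    finally show ?thesis unfolding \<gamma>_def s_def .
  qed
qed

section \<open>Transforms of the functions \<open>G\<close> and \<open>Gkj\<close>\<close>

definition yn :: "nat \<Rightarrow> real \<Rightarrow> complex" where
  "yn n t = real n * Y (t / real n powr (1 / \<alpha>))"

text \<open>Existence comes from the algebra of transforms after dilation; the choice operator then
  yields a function with the same transform, and from here on nothing else about it is used.\<close>

lemma bv_char_Gkj:
  assumes n: "n \<ge> 1"
  shows "bv_char (Gkj k j \<alpha> p (gam p n)) (\<lambda>t. (- \<i> * complex_of_real t) ^ k * yn n t ^ j * exp (yn n t))"
proof -
  define N where "N = real n powr (1 / \<alpha>)"
  have N: "N > 0" using n by (simp add: N_def)
  have "sgn_char (\<lambda>t. (- \<i> * complex_of_real ((1 / N) * t)) ^ k * Y ((1 / N) * t) ^ j * exp (complex_of_real (real n) * Y ((1 / N) * t)))"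
    using sgn_char_dilate[OF sgn_char_poly_exp_Y[of "real n" k j], of "1 / N"] n by simp
  \<comment> \<open>A real factor undoes the dilation in the powers of t and the factor n in the
    powers of the exponent.\<close>
  then have "sgn_char (\<lambda>t. complex_of_real (N ^ k * real n ^ j) * ((- \<i> * complex_of_real ((1 / N) * t)) ^ k * Y ((1 / N) * t) ^ j * exp (complex_of_real (real n) * Y ((1 / N) * t))))"
    by (rule sgn_char_mult[OF sgn_char_const])
  also have "(\<lambda>t. complex_of_real (N ^ k * real n ^ j) * ((- \<i> * complex_of_real ((1 / N) * t)) ^ k * Y ((1 / N) * t) ^ j * exp (complex_of_real (real n) * Y ((1 / N) * t)))) =
     (\<lambda>t. (- \<i> * complex_of_real t) ^ k * yn n t ^ j * exp (yn n t))"
  proof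
    fix t
    have "(- \<i> * complex_of_real t) ^ k = complex_of_real (N ^ k) * (- \<i> * complex_of_real ((1 / N) * t)) ^ k"
      unfolding of_real_power power_mult_distrib[symmetric] using N by simp
    moreover have "yn n t ^ j = complex_of_real (real n ^ j) * Y ((1 / N) * t) ^ j"
      by (simp add: yn_def N_def power_mult_distrib)
    moreover have "exp (yn n t) = exp (complex_of_real (real n) * Y ((1 / N) * t))"
      by (simp add: yn_def N_def)
    ultimately show "complex_of_real (N ^ k * real n ^ j) * ((- \<i> * complex_of_real ((1 / N) * t)) ^ k * Y ((1 / N) * t) ^ j * exp (complex_of_real (real n) * Y ((1 / N) * t))) =
     (- \<i> * complex_of_real t) ^ k * yn n t ^ j * exp (yn n t)"
      by (simp only: of_real_mult mult_ac)
  qed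
  finally obtain F N1 N2 where N12: "finite_borel_measure N1" "finite_borel_measure N2"
      and F: "\<And>x. F x = measure N1 {..x} - measure N2 {..x}"
      "\<And>t. char N1 t - char N2 t = (- \<i> * complex_of_real t) ^ k * yn n t ^ j * exp (yn n t)"
    unfolding sgn_char_iff_bv_char bv_char_def by blast
  define Q where "Q F \<longleftrightarrow> (\<exists>N1 N2. finite_measure N1 \<and> sets N1 = sets borel \<and> finite_measure N2 \<and> sets N2 = sets borel \<and>
      (\<forall>x. F x = measure N1 {..x} - measure N2 {..x}) \<and>
      (\<forall>t. char N1 t - char N2 t =
             (- \<i> * complex_of_real t) ^ k * (yfun \<alpha> p (gam p n) t) ^ j * exp (yfun \<alpha> p (gam p n) t)))" for F
  have "Q F"
    unfolding Q_def yfun_eq[OF n] yn_def[symmetric]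
    by (intro exI[of _ N1] exI[of _ N2] conjI finite_borel_measureD N12 allI F)
  then have "Q (Eps Q)" by (rule someI[of Q])
  also have "Eps Q = Gkj k j \<alpha> p (gam p n)" unfolding Q_def[abs_def] Gkj_def ..
  finally obtain K1 K2 where "finite_measure K1" "sets K1 = sets borel" "finite_measure K2" "sets K2 = sets borel"
      "\<And>x. Gkj k j \<alpha> p (gam p n) x = measure K1 {..x} - measure K2 {..x}"
      "\<And>t. char K1 t - char K2 t = (- \<i> * complex_of_real t) ^ k * yn n t ^ j * exp (yn n t)"
    unfolding Q_def yfun_eq[OF n] yn_def[symmetric] by blast
  then show ?thesis by (intro bv_charI[of K1 K2] finite_borel_measureI) simp_all
qed

lemma bv_char_G:
  assumes n: "n \<ge> 1"
  shows "bv_char (G \<alpha> p (gam p n)) (\<lambda>t. exp (yn n t))"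
proof -
  define N where "N = real n powr (1 / \<alpha>)"
  have "pos_char (\<lambda>t. exp (complex_of_real (real n) * Y ((1 / N) * t)))"
    by (rule pos_char_dilate[OF pos_char_exp_Y]) simp
  then have "pos_char (\<lambda>t. exp (yn n t))" by (simp add: yn_def N_def)
  then obtain M where "real_distribution M" "char M = (\<lambda>t. exp (yn n t))"
    by (rule pos_char_real_distribution) (simp add: yn_def Y_0)
  then have "\<exists>M. real_distribution M \<and> char M = (\<lambda>t. exp (yfun \<alpha> p (gam p n) t))"
    unfolding yfun_eq[OF n] yn_def by blast
  from someI_ex[OF this, folded Glaw_def] have *: "real_distribution (Glaw \<alpha> p (gam p n))" "char (Glaw \<alpha> p (gam p n)) = (\<lambda>t. exp (yn n t))"
    unfolding yfun_eq[OF n] yn_def by auto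
  have "cdf (Glaw \<alpha> p (gam p n)) = G \<alpha> p (gam p n)"
    by (rule ext) (simp add: cdf_def G_def)
  then show ?thesis using bv_char_cdf[OF real_distribution_finite_borel[OF *(1)]] *(2) by simp
qed

end

subsection \<open>Local expansion of the characteristic function\<close>

text \<open>Second-order Taylor estimate for powers. The power M^(n-2) is kept, since it carries the
  decay in t once M is exponentially small.\<close>

lemma norm_power_taylor1:
  fixes a b :: complex
  assumes "norm a \<le> M" "norm b \<le> M"
  shows "norm (a ^ n - b ^ n - of_nat n * (a - b) * b ^ (n - 1)) \<le> (real n)\<^sup>2 * M ^ (n - 2) * (norm (a - b))\<^sup>2"
proof (induction n)
  case (Suc n)
  have M: "0 \<le> M" using assms(1) norm_ge_zero order_trans by blast
  show ?case
  proof (cases n)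
    case (Suc k)
    define D where "D = a ^ n - b ^ n - of_nat n * (a - b) * b ^ (n - 1)"
    have "a ^ Suc n - b ^ Suc n - of_nat (Suc n) * (a - b) * b ^ n = a * D + of_nat n * (a - b)\<^sup>2 * b ^ (n - 1)"
      unfolding D_def Suc by (simp add: algebra_simps power2_eq_square)
    then have "norm (a ^ Suc n - b ^ Suc n - of_nat (Suc n) * (a - b) * b ^ n) \<le> norm (a * D) + norm (of_nat n * (a - b)\<^sup>2 * b ^ (n - 1))"
      by (simp only: norm_triangle_ineq)
    also have "norm (a * D) \<le> M * norm D" unfolding norm_mult using assms by (intro mult_right_mono) auto
    also have "M * norm D \<le> (real n)\<^sup>2 * M ^ (n - 1) * (norm (a - b))\<^sup>2"
    \<comment> \<open>For n = 1 truncated subtraction makes both n-2 and n-1 zero, so the extra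
      factor M cannot be absorbed; but then the remainder is 0.\<close>
    proof (cases k)
      case 0
      then have "D = 0" by (simp add: D_def Suc)
      then show ?thesis using M by simp
    next
      case (Suc l)
      have "M * norm D \<le> M * ((real n)\<^sup>2 * M ^ (n - 2) * (norm (a - b))\<^sup>2)"
        using Suc.IH M unfolding D_def by (intro mult_left_mono) auto
      also have "\<dots> = (real n)\<^sup>2 * M ^ (n - 1) * (norm (a - b))\<^sup>2"
        using Suc \<open>n = Suc k\<close> by (simp add: mult_ac)
      finally show ?thesis .
    qed
    also have "norm (of_nat n * (a - b)\<^sup>2 * b ^ (n - 1)) \<le> real n * (norm (a - b))\<^sup>2 * M ^ (n - 1)"
      unfolding norm_mult norm_power norm_of_nat using assms by (intro mult_left_mono power_mono) auto
    also have "(real n)\<^sup>2 * M ^ (n - 1) * (norm (a - b))\<^sup>2 + real n * (norm (a - b))\<^sup>2 * M ^ (n - 1)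
       = ((real n)\<^sup>2 + real n) * (M ^ (n - 1) * (norm (a - b))\<^sup>2)" by (simp add: algebra_simps)
    also have "\<dots> \<le> (real (Suc n))\<^sup>2 * (M ^ (n - 1) * (norm (a - b))\<^sup>2)"
      using M by (intro mult_right_mono) (auto simp: power2_eq_square algebra_simps)
    finally show ?thesis by (simp add: mult.assoc Suc)
  qed simp
qed simp

context semistable
begin

definition hc :: "real \<Rightarrow> complex" where "hc s = f s * iexp (- (m1 * s))"
text \<open>Minus one half of the formal variance m2 - m1^2. It is positive, so exp (sg s^2) grows;
  this is harmless near 0, where Re Y is of order \<alpha> < 2.\<close>

definition sg :: real where "sg = (m1\<^sup>2 - m2) / 2"
text \<open>The principal part of \<open>hc\<close>. For \<alpha> > 1 the exponential form makes the
  n-th power explicit, at the price of terms quadratic in \<open>Y\<close>, which are of order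
  2\<alpha> > 1+\<alpha>. For \<alpha> < 1 such terms matter and 1 + Y is kept, while s^2 is
  negligible.\<close>

definition A :: "real \<Rightarrow> complex" where
  "A s = (if \<alpha> < 1 then 1 + Y s else exp (Y s + complex_of_real (sg * s\<^sup>2)))"
text \<open>The product of the linear term of the centring factor with \<open>Y\<close>: the only
  contribution of order exactly 1+\<alpha> that \<open>A\<close> misses.\<close>

definition dl :: "real \<Rightarrow> complex" where "dl s = - \<i> * complex_of_real (m1 * s) * Y s"

lemma powr_le_of_le1:
  fixes x :: real
  assumes "\<bar>x\<bar> \<le> 1" "a \<le> b" "0 < a"
  shows "\<bar>x\<bar> powr b \<le> \<bar>x\<bar> powr a"
  using assms by (cases "x = 0") (auto intro: powr_mono')

lemma abs_power_eq_powr: "0 < k \<Longrightarrow> \<bar>x::real\<bar> ^ k = \<bar>x\<bar> powr real k"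
  by (cases "x = 0") (auto simp: powr_realpow)

lemma norm_iexp1_expand: "norm (iexp (- x) - 1 + \<i> * complex_of_real x) \<le> x\<^sup>2"
proof -
  have "norm (iexp (- x) - 1 + \<i> * complex_of_real x) \<le> x\<^sup>2 / 2" using norm_iexp2[of "-x"] by simp
  also have "\<dots> \<le> x\<^sup>2" by simp
  finally show ?thesis .
qed

text \<open>What is left has order 2, beyond 1+\<alpha> since \<alpha> < 1: the quadratic remainder
  of the centring factor and the smooth part \<open>Z\<close>.\<close>

lemma expansion_lt1:
  assumes a: "\<alpha> < 1"
  obtains K where "K > 0" "\<And>s. \<bar>s\<bar> \<le> 1 \<Longrightarrow> norm (hc s - A s - dl s) \<le> K * \<bar>s\<bar> powr 2"
proof
  show "(1 + CY) * m1\<^sup>2 + m1\<^sup>2 - m2 > 0" 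
  proof -
    have "0 \<le> (1 + CY) * m1\<^sup>2" using CY_pos by simp
    then show ?thesis using m2_neg(2) zero_le_power2[of m1] by linarith
  qed
  fix s :: real assume s: "\<bar>s\<bar> \<le> 1"
  define x where "x = m1 * s"
  define e where "e = iexp (- x)"
  have x2: "x\<^sup>2 = m1\<^sup>2 * s\<^sup>2" by (simp add: x_def power_mult_distrib)
  have "hc s - A s - dl s = (1 + Y s) * (e - 1 + \<i> * complex_of_real x) + \<i> * complex_of_real x * (e - 1) - Z s * e"
  proof -
    have fY: "f s = 1 + Y s + \<i> * complex_of_real x - Z s" by (simp add: Y_def x_def)
    show ?thesis using a unfolding hc_def A_def dl_def x_def[symmetric] e_def[symmetric] fY by (simp add: algebra_simps)
  qed
  also have "norm \<dots> \<le> norm ((1 + Y s) * (e - 1 + \<i> * complex_of_real x)) + norm (\<i> * complex_of_real x * (e - 1)) + norm (Z s * e)"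
    by (intro order_trans[OF norm_triangle_ineq4] add_mono norm_triangle_ineq order_refl)
  also have "\<dots> \<le> (1 + CY) * x\<^sup>2 + x\<^sup>2 + s\<^sup>2 * (- m2)"
  proof (intro add_mono)
    have "norm (Y s) \<le> CY * \<bar>s\<bar> powr \<alpha>" by (rule norm_Y)
    also have "\<dots> \<le> CY * 1" using s \<alpha> CY_pos by (intro mult_left_mono powr_le1) auto
    finally have "norm (1 + Y s) \<le> 1 + CY" using norm_triangle_ineq[of 1 "Y s"] by simp
    then show "norm ((1 + Y s) * (e - 1 + \<i> * complex_of_real x)) \<le> (1 + CY) * x\<^sup>2"
      unfolding norm_mult e_def using CY_pos by (intro mult_mono norm_iexp1_expand) auto
    have "norm (\<i> * complex_of_real x * (e - 1)) \<le> \<bar>x\<bar> * \<bar>- x\<bar>"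
      unfolding norm_mult e_def norm_of_real norm_ii mult_1 by (intro mult_left_mono norm_iexp1) auto
    then show "norm (\<i> * complex_of_real x * (e - 1)) \<le> x\<^sup>2" by (simp add: power2_eq_square)
    have "norm (Z s * e) \<le> (s\<^sup>2 / 2) * (- m2)" unfolding norm_mult e_def using norm_Z[of s] by simp
    also have "\<dots> \<le> s\<^sup>2 * (- m2)" using m2_neg by (intro mult_right_mono) auto
    finally show "norm (Z s * e) \<le> s\<^sup>2 * (- m2)" .
  qed
  also have "\<dots> = ((1 + CY) * m1\<^sup>2 + m1\<^sup>2 - m2) * s\<^sup>2" unfolding x2 by (simp add: algebra_simps)
  also have "s\<^sup>2 = \<bar>s\<bar> powr 2" using abs_power_eq_powr[of 2 s] by simp
  finally show "norm (hc s - A s - dl s) \<le> ((1 + CY) * m1\<^sup>2 + m1\<^sup>2 - m2) * \<bar>s\<bar> powr 2" .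
qed

lemma sg_pos: "sg > 0"
proof -
  have "m1\<^sup>2 - m2 > 0" using m2_neg(2) zero_le_power2[of m1] by linarith
  then show ?thesis by (simp add: sg_def)
qed

text \<open>The exponential contributes an error of order 2\<alpha>, everything else order 3; both
  exceed 1+\<alpha> for 1 < \<alpha> < 2.\<close>

lemma expansion_gt1:
  assumes a: "\<alpha> > 1"
  obtains K where "K > 0" "\<And>s. \<bar>s\<bar> \<le> 1 \<Longrightarrow> norm (hc s - A s - dl s) \<le> K * \<bar>s\<bar> powr (min (2 * \<alpha>) 3)"
proof
  define k where "k = min (2 * \<alpha>) 3"
  define C2 where "C2 = CY + sg"
  define K1 where "K1 = C2\<^sup>2 * exp C2 + CY * m1\<^sup>2"
  define K2 where "K2 = m3 + (1 + \<bar>m1\<bar> + \<bar>m2\<bar>) * \<bar>m1\<bar> ^ 3 + \<bar>m1\<bar> * (m1\<^sup>2 + \<bar>m2\<bar>) + \<bar>m2\<bar> * m1\<^sup>2"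
  note sg0 = sg_pos
  have C2: "C2 > 0" using CY_pos sg0 by (simp add: C2_def)
  have K2: "K2 > 0" unfolding K2_def using m3_pos by (intro add_pos_nonneg) auto
  show "K1 + K2 > 0" unfolding K1_def using K2 CY_pos by (intro add_nonneg_pos[OF add_nonneg_nonneg]) auto
  fix s :: real assume s: "\<bar>s\<bar> \<le> 1"
  define x where "x = m1 * s"
  define X where "X = \<i> * complex_of_real x"
  define e where "e = iexp (- x)"
  define W where "W = complex_of_real (m2 * s\<^sup>2 / 2)"
  define \<sigma> where "\<sigma> = complex_of_real (sg * s\<^sup>2)"
  have pk: "\<bar>s\<bar> powr (2 * \<alpha>) \<le> \<bar>s\<bar> powr k" "\<bar>s\<bar> ^ 3 \<le> \<bar>s\<bar> powr k"
  proof -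
    show "\<bar>s\<bar> powr (2 * \<alpha>) \<le> \<bar>s\<bar> powr k" using a by (intro powr_le_of_le1[OF s]) (auto simp: k_def)
    have e3: "\<bar>s\<bar> ^ 3 = \<bar>s\<bar> powr real 3" by (rule abs_power_eq_powr) simp
    show "\<bar>s\<bar> ^ 3 \<le> \<bar>s\<bar> powr k" unfolding e3 using a by (intro powr_le_of_le1[OF s]) (auto simp: k_def)
  qed
  have s1: "\<bar>s\<bar> powr \<alpha> \<le> 1" using s \<alpha> by (intro powr_le1) auto
  have s2a: "s\<^sup>2 \<le> \<bar>s\<bar> powr \<alpha>"
    using powr_le_of_le1[OF s, of \<alpha> 2] \<alpha> abs_power_eq_powr[of 2 s] by simp
  have fY: "f s = 1 + Y s + X - Z s" by (simp add: Y_def x_def X_def)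
  \<comment> \<open>Three sources of error: linearizing the exponential, linearizing the centring
    factor in the product with \<open>Y\<close>, and a remainder free of \<open>Y\<close>.\<close>
  have 1: "hc s - A s - dl s = - (exp (Y s + \<sigma>) - 1 - (Y s + \<sigma>)) + Y s * (e - 1 + X)
      + ((1 + X - Z s) * e - 1 - \<sigma>)"
    using a unfolding hc_def A_def dl_def x_def[symmetric] e_def[symmetric] fY \<sigma>_def[symmetric] X_def
    by (simp add: algebra_simps)
  have n1: "norm (exp (Y s + \<sigma>) - 1 - (Y s + \<sigma>)) \<le> C2\<^sup>2 * exp C2 * \<bar>s\<bar> powr k"
  proof -
    have "norm (Y s + \<sigma>) \<le> CY * \<bar>s\<bar> powr \<alpha> + sg * \<bar>s\<bar> powr \<alpha>"
      unfolding \<sigma>_def using sg0 s2a by (intro order_trans[OF norm_triangle_ineq] add_mono norm_Y) (simp add: abs_mult norm_mult norm_power)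
    also have "\<dots> = C2 * \<bar>s\<bar> powr \<alpha>" by (simp add: C2_def distrib_right)
    finally have b: "norm (Y s + \<sigma>) \<le> C2 * \<bar>s\<bar> powr \<alpha>" .
    have "norm (exp (Y s + \<sigma>) - 1 - (Y s + \<sigma>)) \<le> norm (Y s + \<sigma>) ^ 2 * exp (norm (Y s + \<sigma>))"
      using norm_exp_remainder[of "Y s + \<sigma>" 2] by (simp add: numeral_2_eq_2 diff_diff_eq)
    also have "\<dots> \<le> (C2 * \<bar>s\<bar> powr \<alpha>)\<^sup>2 * exp C2"
    proof (intro mult_mono power_mono b)
      have "C2 * \<bar>s\<bar> powr \<alpha> \<le> C2 * 1" using C2 by (intro mult_left_mono s1) auto
      then show "exp (norm (Y s + \<sigma>)) \<le> exp C2" using b by simp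
    qed (use C2 in auto)
    also have "\<dots> = C2\<^sup>2 * exp C2 * \<bar>s\<bar> powr (2 * \<alpha>)"
    proof -
      have "(\<bar>s\<bar> powr \<alpha>)\<^sup>2 = \<bar>s\<bar> powr (2 * \<alpha>)" by (simp only: power2_eq_square mult_2 powr_add)
      then show ?thesis by (simp only: power_mult_distrib mult_ac)
    qed
    also have "\<dots> \<le> C2\<^sup>2 * exp C2 * \<bar>s\<bar> powr k" using C2 by (intro mult_left_mono pk) auto
    finally show ?thesis .
  qed
  have n2: "norm (Y s * (e - 1 + X)) \<le> CY * m1\<^sup>2 * \<bar>s\<bar> powr k"
  proof -
    have "norm (Y s * (e - 1 + X)) \<le> (CY * \<bar>s\<bar> powr \<alpha>) * x\<^sup>2"
      unfolding norm_mult e_def X_def using CY_pos by (intro mult_mono norm_Y norm_iexp1_expand) auto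
    also have "\<dots> \<le> (CY * \<bar>s\<bar> powr 1) * x\<^sup>2"
      using CY_pos powr_le_of_le1[OF s, of 1 \<alpha>] a by (intro mult_right_mono mult_left_mono) auto
    also have "\<dots> = CY * m1\<^sup>2 * \<bar>s\<bar> ^ 3"
    proof -
      have "\<bar>s\<bar> ^ 3 = \<bar>s\<bar> * s\<^sup>2" by (simp add: power3_eq_cube power2_eq_square mult.assoc)
      moreover have "\<bar>s\<bar> powr 1 = \<bar>s\<bar>" by simp
      ultimately show ?thesis unfolding x_def by (simp only: power_mult_distrib mult_ac)
    qed
    also have "\<dots> \<le> CY * m1\<^sup>2 * \<bar>s\<bar> powr k" using CY_pos by (intro mult_left_mono pk) auto
    finally show ?thesis .
  qed
  have n3: "norm ((1 + X - Z s) * e - 1 - \<sigma>) \<le> K2 * \<bar>s\<bar> powr k"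
  proof -
    define r where "r = e - (1 - X + X\<^sup>2 / 2)"
    have X2: "X\<^sup>2 = - complex_of_real (m1\<^sup>2 * s\<^sup>2)" by (simp add: X_def x_def power_mult_distrib)
    have sig: "\<sigma> = - X\<^sup>2 / 2 - W" unfolding X2 \<sigma>_def W_def sg_def by (simp add: field_simps)
    define H where "H = X\<^sup>2 / 2"
    have XX: "X * X = 2 * H" by (simp add: H_def power2_eq_square)
    have sigH: "\<sigma> = - H - W" by (simp add: sig H_def)
    \<comment> \<open>The value of \<open>sg\<close> is chosen for this cancellation: the quadratic
      terms are -H - W, which is \<sigma>, and only cubic and higher terms remain.\<close>
    have "(1 + X - Z s) * e - 1 - \<sigma> = (W - Z s) * e + (1 + X - W) * r + X * (H + W) - W * H"
      unfolding sigH r_def H_def[symmetric] by (simp add: algebra_simps XX)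
    then have "(1 + X - Z s) * e - 1 - \<sigma> = (W - Z s) * e + (1 + X - W) * r + X * (X\<^sup>2 / 2 + W) - W * X\<^sup>2 / 2"
      unfolding H_def by simp
    also have "norm \<dots> \<le> norm ((W - Z s) * e) + norm ((1 + X - W) * r) + norm (X * (X\<^sup>2 / 2 + W)) + norm (W * X\<^sup>2 / 2)"
      by (intro order_trans[OF norm_triangle_ineq4] order_trans[OF norm_triangle_ineq] add_mono order_refl)
    also have "\<dots> \<le> m3 * \<bar>s\<bar> ^ 3 + (1 + \<bar>m1\<bar> + \<bar>m2\<bar>) * (\<bar>m1\<bar> ^ 3 * \<bar>s\<bar> ^ 3) + \<bar>m1\<bar> * (m1\<^sup>2 + \<bar>m2\<bar>) * \<bar>s\<bar> ^ 3 + \<bar>m2\<bar> * m1\<^sup>2 * \<bar>s\<bar> ^ 3"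
    proof (intro add_mono)
      have ss: "\<bar>s\<bar> ^ 2 \<le> 1" "\<bar>s\<bar> ^ 4 \<le> \<bar>s\<bar> ^ 3" using power_le_one[of "\<bar>s\<bar>" 2] power_decreasing[of 3 4 "\<bar>s\<bar>"] s by auto
      have nX: "norm X = \<bar>m1\<bar> * \<bar>s\<bar>" by (simp add: X_def x_def norm_mult abs_mult)
      have nW: "norm W = \<bar>m2\<bar> / 2 * \<bar>s\<bar> ^ 2" unfolding W_def norm_of_real by (simp add: abs_mult)
      have "norm ((W - Z s) * e) \<le> (\<bar>s\<bar> ^ 3 / 6) * m3"
        using norm_Z_expand[of s] by (simp add: W_def e_def norm_mult norm_minus_commute)
      also have "\<dots> \<le> m3 * \<bar>s\<bar> ^ 3" using m3_pos by simp
      finally show "norm ((W - Z s) * e) \<le> m3 * \<bar>s\<bar> ^ 3" .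
      have "norm (1 + X - W) \<le> norm (1 + X) + norm W" by (rule norm_triangle_ineq4)
      also have "\<dots> \<le> 1 + norm X + norm W" using norm_triangle_ineq[of 1 X] by simp
      also have "\<dots> \<le> 1 + \<bar>m1\<bar> * 1 + \<bar>m2\<bar> * 1"
        unfolding nX nW using s ss by (intro add_mono mult_left_mono) (auto simp: mult_le_cancel_left)
      finally have "norm (1 + X - W) \<le> 1 + \<bar>m1\<bar> + \<bar>m2\<bar>" by simp
      moreover have "norm r \<le> \<bar>m1\<bar> ^ 3 * \<bar>s\<bar> ^ 3"
      proof -
        have "r = iexp (- x) - 1 - \<i> * complex_of_real (- x) + complex_of_real ((- x)\<^sup>2 / 2)"
          unfolding r_def e_def X_def by (simp add: power_mult_distrib)
        then have "norm r \<le> \<bar>- x\<bar> ^ 3 / 6" using norm_iexp3[of "- x"] by (simp only:)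
        also have "\<dots> \<le> \<bar>m1\<bar> ^ 3 * \<bar>s\<bar> ^ 3" by (simp add: x_def abs_mult power_mult_distrib)
        finally show ?thesis .
      qed
      ultimately show "norm ((1 + X - W) * r) \<le> (1 + \<bar>m1\<bar> + \<bar>m2\<bar>) * (\<bar>m1\<bar> ^ 3 * \<bar>s\<bar> ^ 3)"
        unfolding norm_mult by (intro mult_mono) auto
      have "norm (X\<^sup>2 / 2 + W) \<le> norm (X\<^sup>2 / 2) + norm W" by (rule norm_triangle_ineq)
      also have "\<dots> \<le> (m1\<^sup>2 + \<bar>m2\<bar>) * \<bar>s\<bar> ^ 2"
        unfolding nW norm_divide norm_power nX by (simp add: power_mult_distrib algebra_simps) (intro add_mono; simp)
      finally have "norm X * norm (X\<^sup>2 / 2 + W) \<le> (\<bar>m1\<bar> * \<bar>s\<bar>) * ((m1\<^sup>2 + \<bar>m2\<bar>) * \<bar>s\<bar> ^ 2)"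
        unfolding nX by (intro mult_left_mono) auto
      also have "\<dots> = \<bar>m1\<bar> * (m1\<^sup>2 + \<bar>m2\<bar>) * \<bar>s\<bar> ^ 3"
        by (simp only: power2_eq_square[of "\<bar>s\<bar>"] power3_eq_cube mult_ac)
      finally show "norm (X * (X\<^sup>2 / 2 + W)) \<le> \<bar>m1\<bar> * (m1\<^sup>2 + \<bar>m2\<bar>) * \<bar>s\<bar> ^ 3" by (simp only: norm_mult)
      have "norm (W * X\<^sup>2 / 2) = (\<bar>m2\<bar> * m1\<^sup>2 / 4) * \<bar>s\<bar> ^ 4"
        unfolding norm_divide norm_mult norm_power nX nW by (simp add: power_mult_distrib)
      also have "\<dots> \<le> (\<bar>m2\<bar> * m1\<^sup>2) * \<bar>s\<bar> ^ 3" using ss by (intro mult_mono) auto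
      finally show "norm (W * X\<^sup>2 / 2) \<le> \<bar>m2\<bar> * m1\<^sup>2 * \<bar>s\<bar> ^ 3" .
    qed
    also have "\<dots> = K2 * \<bar>s\<bar> ^ 3" by (simp only: K2_def distrib_right mult.assoc)
    also have "\<dots> \<le> K2 * \<bar>s\<bar> powr k" using K2 by (intro mult_left_mono pk) auto
    finally show ?thesis .
  qed
  have "norm (hc s - A s - dl s) \<le> norm (exp (Y s + \<sigma>) - 1 - (Y s + \<sigma>)) + norm (Y s * (e - 1 + X)) + norm ((1 + X - Z s) * e - 1 - \<sigma>)"
    unfolding 1 by (intro order_trans[OF norm_triangle_ineq] add_mono order_refl) (simp add: norm_minus_commute)
  also have "\<dots> \<le> (K1 + K2) * \<bar>s\<bar> powr k" using n1 n2 n3 by (simp add: K1_def algebra_simps)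
  finally show "norm (hc s - A s - dl s) \<le> (K1 + K2) * \<bar>s\<bar> powr (min (2 * \<alpha>) 3)" by (simp add: k_def)
qed

text \<open>From the decay rate \<open>cY\<close> of the exponent: half is kept for
  \<open>A\<close>, half of that after bounding the exponential by a linear function, and half of
  the rest after admitting the error hc - A.\<close>

definition c1 :: real where "c1 = cY / 8"

lemma c1_pos: "c1 > 0" using cY_pos by (simp add: c1_def)

lemma powr_small:
  fixes a b :: real
  assumes "a > 0" "b > 0" "K \<ge> 0"
  obtains \<epsilon> where "0 < \<epsilon>" "\<epsilon> \<le> 1" "\<And>s. \<bar>s\<bar> \<le> \<epsilon> \<Longrightarrow> K * \<bar>s\<bar> powr a \<le> b"
proof -
  define \<epsilon> where "\<epsilon> = min 1 ((b / (K + 1)) powr (1 / a))"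
  have e: "0 < \<epsilon>" "\<epsilon> \<le> 1" using assms by (simp_all add: \<epsilon>_def)
  moreover have "K * \<bar>s\<bar> powr a \<le> b" if "\<bar>s\<bar> \<le> \<epsilon>" for s
  proof -
    have "\<bar>s\<bar> powr a \<le> ((b / (K + 1)) powr (1 / a)) powr a"
      using that assms(1) by (intro powr_mono2) (simp_all add: \<epsilon>_def)
    also have "\<dots> = b / (K + 1)" using assms by (simp add: powr_powr)
    finally have "K * \<bar>s\<bar> powr a \<le> K * (b / (K + 1))" using assms by (intro mult_left_mono) auto
    also have "\<dots> = b * (K / (K + 1))" by simp
    also have "\<dots> \<le> b * 1" using assms by (intro mult_left_mono) (auto simp: divide_le_eq_1)
    also have "\<dots> = b" by simp
    finally show ?thesis .
  qed
  ultimately show ?thesis by (rule that)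
qed

lemma norm_dl: "norm (dl s) \<le> (\<bar>m1\<bar> * CY) * \<bar>s\<bar> powr (1 + \<alpha>)"
proof -
  have "norm (dl s) = \<bar>m1\<bar> * \<bar>s\<bar> * norm (Y s)" by (simp add: dl_def norm_mult abs_mult)
  also have "\<dots> \<le> \<bar>m1\<bar> * \<bar>s\<bar> * (CY * \<bar>s\<bar> powr \<alpha>)" by (intro mult_left_mono norm_Y) auto
  also have "\<dots> = (\<bar>m1\<bar> * CY) * \<bar>s\<bar> powr (1 + \<alpha>)"
  proof -
    have "\<bar>s\<bar> powr (1 + \<alpha>) = \<bar>s\<bar> * \<bar>s\<bar> powr \<alpha>" by (simp add: powr_add)
    then show ?thesis by (simp only: mult_ac)
  qed
  finally show ?thesis .
qed

text \<open>For \<alpha> < 1, the square of the norm is 1 + 2 Re Y + \<bar>Y\<bar>^2, and near 0 the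
  last term uses up only half of the decay. For \<alpha> > 1, the growing factor exp (sg s^2) costs
  half of it, since 2 > \<alpha>.\<close>

lemma norm_A:
  obtains \<epsilon> K where "0 < \<epsilon>" "\<epsilon> \<le> 1" "K > 0" "\<And>s. \<bar>s\<bar> \<le> \<epsilon> \<Longrightarrow> norm (A s) \<le> exp (- (cY / 2) * \<bar>s\<bar> powr \<alpha>)"
    "\<And>s. \<bar>s\<bar> \<le> \<epsilon> \<Longrightarrow> norm (A s - 1) \<le> K * \<bar>s\<bar> powr \<alpha>"
proof (cases "\<alpha> < 1")
  case True
  obtain \<epsilon> where e: "0 < \<epsilon>" "\<epsilon> \<le> 1" "\<And>s. \<bar>s\<bar> \<le> \<epsilon> \<Longrightarrow> CY\<^sup>2 * \<bar>s\<bar> powr \<alpha> \<le> cY"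
    by (rule powr_small[OF \<alpha>(1) cY_pos zero_le_power2[of CY]]) (rule that; assumption)
  show ?thesis
  proof (rule that[OF e(1,2) CY_pos])
    fix s assume s: "\<bar>s\<bar> \<le> \<epsilon>"
    define v where "v = \<bar>s\<bar> powr \<alpha>"
    have "(norm (Y s))\<^sup>2 \<le> (CY * v)\<^sup>2" unfolding v_def by (intro power_mono norm_Y) auto
    also have "\<dots> = (CY\<^sup>2 * v) * v" by (simp add: power2_eq_square)
    also have "\<dots> \<le> cY * v" using e(3)[OF s] by (intro mult_right_mono) (auto simp: v_def)
    finally have Y2: "(norm (Y s))\<^sup>2 \<le> cY * v" .
    have "(norm (1 + Y s))\<^sup>2 = 1 + 2 * Re (Y s) + (norm (Y s))\<^sup>2"
      unfolding cmod_power2 by (simp add: power2_eq_square algebra_simps)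
    also have "\<dots> \<le> 1 + - (cY * v)" using Re_Y_le[of s] Y2 by (simp add: v_def)
    also have "\<dots> \<le> exp (- (cY * v))" by (rule exp_ge_add_one_self)
    also have "\<dots> = (exp (- (cY / 2) * v))\<^sup>2" by (simp add: power2_eq_square exp_add[symmetric])
    finally have "norm (1 + Y s) \<le> exp (- (cY / 2) * v)" by (rule power2_le_imp_le) simp
    then show "norm (A s) \<le> exp (- (cY / 2) * \<bar>s\<bar> powr \<alpha>)" using True by (simp add: A_def v_def)
    show "norm (A s - 1) \<le> CY * \<bar>s\<bar> powr \<alpha>" using True norm_Y by (simp add: A_def)
  qed
next
  case False
  then have a: "\<alpha> > 1" using \<alpha> by simp
  obtain \<epsilon> where e: "0 < \<epsilon>" "\<epsilon> \<le> 1" "\<And>s. \<bar>s\<bar> \<le> \<epsilon> \<Longrightarrow> sg * \<bar>s\<bar> powr (2 - \<alpha>) \<le> cY / 2"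
  proof (rule powr_small[of "2 - \<alpha>" "cY / 2" sg])
    show "0 < 2 - \<alpha>" "0 < cY / 2" "0 \<le> sg" using \<alpha> cY_pos sg_pos by auto
  qed (rule that; assumption)
  define C where "C = (CY + sg) * exp (CY + sg)"
  have C: "C > 0" unfolding C_def using CY_pos sg_pos by (intro mult_pos_pos) auto
  show ?thesis
  proof (rule that[OF e(1,2) C])
    fix s assume s: "\<bar>s\<bar> \<le> \<epsilon>"
    have s1: "\<bar>s\<bar> \<le> 1" using s e by simp
    have s2: "s\<^sup>2 = \<bar>s\<bar> powr (2 - \<alpha>) * \<bar>s\<bar> powr \<alpha>"
      using abs_power_eq_powr[of 2 s] by (simp add: powr_add[symmetric])
    have "sg * s\<^sup>2 = (sg * \<bar>s\<bar> powr (2 - \<alpha>)) * \<bar>s\<bar> powr \<alpha>" unfolding s2 by simp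
    also have "\<dots> \<le> (cY / 2) * \<bar>s\<bar> powr \<alpha>" by (intro mult_right_mono e s) simp
    finally have *: "sg * s\<^sup>2 \<le> (cY / 2) * \<bar>s\<bar> powr \<alpha>" .
    have "Re (Y s + complex_of_real (sg * s\<^sup>2)) \<le> - (cY / 2) * \<bar>s\<bar> powr \<alpha>"
      using * Re_Y_le[of s] by (simp add: Re_power2 power2_eq_square)
    then show "norm (A s) \<le> exp (- (cY / 2) * \<bar>s\<bar> powr \<alpha>)"
      using a by (simp add: A_def norm_exp_eq_Re)
    define z where "z = Y s + complex_of_real (sg * s\<^sup>2)"
    have v1: "\<bar>s\<bar> powr \<alpha> \<le> 1" using s1 \<alpha> by (intro powr_le1) auto
    have "norm z \<le> CY * \<bar>s\<bar> powr \<alpha> + sg * \<bar>s\<bar> powr \<alpha>"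
      unfolding z_def
    proof (intro order_trans[OF norm_triangle_ineq] add_mono norm_Y)
      have "s\<^sup>2 \<le> \<bar>s\<bar> powr \<alpha>" using powr_le_of_le1[OF s1, of \<alpha> 2] \<alpha> abs_power_eq_powr[of 2 s] by simp
      then show "norm (complex_of_real (sg * s\<^sup>2)) \<le> sg * \<bar>s\<bar> powr \<alpha>"
        unfolding norm_of_real using sg_pos by (simp add: abs_mult)
    qed
    then have nz: "norm z \<le> (CY + sg) * \<bar>s\<bar> powr \<alpha>" by (simp add: distrib_right)
    have "norm (exp z - 1) \<le> norm z * exp (norm z)" using norm_exp_remainder[of z 1] by simp
    also have "\<dots> \<le> ((CY + sg) * \<bar>s\<bar> powr \<alpha>) * exp (CY + sg)"
    proof (intro mult_mono nz)
      have "(CY + sg) * \<bar>s\<bar> powr \<alpha> \<le> (CY + sg) * 1" using CY_pos sg_pos by (intro mult_left_mono v1) auto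
      then show "exp (norm z) \<le> exp (CY + sg)" using nz by simp
    qed (use CY_pos sg_pos in auto)
    finally show "norm (A s - 1) \<le> C * \<bar>s\<bar> powr \<alpha>"
      using a by (simp add: A_def z_def C_def mult_ac)
  qed
qed

text \<open>One neighbourhood and one constant for all estimates in both regimes; only k >
  1+\<alpha> is remembered of the order of the error.\<close>

lemma local_expansion:
  obtains \<epsilon> K k where "0 < \<epsilon>" "\<epsilon> \<le> 1" "K > 0" "k > 1 + \<alpha>"
    "\<And>s. \<bar>s\<bar> \<le> \<epsilon> \<Longrightarrow> norm (hc s - A s - dl s) \<le> K * \<bar>s\<bar> powr k"
    "\<And>s. \<bar>s\<bar> \<le> \<epsilon> \<Longrightarrow> norm (hc s - A s) \<le> K * \<bar>s\<bar> powr (1 + \<alpha>)"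
    "\<And>s. \<bar>s\<bar> \<le> \<epsilon> \<Longrightarrow> norm (A s - 1) \<le> K * \<bar>s\<bar> powr \<alpha>"
    "\<And>s. \<bar>s\<bar> \<le> \<epsilon> \<Longrightarrow> norm (A s) \<le> exp (- c1 * \<bar>s\<bar> powr \<alpha>)"
    "\<And>s. \<bar>s\<bar> \<le> \<epsilon> \<Longrightarrow> norm (hc s) \<le> exp (- c1 * \<bar>s\<bar> powr \<alpha>)"
proof -
  obtain K1 k where K1: "K1 > 0" "k > 1 + \<alpha>" "\<And>s. \<bar>s\<bar> \<le> 1 \<Longrightarrow> norm (hc s - A s - dl s) \<le> K1 * \<bar>s\<bar> powr k"
  proof (cases "\<alpha> < 1")
    case True
    obtain K where K: "K > 0" "\<And>s. \<bar>s\<bar> \<le> 1 \<Longrightarrow> norm (hc s - A s - dl s) \<le> K * \<bar>s\<bar> powr 2"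
      by (rule expansion_lt1[OF True]) (rule that; assumption)
    show ?thesis by (rule that[of K 2, OF K(1) _ K(2)]) (use True in auto)
  next
    case False
    then have a: "\<alpha> > 1" using \<alpha> by simp
    obtain K where K: "K > 0" "\<And>s. \<bar>s\<bar> \<le> 1 \<Longrightarrow> norm (hc s - A s - dl s) \<le> K * \<bar>s\<bar> powr (min (2 * \<alpha>) 3)"
      by (rule expansion_gt1[OF a]) (rule that; assumption)
    show ?thesis by (rule that[of K "min (2 * \<alpha>) 3", OF K(1) _ K(2)]) (use a \<alpha> in auto)
  qed
  obtain e2 K2 where K2: "0 < e2" "e2 \<le> 1" "K2 > 0" "\<And>s. \<bar>s\<bar> \<le> e2 \<Longrightarrow> norm (A s) \<le> exp (- (cY / 2) * \<bar>s\<bar> powr \<alpha>)"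
    "\<And>s. \<bar>s\<bar> \<le> e2 \<Longrightarrow> norm (A s - 1) \<le> K2 * \<bar>s\<bar> powr \<alpha>"
    by (rule norm_A) (rule that; assumption)
  define K where "K = K1 + \<bar>m1\<bar> * CY + K2"
  have K: "K > 0" "K1 \<le> K" "K2 \<le> K" "K1 + \<bar>m1\<bar> * CY \<le> K" using K1 K2 CY_pos by (auto simp: K_def intro!: add_pos_nonneg)
  obtain e3 where e3: "0 < e3" "e3 \<le> 1" "\<And>s. \<bar>s\<bar> \<le> e3 \<Longrightarrow> K * \<bar>s\<bar> powr 1 \<le> cY / 8"
  proof (rule powr_small[of 1 "cY / 8" K])
    show "0 < (1::real)" "0 < cY / 8" "0 \<le> K" using cY_pos K by auto
  qed (rule that; assumption)
  obtain e4 where e4: "0 < e4" "e4 \<le> 1" "\<And>s. \<bar>s\<bar> \<le> e4 \<Longrightarrow> (cY / 2) * \<bar>s\<bar> powr \<alpha> \<le> 1"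
  proof (rule powr_small[of \<alpha> 1 "cY / 2"])
    show "0 < \<alpha>" "0 < (1::real)" "0 \<le> cY / 2" using cY_pos \<alpha> by auto
  qed (rule that; assumption)
  define \<epsilon> where "\<epsilon> = min e2 (min e3 e4)"
  have e: "0 < \<epsilon>" "\<epsilon> \<le> 1" "\<epsilon> \<le> e2" "\<epsilon> \<le> e3" "\<epsilon> \<le> e4" using K2 e3 e4 by (auto simp: \<epsilon>_def)
  have hA: "norm (hc s - A s) \<le> K * \<bar>s\<bar> powr (1 + \<alpha>)" if s: "\<bar>s\<bar> \<le> 1" for s
  proof -
    have "norm (hc s - A s) \<le> norm (hc s - A s - dl s) + norm (dl s)"
      using norm_triangle_ineq[of "hc s - A s - dl s" "dl s"] by simp
    also have "\<dots> \<le> K1 * \<bar>s\<bar> powr (1 + \<alpha>) + (\<bar>m1\<bar> * CY) * \<bar>s\<bar> powr (1 + \<alpha>)"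
      using K1(1,2) \<alpha> by (intro add_mono norm_dl order_trans[OF K1(3)[OF s]] mult_left_mono powr_le_of_le1 s) auto
    also have "\<dots> \<le> K * \<bar>s\<bar> powr (1 + \<alpha>)"
      unfolding distrib_right[symmetric] by (intro mult_right_mono K) simp
    finally show ?thesis .
  qed
  show ?thesis
  proof (rule that[OF e(1,2) K(1) K1(2)])
    fix s assume s: "\<bar>s\<bar> \<le> \<epsilon>"
    have s1: "\<bar>s\<bar> \<le> 1" using s e by simp
    have s2: "\<bar>s\<bar> \<le> e2" "\<bar>s\<bar> \<le> e3" "\<bar>s\<bar> \<le> e4" using s e by auto
    define v where "v = \<bar>s\<bar> powr \<alpha>"
    have v: "v \<ge> 0" "(cY / 2) * v \<le> 1" using e4(3)[OF s2(3)] by (auto simp: v_def)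
    show "norm (hc s - A s - dl s) \<le> K * \<bar>s\<bar> powr k"
      by (rule order_trans[OF K1(3)[OF s1]]) (intro mult_right_mono K, simp)
    show "norm (hc s - A s) \<le> K * \<bar>s\<bar> powr (1 + \<alpha>)" by (rule hA[OF s1])
    show "norm (A s - 1) \<le> K * \<bar>s\<bar> powr \<alpha>"
      by (rule order_trans[OF K2(5)[OF s2(1)]]) (intro mult_right_mono K, simp)
    have 1: "norm (A s) \<le> exp (- (cY / 2) * v)" unfolding v_def by (rule K2(4)[OF s2(1)])
    have le: "exp (- (cY / 2) * v) \<le> exp (- c1 * v)"
      using v cY_pos by (auto simp: c1_def intro!: mult_right_mono)
    show "norm (A s) \<le> exp (- c1 * \<bar>s\<bar> powr \<alpha>)" using 1 le unfolding v_def by linarith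
    \<comment> \<open>On [0,1], exp (-x) lies below 1 - x/2; the radius \<open>e4\<close> keeps the
      argument in that range. The slack so gained absorbs hc - A.\<close>
    have "exp (- ((cY / 2) * v)) \<le> 1 - ((cY / 2) * v) / 2"
    proof -
      define x where "x = (cY / 2) * v"
      have x: "0 \<le> x" "x \<le> 1" using v cY_pos by (auto simp: x_def)
      have "exp (- x) = 1 / exp x" by (simp add: exp_minus inverse_eq_divide)
      also have "\<dots> \<le> 1 / (1 + x)" using x exp_ge_add_one_self[of x] by (intro divide_left_mono) auto
      also have "\<dots> \<le> 1 - x / 2"
      proof -
        have "x * x \<le> x * 1" using x by (intro mult_left_mono) auto
        then have "1 \<le> (1 - x / 2) * (1 + x)" by (simp add: algebra_simps)
        then show ?thesis using x by (simp add: divide_le_eq)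
      qed
      finally show ?thesis by (simp add: x_def)
    qed
    moreover have "norm (hc s - A s) \<le> (cY / 8) * v"
    proof -
      have "K * \<bar>s\<bar> powr (1 + \<alpha>) = (K * \<bar>s\<bar> powr 1) * v" by (simp only: powr_add v_def mult.assoc)
      also have "\<dots> \<le> (cY / 8) * v" using e3(3)[OF s2(2)] v by (intro mult_right_mono) auto
      finally show ?thesis using hA[OF s1] by linarith
    qed
    moreover have "norm (hc s) \<le> norm (A s) + norm (hc s - A s)"
      using norm_triangle_ineq[of "A s" "hc s - A s"] by simp
    ultimately have "norm (hc s) \<le> 1 + - (c1 * v)" using 1 by (simp add: c1_def)
    also have "\<dots> \<le> exp (- (c1 * v))" by (rule exp_ge_add_one_self)
    finally show "norm (hc s) \<le> exp (- c1 * \<bar>s\<bar> powr \<alpha>)" by (simp add: v_def)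
  qed
qed

end

subsection \<open>Expansion of powers of the characteristic function\<close>

context semistable
begin

definition NN :: "nat \<Rightarrow> real" where "NN n = real n powr (1 / \<alpha>)"

lemma NN_pos: "n \<ge> 1 \<Longrightarrow> NN n > 0" by (simp add: NN_def)

text \<open>Remainder terms of order \<open>n powr - \<eta>\<close> on the range \<open>\<bar>t\<bar> \<le> \<epsilon> n powr (1/\<alpha>)\<close>, with enough decay in \<open>t\<close>
  for division by \<open>\<bar>t\<bar>\<close> to leave an integrable function.\<close>

definition rbound :: "real \<Rightarrow> (nat \<Rightarrow> real \<Rightarrow> complex) \<Rightarrow> bool" where
  "rbound \<eta> R \<longleftrightarrow> (\<exists>\<epsilon>>0. \<exists>C\<ge>0. \<exists>c>0. \<exists>k::nat. \<forall>n\<ge>4. \<forall>t. \<bar>t\<bar> \<le> \<epsilon> * NN n \<longrightarrow>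
     norm (R n t) \<le> C * real n powr (- \<eta>) * (\<bar>t\<bar> powr \<alpha> * (1 + \<bar>t\<bar>) ^ k * exp (- c * \<bar>t\<bar> powr \<alpha>)))"

lemma rboundE:
  assumes "rbound \<eta> R"
  obtains \<epsilon> C c k where "\<epsilon> > 0" "C \<ge> 0" "c > 0"
    "\<And>n t. n \<ge> 4 \<Longrightarrow> \<bar>t\<bar> \<le> \<epsilon> * NN n \<Longrightarrow>
     norm (R n t) \<le> C * real n powr (- \<eta>) * (\<bar>t\<bar> powr \<alpha> * (1 + \<bar>t\<bar>) ^ k * exp (- c * \<bar>t\<bar> powr \<alpha>))"
  using assms unfolding rbound_def by blast

lemma rboundI':
  assumes "\<epsilon> > 0" "C \<ge> 0" "c > 0"
    "\<And>n t. n \<ge> 4 \<Longrightarrow> \<bar>t\<bar> \<le> \<epsilon> * NN n \<Longrightarrow>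
     norm (R n t) \<le> C * real n powr (- \<eta>) * (\<bar>t\<bar> powr \<alpha> * (1 + \<bar>t\<bar>) ^ k * exp (- c * \<bar>t\<bar> powr \<alpha>))"
  shows "rbound \<eta> R"
  using assms unfolding rbound_def by blast

lemma powr_le_power_1_plus:
  fixes x :: real
  assumes "0 \<le> x" "0 \<le> d" "d \<le> real k"
  shows "x powr d \<le> (1 + x) ^ k"
proof -
  have "x powr d \<le> (1 + x) powr d" using assms by (intro powr_mono2) auto
  also have "\<dots> \<le> (1 + x) powr real k" using assms by (intro powr_mono) auto
  also have "\<dots> = (1 + x) ^ k" using assms by (intro powr_realpow) auto
  finally show ?thesis .
qed

lemma rboundI:
  assumes "\<epsilon> > 0" "C \<ge> 0" "c > 0" and b: "b \<ge> \<alpha>"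
    and R: "\<And>n t. n \<ge> 4 \<Longrightarrow> \<bar>t\<bar> \<le> \<epsilon> * NN n \<Longrightarrow>
     norm (R n t) \<le> C * real n powr (- \<eta>) * (\<bar>t\<bar> powr b * exp (- c * \<bar>t\<bar> powr \<alpha>))"
  shows "rbound \<eta> R"
proof (rule rboundI'[OF assms(1-3)])
  fix n :: nat and t :: real assume n: "n \<ge> 4" "\<bar>t\<bar> \<le> \<epsilon> * NN n"
  define k where "k = nat \<lceil>b - \<alpha>\<rceil>"
  have "b - \<alpha> \<le> real k" unfolding k_def by linarith
  then have "\<bar>t\<bar> powr (b - \<alpha>) \<le> (1 + \<bar>t\<bar>) ^ k" using b by (intro powr_le_power_1_plus) auto
  then have "\<bar>t\<bar> powr \<alpha> * \<bar>t\<bar> powr (b - \<alpha>) \<le> \<bar>t\<bar> powr \<alpha> * (1 + \<bar>t\<bar>) ^ k" by (intro mult_left_mono) auto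
  then have "\<bar>t\<bar> powr b \<le> \<bar>t\<bar> powr \<alpha> * (1 + \<bar>t\<bar>) ^ k" by (simp add: powr_add[symmetric])
  then have "C * real n powr (- \<eta>) * (\<bar>t\<bar> powr b * exp (- c * \<bar>t\<bar> powr \<alpha>)) \<le>
     C * real n powr (- \<eta>) * (\<bar>t\<bar> powr \<alpha> * (1 + \<bar>t\<bar>) ^ k * exp (- c * \<bar>t\<bar> powr \<alpha>))"
    using assms(2) by (intro mult_left_mono mult_right_mono) auto
  then show "norm (R n t) \<le> C * real n powr (- \<eta>) * (\<bar>t\<bar> powr \<alpha> * (1 + \<bar>t\<bar>) ^ k * exp (- c * \<bar>t\<bar> powr \<alpha>))"
    using R[OF n] by linarith
qed

lemma rbound_mono:
  assumes "rbound \<eta> R" "\<eta>' \<le> \<eta>"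
  shows "rbound \<eta>' R"
proof -
  from assms(1) obtain \<epsilon> C c k where *: "\<epsilon> > 0" "C \<ge> 0" "c > 0"
    "\<And>n t. n \<ge> 4 \<Longrightarrow> \<bar>t\<bar> \<le> \<epsilon> * NN n \<Longrightarrow>
     norm (R n t) \<le> C * real n powr (- \<eta>) * (\<bar>t\<bar> powr \<alpha> * (1 + \<bar>t\<bar>) ^ k * exp (- c * \<bar>t\<bar> powr \<alpha>))"
    by (rule rboundE) (rule that; assumption)
  show ?thesis
  proof (rule rboundI'[OF *(1-3)])
    fix n :: nat and t :: real assume n: "n \<ge> 4" "\<bar>t\<bar> \<le> \<epsilon> * NN n"
    have "C * real n powr (- \<eta>) * (\<bar>t\<bar> powr \<alpha> * (1 + \<bar>t\<bar>) ^ k * exp (- c * \<bar>t\<bar> powr \<alpha>)) \<le>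
       C * real n powr (- \<eta>') * (\<bar>t\<bar> powr \<alpha> * (1 + \<bar>t\<bar>) ^ k * exp (- c * \<bar>t\<bar> powr \<alpha>))"
      using n *(2) assms(2) by (intro mult_right_mono mult_left_mono powr_mono) auto
    with *(4)[OF n] show "norm (R n t) \<le> C * real n powr (- \<eta>') * (\<bar>t\<bar> powr \<alpha> * (1 + \<bar>t\<bar>) ^ k * exp (- c * \<bar>t\<bar> powr \<alpha>))"
      by linarith
  qed
qed

lemma rbound_add:
  assumes "rbound \<eta> R" "rbound \<eta> R'"
  shows "rbound \<eta> (\<lambda>n t. R n t + R' n t)"
proof -
  from assms(1) obtain \<epsilon> C c k where 1: "\<epsilon> > 0" "C \<ge> 0" "c > 0"
    "\<And>n t. n \<ge> 4 \<Longrightarrow> \<bar>t\<bar> \<le> \<epsilon> * NN n \<Longrightarrow>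
     norm (R n t) \<le> C * real n powr (- \<eta>) * (\<bar>t\<bar> powr \<alpha> * (1 + \<bar>t\<bar>) ^ k * exp (- c * \<bar>t\<bar> powr \<alpha>))"
    by (rule rboundE) (rule that; assumption)
  from assms(2) obtain \<epsilon>' C' c' k' where 2: "\<epsilon>' > 0" "C' \<ge> 0" "c' > 0"
    "\<And>n t. n \<ge> 4 \<Longrightarrow> \<bar>t\<bar> \<le> \<epsilon>' * NN n \<Longrightarrow>
     norm (R' n t) \<le> C' * real n powr (- \<eta>) * (\<bar>t\<bar> powr \<alpha> * (1 + \<bar>t\<bar>) ^ k' * exp (- c' * \<bar>t\<bar> powr \<alpha>))"
    by (rule rboundE) (rule that; assumption)
  show ?thesis
  proof (rule rboundI'[of "min \<epsilon> \<epsilon>'" "C + C'" "min c c'"])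
    fix n :: nat and t :: real assume n: "n \<ge> 4" "\<bar>t\<bar> \<le> min \<epsilon> \<epsilon>' * NN n"
    have Npos: "NN n \<ge> 0" using NN_pos[of n] n by simp
    have t: "\<bar>t\<bar> \<le> \<epsilon> * NN n" "\<bar>t\<bar> \<le> \<epsilon>' * NN n"
      using n(2) mult_right_mono[of "min \<epsilon> \<epsilon>'" \<epsilon> "NN n"] mult_right_mono[of "min \<epsilon> \<epsilon>'" \<epsilon>' "NN n"] Npos by auto
    define w where "w = \<bar>t\<bar> powr \<alpha> * (1 + \<bar>t\<bar>) ^ max k k' * exp (- min c c' * \<bar>t\<bar> powr \<alpha>)"
    have a: "\<bar>t\<bar> powr \<alpha> * (1 + \<bar>t\<bar>) ^ l * exp (- d * \<bar>t\<bar> powr \<alpha>) \<le> w" if "l \<le> max k k'" "min c c' \<le> d" for l d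
      unfolding w_def
    proof (intro mult_mono power_increasing)
      have "min c c' * \<bar>t\<bar> powr \<alpha> \<le> d * \<bar>t\<bar> powr \<alpha>" using that by (intro mult_right_mono) auto
      then show "exp (- d * \<bar>t\<bar> powr \<alpha>) \<le> exp (- min c c' * \<bar>t\<bar> powr \<alpha>)" by simp
    qed (use that in auto)
    have "norm (R n t + R' n t) \<le> norm (R n t) + norm (R' n t)" by (rule norm_triangle_ineq)
    also have "\<dots> \<le> C * real n powr (- \<eta>) * w + C' * real n powr (- \<eta>) * w"
      using 1(2) 2(2)
      by (intro add_mono order_trans[OF 1(4)[OF n(1) t(1)]] order_trans[OF 2(4)[OF n(1) t(2)]] mult_left_mono a) auto
    also have "\<dots> = (C + C') * real n powr (- \<eta>) * w" by (simp add: algebra_simps)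
    finally show "norm (R n t + R' n t) \<le> (C + C') * real n powr (- \<eta>) * (\<bar>t\<bar> powr \<alpha> * (1 + \<bar>t\<bar>) ^ max k k' * exp (- min c c' * \<bar>t\<bar> powr \<alpha>))"
      unfolding w_def .
  qed (use 1 2 in auto)
qed

lemma rbound_sum:
  assumes "finite I" "\<And>i. i \<in> I \<Longrightarrow> rbound \<eta> (R i)"
  shows "rbound \<eta> (\<lambda>n t. \<Sum>i\<in>I. R i n t)"
  using assms
proof (induction I rule: finite_induct)
  case empty
  show ?case by (rule rboundI[of 1 0 1 \<alpha>]) auto
qed (auto intro: rbound_add)

lemma rbound_mult:
  assumes "rbound \<eta> R" and C': "C' \<ge> 0"
    and Q: "\<And>n t. n \<ge> 4 \<Longrightarrow> norm (Q n t) \<le> C' * real n powr (- \<eta>') * (1 + \<bar>t\<bar>) ^ k'"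
  shows "rbound (\<eta> + \<eta>') (\<lambda>n t. Q n t * R n t)"
proof -
  from assms(1) obtain \<epsilon> C c k where 1: "\<epsilon> > 0" "C \<ge> 0" "c > 0"
    "\<And>n t. n \<ge> 4 \<Longrightarrow> \<bar>t\<bar> \<le> \<epsilon> * NN n \<Longrightarrow>
     norm (R n t) \<le> C * real n powr (- \<eta>) * (\<bar>t\<bar> powr \<alpha> * (1 + \<bar>t\<bar>) ^ k * exp (- c * \<bar>t\<bar> powr \<alpha>))"
    by (rule rboundE) (rule that; assumption)
  show ?thesis
  proof (rule rboundI'[of \<epsilon> "C * C'" c])
    fix n :: nat and t :: real assume n: "n \<ge> 4" "\<bar>t\<bar> \<le> \<epsilon> * NN n"
    have "norm (Q n t * R n t) \<le> (C' * real n powr (- \<eta>') * (1 + \<bar>t\<bar>) ^ k') *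
        (C * real n powr (- \<eta>) * (\<bar>t\<bar> powr \<alpha> * (1 + \<bar>t\<bar>) ^ k * exp (- c * \<bar>t\<bar> powr \<alpha>)))"
      unfolding norm_mult using 1(4)[OF n] Q[OF n(1)] C' by (intro mult_mono) auto
    also have "\<dots> = (C * C') * (real n powr (- \<eta>) * real n powr (- \<eta>')) * (\<bar>t\<bar> powr \<alpha> * ((1 + \<bar>t\<bar>) ^ k * (1 + \<bar>t\<bar>) ^ k') * exp (- c * \<bar>t\<bar> powr \<alpha>))"
      by (simp only: mult_ac)
    also have "real n powr (- \<eta>) * real n powr (- \<eta>') = real n powr (- (\<eta> + \<eta>'))"
      by (simp add: powr_add[symmetric])
    also have "(1 + \<bar>t\<bar>) ^ k * (1 + \<bar>t\<bar>) ^ k' = (1 + \<bar>t\<bar>) ^ (k + k')" by (rule power_add[symmetric])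
    finally show "norm (Q n t * R n t) \<le> (C * C') * real n powr (- (\<eta> + \<eta>')) * (\<bar>t\<bar> powr \<alpha> * (1 + \<bar>t\<bar>) ^ (k + k') * exp (- c * \<bar>t\<bar> powr \<alpha>))" .
  qed (use 1 C' in auto)
qed

section \<open>Powers at the scale n powr (1/\<alpha>)\<close>

lemma scaled_powr:
  assumes "n \<ge> 1"
  shows "\<bar>t / NN n\<bar> powr b = \<bar>t\<bar> powr b * real n powr (- b / \<alpha>)"
proof -
  have "\<bar>t / NN n\<bar> powr b = \<bar>t\<bar> powr b / (NN n powr b)"
    using NN_pos[OF assms] by (simp add: abs_divide powr_divide)
  also have "NN n powr b = real n powr (b / \<alpha>)" by (simp add: NN_def powr_powr)
  finally show ?thesis by (simp add: powr_minus_divide)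
qed

lemma n_scaled_powr:
  assumes "n \<ge> 1"
  shows "real n * \<bar>t / NN n\<bar> powr b = real n powr (- (b / \<alpha> - 1)) * \<bar>t\<bar> powr b"
proof -
  have "real n * real n powr (- b / \<alpha>) = real n powr (1 + (- b / \<alpha>))"
    using assms by (subst powr_add) simp
  also have "1 + (- b / \<alpha>) = - (b / \<alpha> - 1)" by simp
  finally have e: "real n * real n powr (- b / \<alpha>) = real n powr (- (b / \<alpha> - 1))" .
  have "real n * (\<bar>t\<bar> powr b * real n powr (- b / \<alpha>)) = (real n * real n powr (- b / \<alpha>)) * \<bar>t\<bar> powr b"
    by (simp only: mult_ac)
  then show ?thesis unfolding scaled_powr[OF assms] e .
qed

lemma n_scaled_powr_\<alpha>: "n \<ge> 1 \<Longrightarrow> real n * \<bar>t / NN n\<bar> powr \<alpha> = \<bar>t\<bar> powr \<alpha>"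
  using n_scaled_powr[of n t \<alpha>] \<alpha> by simp

text \<open>Reason for the restriction n \<ge> 4: then n - 2 \<ge> n/2, so dropping up to two
  factors costs at most half of the rate.\<close>

lemma exp_power_scaled:
  assumes n: "n \<ge> 4" and i: "i \<le> 2" and c: "c > 0"
  shows "exp (- c * \<bar>t / NN n\<bar> powr \<alpha>) ^ (n - i) \<le> exp (- (c / 2) * \<bar>t\<bar> powr \<alpha>)"
proof -
  have "real n / 2 \<le> real (n - i)" using n i by (simp add: of_nat_diff)
  then have "(real n / 2) * (c * \<bar>t / NN n\<bar> powr \<alpha>) \<le> real (n - i) * (c * \<bar>t / NN n\<bar> powr \<alpha>)"
    using c by (intro mult_right_mono) auto
  moreover have "(real n / 2) * (c * \<bar>t / NN n\<bar> powr \<alpha>) = (c / 2) * (real n * \<bar>t / NN n\<bar> powr \<alpha>)" by (simp only: mult_ac times_divide_eq_left times_divide_eq_right)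
  moreover have "real n * \<bar>t / NN n\<bar> powr \<alpha> = \<bar>t\<bar> powr \<alpha>" using n by (intro n_scaled_powr_\<alpha>) simp
  ultimately have le: "(c / 2) * \<bar>t\<bar> powr \<alpha> \<le> real (n - i) * (c * \<bar>t / NN n\<bar> powr \<alpha>)" by (simp only:)
  have "exp (- c * \<bar>t / NN n\<bar> powr \<alpha>) ^ (n - i) = exp (- (real (n - i) * (c * \<bar>t / NN n\<bar> powr \<alpha>)))"
    unfolding exp_of_nat_mult[symmetric] by (simp only: mult_minus_left mult_minus_right)
  also have "\<dots> \<le> exp (- ((c / 2) * \<bar>t\<bar> powr \<alpha>))" using le by (simp only: exp_le_cancel_iff neg_le_iff_le)
  finally show ?thesis by (simp only: mult_minus_left)
qed

lemma scaled_abs_le: "n \<ge> 1 \<Longrightarrow> \<bar>t\<bar> \<le> \<epsilon> * NN n \<Longrightarrow> \<bar>t / NN n\<bar> \<le> \<epsilon>"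
  using NN_pos[of n] by (simp add: abs_divide divide_le_eq)

text \<open>Writing \<open>hc = A + dl + \<dots>\<close>, the term \<open>T0\<close> is the linear part in \<open>dl\<close> of \<open>hc ^ n\<close>, \<open>T1\<close> the remainder, and \<open>T2\<close>
  the error of completing \<open>A ^ (n - 1)\<close> to \<open>A ^ n\<close>.\<close>

definition T0 :: "nat \<Rightarrow> real \<Rightarrow> complex" where
  "T0 n t = of_nat n * dl (t / NN n) * A (t / NN n) ^ (n - 1)"
definition T1 :: "nat \<Rightarrow> real \<Rightarrow> complex" where
  "T1 n t = hc (t / NN n) ^ n - A (t / NN n) ^ n - T0 n t"
definition T2 :: "nat \<Rightarrow> real \<Rightarrow> complex" where
  "T2 n t = T0 n t - of_nat n * dl (t / NN n) * A (t / NN n) ^ n"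

lemma norm_n_dl: "n \<ge> 1 \<Longrightarrow> norm (of_nat n * dl (t / NN n)) \<le> (\<bar>m1\<bar> * CY) * real n powr (- (1 / \<alpha>)) * \<bar>t\<bar> powr (1 + \<alpha>)"
proof -
  assume n: "n \<ge> 1"
  have "norm (of_nat n * dl (t / NN n)) \<le> real n * ((\<bar>m1\<bar> * CY) * \<bar>t / NN n\<bar> powr (1 + \<alpha>))"
    unfolding norm_mult norm_of_nat by (intro mult_left_mono norm_dl) simp
  also have "\<dots> = (\<bar>m1\<bar> * CY) * (real n * \<bar>t / NN n\<bar> powr (1 + \<alpha>))" by (simp only: mult_ac)
  also have "\<dots> = (\<bar>m1\<bar> * CY) * (real n powr (- ((1 + \<alpha>) / \<alpha> - 1)) * \<bar>t\<bar> powr (1 + \<alpha>))"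
    by (simp only: n_scaled_powr[OF n])
  also have "(1 + \<alpha>) / \<alpha> - 1 = 1 / \<alpha>" using \<alpha> by (simp add: field_simps)
  finally show ?thesis by (simp only: mult.assoc)
qed

lemma rbound_T:
  obtains \<eta> where "\<eta> > 1 / \<alpha>" "rbound \<eta> T1" "rbound \<eta> T2" "rbound (1 / \<alpha>) T0"
proof -
  obtain \<epsilon> K k where L: "0 < \<epsilon>" "\<epsilon> \<le> 1" "K > 0" "k > 1 + \<alpha>"
    "\<And>s. \<bar>s\<bar> \<le> \<epsilon> \<Longrightarrow> norm (hc s - A s - dl s) \<le> K * \<bar>s\<bar> powr k"
    "\<And>s. \<bar>s\<bar> \<le> \<epsilon> \<Longrightarrow> norm (hc s - A s) \<le> K * \<bar>s\<bar> powr (1 + \<alpha>)"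
    "\<And>s. \<bar>s\<bar> \<le> \<epsilon> \<Longrightarrow> norm (A s - 1) \<le> K * \<bar>s\<bar> powr \<alpha>"
    "\<And>s. \<bar>s\<bar> \<le> \<epsilon> \<Longrightarrow> norm (A s) \<le> exp (- c1 * \<bar>s\<bar> powr \<alpha>)"
    "\<And>s. \<bar>s\<bar> \<le> \<epsilon> \<Longrightarrow> norm (hc s) \<le> exp (- c1 * \<bar>s\<bar> powr \<alpha>)"
    by (rule local_expansion) (rule that; assumption)
  have Apow: "norm (A (t / NN n) ^ (n - 1)) \<le> exp (- (c1 / 2) * \<bar>t\<bar> powr \<alpha>)" if "n \<ge> 4" "\<bar>t\<bar> \<le> \<epsilon> * NN n" for n t
  proof -
    have s: "\<bar>t / NN n\<bar> \<le> \<epsilon>" using that by (intro scaled_abs_le) auto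
    have "norm (A (t / NN n) ^ (n - 1)) \<le> exp (- c1 * \<bar>t / NN n\<bar> powr \<alpha>) ^ (n - 1)"
      unfolding norm_power by (intro power_mono L(8)[OF s]) simp
    also have "\<dots> \<le> exp (- (c1 / 2) * \<bar>t\<bar> powr \<alpha>)" by (intro exp_power_scaled that c1_pos) simp
    finally show ?thesis .
  qed
  have c12: "c1 / 2 > 0" using c1_pos by simp
  \<comment> \<open>\<open>T1\<close> splits into the linear term in the error of the local
    expansion and \<open>V\<close>, the second-order remainder in hc - A. Their orders are
    k/\<alpha> - 1 and 2/\<alpha>.\<close>
  define U where "U n t = of_nat n * (hc (t / NN n) - A (t / NN n) - dl (t / NN n)) * A (t / NN n) ^ (n - 1)" for n t
  define V where "V n t = hc (t / NN n) ^ n - A (t / NN n) ^ n - of_nat n * (hc (t / NN n) - A (t / NN n)) * A (t / NN n) ^ (n - 1)" for n t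
  have U: "rbound (k / \<alpha> - 1) U"
  proof (rule rboundI[of \<epsilon> K "c1 / 2" k])
    fix n :: nat and t :: real assume n: "n \<ge> 4" "\<bar>t\<bar> \<le> \<epsilon> * NN n"
    have s: "\<bar>t / NN n\<bar> \<le> \<epsilon>" using n by (intro scaled_abs_le) auto
    have "norm (U n t) \<le> (real n * (K * \<bar>t / NN n\<bar> powr k)) * exp (- (c1 / 2) * \<bar>t\<bar> powr \<alpha>)"
      unfolding U_def norm_mult norm_of_nat using L(3) by (intro mult_mono L(5)[OF s] Apow n) auto
    also have "\<dots> = K * (real n * \<bar>t / NN n\<bar> powr k) * exp (- (c1 / 2) * \<bar>t\<bar> powr \<alpha>)" by (simp only: mult_ac)
    also have "real n * \<bar>t / NN n\<bar> powr k = real n powr (- (k / \<alpha> - 1)) * \<bar>t\<bar> powr k"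
      using n by (intro n_scaled_powr) simp
    finally show "norm (U n t) \<le> K * real n powr (- (k / \<alpha> - 1)) * (\<bar>t\<bar> powr k * exp (- (c1 / 2) * \<bar>t\<bar> powr \<alpha>))"
      by (simp only: mult.assoc)
  qed (use L c1_pos \<alpha> in auto)
  have V: "rbound (2 / \<alpha>) V"
  proof (rule rboundI[of \<epsilon> "K\<^sup>2" "c1 / 2" "2 * (1 + \<alpha>)"])
    fix n :: nat and t :: real assume n: "n \<ge> 4" "\<bar>t\<bar> \<le> \<epsilon> * NN n"
    have s: "\<bar>t / NN n\<bar> \<le> \<epsilon>" using n by (intro scaled_abs_le) auto
    have "norm (V n t) \<le> (real n)\<^sup>2 * exp (- c1 * \<bar>t / NN n\<bar> powr \<alpha>) ^ (n - 2) * (norm (hc (t / NN n) - A (t / NN n)))\<^sup>2"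
      unfolding V_def by (rule norm_power_taylor1[OF L(9)[OF s] L(8)[OF s]])
    also have "\<dots> \<le> (real n)\<^sup>2 * exp (- (c1 / 2) * \<bar>t\<bar> powr \<alpha>) * (K * \<bar>t / NN n\<bar> powr (1 + \<alpha>))\<^sup>2"
      by (intro mult_mono mult_left_mono power_mono L(6)[OF s] exp_power_scaled n c1_pos) auto
    also have "\<dots> = K\<^sup>2 * (real n * \<bar>t / NN n\<bar> powr (1 + \<alpha>))\<^sup>2 * exp (- (c1 / 2) * \<bar>t\<bar> powr \<alpha>)"
      by (simp only: power_mult_distrib mult_ac)
    also have "real n * \<bar>t / NN n\<bar> powr (1 + \<alpha>) = real n powr (- (1 / \<alpha>)) * \<bar>t\<bar> powr (1 + \<alpha>)"
    proof -
      have "(1 + \<alpha>) / \<alpha> - 1 = 1 / \<alpha>" using \<alpha> by (simp add: field_simps)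
      then show ?thesis using n_scaled_powr[of n t "1 + \<alpha>"] n by simp
    qed
    also have "(real n powr (- (1 / \<alpha>)) * \<bar>t\<bar> powr (1 + \<alpha>))\<^sup>2 = real n powr (- (2 / \<alpha>)) * \<bar>t\<bar> powr (2 * (1 + \<alpha>))"
    proof -
      have "(real n powr (- (1 / \<alpha>)))\<^sup>2 = real n powr (- (1 / \<alpha>) + - (1 / \<alpha>))" by (simp only: power2_eq_square powr_add)
      moreover have "- (1 / \<alpha>) + - (1 / \<alpha>) = - (2 / \<alpha>)" by simp
      moreover have "(\<bar>t\<bar> powr (1 + \<alpha>))\<^sup>2 = \<bar>t\<bar> powr (2 * (1 + \<alpha>))" by (simp only: power2_eq_square mult_2 powr_add)
      ultimately show ?thesis by (simp only: power_mult_distrib)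
    qed
    finally show "norm (V n t) \<le> K\<^sup>2 * real n powr (- (2 / \<alpha>)) * (\<bar>t\<bar> powr (2 * (1 + \<alpha>)) * exp (- (c1 / 2) * \<bar>t\<bar> powr \<alpha>))"
      by (simp only: mult.assoc)
  qed (use L c1_pos \<alpha> in auto)
  have T1: "T1 = (\<lambda>n t. U n t + V n t)"
    by (intro ext) (simp add: T1_def T0_def U_def V_def algebra_simps)
  have T2: "rbound (1 / \<alpha> + 1) T2"
  proof (rule rboundI[of \<epsilon> "\<bar>m1\<bar> * CY * K" "c1 / 2" "1 + \<alpha> + \<alpha>"])
    fix n :: nat and t :: real assume n: "n \<ge> 4" "\<bar>t\<bar> \<le> \<epsilon> * NN n"
    have n1: "n \<ge> 1" using n by simp
    have s: "\<bar>t / NN n\<bar> \<le> \<epsilon>" using n by (intro scaled_abs_le) auto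
    have "A (t / NN n) ^ n = A (t / NN n) ^ (n - 1) * A (t / NN n)" by (rule power_minus_mult[symmetric]) (use n in simp)
    then have "T2 n t = (of_nat n * dl (t / NN n)) * (A (t / NN n) ^ (n - 1) * (1 - A (t / NN n)))"
      unfolding T2_def T0_def by (simp add: algebra_simps)
    also have "norm \<dots> \<le> ((\<bar>m1\<bar> * CY) * real n powr (- (1 / \<alpha>)) * \<bar>t\<bar> powr (1 + \<alpha>)) * (exp (- (c1 / 2) * \<bar>t\<bar> powr \<alpha>) * (K * \<bar>t / NN n\<bar> powr \<alpha>))"
      unfolding norm_mult[of "of_nat n * dl (t / NN n)"] norm_mult[of "A (t / NN n) ^ (n - 1)"]
      using CY_pos L(7)[OF s] by (intro mult_mono norm_n_dl Apow n n1) (auto simp: norm_minus_commute)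
    also have "\<bar>t / NN n\<bar> powr \<alpha> = \<bar>t\<bar> powr \<alpha> * real n powr (- 1)"
      using scaled_powr[OF n1, of t \<alpha>] \<alpha> by simp
    also have "((\<bar>m1\<bar> * CY) * real n powr (- (1 / \<alpha>)) * \<bar>t\<bar> powr (1 + \<alpha>)) * (exp (- (c1 / 2) * \<bar>t\<bar> powr \<alpha>) * (K * (\<bar>t\<bar> powr \<alpha> * real n powr (- 1))))
      = (\<bar>m1\<bar> * CY * K) * (real n powr (- (1 / \<alpha>)) * real n powr (- 1)) * ((\<bar>t\<bar> powr (1 + \<alpha>) * \<bar>t\<bar> powr \<alpha>) * exp (- (c1 / 2) * \<bar>t\<bar> powr \<alpha>))"
      by (simp only: mult_ac)
    also have "real n powr (- (1 / \<alpha>)) * real n powr (- 1) = real n powr (- (1 / \<alpha> + 1))"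
      by (simp only: powr_add[symmetric] minus_add_distrib)
    also have "\<bar>t\<bar> powr (1 + \<alpha>) * \<bar>t\<bar> powr \<alpha> = \<bar>t\<bar> powr (1 + \<alpha> + \<alpha>)" by (rule powr_add[symmetric])
    finally show "norm (T2 n t) \<le> (\<bar>m1\<bar> * CY * K) * real n powr (- (1 / \<alpha> + 1)) * (\<bar>t\<bar> powr (1 + \<alpha> + \<alpha>) * exp (- (c1 / 2) * \<bar>t\<bar> powr \<alpha>))" .
  qed (use L c1_pos CY_pos \<alpha> in auto)
  have T0: "rbound (1 / \<alpha>) T0"
  proof (rule rboundI[of \<epsilon> "\<bar>m1\<bar> * CY" "c1 / 2" "1 + \<alpha>"])
    fix n :: nat and t :: real assume n: "n \<ge> 4" "\<bar>t\<bar> \<le> \<epsilon> * NN n"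
    have "norm (T0 n t) \<le> ((\<bar>m1\<bar> * CY) * real n powr (- (1 / \<alpha>)) * \<bar>t\<bar> powr (1 + \<alpha>)) * exp (- (c1 / 2) * \<bar>t\<bar> powr \<alpha>)"
      unfolding T0_def norm_mult[of "of_nat n * dl (t / NN n)"]
      using CY_pos n by (intro mult_mono norm_n_dl Apow n) auto
    then show "norm (T0 n t) \<le> \<bar>m1\<bar> * CY * real n powr (- (1 / \<alpha>)) * (\<bar>t\<bar> powr (1 + \<alpha>) * exp (- (c1 / 2) * \<bar>t\<bar> powr \<alpha>))"
      by (simp only: mult.assoc)
  qed (use L c1_pos CY_pos \<alpha> in auto)
  \<comment> \<open>Smallest of the orders of \<open>U\<close>, \<open>V\<close> and
    \<open>T2\<close>; the first exceeds 1/\<alpha> because k > 1+\<alpha>.\<close>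
  define \<eta> where "\<eta> = min (k / \<alpha> - 1) (min (2 / \<alpha>) (1 / \<alpha> + 1))"
  have "k / \<alpha> - 1 > 1 / \<alpha>" using L(4) \<alpha> by (simp add: field_simps)
  moreover have "2 / \<alpha> > 1 / \<alpha>" using \<alpha> by (simp add: divide_strict_right_mono)
  ultimately have "\<eta> > 1 / \<alpha>" by (simp add: \<eta>_def)
  moreover have "rbound \<eta> T1" unfolding T1
    by (intro rbound_add rbound_mono[OF U] rbound_mono[OF V]) (auto simp: \<eta>_def)
  moreover have "rbound \<eta> T2" by (rule rbound_mono[OF T2]) (simp add: \<eta>_def)
  ultimately show ?thesis using T0 by (rule that)
qed

end

subsection \<open>The coefficients \<open>w\<close> and the Edgeworth polynomials\<close>

text \<open>The series D(0,b) = log (1+b) - b over the complex numbers, so that it can be evaluated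
  at values of \<open>Y\<close>.\<close>

definition LF :: "complex fps" where "LF = fps_ln 1 - fps_X"

lemma LF_nth: "fps_nth LF n = (if n \<le> 1 then 0 else (- 1) ^ (n - 1) / of_nat n)"
  by (cases "n = 0"; cases "n = 1") (auto simp: LF_def fps_ln_nth fps_X_nth)

lemma fps_conv_radius_LF: "fps_conv_radius LF \<ge> 1"
  using fps_conv_radius_diff[of "fps_ln 1" "fps_X :: complex fps"] unfolding LF_def by simp

lemma eval_fps_LF:
  assumes "norm b < 1"
  shows "eval_fps LF b = ln (1 + b) - b"
proof -
  have "(\<lambda>n. (- ((- b) ^ n) / of_nat n) - (if n = 1 then b else 0)) sums (ln (1 + b) - b)"
    by (intro sums_diff Ln_series' assms) (use sums_single[of 1 "\<lambda>_. b"] in simp)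
  moreover have "(\<lambda>n. (- ((- b) ^ n) / of_nat n) - (if n = 1 then b else 0)) = (\<lambda>n. fps_nth LF n * b ^ n)"
  proof
    fix n :: nat
    consider "n = 0" | "n = 1" | "n \<ge> 2" by linarith
    then show "(- ((- b) ^ n) / of_nat n) - (if n = 1 then b else 0) = fps_nth LF n * b ^ n"
    proof cases
      case 3
      then obtain k where "n = Suc k" by (cases n) auto
      then show ?thesis using 3 by (simp add: LF_nth power_minus[of b])
    qed (auto simp: LF_nth)
  qed
  moreover have "(\<lambda>n. fps_nth LF n * b ^ n) sums eval_fps LF b"
  proof (rule sums_eval_fps)
    have "ereal (norm b) < 1" using assms by (simp add: one_ereal_def)
    then show "ereal (norm b) < fps_conv_radius LF" using fps_conv_radius_LF by (rule order_less_le_trans)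
  qed
  ultimately show ?thesis using sums_unique2 by metis
qed

text \<open>The shifted coefficients still sum absolutely at radius \<rho>, which gives a constant
  uniform over the closed disc.\<close>

lemma eval_fps_remainder:
  fixes F :: "complex fps"
  assumes "ereal \<rho> < fps_conv_radius F" "0 \<le> \<rho>"
  obtains C where "C \<ge> 0" "\<And>z. norm z \<le> \<rho> \<Longrightarrow> norm (eval_fps F z - (\<Sum>i<N. fps_nth F i * z ^ i)) \<le> C * norm z ^ N"
proof
  have rad: "ereal \<rho> < fps_conv_radius (fps_shift N F)" using assms by simp
  have s: "summable (\<lambda>n. norm (fps_nth F (n + N) * complex_of_real \<rho> ^ n))"
    using norm_summable_fps[of "complex_of_real \<rho>" "fps_shift N F"] rad assms(2) by simp
  define C where "C = (\<Sum>n. norm (fps_nth F (n + N) * complex_of_real \<rho> ^ n))"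
  show "C \<ge> 0" unfolding C_def by (intro suminf_nonneg s) simp
  fix z :: complex assume z: "norm z \<le> \<rho>"
  have zr: "ereal (norm z) < fps_conv_radius F" using z assms(1) by (meson ereal_less_eq(3) order_le_less_trans)
  have "eval_fps F z - (\<Sum>i<N. fps_nth F i * z ^ i) = (\<Sum>n. fps_nth F (n + N) * z ^ (n + N))"
    unfolding eval_fps_def using suminf_split_initial_segment[OF summable_fps[OF zr], of N] by simp
  also have "\<dots> = (\<Sum>n. z ^ N * (fps_nth F (n + N) * z ^ n))"
    by (simp add: power_add mult_ac)
  also have "norm \<dots> \<le> norm z ^ N * C"
  proof -
    have le: "norm (fps_nth F (n + N) * z ^ n) \<le> norm (fps_nth F (n + N) * complex_of_real \<rho> ^ n)" for n
      unfolding norm_mult norm_power using z assms(2) by (intro mult_left_mono power_mono) auto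
    have sz: "summable (\<lambda>n. norm (fps_nth F (n + N) * z ^ n))"
      by (rule summable_comparison_test[OF _ s]) (use le in auto)
    have "(\<Sum>n. z ^ N * (fps_nth F (n + N) * z ^ n)) = z ^ N * (\<Sum>n. fps_nth F (n + N) * z ^ n)"
      by (rule suminf_mult[OF summable_norm_cancel[OF sz]])
    also have "norm \<dots> = norm z ^ N * norm (\<Sum>n. fps_nth F (n + N) * z ^ n)" by (simp add: norm_mult norm_power)
    also have "\<dots> \<le> norm z ^ N * C"
    proof (intro mult_left_mono)
      have "norm (\<Sum>n. fps_nth F (n + N) * z ^ n) \<le> (\<Sum>n. norm (fps_nth F (n + N) * z ^ n))" by (rule summable_norm[OF sz])
      also have "\<dots> \<le> C" unfolding C_def by (rule suminf_le[OF le sz s])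
      finally show "norm (\<Sum>n. fps_nth F (n + N) * z ^ n) \<le> C" .
    qed simp
    finally show ?thesis .
  qed
  finally show "norm (eval_fps F z - (\<Sum>i<N. fps_nth F i * z ^ i)) \<le> C * norm z ^ N" by (simp add: mult.commute)
qed

text \<open>Only the part of \<open>Dser\<close> that is constant in the inner variable enters \<open>w\<^sub>m\<^sub>,\<^sub>0\<^sub>,\<^sub>j\<close>.\<close>

definition inner_const :: "real fps fps \<Rightarrow> complex fps" where
  "inner_const S = Abs_fps (\<lambda>N. complex_of_real (fps_nth (fps_nth S N) 0))"

lemma inner_const_nth: "fps_nth (inner_const S) N = complex_of_real (fps_nth (fps_nth S N) 0)"
  by (simp add: inner_const_def)

lemma inner_const_mult: "inner_const (S * T) = inner_const S * inner_const T"
  by (rule fps_ext) (simp add: inner_const_nth fps_mult_nth fps_sum_nth)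

lemma inner_const_one: "inner_const 1 = 1"
  by (rule fps_ext) (auto simp: inner_const_nth)

lemma inner_const_power: "inner_const (S ^ n) = inner_const S ^ n"
  by (induction n) (auto simp: inner_const_one inner_const_mult)

text \<open>At a = 0 the sum over s vanishes, so the argument of the formal logarithm reduces to b
  and its n-th power contributes to the coefficient of b^n only.\<close>

lemma inner_const_Dser: "inner_const (Dser \<alpha> p) = LF"
proof (rule fps_ext)
  fix N
  define u where "u = bvB + fps_const (Abs_fps (\<lambda>s. if s = 0 then 0 else mu \<alpha> p (real s) * (-1) ^ s / fact s))"
  have cu: "inner_const u = fps_X"
    by (rule fps_ext) (auto simp: inner_const_nth u_def bvB_def fps_X_nth)
  have un: "complex_of_real (fps_nth (fps_nth (u ^ n) N) 0) = (if n = N then 1 else 0)" for n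
    using arg_cong[OF inner_const_power[of u n], of "\<lambda>S. fps_nth S N"] by (simp add: inner_const_nth cu fps_X_power_nth)
  then have un': "fps_nth (fps_nth (u ^ n) N) 0 = (if n = N then 1 else 0)" for n
    by (metis of_real_1 of_real_0 of_real_eq_iff)
  \<comment> \<open>For k = 0 the defining sum runs up to N, just far enough to contain the
    contributing index n = N.\<close>
  have "fps_nth (fps_nth (bv_log1p u) N) 0 = (\<Sum>n=1..N. (-1) ^ (n+1) / real n * (if n = N then 1 else 0))"
    unfolding bv_log1p_def by (simp add: un')
  also have "\<dots> = (if N = 0 then 0 else (-1) ^ (N+1) / real N)"
    by (simp add: if_distrib[of "\<lambda>x. _ * x"] sum.delta cong: if_cong)
  finally have lg: "fps_nth (fps_nth (bv_log1p u) N) 0 = (if N = 0 then 0 else (-1) ^ (N+1) / real N)" .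
  have "fps_nth (inner_const (Dser \<alpha> p)) N = complex_of_real ((if N = 0 then 0 else (-1) ^ (N+1) / real N) - (if N = 1 then 1 else 0))"
    unfolding inner_const_nth Dser_def u_def[symmetric] by (simp add: lg bvA_def bvB_def fps_X_nth)
  also have "\<dots> = fps_nth LF N"
    unfolding LF_nth by (cases N) (auto simp: Suc_le_eq)
  finally show "fps_nth (inner_const (Dser \<alpha> p)) N = fps_nth LF N" .
qed

lemma w_eq: "complex_of_real (w \<alpha> p m 0 j) = fps_nth (LF ^ m) (j + m)"
  unfolding w_def inner_const_nth[symmetric] inner_const_power inner_const_Dser ..

text \<open>\<open>LF\<close> begins with b^2. Hence the coefficients w with k = 0 and m > j vanish,
  in accordance with the inner sum of \<open>Gt\<close> stopping at m = j.\<close>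

lemma LF_power_nth_0: "i < 2 * m \<Longrightarrow> fps_nth (LF ^ m) i = 0"
proof -
  assume "i < 2 * m"
  moreover have "subdegree LF = 2"
    by (rule subdegreeI) (auto simp: LF_nth)
  ultimately show ?thesis by (intro nth_less_subdegree_zero) (simp add: mult.commute)
qed

context semistable
begin

text \<open>The factor by which the transform of \<open>Gt\<close> differs from exp y. For \<alpha>
  > 1 it is a truncated exponential series.\<close>

definition edgeworth :: "nat \<Rightarrow> nat \<Rightarrow> real \<Rightarrow> complex" where
  "edgeworth L n t = (if \<alpha> < 1 then 1 + (\<Sum>j=1..L. \<Sum>m=1..j. complex_of_real (w \<alpha> p m 0 j / (fact m * real n ^ j)) * yn n t ^ (j + m))
     else (\<Sum>j\<le>L. (complex_of_real (sg * t\<^sup>2 * real n powr (- ((2 - \<alpha>) / \<alpha>)))) ^ j / fact j))"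

text \<open>Each further term of the expansion gains a factor n powr -\<open>\<tau>\<close>.\<close>

definition \<tau> :: real where "\<tau> = (if \<alpha> < 1 then 1 else (2 - \<alpha>) / \<alpha>)"

definition T4 :: "nat \<Rightarrow> nat \<Rightarrow> real \<Rightarrow> complex" where
  "T4 L n t = A (t / NN n) ^ n - exp (yn n t) * edgeworth L n t"

lemma \<tau>_pos: "\<tau> > 0" using \<alpha> by (auto simp: \<tau>_def)

lemma yn_eq: "yn n t = of_nat n * Y (t / NN n)" by (simp add: yn_def NN_def)

lemma norm_yn: "n \<ge> 1 \<Longrightarrow> norm (yn n t) \<le> CY * \<bar>t\<bar> powr \<alpha>"
proof -
  assume n: "n \<ge> 1"
  have "norm (yn n t) \<le> real n * (CY * \<bar>t / NN n\<bar> powr \<alpha>)"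
    unfolding yn_eq norm_mult norm_of_nat by (intro mult_left_mono norm_Y) simp
  also have "\<dots> = CY * (real n * \<bar>t / NN n\<bar> powr \<alpha>)" by (simp only: mult_ac)
  finally show ?thesis unfolding n_scaled_powr_\<alpha>[OF n] .
qed

lemma norm_exp_yn: "n \<ge> 1 \<Longrightarrow> norm (exp (yn n t)) \<le> exp (- cY * \<bar>t\<bar> powr \<alpha>)"
proof -
  assume n: "n \<ge> 1"
  have "real n * Re (Y (t / NN n)) \<le> real n * (- cY * \<bar>t / NN n\<bar> powr \<alpha>)"
    by (intro mult_left_mono Re_Y_le) simp
  also have "\<dots> = - cY * (real n * \<bar>t / NN n\<bar> powr \<alpha>)" by (simp only: mult_ac)
  finally show ?thesis unfolding n_scaled_powr_\<alpha>[OF n] by (simp add: norm_exp_eq_Re yn_eq)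
qed

text \<open>Half of the decay of exp y pays for exponential remainders whose exponent is bounded by
  that half.\<close>

lemma norm_exp_mult_bound:
  assumes n: "n \<ge> 1" and z: "norm z \<le> (cY / 2) * \<bar>t\<bar> powr \<alpha>"
  shows "norm (exp (yn n t)) * exp (norm z) \<le> exp (- (cY / 2) * \<bar>t\<bar> powr \<alpha>)"
proof -
  have "norm (exp (yn n t)) * exp (norm z) \<le> exp (- cY * \<bar>t\<bar> powr \<alpha>) * exp ((cY / 2) * \<bar>t\<bar> powr \<alpha>)"
    using z by (intro mult_mono norm_exp_yn n) auto
  also have "\<dots> = exp (- cY * \<bar>t\<bar> powr \<alpha> + (cY / 2) * \<bar>t\<bar> powr \<alpha>)" by (rule exp_add[symmetric])
  also have "- cY * \<bar>t\<bar> powr \<alpha> + (cY / 2) * \<bar>t\<bar> powr \<alpha> = - (cY / 2) * \<bar>t\<bar> powr \<alpha>" by (simp add: algebra_simps)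
  finally show ?thesis .
qed

text \<open>Here A^n is exactly exp y times exp z with z = sg t^2 n powr -\<open>\<tau>\<close>, so
  the error is the Taylor remainder of exp z.\<close>

lemma rbound_T4_gt1:
  assumes a: "\<alpha> > 1"
  shows "rbound ((real L + 1) * \<tau>) (T4 L)"
proof -
  obtain \<epsilon> where e: "0 < \<epsilon>" "\<epsilon> \<le> 1" "\<And>s. \<bar>s\<bar> \<le> \<epsilon> \<Longrightarrow> sg * \<bar>s\<bar> powr (2 - \<alpha>) \<le> cY / 2"
  proof (rule powr_small[of "2 - \<alpha>" "cY / 2" sg])
    show "0 < 2 - \<alpha>" "0 < cY / 2" "0 \<le> sg" using \<alpha> cY_pos sg_pos by auto
  qed (rule that; assumption)
  have c: "cY / 2 > 0" using cY_pos by simp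
  have tau: "\<tau> = (2 - \<alpha>) / \<alpha>" using a by (simp add: \<tau>_def)
  show ?thesis
  proof (rule rboundI[OF e(1) _ c, of "sg ^ (L + 1)" "real (2 * (L + 1))"])
    fix n :: nat and t :: real assume n: "n \<ge> 4" "\<bar>t\<bar> \<le> \<epsilon> * NN n"
    have n1: "n \<ge> 1" using n by simp
    define s where "s = t / NN n"
    have s: "\<bar>s\<bar> \<le> \<epsilon>" unfolding s_def using n by (intro scaled_abs_le) auto
    define z where "z = complex_of_real (sg * t\<^sup>2 * real n powr (- \<tau>))"
    have ns2: "real n * s\<^sup>2 = t\<^sup>2 * real n powr (- \<tau>)"
    proof -
      have "real n * \<bar>s\<bar> powr real 2 = real n powr (- (2 / \<alpha> - 1)) * \<bar>t\<bar> powr real 2"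
        unfolding s_def using n_scaled_powr[OF n1, of t 2] by simp
      moreover have "2 / \<alpha> - 1 = \<tau>" using \<alpha> by (simp add: tau field_simps)
      ultimately show ?thesis unfolding abs_power_eq_powr[of 2, symmetric, OF zero_less_numeral] by (simp add: mult.commute)
    qed
    have zs: "z = of_nat n * complex_of_real (sg * s\<^sup>2)"
    proof -
      have "sg * t\<^sup>2 * real n powr (- \<tau>) = real n * (sg * s\<^sup>2)"
        unfolding mult.assoc ns2[symmetric] by (simp only: mult_ac)
      then have "z = complex_of_real (real n * (sg * s\<^sup>2))" unfolding z_def by (simp only:)
      then show ?thesis by (simp only: of_real_mult of_real_of_nat_eq)
    qed
    have An: "A s ^ n = exp (yn n t) * exp z"
      using a unfolding A_def zs yn_eq s_def[symmetric] by (simp add: exp_of_nat_mult[symmetric] exp_add[symmetric] distrib_left)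
    have nz: "norm z = sg * (t\<^sup>2 * real n powr (- \<tau>))" unfolding z_def norm_of_real using sg_pos by (simp add: abs_mult)
    have "norm z = sg * (real n * \<bar>s\<bar> powr (2 - \<alpha> + \<alpha>))"
      unfolding nz ns2[symmetric] using abs_power_eq_powr[of 2 s] by simp
    also have "\<dots> = (sg * \<bar>s\<bar> powr (2 - \<alpha>)) * (real n * \<bar>s\<bar> powr \<alpha>)" by (simp only: powr_add mult_ac)
    also have "\<dots> \<le> (cY / 2) * (real n * \<bar>s\<bar> powr \<alpha>)" by (intro mult_right_mono e s) simp
    also have "real n * \<bar>s\<bar> powr \<alpha> = \<bar>t\<bar> powr \<alpha>" unfolding s_def by (rule n_scaled_powr_\<alpha>[OF n1])
    finally have zb: "norm z \<le> (cY / 2) * \<bar>t\<bar> powr \<alpha>" .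
    have "edgeworth L n t = (\<Sum>k<Suc L. z ^ k / fact k)"
      unfolding edgeworth_def z_def tau lessThan_Suc_atMost using a by simp
    then have "T4 L n t = exp (yn n t) * (exp z - (\<Sum>k<Suc L. z ^ k / fact k))"
      unfolding T4_def s_def[symmetric] An by (simp only: right_diff_distrib)
    also have "norm \<dots> \<le> norm (exp (yn n t)) * (norm z ^ Suc L * exp (norm z))"
      unfolding norm_mult by (intro mult_left_mono norm_exp_remainder) simp
    also have "\<dots> = norm z ^ Suc L * (norm (exp (yn n t)) * exp (norm z))" by (simp only: mult_ac)
    also have "\<dots> \<le> norm z ^ Suc L * exp (- (cY / 2) * \<bar>t\<bar> powr \<alpha>)"
      by (intro mult_left_mono norm_exp_mult_bound n1 zb) simp
    also have "norm z ^ Suc L = sg ^ (L + 1) * real n powr (- ((real L + 1) * \<tau>)) * \<bar>t\<bar> powr real (2 * (L + 1))"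
    proof -
      have "(real n powr (- \<tau>)) ^ Suc L = real n powr (- ((real L + 1) * \<tau>))"
      proof -
        have "(real n powr (- \<tau>)) ^ Suc L = (real n powr (- \<tau>)) powr real (Suc L)"
          by (rule powr_realpow[symmetric]) (use n1 in simp)
        also have "\<dots> = real n powr (- \<tau> * real (Suc L))" by (rule powr_powr)
        also have "- \<tau> * real (Suc L) = - ((real L + 1) * \<tau>)" by simp
        finally show ?thesis .
      qed
      moreover have "(t\<^sup>2) ^ Suc L = \<bar>t\<bar> powr real (2 * (L + 1))"
      proof -
        have "\<bar>t\<bar> powr real (2 * (L + 1)) = \<bar>t\<bar> ^ (2 * (L + 1))" by (rule abs_power_eq_powr[symmetric]) simp
        also have "\<dots> = (\<bar>t\<bar>\<^sup>2) ^ (L + 1)" by (rule power_mult)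
        finally show ?thesis by (simp only: power2_abs Suc_eq_plus1)
      qed
      ultimately show ?thesis unfolding nz power_mult_distrib by (simp only: Suc_eq_plus1 mult_ac)
    qed
    finally show "norm (T4 L n t) \<le> sg ^ (L + 1) * real n powr (- ((real L + 1) * \<tau>)) * (\<bar>t\<bar> powr real (2 * (L + 1)) * exp (- (cY / 2) * \<bar>t\<bar> powr \<alpha>))"
      by (simp only: mult.assoc)
  qed (use sg_pos \<alpha> in auto)
qed

text \<open>Regroups the double sum by m: up to truncation the inner sums are the m-th powers of n
  (log (1+b) - b), divided by m!. This is the form in which it arises from the exponential
  series.\<close>

lemma edgeworth_lt1:
  assumes a: "\<alpha> < 1" and n: "n \<ge> 1" and y: "yn n t = of_nat n * b"
  shows "edgeworth L n t = (\<Sum>m\<le>L. of_nat n ^ m * (\<Sum>i<L + m + 1. fps_nth (LF ^ m) i * b ^ i) / fact m)"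
proof -
  define c where "c m i = fps_nth (LF ^ m) i" for m i
  define W where "W m j = c m (j + m) * (of_nat n ^ m * b ^ (j + m)) / fact m" for m j
  \<comment> \<open>With i = j+m. The indices i \<le> m drop out because the m-th power starts at 2m
    > m.\<close>
  have inner: "of_nat n ^ m * (\<Sum>i<L + m + 1. c m i * b ^ i) / fact m = (\<Sum>j=1..L. W m j)" if m: "m \<ge> 1" for m
  proof -
    have "(\<Sum>i<L + m + 1. c m i * b ^ i) = (\<Sum>i\<in>{1 + m..L + m}. c m i * b ^ i)"
    proof (rule sum.mono_neutral_right)
      show "\<forall>i\<in>{..<L + m + 1} - {1 + m..L + m}. c m i * b ^ i = 0"
        using m by (auto simp: c_def LF_power_nth_0)
    qed auto
    also have "\<dots> = (\<Sum>j=1..L. c m (j + m) * b ^ (j + m))"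
      by (rule sum.shift_bounds_cl_nat_ivl)
    finally show ?thesis
      by (simp add: W_def sum_distrib_left sum_divide_distrib mult_ac)
  qed
  have zero: "of_nat n ^ 0 * (\<Sum>i<L + 0 + 1. c 0 i * b ^ i) / fact 0 = 1"
  proof -
    have "(\<Sum>i<L + 0 + 1. c 0 i * b ^ i) = (\<Sum>i\<in>{0}. c 0 i * b ^ i)"
      by (rule sum.mono_neutral_right) (auto simp: c_def)
    then show ?thesis by (simp add: c_def)
  qed
  have trm: "complex_of_real (w \<alpha> p m 0 j / (fact m * real n ^ j)) * yn n t ^ (j + m) = W m j" for m j
  proof -
    have "complex_of_real (w \<alpha> p m 0 j / (fact m * real n ^ j)) * yn n t ^ (j + m) =
        c m (j + m) / (fact m * of_nat n ^ j) * (of_nat n ^ (j + m) * b ^ (j + m))"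
      unfolding y c_def w_eq[of \<alpha> p m j, symmetric] by (simp add: power_mult_distrib)
    also have "\<dots> = W m j"
    proof -
      have "n \<noteq> 0" using n by simp
      then show ?thesis unfolding W_def power_add by (simp add: divide_simps)
    qed
    finally show ?thesis .
  qed
  have "edgeworth L n t = 1 + (\<Sum>j=1..L. \<Sum>m=1..j. W m j)"
    using a unfolding edgeworth_def trm by simp
  \<comment> \<open>The inner range may be extended to L, since coefficients with m > j vanish; the
    two sums can then be interchanged.\<close>
  also have "(\<Sum>j=1..L. \<Sum>m=1..j. W m j) = (\<Sum>j=1..L. \<Sum>m=1..L. W m j)"
  proof (rule sum.cong[OF refl], rule sum.mono_neutral_left)
    fix j assume "j \<in> {1..L}"
    then show "{1..j} \<subseteq> {1..L}" by auto
    show "\<forall>m\<in>{1..L} - {1..j}. W m j = 0" by (auto simp: W_def c_def LF_power_nth_0)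
  qed simp
  also have "\<dots> = (\<Sum>m=1..L. \<Sum>j=1..L. W m j)" by (rule sum.swap)
  also have "\<dots> = (\<Sum>m=1..L. of_nat n ^ m * (\<Sum>i<L + m + 1. c m i * b ^ i) / fact m)"
    by (rule sum.cong[OF refl], rule inner[symmetric]) simp
  also have "1 + \<dots> = (\<Sum>m\<le>L. of_nat n ^ m * (\<Sum>i<L + m + 1. c m i * b ^ i) / fact m)"
  proof -
    have "{..L} = insert 0 {1..L}" by auto
    then show ?thesis using zero by simp
  qed
  finally show ?thesis by (simp only: c_def)
qed

text \<open>(1+b)^n is exp (y + z) with z = n (log (1+b) - b) of order 1/n. Truncating exp z after L
  terms gives \<open>R1\<close>; truncating the m-th power of the logarithmic series at b^(L+m)
  gives \<open>R2\<close>. Both have order L+1.\<close>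

lemma rbound_T4_lt1:
  assumes a: "\<alpha> < 1"
  shows "rbound (real L + 1) (T4 L)"
proof -
  obtain e1 where e1: "0 < e1" "e1 \<le> 1" "\<And>s. \<bar>s\<bar> \<le> e1 \<Longrightarrow> (2 * CY\<^sup>2) * \<bar>s\<bar> powr \<alpha> \<le> cY / 2"
  proof (rule powr_small[of \<alpha> "cY / 2" "2 * CY\<^sup>2"])
    show "0 < \<alpha>" "0 < cY / 2" "0 \<le> 2 * CY\<^sup>2" using \<alpha> cY_pos by auto
  qed (rule that; assumption)
  obtain e2 where e2: "0 < e2" "e2 \<le> 1" "\<And>s. \<bar>s\<bar> \<le> e2 \<Longrightarrow> CY * \<bar>s\<bar> powr \<alpha> \<le> 1 / 2"
  proof (rule powr_small[of \<alpha> "1 / 2" CY])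
    show "0 < \<alpha>" "0 < (1 / 2 :: real)" "0 \<le> CY" using \<alpha> CY_pos by auto
  qed (rule that; assumption)
  define \<epsilon> where "\<epsilon> = min e1 e2"
  have e: "0 < \<epsilon>" "\<epsilon> \<le> e1" "\<epsilon> \<le> e2" using e1 e2 by (auto simp: \<epsilon>_def)
  have c: "cY / 2 > 0" using cY_pos by simp
  define b where "b n t = Y (t / NN n)" for n t
  define z where "z n t = of_nat n * (ln (1 + b n t) - b n t)" for n t
  define R1 where "R1 n t = exp (yn n t) * (exp (z n t) - (\<Sum>k<Suc L. z n t ^ k / fact k))" for n t
  define R2 where "R2 m n t = exp (yn n t) * ((z n t ^ m - of_nat n ^ m * (\<Sum>i<L + m + 1. fps_nth (LF ^ m) i * b n t ^ i)) / fact m)" for m n t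
  have s: "\<bar>t / NN n\<bar> \<le> e1" "\<bar>t / NN n\<bar> \<le> e2" if "n \<ge> 4" "\<bar>t\<bar> \<le> \<epsilon> * NN n" for n t
    using scaled_abs_le[of n t \<epsilon>] that e by auto
  have nb: "norm (b n t) \<le> CY * \<bar>t / NN n\<bar> powr \<alpha>" for n t unfolding b_def by (rule norm_Y)
  have nb2: "norm (b n t) \<le> 1 / 2" if "n \<ge> 4" "\<bar>t\<bar> \<le> \<epsilon> * NN n" for n t
    using nb[of n t] e2(3)[OF s(2)[OF that]] by linarith
  have nz: "norm (z n t) \<le> (2 * CY\<^sup>2) * (real n powr (- 1) * \<bar>t\<bar> powr (2 * \<alpha>))" "norm (z n t) \<le> (cY / 2) * \<bar>t\<bar> powr \<alpha>"
    if nt: "n \<ge> 4" "\<bar>t\<bar> \<le> \<epsilon> * NN n" for n t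
  proof -
    have n1: "n \<ge> 1" using nt by simp
    have bb: "norm (b n t) < 1" using nb2[OF nt] by simp
    have "norm (z n t) \<le> real n * ((norm (b n t))\<^sup>2 / (1 - norm (b n t)))"
      unfolding z_def norm_mult norm_of_nat by (intro mult_left_mono Ln_approx_linear bb) simp
    also have "\<dots> \<le> real n * ((norm (b n t))\<^sup>2 / (1 / 2))"
      using nb2[OF nt] by (intro mult_left_mono divide_left_mono) auto
    also have "\<dots> \<le> real n * ((CY * \<bar>t / NN n\<bar> powr \<alpha>)\<^sup>2 / (1 / 2))"
      by (intro mult_left_mono divide_right_mono power_mono nb) auto
    also have "\<dots> = (2 * CY\<^sup>2) * (real n * (\<bar>t / NN n\<bar> powr \<alpha> * \<bar>t / NN n\<bar> powr \<alpha>))"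
      unfolding power_mult_distrib power2_eq_square[of "_ powr _"] by (simp del: abs_divide)
    finally have 1: "norm (z n t) \<le> (2 * CY\<^sup>2) * (real n * (\<bar>t / NN n\<bar> powr \<alpha> * \<bar>t / NN n\<bar> powr \<alpha>))" .
    have "\<bar>t / NN n\<bar> powr \<alpha> * \<bar>t / NN n\<bar> powr \<alpha> = \<bar>t / NN n\<bar> powr (2 * \<alpha>)" by (simp only: mult_2 powr_add)
    moreover have "real n * \<bar>t / NN n\<bar> powr (2 * \<alpha>) = real n powr (- (2 * \<alpha> / \<alpha> - 1)) * \<bar>t\<bar> powr (2 * \<alpha>)"
      by (rule n_scaled_powr[OF n1])
    moreover have "2 * \<alpha> / \<alpha> - 1 = 1" using \<alpha> by simp
    ultimately have "real n * (\<bar>t / NN n\<bar> powr \<alpha> * \<bar>t / NN n\<bar> powr \<alpha>) = real n powr (- 1) * \<bar>t\<bar> powr (2 * \<alpha>)"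
      by (simp only:)
    then show "norm (z n t) \<le> (2 * CY\<^sup>2) * (real n powr (- 1) * \<bar>t\<bar> powr (2 * \<alpha>))" using 1 by (simp only:)
    have "(2 * CY\<^sup>2) * (real n * (\<bar>t / NN n\<bar> powr \<alpha> * \<bar>t / NN n\<bar> powr \<alpha>)) = ((2 * CY\<^sup>2) * \<bar>t / NN n\<bar> powr \<alpha>) * (real n * \<bar>t / NN n\<bar> powr \<alpha>)"
      by (simp only: mult_ac)
    also have "\<dots> \<le> (cY / 2) * (real n * \<bar>t / NN n\<bar> powr \<alpha>)"
      by (intro mult_right_mono e1(3) s[OF nt]) simp
    also have "\<dots> = (cY / 2) * \<bar>t\<bar> powr \<alpha>" by (simp only: n_scaled_powr_\<alpha>[OF n1])
    finally show "norm (z n t) \<le> (cY / 2) * \<bar>t\<bar> powr \<alpha>" using 1 by linarith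
  qed
  have R1: "rbound (real L + 1) R1"
  proof (rule rboundI[OF e(1) _ c, of "(2 * CY\<^sup>2) ^ Suc L" "2 * \<alpha> * real (Suc L)"])
    fix n :: nat and t :: real assume nt: "n \<ge> 4" "\<bar>t\<bar> \<le> \<epsilon> * NN n"
    have n1: "n \<ge> 1" using nt by simp
    have "norm (R1 n t) \<le> norm (exp (yn n t)) * (norm (z n t) ^ Suc L * exp (norm (z n t)))"
      unfolding R1_def norm_mult by (intro mult_left_mono norm_exp_remainder) simp
    also have "\<dots> = norm (z n t) ^ Suc L * (norm (exp (yn n t)) * exp (norm (z n t)))" by (simp only: mult_ac)
    also have "\<dots> \<le> ((2 * CY\<^sup>2) * (real n powr (- 1) * \<bar>t\<bar> powr (2 * \<alpha>))) ^ Suc L * exp (- (cY / 2) * \<bar>t\<bar> powr \<alpha>)"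
      by (intro mult_mono power_mono nz[OF nt] norm_exp_mult_bound n1) auto
    also have "((2 * CY\<^sup>2) * (real n powr (- 1) * \<bar>t\<bar> powr (2 * \<alpha>))) ^ Suc L = (2 * CY\<^sup>2) ^ Suc L * real n powr (- (real L + 1)) * \<bar>t\<bar> powr (2 * \<alpha> * real (Suc L))"
    proof -
      have "(real n powr (- 1)) ^ Suc L = (real n powr (- 1)) powr real (Suc L)"
        by (rule powr_realpow[symmetric]) (use n1 in simp)
      also have "\<dots> = real n powr (- 1 * real (Suc L))" by (rule powr_powr)
      also have "- 1 * real (Suc L) = - (real L + 1)" by simp
      finally have 1: "(real n powr (- 1)) ^ Suc L = real n powr (- (real L + 1))" .
      have "(\<bar>t\<bar> powr (2 * \<alpha>)) ^ Suc L = \<bar>\<bar>t\<bar> powr (2 * \<alpha>)\<bar> powr real (Suc L)"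
        by (subst abs_power_eq_powr[symmetric]) simp_all
      also have "\<dots> = \<bar>t\<bar> powr (2 * \<alpha> * real (Suc L))" by (simp only: abs_of_nonneg[OF powr_ge_zero] powr_powr)
      finally show ?thesis unfolding power_mult_distrib 1 by (simp only: mult.assoc)
    qed
    finally show "norm (R1 n t) \<le> (2 * CY\<^sup>2) ^ Suc L * real n powr (- (real L + 1)) * (\<bar>t\<bar> powr (2 * \<alpha> * real (Suc L)) * exp (- (cY / 2) * \<bar>t\<bar> powr \<alpha>))"
      by (simp only: mult.assoc)
  next
    show "\<alpha> \<le> 2 * \<alpha> * real (Suc L)"
      using mult_left_mono[of 1 "2 * real (Suc L)" \<alpha>] \<alpha>(1) by simp
  qed simp
  have R2: "rbound (real L + 1) (R2 m)" for m
  proof -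
    have "1 \<le> fps_conv_radius (LF ^ m)" using fps_conv_radius_LF fps_conv_radius_power order_trans by blast
    moreover have "ereal (1 / 2) < 1" by (simp add: one_ereal_def)
    ultimately have rad: "ereal (1 / 2) < fps_conv_radius (LF ^ m)" by (rule order_less_le_trans[rotated])
    have half: "(0::real) \<le> 1 / 2" by simp
    obtain C where C: "C \<ge> 0" "\<And>x. norm x \<le> 1 / 2 \<Longrightarrow> norm (eval_fps (LF ^ m) x - (\<Sum>i<L + m + 1. fps_nth (LF ^ m) i * x ^ i)) \<le> C * norm x ^ (L + m + 1)"
      by (rule eval_fps_remainder[OF rad half, of "L + m + 1"]) (rule that; assumption)
    show ?thesis
    proof (rule rboundI[OF e(1) _ cY_pos, of "C * CY ^ (L + m + 1)" "\<alpha> * real (L + m + 1)"])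
      fix n :: nat and t :: real assume nt: "n \<ge> 4" "\<bar>t\<bar> \<le> \<epsilon> * NN n"
      have n1: "n \<ge> 1" using nt by simp
      define B where "B = b n t"
      have B: "norm B \<le> 1 / 2" using nb2[OF nt] by (simp add: B_def)
      have "ereal (norm B) < 1" using B by (simp add: one_ereal_def)
      then have rB: "ereal (norm B) < fps_conv_radius LF" using fps_conv_radius_LF by (rule order_less_le_trans)
      have lB: "eval_fps LF B = ln (1 + B) - B" by (rule eval_fps_LF) (use B in linarith)
      have ev: "eval_fps (LF ^ m) B = (ln (1 + B) - B) ^ m"
        unfolding eval_fps_power[OF rB] lB ..
      have "R2 m n t = exp (yn n t) * (of_nat n ^ m * (eval_fps (LF ^ m) B - (\<Sum>i<L + m + 1. fps_nth (LF ^ m) i * B ^ i)) / fact m)"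
        unfolding R2_def z_def ev B_def[symmetric] power_mult_distrib right_diff_distrib[of "of_nat n ^ m"] ..
      also have "norm \<dots> = norm (exp (yn n t)) * (real n ^ m * norm (eval_fps (LF ^ m) B - (\<Sum>i<L + m + 1. fps_nth (LF ^ m) i * B ^ i)) / fact m)"
        by (simp add: norm_mult norm_divide norm_power)
      also have "\<dots> \<le> exp (- cY * \<bar>t\<bar> powr \<alpha>) * (real n ^ m * (C * norm B ^ (L + m + 1)) / 1)"
        by (intro mult_mono norm_exp_yn n1 frac_le mult_left_mono C(2)[OF B]) (use C in \<open>auto simp: fact_ge_1\<close>)
      also have "\<dots> \<le> exp (- cY * \<bar>t\<bar> powr \<alpha>) * (real n ^ m * (C * (CY * \<bar>t / NN n\<bar> powr \<alpha>) ^ (L + m + 1)) / 1)"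
        unfolding B_def by (intro mult_left_mono divide_right_mono power_mono nb C(1)) auto
      also have "\<dots> = C * CY ^ (L + m + 1) * (real n ^ m * (\<bar>t / NN n\<bar> powr \<alpha>) ^ (L + m + 1)) * exp (- cY * \<bar>t\<bar> powr \<alpha>)"
        by (simp only: power_mult_distrib div_by_1 mult_ac)
      \<comment> \<open>Of the L+m+1 factors \<bar>t\<bar> powr \<alpha> / n, exactly m are
        compensated by n^m.\<close>
      also have "real n ^ m * (\<bar>t / NN n\<bar> powr \<alpha>) ^ (L + m + 1) = real n powr (- (real L + 1)) * \<bar>t\<bar> powr (\<alpha> * real (L + m + 1))"
      proof -
        have "(real n) ^ (L + 1) * (real n ^ m * (\<bar>t / NN n\<bar> powr \<alpha>) ^ (L + m + 1)) = (real n * \<bar>t / NN n\<bar> powr \<alpha>) ^ (L + m + 1)"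
        proof -
          have "real n ^ (L + m + 1) = real n ^ (L + 1) * real n ^ m"
            unfolding power_add[symmetric] by (simp only: add_ac)
          then show ?thesis unfolding power_mult_distrib by (simp only: mult.assoc)
        qed
        also have "\<dots> = (\<bar>t\<bar> powr \<alpha>) ^ (L + m + 1)" by (simp only: n_scaled_powr_\<alpha>[OF n1])
        also have "\<dots> = \<bar>\<bar>t\<bar> powr \<alpha>\<bar> powr real (L + m + 1)"
          by (subst abs_power_eq_powr[symmetric]) simp_all
        also have "\<dots> = \<bar>t\<bar> powr (\<alpha> * real (L + m + 1))" by (simp only: abs_of_nonneg[OF powr_ge_zero] powr_powr)
        finally have 1: "(real n) ^ (L + 1) * (real n ^ m * (\<bar>t / NN n\<bar> powr \<alpha>) ^ (L + m + 1)) = \<bar>t\<bar> powr (\<alpha> * real (L + m + 1))" .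
        have "real n powr (- (real L + 1)) * real n ^ (L + 1) = real n powr (- (real L + 1)) * real n powr (real L + 1)"
          using n1 powr_realpow[of "real n" "L + 1"] by (simp add: add.commute)
        also have "\<dots> = real n powr (- (real L + 1) + (real L + 1))" by (rule powr_add[symmetric])
        also have "\<dots> = 1" using n1 by simp
        finally have 2: "real n powr (- (real L + 1)) * real n ^ (L + 1) = 1" .
        have "real n ^ m * (\<bar>t / NN n\<bar> powr \<alpha>) ^ (L + m + 1) = (real n powr (- (real L + 1)) * real n ^ (L + 1)) * (real n ^ m * (\<bar>t / NN n\<bar> powr \<alpha>) ^ (L + m + 1))"
          unfolding 2 by (simp only: mult_1)
        also have "\<dots> = real n powr (- (real L + 1)) * ((real n) ^ (L + 1) * (real n ^ m * (\<bar>t / NN n\<bar> powr \<alpha>) ^ (L + m + 1)))"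
          by (rule mult.assoc)
        finally show ?thesis unfolding 1 .
      qed
      finally show "norm (R2 m n t) \<le> C * CY ^ (L + m + 1) * real n powr (- (real L + 1)) * (\<bar>t\<bar> powr (\<alpha> * real (L + m + 1)) * exp (- cY * \<bar>t\<bar> powr \<alpha>))"
        by (simp only: mult.assoc)
    next
      show "0 \<le> C * CY ^ (L + m + 1)" using C(1) CY_pos by simp
      show "\<alpha> \<le> \<alpha> * real (L + m + 1)" using mult_left_mono[of 1 "real (L + m + 1)" \<alpha>] \<alpha>(1) by simp
    qed
  qed
  have "rbound (real L + 1) (\<lambda>n t. R1 n t + (\<Sum>m\<le>L. R2 m n t))"
    by (intro rbound_add R1 rbound_sum R2) simp
  then obtain \<epsilon>' C c' k where *: "\<epsilon>' > 0" "C \<ge> 0" "c' > 0"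
    "\<And>n t. n \<ge> 4 \<Longrightarrow> \<bar>t\<bar> \<le> \<epsilon>' * NN n \<Longrightarrow>
     norm (R1 n t + (\<Sum>m\<le>L. R2 m n t)) \<le> C * real n powr (- (real L + 1)) * (\<bar>t\<bar> powr \<alpha> * (1 + \<bar>t\<bar>) ^ k * exp (- c' * \<bar>t\<bar> powr \<alpha>))"
    by (rule rboundE) (rule that; assumption)
  show ?thesis
  proof (rule rboundI'[of "min \<epsilon> \<epsilon>'" C c'])
    fix n :: nat and t :: real assume n: "n \<ge> 4" "\<bar>t\<bar> \<le> min \<epsilon> \<epsilon>' * NN n"
    have n1: "n \<ge> 1" using n by simp
    have "min \<epsilon> \<epsilon>' * NN n \<le> \<epsilon> * NN n" "min \<epsilon> \<epsilon>' * NN n \<le> \<epsilon>' * NN n"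
      using NN_pos[OF n1] by (auto intro!: mult_right_mono)
    then have nt: "\<bar>t\<bar> \<le> \<epsilon> * NN n" "\<bar>t\<bar> \<le> \<epsilon>' * NN n" using n by auto
    have y: "yn n t = of_nat n * b n t" by (simp add: yn_eq b_def)
    have "1 + b n t \<noteq> 0"
    proof
      assume "1 + b n t = 0"
      then have "b n t = -1" by (simp add: add_eq_0_iff)
      then show False using nb2[OF n(1) nt(1)] by simp
    qed
    then have "A (t / NN n) ^ n = exp (of_nat n * ln (1 + b n t))"
      using a by (simp add: A_def b_def[symmetric] exp_of_nat_mult)
    also have "of_nat n * ln (1 + b n t) = yn n t + z n t" by (simp add: y z_def algebra_simps)
    finally have An: "A (t / NN n) ^ n = exp (yn n t) * exp (z n t)" by (simp add: exp_add)
    have "T4 L n t = R1 n t + (\<Sum>m\<le>L. R2 m n t)"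
    proof -
      have "(\<Sum>m\<le>L. R2 m n t) = exp (yn n t) * ((\<Sum>m\<le>L. z n t ^ m / fact m) - edgeworth L n t)"
        unfolding R2_def edgeworth_lt1[OF a n1 y] diff_divide_distrib sum_subtractf sum_distrib_left[symmetric] ..
      then show ?thesis
        unfolding T4_def An R1_def lessThan_Suc_atMost by (simp add: algebra_simps)
    qed
    then show "norm (T4 L n t) \<le> C * real n powr (- (real L + 1)) * (\<bar>t\<bar> powr \<alpha> * (1 + \<bar>t\<bar>) ^ k * exp (- c' * \<bar>t\<bar> powr \<alpha>))"
      using *(4)[OF n(1) nt(2)] by simp
  qed (use * e in auto)
qed

lemma rbound_T4: "rbound ((real L + 1) * \<tau>) (T4 L)"
proof (cases "\<alpha> < 1")
  case True
  then show ?thesis using rbound_T4_lt1[OF True, of L] by (simp add: \<tau>_def)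
next
  case False
  then show ?thesis using \<alpha> by (intro rbound_T4_gt1) simp
qed

end

subsection \<open>The distribution of the sums\<close>

context semistable
begin

text \<open>The hypothesis fixes only the masses of the atoms. The first n of them exhaust all but
  q^n of the probability, so nothing else contributes in the limit.\<close>

lemma char_gain:
  fixes X :: "'b \<Rightarrow> real"
  assumes M: "prob_space M" and X [measurable]: "X \<in> borel_measurable M"
    and law: "\<And>k. k \<ge> 1 \<Longrightarrow> measure M {\<omega> \<in> space M. X \<omega> = rr p powr (real k / \<alpha>)} = (1 - p) ^ (k - 1) * p"
  shows "char (distr M borel X) s = f s"
proof -
  interpret M: prob_space M by fact
  define x where "x j = (1 / \<theta>) ^ Suc j" for j
  have xk: "rr p powr (real (Suc j) / \<alpha>) = x j" for j
    using xk_pos[of j] unfolding xk_def x_def rr_def q_def by (simp add: add.commute)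
  define E where "E j = {\<omega> \<in> space M. X \<omega> = x j}" for j
  have mE [measurable]: "E j \<in> sets M" for j unfolding E_def by measurable
  have PE: "measure M (E j) = p * q ^ j" for j
    using law[of "Suc j"] unfolding xk E_def q_def by simp
  define U where "U n = (\<Union>j<n. E j)" for n
  have mU [measurable]: "U n \<in> sets M" for n unfolding U_def by measurable
  have inj: "x i \<noteq> x j" if "i < j" for i j
  proof -
    have "1 / \<theta> > 1" using \<theta>01 by simp
    then have "x i < x j" unfolding x_def using that by (intro power_strict_increasing) auto
    then show ?thesis by simp
  qed
  have US: "U (Suc n) = U n \<union> E n" for n unfolding U_def by (auto simp: less_Suc_eq)
  have disj: "U n \<inter> E n = {}" for n using inj unfolding U_def E_def by force
  have PU: "measure M (U n) = 1 - q ^ n" for n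
  proof (induction n)
    case (Suc n)
    have "measure M (U (Suc n)) = measure M (U n) + measure M (E n)"
      unfolding US by (rule M.finite_measure_Union) (use disj in auto)
    then show ?case using Suc by (simp add: PE q_def algebra_simps)
  qed (simp add: U_def)
  have int: "integrable M (\<lambda>\<omega>. indicator B \<omega> *\<^sub>R iexp (s * X \<omega>))" if [measurable]: "B \<in> sets M" for B
    by (rule M.integrable_const_bound[where B = 1]) (auto simp: indicator_def)
  have partial: "(\<integral>\<omega>. indicator (U n) \<omega> *\<^sub>R iexp (s * X \<omega>) \<partial>M) = (\<Sum>j<n. ft s j)" for n
  proof (induction n)
    case (Suc n)
    have "(\<integral>\<omega>. indicator (U (Suc n)) \<omega> *\<^sub>R iexp (s * X \<omega>) \<partial>M) =
        (\<integral>\<omega>. indicator (U n) \<omega> *\<^sub>R iexp (s * X \<omega>) + indicator (E n) \<omega> *\<^sub>R iexp (s * X \<omega>) \<partial>M)"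
      by (rule Bochner_Integration.integral_cong[OF refl]) (use disj[of n] in \<open>auto simp: US indicator_def\<close>)
    also have "\<dots> = (\<integral>\<omega>. indicator (U n) \<omega> *\<^sub>R iexp (s * X \<omega>) \<partial>M) + (\<integral>\<omega>. indicator (E n) \<omega> *\<^sub>R iexp (s * X \<omega>) \<partial>M)"
      by (rule Bochner_Integration.integral_add[OF int[OF mU] int[OF mE]])
    also have "(\<integral>\<omega>. indicator (E n) \<omega> *\<^sub>R iexp (s * X \<omega>) \<partial>M) = (\<integral>\<omega>. indicator (E n) \<omega> *\<^sub>R iexp (s * x n) \<partial>M)"
      by (rule Bochner_Integration.integral_cong[OF refl]) (auto simp: E_def indicator_def)
    also have "\<dots> = complex_of_real (measure M (E n)) * iexp (s * x n)"
      by (simp add: M.emeasure_eq_measure scaleR_conv_of_real)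
    also have "\<dots> = ft s n" by (simp add: PE ft_def x_def)
    finally show ?case using Suc by simp
  qed (simp add: U_def)
  have tot: "char (distr M borel X) s = (\<integral>\<omega>. iexp (s * X \<omega>) \<partial>M)"
    unfolding char_def by (subst integral_distr) auto
  \<comment> \<open>The difference is an integral over the complement of the first n atoms, whose
    mass is q^n.\<close>
  have diff: "norm ((\<Sum>j<n. ft s j) - char (distr M borel X) s) \<le> q ^ n" for n
  proof -
    have "char (distr M borel X) s - (\<Sum>j<n. ft s j) = (\<integral>\<omega>. indicator (space M - U n) \<omega> *\<^sub>R iexp (s * X \<omega>) \<partial>M)"
    proof -
      have "(\<integral>\<omega>. iexp (s * X \<omega>) \<partial>M) = (\<integral>\<omega>. indicator (U n) \<omega> *\<^sub>R iexp (s * X \<omega>) + indicator (space M - U n) \<omega> *\<^sub>R iexp (s * X \<omega>) \<partial>M)"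
        by (rule Bochner_Integration.integral_cong[OF refl]) (auto simp: indicator_def)
      also have "\<dots> = (\<integral>\<omega>. indicator (U n) \<omega> *\<^sub>R iexp (s * X \<omega>) \<partial>M) + (\<integral>\<omega>. indicator (space M - U n) \<omega> *\<^sub>R iexp (s * X \<omega>) \<partial>M)"
        by (rule Bochner_Integration.integral_add[OF int[OF mU] int[OF sets.compl_sets[OF mU]]])
      finally show ?thesis unfolding tot partial by simp
    qed
    also have "norm \<dots> \<le> (\<integral>\<omega>. norm (indicator (space M - U n) \<omega> *\<^sub>R iexp (s * X \<omega>)) \<partial>M)" by (rule integral_norm_bound)
    also have "\<dots> = (\<integral>\<omega>. indicator (space M - U n) \<omega> \<partial>M)"
      by (rule Bochner_Integration.integral_cong[OF refl]) (auto simp: indicator_def)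
    also have "\<dots> = measure M (space M - U n)" by simp
    also have "\<dots> = q ^ n" by (subst M.prob_compl) (auto simp: PU)
    finally show ?thesis by (simp add: norm_minus_commute)
  qed
  have "(\<lambda>n. q ^ n) \<longlonglongrightarrow> 0" using q by (intro LIMSEQ_realpow_zero) auto
  then have "(\<lambda>n. (\<Sum>j<n. ft s j) - char (distr M borel X) s) \<longlonglongrightarrow> 0"
    by (rule Lim_null_comparison[rotated]) (use diff in auto)
  then have "(\<lambda>n. (\<Sum>j<n. ft s j)) \<longlonglongrightarrow> char (distr M borel X) s" by (simp add: LIM_zero_iff)
  moreover have "(\<lambda>n. (\<Sum>j<n. ft s j)) \<longlonglongrightarrow> f s" unfolding f_eq by (rule summable_LIMSEQ[OF summable_ft(1)])
  ultimately show ?thesis by (rule LIMSEQ_unique)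
qed

lemma bv_char_Fn:
  fixes X :: "nat \<Rightarrow> 'b \<Rightarrow> real"
  assumes M: "prob_space M" and ind: "prob_space.indep_vars M (\<lambda>_. borel) X UNIV"
    and law: "\<And>i k. k \<ge> 1 \<Longrightarrow> measure M {\<omega> \<in> space M. X i \<omega> = rr p powr (real k / \<alpha>)} = (1 - p) ^ (k - 1) * p"
    and n: "n \<ge> 1"
  shows "bv_char (Fn M X \<alpha> p n) (\<lambda>t. hc (t / NN n) ^ n)" "mono (Fn M X \<alpha> p n)"
proof -
  interpret M: prob_space M by fact
  have X [measurable]: "X i \<in> borel_measurable M" for i using ind unfolding M.indep_vars_def by blast
  define S where "S \<omega> = (\<Sum>i=1..n. X i \<omega>)" for \<omega>
  define W where "W \<omega> = (S \<omega> - m1 * real n) / NN n" for \<omega>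
  have [measurable]: "S \<in> borel_measurable M" unfolding S_def by measurable
  have [measurable]: "W \<in> borel_measurable M" unfolding W_def by measurable
  have N: "NN n > 0" using n by (rule NN_pos)
  interpret D: real_distribution "distr M borel W" by simp
  have fD: "finite_borel_measure (distr M borel W)" by (rule real_distribution_finite_borel) unfold_locales
  have F: "Fn M X \<alpha> p n = cdf (distr M borel W)"
  proof
    fix x
    have "cdf (distr M borel W) x = measure M (W -` {..x} \<inter> space M)"
      unfolding cdf_def by (rule measure_distr) auto
    also have "W -` {..x} \<inter> space M = {\<omega> \<in> space M. W \<omega> \<le> x}" by auto
    finally show "Fn M X \<alpha> p n x = cdf (distr M borel W) x"
      unfolding Fn_def W_def S_def mu_eq NN_def by simp
  qed
  have indn: "M.indep_vars (\<lambda>_. borel) X {1..n}" using ind by (rule M.indep_vars_subset) simp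
  have cS: "char (distr M borel S) u = f u ^ n" for u
  proof -
    have "char (distr M borel S) u = (\<Prod>i\<in>{1..n}. char (distr M borel (X i)) u)"
      unfolding S_def by (rule M.char_distr_sum[OF indn])
    also have "\<dots> = f u ^ n" using char_gain[OF M X law] by simp
    finally show ?thesis .
  qed
  have "char (distr M borel W) = (\<lambda>t. hc (t / NN n) ^ n)"
  proof
    fix t
    have "char (distr M borel W) t = (\<integral>\<omega>. iexp (t * W \<omega>) \<partial>M)"
      unfolding char_def by (subst integral_distr) auto
    also have "\<dots> = (\<integral>\<omega>. iexp (- (m1 * (t / NN n))) ^ n * iexp ((t / NN n) * S \<omega>) \<partial>M)"
    proof (rule Bochner_Integration.integral_cong[OF refl])
      fix \<omega>
      have "t * W \<omega> = real n * (- (m1 * (t / NN n))) + (t / NN n) * S \<omega>"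
        by (simp add: W_def diff_divide_distrib algebra_simps)
      then have "complex_of_real (t * W \<omega>) = complex_of_real (real n * (- (m1 * (t / NN n))) + (t / NN n) * S \<omega>)"
        by (rule arg_cong)
      also have "\<dots> = of_nat n * complex_of_real (- (m1 * (t / NN n))) + complex_of_real ((t / NN n) * S \<omega>)"
        by (simp only: of_real_add of_real_mult of_real_of_nat_eq)
      finally have "\<i> * complex_of_real (t * W \<omega>) = of_nat n * (\<i> * complex_of_real (- (m1 * (t / NN n)))) + \<i> * complex_of_real ((t / NN n) * S \<omega>)"
        by (simp only: distrib_left mult.left_commute)
      then show "iexp (t * W \<omega>) = iexp (- (m1 * (t / NN n))) ^ n * iexp ((t / NN n) * S \<omega>)"
        by (simp only: exp_add exp_of_nat_mult)
    qed
    also have "\<dots> = iexp (- (m1 * (t / NN n))) ^ n * (\<integral>\<omega>. iexp ((t / NN n) * S \<omega>) \<partial>M)"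
      by (rule integral_mult_right_zero)
    also have "(\<integral>\<omega>. iexp ((t / NN n) * S \<omega>) \<partial>M) = char (distr M borel S) (t / NN n)"
      unfolding char_def by (subst integral_distr) auto
    finally show "char (distr M borel W) t = hc (t / NN n) ^ n" unfolding cS hc_def by (simp only: power_mult_distrib mult.commute)
  qed
  then show "bv_char (Fn M X \<alpha> p n) (\<lambda>t. hc (t / NN n) ^ n)"
    using bv_char_cdf[OF fD] by (simp add: F)
  show "mono (Fn M X \<alpha> p n)" unfolding F mono_def using D.cdf_nondecreasing by blast
qed

subsection \<open>The characteristic function away from the origin\<close>

text \<open>R = u/v in lowest terms, and c is an integer; all powers of v divide c, which forces v =
  1.\<close>

lemma int_power_imp_Nat:
  fixes R c :: real
  assumes R: "R > 1" and c: "c \<noteq> 0" and int: "\<And>j::nat. c * R ^ j \<in> \<int>"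
  shows "R \<in> \<nat>"
proof -
  obtain a b where c0: "c = of_int a" and cR: "c * R = of_int b"
    using int[of 0] int[of 1] by (auto elim!: Ints_cases)
  have a0: "a \<noteq> 0" using c c0 by auto
  have "R = of_int b / of_int a" using cR c0 a0 by (simp add: field_simps)
  then have "R \<in> \<rat>" by simp
  then obtain u v :: int where uv: "R = of_int u / of_int v" "v > 0" "coprime u v"
    by (rule Rats_cases')
  have dvd: "v ^ j dvd a" for j
  proof -
    obtain m where "c * R ^ j = of_int m" using int[of j] by (auto elim!: Ints_cases)
    then have "of_int (a * u ^ j) = (of_int (m * v ^ j) :: real)"
      using uv by (simp add: c0 power_divide field_simps)
    then have "a * u ^ j = m * v ^ j" by (simp only: of_int_eq_iff)
    then have "v ^ j dvd a * u ^ j" by simp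
    moreover have "coprime (v ^ j) (u ^ j)" using uv(3) by (simp add: coprime_commute)
    ultimately show ?thesis by (simp add: coprime_dvd_mult_left_iff)
  qed
  have "v = 1"
  proof (rule ccontr)
    assume "v \<noteq> 1"
    then have "v \<ge> 2" using uv(2) by simp
    \<comment> \<open>Any j with 2^j > \<bar>a\<bar> makes v^j too large to divide a when v \<ge>
      2.\<close>
    define j where "j = nat \<bar>a\<bar>"
    have "\<bar>a\<bar> < 2 ^ j" unfolding j_def
      by (metis abs_ge_zero int_nat_eq of_nat_less_two_power of_nat_numeral of_nat_power_less_of_nat_cancel_iff)
    also have "(2::int) ^ j \<le> v ^ j" using \<open>v \<ge> 2\<close> by (intro power_mono) auto
    finally have "\<bar>a\<bar> < v ^ j" .
    moreover have "v ^ j \<le> \<bar>a\<bar>" using dvd_imp_le_int[OF a0 dvd[of j]] uv(2) by simp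
    ultimately show False by simp
  qed
  then have "R = of_int u" using uv by simp
  moreover have "u \<ge> 0" using R \<open>R = of_int u\<close> by linarith
  ultimately show ?thesis by (simp add: Nats_altdef2)
qed

text \<open>Modulus 1 means equality in the triangle inequality, so all phases coincide and s (R-1)
  R^(k+1) is a multiple of 2 pi for every k. This forces R = 1/\<theta> to be an integer.\<close>

lemma norm_f_less_1:
  assumes s: "s \<noteq> 0" and nl: "1 / \<theta> \<notin> \<nat>"
  shows "norm (f s) < 1"
proof (rule ccontr)
  assume "\<not> ?thesis"
  then have f1: "norm (f s) = 1" using norm_f[of s] by simp
  define R where "R = 1 / \<theta>"
  have R: "R > 1" using \<theta>01 by (simp add: R_def)
  \<comment> \<open>Two consecutive terms with different phases would make their partial sum
    strictly shorter than its weight, and the remaining terms cannot make up for it.\<close>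
  have phase: "iexp (s * R ^ Suc k) = iexp (s * R ^ Suc (Suc k))" for k
  proof (rule ccontr)
    assume ne: "iexp (s * R ^ Suc k) \<noteq> iexp (s * R ^ Suc (Suc k))"
    let ?w = "\<lambda>j. p * q ^ j"
    have w: "?w j > 0" for j using p q by simp
    have ftR: "ft s j = complex_of_real (?w j) * iexp (s * R ^ Suc j)" for j by (simp add: ft_def R_def)
    have strict: "norm (ft s k + ft s (Suc k)) < ?w k + ?w (Suc k)"
    proof -
      define z where "z = iexp (s * R ^ Suc k)"
      define z' where "z' = iexp (s * R ^ Suc (Suc k))"
      have nz: "norm z = 1" "norm z' = 1" by (auto simp: z_def z'_def simp del: of_real_mult of_real_power)
      have "norm (complex_of_real (?w k) * z + complex_of_real (?w (Suc k)) * z') \<noteq> ?w k + ?w (Suc k)"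
      proof
        assume "norm (complex_of_real (?w k) * z + complex_of_real (?w (Suc k)) * z') = ?w k + ?w (Suc k)"
        then have "norm (complex_of_real (?w k) * z + complex_of_real (?w (Suc k)) * z') = norm (complex_of_real (?w k) * z) + norm (complex_of_real (?w (Suc k)) * z')"
          using w[of k] w[of "Suc k"] nz unfolding norm_mult norm_of_real by simp
        then have "norm (complex_of_real (?w k) * z) *\<^sub>R (complex_of_real (?w (Suc k)) * z') = norm (complex_of_real (?w (Suc k)) * z') *\<^sub>R (complex_of_real (?w k) * z)"
          by (simp only: norm_triangle_eq)
        then have "?w k *\<^sub>R (complex_of_real (?w (Suc k)) * z') = ?w (Suc k) *\<^sub>R (complex_of_real (?w k) * z)"
          using w[of k] w[of "Suc k"] nz unfolding norm_mult norm_of_real by simp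
        then have "complex_of_real (?w k * ?w (Suc k)) * z' = complex_of_real (?w k * ?w (Suc k)) * z"
          by (simp only: scaleR_conv_of_real of_real_mult mult_ac)
        moreover have "complex_of_real (?w k * ?w (Suc k)) \<noteq> 0"
          using mult_pos_pos[OF w[of k] w[of "Suc k"]] by (simp only: of_real_eq_0_iff)
        ultimately have "z' = z" using mult_left_cancel by blast
        then show False using ne by (simp only: z_def z'_def)
      qed
      moreover have "norm (complex_of_real (?w k) * z + complex_of_real (?w (Suc k)) * z') \<le> ?w k + ?w (Suc k)"
        using norm_triangle_ineq[of "complex_of_real (?w k) * z" "complex_of_real (?w (Suc k)) * z'"] w[of k] w[of "Suc k"] nz
        unfolding norm_mult norm_of_real by simp
      ultimately show ?thesis unfolding ftR z_def z'_def by linarith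
    qed
    have "f s = (\<Sum>j<k + 2. ft s j) + (\<Sum>j. ft s (j + (k + 2)))"
      unfolding f_eq using suminf_split_initial_segment[OF summable_ft(1)[of s], of "k + 2"] by simp
    also have "norm \<dots> \<le> norm (\<Sum>j<k + 2. ft s j) + norm (\<Sum>j. ft s (j + (k + 2)))" by (rule norm_triangle_ineq)
    also have "norm (\<Sum>j. ft s (j + (k + 2))) \<le> (\<Sum>j. ?w (j + (k + 2)))"
      by (rule summable_norm_le(3)[OF summable_sums[OF summable_ignore_initial_segment[OF sums_summable[OF sums_geo]]]]) (rule norm_ft)
    also have "(\<Sum>j<k + 2. ft s j) = (\<Sum>j<k. ft s j) + (ft s k + ft s (Suc k))" by simp
    also have "norm \<dots> \<le> norm (\<Sum>j<k. ft s j) + norm (ft s k + ft s (Suc k))" by (rule norm_triangle_ineq)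
    also have "norm (\<Sum>j<k. ft s j) \<le> (\<Sum>j<k. ?w j)" by (rule sum_norm_le) (rule norm_ft)
    also have "(\<Sum>j<k. ?w j) + norm (ft s k + ft s (Suc k)) + (\<Sum>j. ?w (j + (k + 2))) < (\<Sum>j<k. ?w j) + (?w k + ?w (Suc k)) + (\<Sum>j. ?w (j + (k + 2)))"
      using strict by simp
    also have "\<dots> = (\<Sum>j<k + 2. ?w j) + (\<Sum>j. ?w (j + (k + 2)))" by simp
    also have "\<dots> = 1"
      using suminf_split_initial_segment[OF sums_summable[OF sums_geo], of "k + 2"] sums_unique[OF sums_geo] by simp
    finally show False using f1 by simp
  qed
  \<comment> \<open>The phase difference for k = 0 in units of 2 pi; the later differences are c
    R^j.\<close>
  define c where "c = s * (R - 1) * R / (2 * pi)"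
  have Re_iexp: "Re (iexp x) = cos x" for x by (simp add: Re_exp)
  have "c * R ^ j \<in> \<int>" for j
  proof -
    have "iexp (s * R ^ Suc (Suc j) - s * R ^ Suc j) = 1"
      using phase[of j] by (simp add: exp_diff right_diff_distrib)
    then have "cos (s * R ^ Suc (Suc j) - s * R ^ Suc j) = 1" 
      using arg_cong[of _ _ Re] by (metis Re_iexp one_complex.sel(1))
    then obtain m :: int where "s * R ^ Suc (Suc j) - s * R ^ Suc j = of_int m * 2 * pi"
      using cos_one_2pi_int by auto
    moreover have "c * R ^ j * (2 * pi) = s * R ^ Suc (Suc j) - s * R ^ Suc j"
    proof -
      have c2: "c * (2 * pi) = s * (R - 1) * R" by (simp add: c_def)
      have "c * R ^ j * (2 * pi) = (c * (2 * pi)) * R ^ j" by (simp only: mult_ac)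
      also have "\<dots> = s * R ^ Suc (Suc j) - s * R ^ Suc j" unfolding c2 by (simp add: algebra_simps)
      finally show ?thesis .
    qed
    ultimately have "c * R ^ j * (2 * pi) = of_int m * (2 * pi)" by simp
    then have "c * R ^ j = of_int m" by simp
    then show ?thesis by simp
  qed
  moreover have "c \<noteq> 0" using s R by (simp add: c_def)
  ultimately have "R \<in> \<nat>" using R by (intro int_power_imp_Nat[of R c]) auto
  then show False using nl by (simp add: R_def)
qed

text \<open>Continuity on a compact set turns the pointwise strict bound into a uniform one, which
  makes n-th powers exponentially small on the intermediate range.\<close>

lemma norm_f_away_from_0:
  assumes nl: "1 / \<theta> \<notin> \<nat>" and e: "0 < \<epsilon>"
  obtains \<eta> where "0 < \<eta>" "\<eta> < 1" "\<And>s. \<epsilon> \<le> \<bar>s\<bar> \<Longrightarrow> \<bar>s\<bar> \<le> T \<Longrightarrow> norm (f s) \<le> \<eta>"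
proof -
  define S where "S = {s. \<epsilon> \<le> \<bar>s\<bar> \<and> \<bar>s\<bar> \<le> T}"
  have "S = cball 0 T - ball 0 \<epsilon>" by (auto simp: S_def)
  then have cS: "compact S" by (simp add: compact_diff)
  have cont: "continuous_on S (\<lambda>s. norm (f s))"
    by (intro continuous_intros continuous_at_imp_continuous_on ballI isCont_f)
  show ?thesis
  proof (cases "S = {}")
    case True
    then show ?thesis by (intro that[of "1/2"]) (auto simp: S_def)
  next
    case False
    obtain s0 where s0: "s0 \<in> S" "\<And>s. s \<in> S \<Longrightarrow> norm (f s) \<le> norm (f s0)"
      using continuous_attains_sup[OF cS False cont] by blast
    have "s0 \<noteq> 0" using s0(1) e by (auto simp: S_def)
    then have l: "norm (f s0) < 1" by (rule norm_f_less_1[OF _ nl])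
    show ?thesis
    proof (rule that[of "(1 + norm (f s0)) / 2"])
      fix s assume "\<epsilon> \<le> \<bar>s\<bar>" "\<bar>s\<bar> \<le> T"
      then have "norm (f s) \<le> norm (f s0)" by (intro s0) (simp add: S_def)
      then show "norm (f s) \<le> (1 + norm (f s0)) / 2" using l by simp
    qed (use l in \<open>auto simp: add_pos_nonneg\<close>)
  qed
qed

end

subsection \<open>Approximation of the distribution functions\<close>

context semistable
begin

text \<open>Uniformity in n is the point: multiplied by exp y, such a factor has an integral bounded
  independently of n.\<close>

definition poly_bounded :: "(nat \<Rightarrow> real \<Rightarrow> complex) \<Rightarrow> bool" where
  "poly_bounded Q \<longleftrightarrow> (\<exists>K\<ge>0. \<exists>k::nat. \<forall>n\<ge>1. \<forall>t. norm (Q n t) \<le> K * (1 + \<bar>t\<bar>) ^ k)"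

lemma poly_boundedI: "K \<ge> 0 \<Longrightarrow> (\<And>n t. n \<ge> 1 \<Longrightarrow> norm (Q n t) \<le> K * (1 + \<bar>t\<bar>) ^ k) \<Longrightarrow> poly_bounded Q"
  unfolding poly_bounded_def by blast

lemma poly_boundedE:
  assumes "poly_bounded Q"
  obtains K k where "K \<ge> 0" "\<And>n t. n \<ge> 1 \<Longrightarrow> norm (Q n t) \<le> K * (1 + \<bar>t\<bar>) ^ k"
  using assms unfolding poly_bounded_def by blast

lemma poly_bounded_add:
  assumes "poly_bounded Q" "poly_bounded Q'"
  shows "poly_bounded (\<lambda>n t. Q n t + Q' n t)"
proof -
  obtain K k where 1: "K \<ge> 0" "\<And>n t. n \<ge> 1 \<Longrightarrow> norm (Q n t) \<le> K * (1 + \<bar>t\<bar>) ^ k"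
    using assms(1) by (rule poly_boundedE) (rule that; assumption)
  obtain K' k' where 2: "K' \<ge> 0" "\<And>n t. n \<ge> 1 \<Longrightarrow> norm (Q' n t) \<le> K' * (1 + \<bar>t\<bar>) ^ k'"
    using assms(2) by (rule poly_boundedE) (rule that; assumption)
  show ?thesis
  proof (rule poly_boundedI)
    show "0 \<le> K + K'" using 1 2 by simp
    fix n :: nat and t :: real assume n: "n \<ge> 1"
    have "norm (Q n t + Q' n t) \<le> norm (Q n t) + norm (Q' n t)" by (rule norm_triangle_ineq)
    also have "\<dots> \<le> K * (1 + \<bar>t\<bar>) ^ (max k k') + K' * (1 + \<bar>t\<bar>) ^ (max k k')"
      by (intro add_mono order_trans[OF 1(2)[OF n]] order_trans[OF 2(2)[OF n]] mult_left_mono power_increasing 1 2) auto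
    finally show "norm (Q n t + Q' n t) \<le> (K + K') * (1 + \<bar>t\<bar>) ^ (max k k')" by (simp add: distrib_right)
  qed
qed

lemma poly_bounded_mult:
  assumes "poly_bounded Q" "poly_bounded Q'"
  shows "poly_bounded (\<lambda>n t. Q n t * Q' n t)"
proof -
  obtain K k where 1: "K \<ge> 0" "\<And>n t. n \<ge> 1 \<Longrightarrow> norm (Q n t) \<le> K * (1 + \<bar>t\<bar>) ^ k"
    using assms(1) by (rule poly_boundedE) (rule that; assumption)
  obtain K' k' where 2: "K' \<ge> 0" "\<And>n t. n \<ge> 1 \<Longrightarrow> norm (Q' n t) \<le> K' * (1 + \<bar>t\<bar>) ^ k'"
    using assms(2) by (rule poly_boundedE) (rule that; assumption)
  show ?thesis
  proof (rule poly_boundedI)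
    show "0 \<le> K * K'" using 1 2 by simp
    fix n :: nat and t :: real assume n: "n \<ge> 1"
    have "norm (Q n t * Q' n t) \<le> (K * (1 + \<bar>t\<bar>) ^ k) * (K' * (1 + \<bar>t\<bar>) ^ k')"
      unfolding norm_mult using 1(1) by (intro mult_mono 1(2) 2(2) n) auto
    also have "\<dots> = (K * K') * (1 + \<bar>t\<bar>) ^ (k + k')" by (simp only: power_add mult_ac)
    finally show "norm (Q n t * Q' n t) \<le> (K * K') * (1 + \<bar>t\<bar>) ^ (k + k')" .
  qed
qed

lemma poly_bounded_bounded: "0 \<le> K \<Longrightarrow> (\<And>n. n \<ge> 1 \<Longrightarrow> norm (a n) \<le> K) \<Longrightarrow> poly_bounded (\<lambda>n t. a n)"
  by (rule poly_boundedI[of K _ 0]) auto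

lemma poly_bounded_power: "poly_bounded Q \<Longrightarrow> poly_bounded (\<lambda>n t. Q n t ^ k)"
  by (induction k) (auto intro!: poly_bounded_mult poly_bounded_bounded[of 1])

lemma poly_bounded_sum: "finite I \<Longrightarrow> (\<And>i. i \<in> I \<Longrightarrow> poly_bounded (Q i)) \<Longrightarrow> poly_bounded (\<lambda>n t. \<Sum>i\<in>I. Q i n t)"
  by (induction I rule: finite_induct) (auto intro!: poly_bounded_add poly_bounded_bounded[of 0])

lemma poly_bounded_yn: "poly_bounded yn"
proof (rule poly_boundedI[of CY _ 2])
  fix n :: nat and t :: real assume "n \<ge> 1"
  then have "norm (yn n t) \<le> CY * \<bar>t\<bar> powr \<alpha>" by (rule norm_yn)
  also have "\<dots> \<le> CY * (1 + \<bar>t\<bar>) ^ 2"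
    using CY_pos \<alpha> by (intro mult_left_mono powr_le_power_1_plus) auto
  finally show "norm (yn n t) \<le> CY * (1 + \<bar>t\<bar>) ^ 2" .
qed (use CY_pos in simp)

lemma powr_nonpos_le_1: "n \<ge> 1 \<Longrightarrow> a \<ge> 0 \<Longrightarrow> real n powr (- a) \<le> 1"
  using powr_mono[of "- a" 0 "real n"] by simp

lemma poly_bounded_n_dl: "poly_bounded (\<lambda>n t. of_nat n * dl (t / NN n))"
proof (rule poly_boundedI[of "\<bar>m1\<bar> * CY" _ 3])
  fix n :: nat and t :: real assume n: "n \<ge> 1"
  have "norm (of_nat n * dl (t / NN n)) \<le> (\<bar>m1\<bar> * CY) * real n powr (- (1 / \<alpha>)) * \<bar>t\<bar> powr (1 + \<alpha>)"
    by (rule norm_n_dl[OF n])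
  also have "\<dots> \<le> (\<bar>m1\<bar> * CY) * 1 * (1 + \<bar>t\<bar>) ^ 3"
    using CY_pos \<alpha> n by (intro mult_mono powr_nonpos_le_1 powr_le_power_1_plus) auto
  finally show "norm (of_nat n * dl (t / NN n)) \<le> \<bar>m1\<bar> * CY * (1 + \<bar>t\<bar>) ^ 3" by simp
qed (use CY_pos in simp)

lemma poly_bounded_edgeworth: "poly_bounded (edgeworth L)"
proof (cases "\<alpha> < 1")
  case True
  have c: "poly_bounded (\<lambda>n t. complex_of_real (w \<alpha> p m 0 j / (fact m * real n ^ j)))" for m j
  proof (rule poly_bounded_bounded[of "\<bar>w \<alpha> p m 0 j\<bar>"])
    fix n :: nat assume "n \<ge> 1"
    then have "1 * 1 \<le> fact m * real n ^ j" by (intro mult_mono fact_ge_1 one_le_power) auto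
    then have "\<bar>w \<alpha> p m 0 j\<bar> / (fact m * real n ^ j) \<le> \<bar>w \<alpha> p m 0 j\<bar> / 1" by (intro divide_left_mono) auto
    then show "norm (complex_of_real (w \<alpha> p m 0 j / (fact m * real n ^ j))) \<le> \<bar>w \<alpha> p m 0 j\<bar>"
      unfolding norm_of_real abs_divide by (simp add: abs_mult)
  qed simp
  have "poly_bounded (\<lambda>n t. 1 + (\<Sum>j=1..L. \<Sum>m=1..j. complex_of_real (w \<alpha> p m 0 j / (fact m * real n ^ j)) * yn n t ^ (j + m)))"
    by (intro poly_bounded_add poly_bounded_sum poly_bounded_mult c poly_bounded_power poly_bounded_yn poly_bounded_bounded[of 1]) auto
  then show ?thesis using True by (simp add: edgeworth_def[abs_def])
next
  case False
  have "poly_bounded (\<lambda>n t. complex_of_real (sg * t\<^sup>2 * real n powr (- ((2 - \<alpha>) / \<alpha>))))"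
  proof (rule poly_boundedI[of sg _ 2])
    fix n :: nat and t :: real assume n: "n \<ge> 1"
    have "norm (complex_of_real (sg * t\<^sup>2 * real n powr (- ((2 - \<alpha>) / \<alpha>)))) = sg * t\<^sup>2 * real n powr (- ((2 - \<alpha>) / \<alpha>))"
      unfolding norm_of_real using sg_pos by (simp add: abs_mult)
    also have "\<dots> \<le> (sg * (1 + \<bar>t\<bar>) ^ 2) * 1"
      using sg_pos \<alpha> n by (intro mult_mono mult_left_mono powr_nonpos_le_1) (auto simp: power2_sum)
    finally show "norm (complex_of_real (sg * t\<^sup>2 * real n powr (- ((2 - \<alpha>) / \<alpha>)))) \<le> sg * (1 + \<bar>t\<bar>) ^ 2" by simp
  qed (use sg_pos in simp)
  then have "poly_bounded (\<lambda>n t. \<Sum>j\<le>L. (complex_of_real (sg * t\<^sup>2 * real n powr (- ((2 - \<alpha>) / \<alpha>)))) ^ j * (1 / fact j))"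
    by (intro poly_bounded_sum poly_bounded_mult poly_bounded_power poly_bounded_bounded[of 1]) (auto simp: norm_divide fact_ge_1)
  then show ?thesis using False by (simp add: edgeworth_def[abs_def])
qed

text \<open>The stretched exponential decay of exp y beats every polynomial; the exponent 2 suffices
  for integrability and for the tail beyond the local range.\<close>

lemma poly_bounded_decay:
  assumes "poly_bounded Q"
  obtains K where "K \<ge> 0" "\<And>n t. n \<ge> 1 \<Longrightarrow> norm (exp (yn n t) * Q n t) \<le> K / (1 + \<bar>t\<bar>) ^ 2"
proof -
  obtain K k where 1: "K \<ge> 0" "\<And>n t. n \<ge> 1 \<Longrightarrow> norm (Q n t) \<le> K * (1 + \<bar>t\<bar>) ^ k"
    using assms by (rule poly_boundedE) (rule that; assumption)
  obtain K' where 2: "K' > 0" "\<And>t. (1 + \<bar>t\<bar>) ^ (k + 2) * exp (- cY * \<bar>t\<bar> powr \<alpha>) \<le> K'"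
    using power_exp_neg_powr_bounded[OF \<alpha>(1) cY_pos] by metis
  show ?thesis
  proof (rule that[of "K * K'"])
    fix n :: nat and t :: real assume n: "n \<ge> 1"
    have "norm (exp (yn n t) * Q n t) \<le> exp (- cY * \<bar>t\<bar> powr \<alpha>) * (K * (1 + \<bar>t\<bar>) ^ k)"
      unfolding norm_mult by (intro mult_mono norm_exp_yn 1(2) n) auto
    also have "\<dots> = K * ((1 + \<bar>t\<bar>) ^ (k + 2) * exp (- cY * \<bar>t\<bar> powr \<alpha>)) / (1 + \<bar>t\<bar>) ^ 2"
    proof -
      have "(1 + \<bar>t\<bar>) ^ 2 \<noteq> 0" by (simp add: add_nonneg_eq_0_iff)
      then show ?thesis unfolding power_add by simp
    qed
    also have "\<dots> \<le> K * K' / (1 + \<bar>t\<bar>) ^ 2" by (intro divide_right_mono mult_left_mono 2 1) auto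
    finally show "norm (exp (yn n t) * Q n t) \<le> K * K' / (1 + \<bar>t\<bar>) ^ 2" .
  qed (use 1 2 in simp)
qed

text \<open>Linear combinations of functions correspond to linear combinations of transforms; what
  remains is to recognize \<open>edgeworth\<close>.\<close>

lemma bv_char_Gt:
  assumes n: "n \<ge> 1"
  shows "bv_char (Gt \<alpha> p L n) (\<lambda>t. exp (yn n t) * edgeworth L n t)"
proof (cases "\<alpha> < 1")
  case True
  have "bv_char (\<lambda>x. G \<alpha> p (gam p n) x + (\<Sum>j=1..L. \<Sum>m=1..j. (w \<alpha> p m 0 j / (fact m * real n ^ j)) * Gkj 0 (j + m) \<alpha> p (gam p n) x))
    (\<lambda>t. exp (yn n t) + (\<Sum>j=1..L. \<Sum>m=1..j. complex_of_real (w \<alpha> p m 0 j / (fact m * real n ^ j)) * ((- \<i> * complex_of_real t) ^ 0 * yn n t ^ (j + m) * exp (yn n t))))"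
    by (intro bv_char_add bv_char_G n bv_char_sum bv_char_scale bv_char_Gkj) auto
  also have "(\<lambda>x. G \<alpha> p (gam p n) x + (\<Sum>j=1..L. \<Sum>m=1..j. (w \<alpha> p m 0 j / (fact m * real n ^ j)) * Gkj 0 (j + m) \<alpha> p (gam p n) x)) = Gt \<alpha> p L n"
    using True by (intro ext) (simp add: Gt_def)
  also have "(\<lambda>t. exp (yn n t) + (\<Sum>j=1..L. \<Sum>m=1..j. complex_of_real (w \<alpha> p m 0 j / (fact m * real n ^ j)) * ((- \<i> * complex_of_real t) ^ 0 * yn n t ^ (j + m) * exp (yn n t)))) =
    (\<lambda>t. exp (yn n t) * edgeworth L n t)"
  proof
    fix t
    have "(\<Sum>j=1..L. \<Sum>m=1..j. complex_of_real (w \<alpha> p m 0 j / (fact m * real n ^ j)) * ((- \<i> * complex_of_real t) ^ 0 * yn n t ^ (j + m) * exp (yn n t)))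
      = exp (yn n t) * (\<Sum>j=1..L. \<Sum>m=1..j. complex_of_real (w \<alpha> p m 0 j / (fact m * real n ^ j)) * yn n t ^ (j + m))"
      unfolding sum_distrib_left by (intro sum.cong refl) simp
    then show "exp (yn n t) + (\<Sum>j=1..L. \<Sum>m=1..j. complex_of_real (w \<alpha> p m 0 j / (fact m * real n ^ j)) * ((- \<i> * complex_of_real t) ^ 0 * yn n t ^ (j + m) * exp (yn n t))) =
       exp (yn n t) * edgeworth L n t"
      using True by (simp add: edgeworth_def distrib_left)
  qed
  finally show ?thesis .
next
  case False
  define c where "c j = (-1) ^ j * (2 * sg) ^ j / (fact j * 2 ^ j * real n powr (real j * (2 - \<alpha>) / \<alpha>))" for j :: nat
  define u where "u t = complex_of_real (sg * t\<^sup>2 * real n powr (- ((2 - \<alpha>) / \<alpha>)))" for t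
  have "bv_char (\<lambda>x. G \<alpha> p (gam p n) x + (\<Sum>j=1..L. c j * Gkj (2 * j) 0 \<alpha> p (gam p n) x))
    (\<lambda>t. exp (yn n t) + (\<Sum>j=1..L. complex_of_real (c j) * ((- \<i> * complex_of_real t) ^ (2 * j) * yn n t ^ 0 * exp (yn n t))))"
    by (intro bv_char_add bv_char_G n bv_char_sum bv_char_scale bv_char_Gkj) auto
  also have "(\<lambda>x. G \<alpha> p (gam p n) x + (\<Sum>j=1..L. c j * Gkj (2 * j) 0 \<alpha> p (gam p n) x)) = Gt \<alpha> p L n"
  proof
    fix x
    have "2 * sg = (mu \<alpha> p 1)\<^sup>2 - mu \<alpha> p 2" by (simp add: sg_def mu_eq)
    then show "G \<alpha> p (gam p n) x + (\<Sum>j=1..L. c j * Gkj (2 * j) 0 \<alpha> p (gam p n) x) = Gt \<alpha> p L n x"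
      using False unfolding Gt_def c_def by simp
  qed
  also have "(\<lambda>t. exp (yn n t) + (\<Sum>j=1..L. complex_of_real (c j) * ((- \<i> * complex_of_real t) ^ (2 * j) * yn n t ^ 0 * exp (yn n t)))) =
    (\<lambda>t. exp (yn n t) * edgeworth L n t)"
  proof
    fix t
    \<comment> \<open>The factor (-1)^j in \<open>Gt\<close> cancels the sign of the 2j-th power of
      -i t, leaving a power of the positive \<open>sg\<close>.\<close>
    have cj: "complex_of_real (c j) * (- \<i> * complex_of_real t) ^ (2 * j) = u t ^ j / fact j" for j
    proof -
      have "(- \<i> * complex_of_real t) ^ (2 * j) = complex_of_real ((-1) ^ j * (t\<^sup>2) ^ j)"
      proof -
        have "(- \<i> * complex_of_real t)\<^sup>2 = complex_of_real ((-1) * t\<^sup>2)" by (simp add: power_mult_distrib)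
        then show ?thesis unfolding power_mult by (simp only: of_real_power[symmetric] power_mult_distrib)
      qed
      moreover have "c j * ((-1) ^ j * (t\<^sup>2) ^ j) = (sg * t\<^sup>2 * real n powr (- ((2 - \<alpha>) / \<alpha>))) ^ j / fact j"
      proof -
        have e: "(real n powr (- ((2 - \<alpha>) / \<alpha>))) ^ j = 1 / real n powr (real j * (2 - \<alpha>) / \<alpha>)"
        proof -
          have "(real n powr (- ((2 - \<alpha>) / \<alpha>))) ^ j = (real n powr (- ((2 - \<alpha>) / \<alpha>))) powr real j"
            by (rule powr_realpow[symmetric]) (use n in simp)
          also have "\<dots> = real n powr (- ((2 - \<alpha>) / \<alpha>) * real j)" by (rule powr_powr)
          also have "- ((2 - \<alpha>) / \<alpha>) * real j = - (real j * (2 - \<alpha>) / \<alpha>)" by simp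
          also have "real n powr (- (real j * (2 - \<alpha>) / \<alpha>)) = 1 / real n powr (real j * (2 - \<alpha>) / \<alpha>)"
            by (rule powr_minus_divide)
          finally show ?thesis .
        qed
        have m: "((-1::real) ^ j) * ((-1) ^ j) = 1" by (simp flip: power_mult_distrib)
        have "c j * ((-1) ^ j * (t\<^sup>2) ^ j) = (((-1) ^ j) * ((-1) ^ j)) * (sg ^ j * (t\<^sup>2) ^ j / (fact j * real n powr (real j * (2 - \<alpha>) / \<alpha>)))"
          unfolding c_def power_mult_distrib by simp
        then show ?thesis unfolding m power_mult_distrib e by simp
      qed
      ultimately show ?thesis unfolding u_def
        by (metis (no_types, lifting) of_real_divide of_real_fact of_real_mult of_real_power)
    qed
    have "(\<Sum>j=1..L. complex_of_real (c j) * ((- \<i> * complex_of_real t) ^ (2 * j) * yn n t ^ 0 * exp (yn n t)))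
       = exp (yn n t) * (\<Sum>j=1..L. u t ^ j / fact j)"
      unfolding sum_distrib_left cj[symmetric] by (intro sum.cong refl) simp
    moreover have "{..L} = insert 0 {1..L}" by auto
    then have "edgeworth L n t = 1 + (\<Sum>j=1..L. u t ^ j / fact j)"
      using False unfolding edgeworth_def u_def by simp
    ultimately show "exp (yn n t) + (\<Sum>j=1..L. complex_of_real (c j) * ((- \<i> * complex_of_real t) ^ (2 * j) * yn n t ^ 0 * exp (yn n t))) = exp (yn n t) * edgeworth L n t"
      by (simp only: distrib_left mult_1_right)
  qed
  finally show ?thesis .
qed

text \<open>The added function has transform n \<open>dl\<close> (t / n powr (1/\<alpha>)) times exp
  y: the linear term of the expansion with A^n replaced by exp y.\<close>

lemma bv_char_Gtt:
  assumes n: "n \<ge> 1"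
  shows "bv_char (Gtt \<alpha> p L n) (\<lambda>t. exp (yn n t) * (edgeworth L n t + of_nat n * dl (t / NN n)))"
proof -
  have "bv_char (\<lambda>x. Gt \<alpha> p L n x + (m1 / NN n) * Gkj 1 1 \<alpha> p (gam p n) x)
     (\<lambda>t. exp (yn n t) * edgeworth L n t + complex_of_real (m1 / NN n) * ((- \<i> * complex_of_real t) ^ 1 * yn n t ^ 1 * exp (yn n t)))"
    by (intro bv_char_add bv_char_Gt n bv_char_scale bv_char_Gkj)
  also have "(\<lambda>x. Gt \<alpha> p L n x + (m1 / NN n) * Gkj 1 1 \<alpha> p (gam p n) x) = Gtt \<alpha> p L n"
    by (intro ext) (simp add: Gtt_def mu_eq NN_def)
  also have "(\<lambda>t. exp (yn n t) * edgeworth L n t + complex_of_real (m1 / NN n) * ((- \<i> * complex_of_real t) ^ 1 * yn n t ^ 1 * exp (yn n t))) =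
     (\<lambda>t. exp (yn n t) * (edgeworth L n t + of_nat n * dl (t / NN n)))"
    by (intro ext) (simp add: dl_def yn_eq distrib_left right_diff_distrib mult_ac)
  finally show ?thesis .
qed

end

section \<open>From transforms to distribution functions\<close>

lemma integrable_abs_powr_near_0:
  fixes a :: real
  assumes a: "a > -1"
  shows "integrable lborel (\<lambda>t. indicator {-1..1} t * \<bar>t\<bar> powr a)"
proof -
  have pos: "integrable lborel (\<lambda>t. indicator {0..1} t * t powr a)"
  proof (rule integrableI_nonneg)
    have "((\<lambda>x. x powr a) has_integral (1 powr (a + 1) / (a + 1))) {0..1}"
      by (rule has_integral_powr_from_0) (use a in auto)
    then have "((\<lambda>x. if x \<in> {0..1} then x powr a else 0) has_integral (1 powr (a + 1) / (a + 1))) UNIV"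
      by (simp only: has_integral_restrict_UNIV)
    moreover have "(\<lambda>x. if x \<in> {0..1} then x powr a else 0) = (\<lambda>t. indicator {0..1} t * t powr a)"
      by (auto simp: indicator_def fun_eq_iff)
    ultimately have hi: "((\<lambda>t. indicator {0..1} t * t powr a) has_integral (1 powr (a + 1) / (a + 1))) UNIV" by simp
    have "(\<integral>\<^sup>+t. ennreal (indicator {0..1} t * t powr a) \<partial>lborel) = ennreal (1 powr (a + 1) / (a + 1))"
      by (rule nn_integral_has_integral_lborel[OF _ _ hi]) auto
    then show "(\<integral>\<^sup>+t. ennreal (indicator {0..1} t * t powr a) \<partial>lborel) < \<infinity>" by simp
  qed auto
  have neg: "integrable lborel (\<lambda>t. indicator {0..1} (-t) * (-t) powr a)"
    using lborel_integrable_real_affine[OF pos, of "-1" 0] by simp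
  show ?thesis
  proof (rule Bochner_Integration.integrable_bound[OF Bochner_Integration.integrable_add[OF pos neg]])
    show "AE t in lborel. norm (indicator {-1..1} t * \<bar>t\<bar> powr a) \<le> norm (indicator {0..1} t * t powr a + indicator {0..1} (-t) * (-t) powr a)"
      by (intro AE_I2) (auto simp: indicator_def abs_if)
  qed measurable
qed

context semistable
begin

text \<open>Integrable majorant left after dividing a remainder by \<bar>t\<bar>: the factor
  \<bar>t\<bar> powr \<alpha> governs the origin, the stretched exponential the tails.\<close>

definition \<psi> :: "real \<Rightarrow> real" where
  "\<psi> t = indicator {-1..1} t * \<bar>t\<bar> powr (\<alpha> - 1) + 1 / (1 + t\<^sup>2)"

lemma integrable_\<psi>: "integrable lborel \<psi>"
  unfolding \<psi>_def using \<alpha>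
  by (intro Bochner_Integration.integrable_add integrable_abs_powr_near_0 integrable_inverse_1_plus_square_lborel) simp

lemma \<psi>_nonneg: "\<psi> t \<ge> 0" by (simp add: \<psi>_def)

lemma rbound_\<psi>:
  assumes "rbound \<eta> R"
  obtains \<epsilon> C where "\<epsilon> > 0" "C \<ge> 0"
    "\<And>n t. n \<ge> 4 \<Longrightarrow> \<bar>t\<bar> \<le> \<epsilon> * NN n \<Longrightarrow> norm (R n t) \<le> \<bar>t\<bar> * (C * real n powr (- \<eta>) * \<psi> t)"
proof -
  from assms obtain \<epsilon> C c k where R: "\<epsilon> > 0" "C \<ge> 0" "c > 0"
    "\<And>n t. n \<ge> 4 \<Longrightarrow> \<bar>t\<bar> \<le> \<epsilon> * NN n \<Longrightarrow>
     norm (R n t) \<le> C * real n powr (- \<eta>) * (\<bar>t\<bar> powr \<alpha> * (1 + \<bar>t\<bar>) ^ k * exp (- c * \<bar>t\<bar> powr \<alpha>))"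
    by (rule rboundE) (rule that; assumption)
  \<comment> \<open>Four extra powers: two dominate \<bar>t\<bar> powr \<alpha>, two provide the
    decay 1/t^2.\<close>
  obtain K where K: "K > 0" "\<And>t. (1 + \<bar>t\<bar>) ^ (k + 4) * exp (- c * \<bar>t\<bar> powr \<alpha>) \<le> K"
    by (rule power_exp_neg_powr_bounded[OF \<alpha>(1) R(3), of "k + 4"]) (rule that; assumption)
  have bound: "\<bar>t\<bar> powr \<alpha> * (1 + \<bar>t\<bar>) ^ k * exp (- c * \<bar>t\<bar> powr \<alpha>) \<le> \<bar>t\<bar> * (2 * K * \<psi> t)" for t
  proof -
    define T where "T = 1 + \<bar>t\<bar>"
    define E where "E = exp (- c * \<bar>t\<bar> powr \<alpha>)"
    have T: "T \<ge> 1" "\<bar>t\<bar> \<le> T" by (auto simp: T_def)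
    have E: "E > 0" by (simp add: E_def)
    have K': "T ^ (k + 4) * E \<le> K" unfolding T_def E_def by (rule K(2))
    show ?thesis
    proof (cases "\<bar>t\<bar> \<le> 1")
      case True
      have "T ^ k * E \<le> T ^ (k + 4) * E" using T E by (intro mult_right_mono power_increasing) auto
      then have "T ^ k * E \<le> K" using K' by linarith
      then have "\<bar>t\<bar> powr \<alpha> * (T ^ k * E) \<le> \<bar>t\<bar> powr \<alpha> * (2 * K)" using K(1) by (intro mult_left_mono) auto
      also have "\<bar>t\<bar> powr \<alpha> = \<bar>t\<bar> * \<bar>t\<bar> powr (\<alpha> - 1)" by (cases "t = 0") (simp_all add: powr_diff)
      also have "(\<bar>t\<bar> * \<bar>t\<bar> powr (\<alpha> - 1)) * (2 * K) = \<bar>t\<bar> * (2 * K * \<bar>t\<bar> powr (\<alpha> - 1))" by (simp only: mult_ac)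
      also have "\<dots> \<le> \<bar>t\<bar> * (2 * K * \<psi> t)"
        using True K(1) by (intro mult_left_mono) (auto simp: \<psi>_def indicator_def abs_le_iff)
      finally have "(\<bar>t\<bar> * \<bar>t\<bar> powr (\<alpha> - 1)) * (T ^ k * E) \<le> \<bar>t\<bar> * (2 * K * \<psi> t)" .
      moreover have "\<bar>t\<bar> powr \<alpha> = \<bar>t\<bar> * \<bar>t\<bar> powr (\<alpha> - 1)" by (cases "t = 0") (simp_all add: powr_diff)
      ultimately show ?thesis unfolding T_def[symmetric] E_def[symmetric] by (simp only: mult.assoc)
    next
      case False
      have t2: "1 \<le> t\<^sup>2" using False one_le_power[of "\<bar>t\<bar>" 2] by simp
      have ta: "\<bar>t\<bar> powr \<alpha> \<le> T ^ 2" unfolding T_def using \<alpha> by (intro powr_le_power_1_plus) auto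
      have "(\<bar>t\<bar> powr \<alpha> * T ^ k * E) * t\<^sup>2 \<le> (T ^ 2 * T ^ k * E) * T ^ 2"
        using ta E T abs_le_square_iff[of t T] by (intro mult_mono mult_right_mono) auto
      also have "\<dots> = T ^ (k + 4) * E" by (simp add: power_add mult_ac power4_eq_xxxx power2_eq_square)
      also have "\<dots> \<le> K" by (rule K')
      finally have fin: "(\<bar>t\<bar> powr \<alpha> * T ^ k * E) * t\<^sup>2 \<le> K" .
      have "\<bar>t\<bar> powr \<alpha> * T ^ k * E \<le> K / t\<^sup>2"
      proof -
        have "0 < t\<^sup>2" using t2 by linarith
        then show ?thesis using fin by (simp only: pos_le_divide_eq)
      qed
      also have "\<dots> \<le> \<bar>t\<bar> * (2 * K * (1 / (1 + t\<^sup>2)))"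
      proof -
        have "1 / t\<^sup>2 \<le> \<bar>t\<bar> * (2 * (1 / (1 + t\<^sup>2)))"
        proof -
          have "1 + t\<^sup>2 \<le> 2 * t\<^sup>2" using t2 by simp
          also have "\<dots> \<le> \<bar>t\<bar> * (2 * t\<^sup>2)" using False mult_right_mono[of 1 "\<bar>t\<bar>" "2 * t\<^sup>2"] by simp
          finally have b: "1 + t\<^sup>2 \<le> \<bar>t\<bar> * (2 * t\<^sup>2)" .
          have pos: "0 < t\<^sup>2" "0 < 1 + t\<^sup>2" using t2 by linarith+
          have "1 / t\<^sup>2 = (1 + t\<^sup>2) / (t\<^sup>2 * (1 + t\<^sup>2))" using pos by simp
          also have "\<dots> \<le> (\<bar>t\<bar> * (2 * t\<^sup>2)) / (t\<^sup>2 * (1 + t\<^sup>2))" using b pos by (intro divide_right_mono) auto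
          also have "\<dots> = \<bar>t\<bar> * (2 * (1 / (1 + t\<^sup>2)))" using pos by simp
          finally show ?thesis .
        qed
        then have "K * (1 / t\<^sup>2) \<le> K * (\<bar>t\<bar> * (2 * (1 / (1 + t\<^sup>2))))" using K(1) by (intro mult_left_mono) auto
        then show ?thesis by (simp add: mult_ac)
      qed
      also have "\<dots> \<le> \<bar>t\<bar> * (2 * K * \<psi> t)"
        using K(1) by (intro mult_left_mono) (auto simp: \<psi>_def)
      finally show ?thesis unfolding T_def E_def .
    qed
  qed
  show ?thesis
  proof (rule that[of \<epsilon> "C * (2 * K)"])
    fix n :: nat and t :: real assume n: "n \<ge> 4" "\<bar>t\<bar> \<le> \<epsilon> * NN n"
    have "norm (R n t) \<le> C * real n powr (- \<eta>) * (\<bar>t\<bar> powr \<alpha> * (1 + \<bar>t\<bar>) ^ k * exp (- c * \<bar>t\<bar> powr \<alpha>))"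
      by (rule R(4)[OF n])
    also have "\<dots> \<le> C * real n powr (- \<eta>) * (\<bar>t\<bar> * (2 * K * \<psi> t))"
      using R(2) by (intro mult_left_mono bound) auto
    finally show "norm (R n t) \<le> \<bar>t\<bar> * (C * (2 * K) * real n powr (- \<eta>) * \<psi> t)" by (simp only: mult_ac)
  qed (use R K in auto)
qed

text \<open>Smoothing at the cutoff D n powr (1/\<alpha>). The inner range is controlled by the
  remainder bound, the intermediate range by an assumed bound \<kappa>, and the smoothing error is
  of order 1/D. The constants are fixed before D, which may therefore be chosen afterwards.\<close>

lemma approximation_core:
  fixes F P :: "nat \<Rightarrow> real \<Rightarrow> real"
  assumes Q: "poly_bounded Q"
    and F: "\<And>n. n \<ge> 4 \<Longrightarrow> bv_char (F n) (\<lambda>t. exp (yn n t) * Q n t)"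
    and P: "\<And>n. n \<ge> 4 \<Longrightarrow> bv_char (P n) (\<lambda>t. hc (t / NN n) ^ n)" "\<And>n. n \<ge> 4 \<Longrightarrow> mono (P n)"
    and R: "rbound \<eta> (\<lambda>n t. hc (t / NN n) ^ n - exp (yn n t) * Q n t)"
  obtains \<epsilon> C1 C2 where "\<epsilon> > 0" "C1 \<ge> 0" "C2 \<ge> 0"
    "\<And>n D \<kappa> x. n \<ge> 4 \<Longrightarrow> D \<ge> \<epsilon> \<Longrightarrow> \<kappa> \<ge> 0 \<Longrightarrow>
       (\<And>t. \<epsilon> * NN n < \<bar>t\<bar> \<Longrightarrow> \<bar>t\<bar> \<le> D * NN n \<Longrightarrow> norm (hc (t / NN n) ^ n - exp (yn n t) * Q n t) \<le> \<bar>t\<bar> * \<kappa>) \<Longrightarrow>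
       \<bar>P n x - F n x\<bar> \<le> C1 * real n powr (- \<eta>) + 2 * D * NN n * \<kappa> + C2 / (D * NN n)"
proof -
  obtain C0 where C0: "C0 > 0" "\<And>D h T m B x. \<lbrakk>bv_char D h; T > 0; m \<ge> 0;
     \<And>x s. 0 \<le> s \<Longrightarrow> D (x + s) \<ge> D x - m * s;
     integrable lborel B; \<And>t. 0 \<le> B t; \<And>t. \<bar>t\<bar> \<le> T \<Longrightarrow> norm (h t) \<le> \<bar>t\<bar> * B t\<rbrakk>
    \<Longrightarrow> \<bar>D x\<bar> \<le> (\<integral>t. B t \<partial>lborel) + C0 * m / T"
    using Esseen_inequality by blast
  obtain \<epsilon> C where e: "\<epsilon> > 0" "C \<ge> 0"
    "\<And>n t. n \<ge> 4 \<Longrightarrow> \<bar>t\<bar> \<le> \<epsilon> * NN n \<Longrightarrow> norm (hc (t / NN n) ^ n - exp (yn n t) * Q n t) \<le> \<bar>t\<bar> * (C * real n powr (- \<eta>) * \<psi> t)"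
    by (rule rbound_\<psi>[OF R]) (rule that; assumption)
  obtain K where K: "K \<ge> 0" "\<And>n t. n \<ge> 1 \<Longrightarrow> norm (exp (yn n t) * Q n t) \<le> K / (1 + \<bar>t\<bar>) ^ 2"
    by (rule poly_bounded_decay[OF Q]) (rule that; assumption)
  define I where "I = (\<integral>t. 1 / (1 + t\<^sup>2) \<partial>(lborel :: real measure))"
  \<comment> \<open>A Lipschitz constant of \<open>F n\<close> valid for all n \<ge> 4, from the
    uniform integrable bound of its transform.\<close>
  define m where "m = (1 / (2 * pi)) * (K * I)"
  have I0: "I \<ge> 0" unfolding I_def by (rule Bochner_Integration.integral_nonneg) simp
  have m0: "m \<ge> 0" using K(1) I0 by (simp add: m_def)
  have lip: "\<bar>F n b - F n a\<bar> \<le> (b - a) * m" if n: "n \<ge> 4" and ab: "a \<le> b" for n a b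
  proof -
    have kb: "norm (exp (yn n t) * Q n t) \<le> K * (1 / (1 + t\<^sup>2))" for t
    proof -
      have "norm (exp (yn n t) * Q n t) \<le> K / (1 + \<bar>t\<bar>) ^ 2" using n by (intro K) simp
      also have "\<dots> \<le> K / (1 + t\<^sup>2)"
        using K(1) by (intro divide_left_mono) (auto simp: power2_sum add_pos_nonneg intro!: mult_pos_pos)
      finally show ?thesis by simp
    qed
    have iK: "integrable lborel (\<lambda>t::real. K * (1 / (1 + t\<^sup>2)))"
      by (intro integrable_mult_right integrable_inverse_1_plus_square_lborel)
    note [measurable] = bv_char_measurable[OF F[OF n]]
    have ih: "integrable lborel (\<lambda>t. norm (exp (yn n t) * Q n t))"
    proof (rule Bochner_Integration.integrable_bound[OF iK])
      show "AE t in lborel. norm (norm (exp (yn n t) * Q n t)) \<le> norm (K * (1 / (1 + t\<^sup>2)))"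
        using order_trans[OF kb abs_ge_self] by (intro AE_I2) (simp only: real_norm_def abs_norm_cancel)
    qed measurable
    have "\<bar>F n b - F n a\<bar> \<le> (b - a) * ((1 / (2 * pi)) * (\<integral>t. norm (exp (yn n t) * Q n t) \<partial>lborel))"
      by (rule bv_char_lipschitz[OF F[OF n] ih ab])
    also have "\<dots> \<le> (b - a) * m"
    proof -
      have "(\<integral>t. norm (exp (yn n t) * Q n t) \<partial>lborel) \<le> (\<integral>t. K * (1 / (1 + t\<^sup>2)) \<partial>lborel)"
        by (rule integral_mono[OF ih iK]) (rule kb)
      also have "\<dots> = K * I" unfolding I_def by (rule integral_mult_right_zero)
      finally show ?thesis using ab unfolding m_def by (intro mult_left_mono) auto
    qed
    finally show ?thesis .
  qed
  define J where "J = (\<integral>t. \<psi> t \<partial>lborel)"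
  have J0: "J \<ge> 0" unfolding J_def by (rule Bochner_Integration.integral_nonneg) (rule \<psi>_nonneg)
  show ?thesis
  proof (rule that[of \<epsilon> "C * J" "C0 * m"])
    fix n :: nat and D \<kappa> x :: real
    assume n: "n \<ge> 4" and D: "D \<ge> \<epsilon>" and \<kappa>: "\<kappa> \<ge> 0"
      and outer: "\<And>t. \<epsilon> * NN n < \<bar>t\<bar> \<Longrightarrow> \<bar>t\<bar> \<le> D * NN n \<Longrightarrow> norm (hc (t / NN n) ^ n - exp (yn n t) * Q n t) \<le> \<bar>t\<bar> * \<kappa>"
    have N: "NN n > 0" using n by (intro NN_pos) simp
    define T where "T = D * NN n"
    have T: "T > 0" using N D e(1) by (simp add: T_def)
    define B where "B t = C * real n powr (- \<eta>) * \<psi> t + \<kappa> * indicator {-T..T} t" for t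
    have i1: "integrable lborel (\<lambda>t. C * real n powr (- \<eta>) * \<psi> t)" by (intro integrable_mult_right integrable_\<psi>)
    have i2: "integrable lborel (\<lambda>t. \<kappa> * indicator {-T..T} t)"
      by (intro integrable_mult_right integrable_real_indicator) (auto simp: emeasure_lborel_Icc_eq)
    have iB: "integrable lborel B" unfolding B_def by (rule Bochner_Integration.integrable_add[OF i1 i2])
    have intB: "(\<integral>t. B t \<partial>lborel) = C * real n powr (- \<eta>) * J + \<kappa> * (2 * T)"
    proof -
      have "(\<integral>t. B t \<partial>lborel) = (\<integral>t. C * real n powr (- \<eta>) * \<psi> t \<partial>lborel) + (\<integral>t. \<kappa> * indicator {-T..T} t \<partial>lborel)"
        unfolding B_def by (rule Bochner_Integration.integral_add[OF i1 i2])
      also have "(\<integral>t. C * real n powr (- \<eta>) * \<psi> t \<partial>lborel) = C * real n powr (- \<eta>) * J"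
        unfolding J_def by (rule integral_mult_right_zero)
      also have "(\<integral>t. \<kappa> * indicator {-T..T} t \<partial>lborel) = \<kappa> * (2 * T)" using T by simp
      finally show ?thesis .
    qed
    have "\<bar>P n x - F n x\<bar> \<le> (\<integral>t. B t \<partial>lborel) + C0 * m / T"
    proof (rule C0(2)[OF bv_char_diff[OF P(1)[OF n] F[OF n]] T m0 _ iB])
      fix y s :: real assume s: "0 \<le> s"
      have "P n y \<le> P n (y + s)" using P(2)[OF n] s by (simp add: monoD)
      moreover have "\<bar>F n (y + s) - F n y\<bar> \<le> (y + s - y) * m" using s by (intro lip n) simp
      ultimately show "P n y - F n y - m * s \<le> P n (y + s) - F n (y + s)" by (simp add: mult.commute abs_le_iff)
    next
      fix t
      show "0 \<le> B t" unfolding B_def using e(2) \<kappa> \<psi>_nonneg[of t] by simp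
    next
      fix t assume t: "\<bar>t\<bar> \<le> T"
      have ind: "indicator {-T..T} t = (1::real)" using t by (auto simp: indicator_def abs_le_iff)
      show "norm (hc (t / NN n) ^ n - exp (yn n t) * Q n t) \<le> \<bar>t\<bar> * B t"
      proof (cases "\<bar>t\<bar> \<le> \<epsilon> * NN n")
        case True
        have "\<bar>t\<bar> * (C * real n powr (- \<eta>) * \<psi> t) \<le> \<bar>t\<bar> * B t"
          unfolding B_def ind using \<kappa> by (intro mult_left_mono) auto
        then show ?thesis using e(3)[OF n True] by linarith
      next
        case False
        have "\<bar>t\<bar> * \<kappa> \<le> \<bar>t\<bar> * B t"
          unfolding B_def ind using e(2) \<psi>_nonneg[of t] by (intro mult_left_mono) auto
        then show ?thesis using outer[of t] False t unfolding T_def by linarith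
      qed
    qed
    also have "(\<integral>t. B t \<partial>lborel) + C0 * m / T = C * J * real n powr (- \<eta>) + 2 * D * NN n * \<kappa> + C0 * m / (D * NN n)"
      unfolding intB T_def by (simp add: mult_ac)
    finally show "\<bar>P n x - F n x\<bar> \<le> C * J * real n powr (- \<eta>) + 2 * D * NN n * \<kappa> + C0 * m / (D * NN n)" .
  qed (use e C0 J0 m0 in auto)
qed

lemma norm_SUP_abs_le:
  fixes g :: "real \<Rightarrow> real"
  assumes g: "\<And>x. \<bar>g x\<bar> \<le> c" and c: "c \<le> c'"
  shows "norm (SUP x. \<bar>g x\<bar>) \<le> c'"
proof -
  have "(SUP x. \<bar>g x\<bar>) \<le> c" by (rule cSUP_least) (use g in auto)
  \<comment> \<open>The value at 0 shows that the supremum is nonnegative, so its norm is the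
    supremum itself.\<close>
  moreover have "\<bar>g 0\<bar> \<le> (SUP x. \<bar>g x\<bar>)" by (rule cSUP_upper) (use g in \<open>auto intro!: bdd_aboveI\<close>)
  ultimately show ?thesis using c by simp
qed

text \<open>With D = \<epsilon> the intermediate range is empty and \<kappa> = 0; the smoothing
  error is then already of order n powr (-1/\<alpha>).\<close>

lemma approximation_O:
  fixes F P :: "nat \<Rightarrow> real \<Rightarrow> real"
  assumes Q: "poly_bounded Q"
    and F: "\<And>n. n \<ge> 4 \<Longrightarrow> bv_char (F n) (\<lambda>t. exp (yn n t) * Q n t)"
    and P: "\<And>n. n \<ge> 4 \<Longrightarrow> bv_char (P n) (\<lambda>t. hc (t / NN n) ^ n)" "\<And>n. n \<ge> 4 \<Longrightarrow> mono (P n)"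
    and R: "rbound (1 / \<alpha>) (\<lambda>n t. hc (t / NN n) ^ n - exp (yn n t) * Q n t)"
  shows "(\<lambda>n. SUP x. \<bar>P n x - F n x\<bar>) \<in> O(\<lambda>n. real n powr (- 1 / \<alpha>))"
proof -
  obtain \<epsilon> C1 C2 where c: "\<epsilon> > 0" "C1 \<ge> 0" "C2 \<ge> 0"
    "\<And>n D \<kappa> x. n \<ge> 4 \<Longrightarrow> D \<ge> \<epsilon> \<Longrightarrow> \<kappa> \<ge> 0 \<Longrightarrow>
       (\<And>t. \<epsilon> * NN n < \<bar>t\<bar> \<Longrightarrow> \<bar>t\<bar> \<le> D * NN n \<Longrightarrow> norm (hc (t / NN n) ^ n - exp (yn n t) * Q n t) \<le> \<bar>t\<bar> * \<kappa>) \<Longrightarrow>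
       \<bar>P n x - F n x\<bar> \<le> C1 * real n powr (- (1 / \<alpha>)) + 2 * D * NN n * \<kappa> + C2 / (D * NN n)"
    using approximation_core[of Q F P "1 / \<alpha>", OF Q F P R] by blast
  show ?thesis
  proof (rule bigoI[of _ "C1 + C2 / \<epsilon>"], rule eventually_mono[OF eventually_ge_at_top[of 4]])
    fix n :: nat assume n: "n \<ge> 4"
    have "\<bar>P n x - F n x\<bar> \<le> (C1 + C2 / \<epsilon>) * real n powr (- 1 / \<alpha>)" for x
    proof -
      have "\<bar>P n x - F n x\<bar> \<le> C1 * real n powr (- (1 / \<alpha>)) + 2 * \<epsilon> * NN n * 0 + C2 / (\<epsilon> * NN n)"
        by (rule c(4)[OF n]) auto
      moreover have "C2 / (\<epsilon> * NN n) = C2 / \<epsilon> * real n powr (- (1 / \<alpha>))"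
        by (simp add: NN_def powr_minus_divide)
      ultimately show ?thesis by (simp add: distrib_right)
    qed
    then show "norm (SUP x. \<bar>P n x - F n x\<bar>) \<le> (C1 + C2 / \<epsilon>) * norm (real n powr (- 1 / \<alpha>))"
      by (intro norm_SUP_abs_le) auto
  qed
qed

text \<open>D is taken so large that the smoothing error is at most half of the target. On the
  intermediate range the n-th power of \<open>f\<close> decays geometrically, hence faster than
  every power of n.\<close>

lemma approximation_o:
  fixes F P :: "nat \<Rightarrow> real \<Rightarrow> real"
  assumes Q: "poly_bounded Q"
    and F: "\<And>n. n \<ge> 4 \<Longrightarrow> bv_char (F n) (\<lambda>t. exp (yn n t) * Q n t)"
    and P: "\<And>n. n \<ge> 4 \<Longrightarrow> bv_char (P n) (\<lambda>t. hc (t / NN n) ^ n)" "\<And>n. n \<ge> 4 \<Longrightarrow> mono (P n)"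
    and R: "rbound \<eta> (\<lambda>n t. hc (t / NN n) ^ n - exp (yn n t) * Q n t)" and \<eta>: "\<eta> > 1 / \<alpha>"
    and nl: "1 / \<theta> \<notin> \<nat>"
  shows "(\<lambda>n. SUP x. \<bar>P n x - F n x\<bar>) \<in> o(\<lambda>n. real n powr (- 1 / \<alpha>))"
proof (rule landau_o.smallI)
  fix \<delta> :: real assume \<delta>: "\<delta> > 0"
  obtain \<epsilon> C1 C2 where c: "\<epsilon> > 0" "C1 \<ge> 0" "C2 \<ge> 0"
    "\<And>n D \<kappa> x. n \<ge> 4 \<Longrightarrow> D \<ge> \<epsilon> \<Longrightarrow> \<kappa> \<ge> 0 \<Longrightarrow>
       (\<And>t. \<epsilon> * NN n < \<bar>t\<bar> \<Longrightarrow> \<bar>t\<bar> \<le> D * NN n \<Longrightarrow> norm (hc (t / NN n) ^ n - exp (yn n t) * Q n t) \<le> \<bar>t\<bar> * \<kappa>) \<Longrightarrow>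
       \<bar>P n x - F n x\<bar> \<le> C1 * real n powr (- \<eta>) + 2 * D * NN n * \<kappa> + C2 / (D * NN n)"
    using approximation_core[of Q F P \<eta>, OF Q F P R] by blast
  obtain K where K: "K \<ge> 0" "\<And>n t. n \<ge> 1 \<Longrightarrow> norm (exp (yn n t) * Q n t) \<le> K / (1 + \<bar>t\<bar>) ^ 2"
    by (rule poly_bounded_decay[OF Q]) (rule that; assumption)
  define D where "D = max \<epsilon> (2 * C2 / \<delta>)"
  have D: "D \<ge> \<epsilon>" "D > 0" "C2 / D \<le> \<delta> / 2"
  proof -
    show "D \<ge> \<epsilon>" "D > 0" using c(1) by (auto simp: D_def)
    have "2 * C2 / \<delta> \<le> D" by (simp add: D_def)
    then show "C2 / D \<le> \<delta> / 2" using \<delta> \<open>D > 0\<close> by (simp add: field_simps)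
  qed
  obtain \<rho> where \<rho>: "0 < \<rho>" "\<rho> < 1" "\<And>s. \<epsilon> \<le> \<bar>s\<bar> \<Longrightarrow> \<bar>s\<bar> \<le> D \<Longrightarrow> norm (f s) \<le> \<rho>"
    by (rule norm_f_away_from_0[OF nl c(1), of D]) (rule that; assumption)
  \<comment> \<open>n powr (1/\<alpha>) times the bound without its smoothing term; it tends to 0
    because \<eta> > 1/\<alpha> and \<rho> < 1.\<close>
  define g where "g n = C1 * real n powr (- (\<eta> - 1 / \<alpha>)) + (2 * D / \<epsilon>) * (\<rho> ^ n * real n powr (1 / \<alpha>) + (K / \<epsilon>\<^sup>2) * real n powr (- (1 / \<alpha>)))" for n :: nat
  have "g \<longlonglongrightarrow> C1 * 0 + (2 * D / \<epsilon>) * (0 + (K / \<epsilon>\<^sup>2) * 0)"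
    unfolding g_def
  proof (intro tendsto_add tendsto_mult tendsto_const)
    show "(\<lambda>n. real n powr (- (\<eta> - 1 / \<alpha>))) \<longlonglongrightarrow> 0"
      using \<eta> by (intro tendsto_neg_powr filterlim_real_sequentially) simp
    show "(\<lambda>n. real n powr (- (1 / \<alpha>))) \<longlonglongrightarrow> 0"
      using \<alpha> by (intro tendsto_neg_powr filterlim_real_sequentially) simp
    define a where "a = - ln \<rho>"
    have a: "a > 0" using \<rho> by (simp add: a_def)
    have "\<rho> ^ n = exp (- a * real n)" for n
      using \<rho> by (simp add: a_def exp_of_nat2_mult)
    moreover have "(\<lambda>n. exp (- a * real n) * real n powr (1 / \<alpha>)) \<longlonglongrightarrow> 0"
      using a by real_asymp
    ultimately show "(\<lambda>n. \<rho> ^ n * real n powr (1 / \<alpha>)) \<longlonglongrightarrow> 0" by simp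
  qed
  then have "eventually (\<lambda>n. g n < \<delta> / 2) sequentially"
    using \<delta> by (intro order_tendstoD(2)) auto
  then show "eventually (\<lambda>n. norm (SUP x. \<bar>P n x - F n x\<bar>) \<le> \<delta> * norm (real n powr (- 1 / \<alpha>))) sequentially"
    using eventually_ge_at_top[of 4]
  proof eventually_elim
    case (elim n)
    have n: "n \<ge> 4" "n \<ge> 1" using elim by auto
    have N: "NN n > 0" using n by (intro NN_pos) simp
    \<comment> \<open>The bound of both transforms on the intermediate range, divided by the least
      value of \<bar>t\<bar> there.\<close>
    define \<kappa> where "\<kappa> = (\<rho> ^ n + K / (\<epsilon> * NN n)\<^sup>2) / (\<epsilon> * NN n)"
    have \<kappa>0: "\<kappa> \<ge> 0" unfolding \<kappa>_def using \<rho> K N c(1) by simp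
    have "\<bar>P n x - F n x\<bar> \<le> \<delta> * real n powr (- 1 / \<alpha>)" for x
    proof -
      have "\<bar>P n x - F n x\<bar> \<le> C1 * real n powr (- \<eta>) + 2 * D * NN n * \<kappa> + C2 / (D * NN n)"
      proof (rule c(4)[OF n(1) D(1) \<kappa>0])
        fix t assume t: "\<epsilon> * NN n < \<bar>t\<bar>" "\<bar>t\<bar> \<le> D * NN n"
        have eN: "0 < \<epsilon> * NN n" using c(1) N by simp
        have s: "\<epsilon> \<le> \<bar>t / NN n\<bar>" "\<bar>t / NN n\<bar> \<le> D"
          using t N by (auto simp: abs_divide pos_le_divide_eq pos_divide_le_eq)
        have h: "norm (hc (t / NN n)) = norm (f (t / NN n))" by (simp add: hc_def norm_mult)
        have "norm (hc (t / NN n) ^ n - exp (yn n t) * Q n t) \<le> norm (hc (t / NN n) ^ n) + norm (exp (yn n t) * Q n t)"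
          by (rule norm_triangle_ineq4)
        also have "\<dots> \<le> \<rho> ^ n + K / (\<epsilon> * NN n)\<^sup>2"
        proof (rule add_mono)
          show "norm (hc (t / NN n) ^ n) \<le> \<rho> ^ n"
            unfolding norm_power h by (intro power_mono \<rho>(3) s) simp
          have "norm (exp (yn n t) * Q n t) \<le> K / (1 + \<bar>t\<bar>) ^ 2" by (rule K(2)[OF n(2)])
          also have "\<dots> \<le> K / (\<epsilon> * NN n)\<^sup>2"
            using t eN K(1) c(1) N by (intro divide_left_mono power_mono mult_pos_pos zero_less_power) auto
          finally show "norm (exp (yn n t) * Q n t) \<le> K / (\<epsilon> * NN n)\<^sup>2" .
        qed
        also have "\<dots> = (\<epsilon> * NN n) * \<kappa>" unfolding \<kappa>_def using c(1) N by simp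
        also have "\<dots> \<le> \<bar>t\<bar> * \<kappa>" using t \<kappa>0 by (intro mult_right_mono) auto
        finally show "norm (hc (t / NN n) ^ n - exp (yn n t) * Q n t) \<le> \<bar>t\<bar> * \<kappa>" .
      qed
      also have "\<dots> = (g n + C2 / D) / NN n"
      proof -
        have "C1 * real n powr (- \<eta>) = C1 * real n powr (- (\<eta> - 1 / \<alpha>)) / NN n"
        proof -
          have "real n powr (- \<eta>) = real n powr (- (\<eta> - 1 / \<alpha>) - 1 / \<alpha>)" by simp
          also have "\<dots> = real n powr (- (\<eta> - 1 / \<alpha>)) / NN n" unfolding NN_def by (rule powr_diff)
          finally show ?thesis by simp
        qed
        moreover have "2 * D * NN n * \<kappa> = (2 * D / \<epsilon>) * (\<rho> ^ n * NN n + (K / \<epsilon>\<^sup>2) * (1 / NN n)) / NN n"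
          unfolding \<kappa>_def using N c(1) by (simp add: field_simps power2_eq_square)
        moreover have "real n powr (- (1 / \<alpha>)) = 1 / NN n" unfolding NN_def by (rule powr_minus_divide)
        ultimately show ?thesis unfolding g_def NN_def[symmetric] by (simp add: add_divide_distrib)
      qed
      also have "\<dots> \<le> \<delta> / NN n"
      proof (rule divide_right_mono)
        show "g n + C2 / D \<le> \<delta>" using elim(1) D(3) by linarith
      qed (use N in simp)
      also have "\<dots> = \<delta> * real n powr (- 1 / \<alpha>)" by (simp add: NN_def powr_minus_divide)
      finally show ?thesis .
    qed
    then show ?case by (intro norm_SUP_abs_le) auto
  qed
qed

text \<open>The difference is T1 + T0 + T4; the uncorrected linear term \<open>T0\<close> is within
  the required order 1/\<alpha>.\<close>

lemma rbound_Gt: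
  assumes "1 / \<alpha> \<le> (real L + 1) * \<tau>"
  shows "rbound (1 / \<alpha>) (\<lambda>n t. hc (t / NN n) ^ n - exp (yn n t) * edgeworth L n t)"
proof -
  obtain \<eta> where T: "\<eta> > 1 / \<alpha>" "rbound \<eta> T1" "rbound \<eta> T2" "rbound (1 / \<alpha>) T0"
    by (rule rbound_T) (rule that; assumption)
  have "rbound (1 / \<alpha>) T1" using T(1) by (intro rbound_mono[OF T(2)]) simp
  then have "rbound (1 / \<alpha>) (\<lambda>n t. (T1 n t + T0 n t) + T4 L n t)"
    by (intro rbound_add T(4) rbound_mono[OF rbound_T4 assms])
  moreover have "(\<lambda>n t. (T1 n t + T0 n t) + T4 L n t) = (\<lambda>n t. hc (t / NN n) ^ n - exp (yn n t) * edgeworth L n t)"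
    by (intro ext) (simp add: T1_def T4_def)
  ultimately show ?thesis by simp
qed

text \<open>With the correction included, \<open>T0\<close> is replaced by its distance from n
  \<open>dl\<close> exp y: \<open>T2\<close> passes from A^(n-1) to A^n, and \<open>T4 0\<close>
  from A^n to exp y. All orders now exceed 1/\<alpha>.\<close>

lemma rbound_Gtt:
  assumes "1 / \<alpha> < (real L + 1) * \<tau>"
  obtains \<eta> where "\<eta> > 1 / \<alpha>"
    "rbound \<eta> (\<lambda>n t. hc (t / NN n) ^ n - exp (yn n t) * (edgeworth L n t + of_nat n * dl (t / NN n)))"
proof -
  obtain \<eta> where T: "\<eta> > 1 / \<alpha>" "rbound \<eta> T1" "rbound \<eta> T2" "rbound (1 / \<alpha>) T0"
    by (rule rbound_T) (rule that; assumption)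
  define \<eta>' where "\<eta>' = min \<eta> (min ((real L + 1) * \<tau>) (\<tau> + 1 / \<alpha>))"
  \<comment> \<open>With no correction terms, A^n and exp y differ by order \<open>\<tau>\<close>;
    the factor n \<open>dl\<close> contributes another 1/\<alpha>.\<close>
  have "rbound (\<tau> + 1 / \<alpha>) (\<lambda>n t. (of_nat n * dl (t / NN n)) * T4 0 n t)"
  proof (rule rbound_mult)
    show "rbound \<tau> (T4 0)" using rbound_T4[of 0] by simp
    show "0 \<le> \<bar>m1\<bar> * CY" using CY_pos by simp
    fix n :: nat and t :: real assume n: "n \<ge> 4"
    have "norm (of_nat n * dl (t / NN n)) \<le> (\<bar>m1\<bar> * CY) * real n powr (- (1 / \<alpha>)) * \<bar>t\<bar> powr (1 + \<alpha>)"
      using n by (intro norm_n_dl) simp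
    also have "\<dots> \<le> (\<bar>m1\<bar> * CY) * real n powr (- (1 / \<alpha>)) * (1 + \<bar>t\<bar>) ^ 3"
      using CY_pos \<alpha> by (intro mult_left_mono powr_le_power_1_plus) auto
    finally show "norm (of_nat n * dl (t / NN n)) \<le> (\<bar>m1\<bar> * CY) * real n powr (- (1 / \<alpha>)) * (1 + \<bar>t\<bar>) ^ 3" .
  qed
  then have "rbound \<eta>' (\<lambda>n t. ((T1 n t + T2 n t) + T4 L n t) + (of_nat n * dl (t / NN n)) * T4 0 n t)"
    by (intro rbound_add rbound_mono[OF T(2)] rbound_mono[OF T(3)] rbound_mono[OF rbound_T4]) (auto simp: \<eta>'_def intro: rbound_mono)
  moreover have "(\<lambda>n t. ((T1 n t + T2 n t) + T4 L n t) + (of_nat n * dl (t / NN n)) * T4 0 n t) =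
      (\<lambda>n t. hc (t / NN n) ^ n - exp (yn n t) * (edgeworth L n t + of_nat n * dl (t / NN n)))"
  proof (intro ext)
    fix n t
    have "edgeworth 0 n t = 1" by (simp add: edgeworth_def)
    then show "((T1 n t + T2 n t) + T4 L n t) + (of_nat n * dl (t / NN n)) * T4 0 n t =
      hc (t / NN n) ^ n - exp (yn n t) * (edgeworth L n t + of_nat n * dl (t / NN n))"
      by (simp add: T1_def T2_def T4_def algebra_simps)
  qed
  moreover have "\<eta>' > 1 / \<alpha>" using T(1) assms \<tau>_pos by (simp add: \<eta>'_def)
  ultimately show ?thesis using that by simp
qed

end

text \<open>For \<alpha> < 1 the inequality amounts to \<alpha> l \<ge> 1, for \<alpha> > 1 to l
  (2-\<alpha>) \<ge> 1; these are the closed endpoints of the two intervals.\<close>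

lemma exponent_le:
  fixes \<alpha> :: real and l :: nat
  assumes "l \<ge> 2" "\<alpha> \<in> {1 / real l ..< 1 / (real l - 1)} \<union> {2 - 1 / (real l - 1) <.. 2 - 1 / real l}" "\<alpha> \<noteq> 1"
  shows "1 / \<alpha> \<le> (real (l - 1) + 1) * (if \<alpha> < 1 then 1 else (2 - \<alpha>) / \<alpha>)"
proof -
  have l: "real l \<ge> 2" "real (l - 1) + 1 = real l" using assms(1) by auto
  have l1: "1 / (real l - 1) \<le> 1" using l by simp
  \<comment> \<open>As 1/(l-1) \<le> 1, one interval lies below 1 and the other above, so the
    position of \<alpha> relative to 1 selects the interval.\<close>
  show ?thesis
  proof (cases "\<alpha> < 1")
    case True
    then have a: "\<alpha> \<ge> 1 / real l" using assms(2) l1 by auto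
    then have "\<alpha> > 0" using l(1) by (smt (verit) zero_less_divide_1_iff)
    then show ?thesis using a True l(1) by (simp add: l(2) field_simps)
  next
    case False
    then have a: "\<alpha> > 1" "\<alpha> \<le> 2 - 1 / real l" using assms(2,3) l1 by auto
    then have "1 \<le> real l * (2 - \<alpha>)" using l(1) by (simp add: field_simps)
    then show ?thesis using a unfolding l(2) by (simp add: divide_right_mono)
  qed
qed

text \<open>The endpoints 1/l and 2 - 1/l are now excluded, which makes the inequality strict and
  leaves a gap that yields o instead of O.\<close>

lemma exponent_less:
  fixes \<alpha> :: real and l :: nat
  assumes "(l = 2 \<and> \<alpha> \<in> {1/2<..<1} \<union> {1<..<3/2}) \<or>
      (l \<ge> 3 \<and> \<alpha> \<in> {1 / real l <.. 1 / (real l - 1)} \<union> {2 - 1 / (real l - 1) ..< 2 - 1 / real l})" "\<alpha> \<noteq> 1"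
  shows "1 / \<alpha> < (real (l - 1) + 1) * (if \<alpha> < 1 then 1 else (2 - \<alpha>) / \<alpha>)"
proof -
  have l: "real l \<ge> 2" "real (l - 1) + 1 = real l" using assms(1) by auto
  have l1: "1 / (real l - 1) \<le> 1" using l by simp
  have range: "\<alpha> < 1 \<and> \<alpha> > 1 / real l \<or> \<alpha> > 1 \<and> \<alpha> < 2 - 1 / real l"
    using assms(1)
  proof (elim disjE)
    assume a: "l \<ge> 3 \<and> \<alpha> \<in> {1 / real l <.. 1 / (real l - 1)} \<union> {2 - 1 / (real l - 1) ..< 2 - 1 / real l}"
    then have u: "1 / (real l - 1) < 1" "1 / real l < 1" by simp_all
    from a consider "1 / real l < \<alpha>" "\<alpha> \<le> 1 / (real l - 1)" | "2 - 1 / (real l - 1) \<le> \<alpha>" "\<alpha> < 2 - 1 / real l"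
      by auto
    then show ?thesis using u by cases linarith+
  qed auto
  show ?thesis
  proof (cases "\<alpha> < 1")
    case True
    then have "\<alpha> > 1 / real l" using range by auto
    moreover have "\<alpha> > 0" using calculation l(1) by (smt (verit) zero_less_divide_1_iff)
    ultimately show ?thesis using True l(1) by (simp add: l(2) field_simps)
  next
    case False
    then have a: "\<alpha> > 1" "\<alpha> < 2 - 1 / real l" using range by auto
    then have "1 < real l * (2 - \<alpha>)" using l(1) by (simp add: field_simps)
    then show ?thesis using a unfolding l(2) by (simp add: divide_strict_right_mono)
  qed
qed

theorem theorem1:
  fixes M :: "'a measure" and X :: "nat \<Rightarrow> 'a \<Rightarrow> real" and p \<alpha> :: real
  assumes "prob_space M"
    and "0 < p" and "p < 1"
    and "\<alpha> \<in> {0<..<1} \<union> {1<..<2}"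
    and "prob_space.indep_vars M (\<lambda>_. borel) X UNIV"
    and "\<And>i k. k \<ge> (1::nat) \<Longrightarrow>
           measure M {\<omega> \<in> space M. X i \<omega> = rr p powr (real k / \<alpha>)} = (1 - p) ^ (k - 1) * p"
  shows
    "(\<forall>l::nat. l \<ge> 2 \<and>
        \<alpha> \<in> {1 / real l ..< 1 / (real l - 1)} \<union> {2 - 1 / (real l - 1) <.. 2 - 1 / real l} \<and>
        rr p powr (1 / \<alpha>) \<in> \<nat> \<longrightarrow>
        (\<lambda>n. SUP x::real. \<bar>Fn M X \<alpha> p n x - Gt \<alpha> p (l - 1) n x\<bar>)
          \<in> O(\<lambda>n. real n powr (- 1 / \<alpha>)))
   \<and>
    (\<forall>l::nat.
        ((l = 2 \<and> \<alpha> \<in> {1/2<..<1} \<union> {1<..<3/2}) \<or>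
         (l \<ge> 3 \<and> \<alpha> \<in> {1 / real l <.. 1 / (real l - 1)} \<union> {2 - 1 / (real l - 1) ..< 2 - 1 / real l})) \<and>
        rr p powr (1 / \<alpha>) \<notin> \<nat> \<longrightarrow>
        (\<lambda>n. SUP x::real. \<bar>Fn M X \<alpha> p n x - Gtt \<alpha> p (l - 1) n x\<bar>)
          \<in> o(\<lambda>n. real n powr (- 1 / \<alpha>)))"
proof -
  interpret semistable \<alpha> p by unfold_locales (use assms in auto)
  have P: "bv_char (Fn M X \<alpha> p n) (\<lambda>t. hc (t / NN n) ^ n)" "mono (Fn M X \<alpha> p n)" if "n \<ge> 4" for n
    using that by (auto intro!: bv_char_Fn assms)
  \<comment> \<open>Turns the arithmetic condition on r powr (1/\<alpha>) into the one on
    1/\<open>\<theta>\<close> used for the characteristic function.\<close>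
  have rr: "rr p powr (1 / \<alpha>) = 1 / \<theta>"
    unfolding \<theta>_def q_def rr_def using p by (simp add: powr_divide)
  show ?thesis
  proof (intro conjI allI impI; elim conjE)
    fix l :: nat
    assume "2 \<le> l" "\<alpha> \<in> {1 / real l ..< 1 / (real l - 1)} \<union> {2 - 1 / (real l - 1) <.. 2 - 1 / real l}"
    then have "1 / \<alpha> \<le> (real (l - 1) + 1) * \<tau>" unfolding \<tau>_def using exponent_le \<alpha>(3) by blast
    then show "(\<lambda>n. SUP x. \<bar>Fn M X \<alpha> p n x - Gt \<alpha> p (l - 1) n x\<bar>) \<in> O(\<lambda>n. real n powr (- 1 / \<alpha>))"
      by (intro approximation_O[where Q = "edgeworth (l - 1)"] poly_bounded_edgeworth bv_char_Gt P rbound_Gt) auto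
  next
    fix l :: nat
    assume l: "(l = 2 \<and> \<alpha> \<in> {1/2<..<1} \<union> {1<..<3/2}) \<or>
         (l \<ge> 3 \<and> \<alpha> \<in> {1 / real l <.. 1 / (real l - 1)} \<union> {2 - 1 / (real l - 1) ..< 2 - 1 / real l})"
      and nl: "rr p powr (1 / \<alpha>) \<notin> \<nat>"
    have "1 / \<alpha> < (real (l - 1) + 1) * \<tau>" unfolding \<tau>_def using exponent_less[OF l \<alpha>(3)] .
    then obtain \<eta> where \<eta>: "\<eta> > 1 / \<alpha>"
      "rbound \<eta> (\<lambda>n t. hc (t / NN n) ^ n - exp (yn n t) * (edgeworth (l - 1) n t + of_nat n * dl (t / NN n)))"
      by (rule rbound_Gtt) (rule that; assumption)
    show "(\<lambda>n. SUP x. \<bar>Fn M X \<alpha> p n x - Gtt \<alpha> p (l - 1) n x\<bar>) \<in> o(\<lambda>n. real n powr (- 1 / \<alpha>))"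
    proof (rule approximation_o[OF _ _ P \<eta>(2) \<eta>(1)])
      show "poly_bounded (\<lambda>n t. edgeworth (l - 1) n t + of_nat n * dl (t / NN n))" by (intro poly_bounded_add poly_bounded_edgeworth poly_bounded_n_dl)
      show "1 / \<theta> \<notin> \<nat>" using nl unfolding rr .
    qed (auto intro: bv_char_Gtt)
  qed
qed

end
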